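(* Let $n\ge2$ and $R\in\mathcal C_n^*$. Then $Q_R$ is vertex-transitive if and only if there exist data of the following form: - a composition $a_1+\dots+a_p=n-1$ into positive integers; put $s_0=1$ and $s_i=1+a_1+\dots+a_i$ (so $s_p=n$); - for each $i$ with $a_i=2$, a choice $\epsilon_i\in\{\mathrm{none},\mathrm{left},\mathrm{right}\}$; such that $F_R$ is the downset, in the forcing order, generated by the following fences: - $f(s_i-1,s_i+1,\emptyset)$ and $f(s_i-1,s_i+1,\{s_i\})$ for $1\le i\le p-1$; - $f(s_{i-1},s_i,\emptyset)$ for each $i$ with $a_i=2$ and $\epsilon_i=\mathrm{left}$; - $f(s_{i-1},s_i,\{s_{i-1}+1\})$ for each $i$ with $a_i=2$ and $\epsilon_i=\mathrm{right}$. Distinct data yield distinct congruences. In this case $Q_R\cong G_1\,\square\cdots\square\, G_p$ (Cartesian product of graphs), where $G_i$ is the 5-cycle $C_5$ if $a_i=2$ and $\epsilon_i\neq\mathrm{none}$, and otherwise $G_i$ is the cover graph of the weak order on $S_{a_i+1}$. Consequently, the number of $R\in\mathcal C_n^*$ with $Q_R$ vertex-transitive equals $\sum_{k\ge0}3^k c_{n-1,k}$, where $c_{m,k}$ is the number of compositions of $m$ with exactly $k$ parts equal to $2$.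
   Context: $S_m$ is the set of permutations of $[m]$ with the weak order (inclusion of inversion sets); a lattice congruence is an equivalence relation compatible with joins and meets. Fences. $]a,b[=\{a+1,\dots,b-1\}$. For $1\le a<b\le n$ and $L\subseteq\,]a,b[$, the fence $f(a,b,L)$ is the set of cover edges of the weak order on $S_n$ swapping adjacent entries $a,b$, with the values of $L$ left of $a,b$ and those of $]a,b[\setminus L$ to the right. Forcing order: $f(a,b,L)\prec f(c,d,M)$ iff $a\le c<d\le b$, $(a,b)\ne(c,d)$, $M=L\cap\,]c,d[$. Lattice congruences $R$ correspond bijectively to downsets $F_R$ of the forcing order (a cover edge joins equivalent permutations iff it lies in a fence of $F_R$). $R$ is essential if $F_R$ contains no $f(a,a+1,\emptyset)$; $\mathcal C_n^*$ is the set of these. $Q_R$ is the undirected cover graph of $S_n/R$. The Cartesian product $G\square H$ has vertex set $V(G)\times V(H)$, with $(v,w)\sim(v',w')$ iff ($v=v'$ and $ww'\in E(H)$) or ($w=w'$ and $vv'\in E(G)$). *)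

theory Defs
  imports Main
begin

definition perms :: "nat \<Rightarrow> nat list set" where
  "perms n = {xs. distinct xs \<and> set xs = {1..n}}"

definition invs :: "nat list \<Rightarrow> (nat \<times> nat) set" where
  "invs xs = {(a,b). a < b \<and> (\<exists>i j. i < j \<and> j < length xs \<and> xs ! i = b \<and> xs ! j = a)}"

definition weak_le :: "nat list \<Rightarrow> nat list \<Rightarrow> bool" where
  "weak_le u v \<longleftrightarrow> invs u \<subseteq> invs v"

definition is_join :: "nat \<Rightarrow> nat list \<Rightarrow> nat list \<Rightarrow> nat list \<Rightarrow> bool" where
  "is_join n x z j \<longleftrightarrow> j \<in> perms n \<and> weak_le x j \<and> weak_le z j \<and>
     (\<forall>u\<in>perms n. weak_le x u \<and> weak_le z u \<longrightarrow> weak_le j u)"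

definition is_meet :: "nat \<Rightarrow> nat list \<Rightarrow> nat list \<Rightarrow> nat list \<Rightarrow> bool" where
  "is_meet n x z j \<longleftrightarrow> j \<in> perms n \<and> weak_le j x \<and> weak_le j z \<and>
     (\<forall>u\<in>perms n. weak_le u x \<and> weak_le u z \<longrightarrow> weak_le u j)"

definition lattice_cong :: "nat \<Rightarrow> (nat list \<times> nat list) set \<Rightarrow> bool" where
  "lattice_cong n R \<longleftrightarrow> R \<subseteq> perms n \<times> perms n \<and> equiv (perms n) R \<and>
     (\<forall>x y z j1 j2. (x,y) \<in> R \<and> z \<in> perms n \<and> is_join n x z j1 \<and> is_join n y z j2
        \<longrightarrow> (j1,j2) \<in> R) \<and>
     (\<forall>x y z j1 j2. (x,y) \<in> R \<and> z \<in> perms n \<and> is_meet n x z j1 \<and> is_meet n y z j2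
        \<longrightarrow> (j1,j2) \<in> R)"

type_synonym fence = "nat \<times> nat \<times> nat set"

definition fences :: "nat \<Rightarrow> fence set" where
  "fences n = {(a,b,L). 1 \<le> a \<and> a < b \<and> b \<le> n \<and> L \<subseteq> {a<..<b}}"

definition swap_adj :: "nat list \<Rightarrow> nat \<Rightarrow> nat list" where
  "swap_adj xs i = xs[i := xs ! Suc i, Suc i := xs ! i]"

text \<open>The cover edges (u below v) in the fence f(a,b,L): a,b adjacent in u (a left of b),
  v obtained by swapping them, values of L left of a,b and those of ]a,b[ - L right.\<close>
definition fence_edges :: "nat \<Rightarrow> fence \<Rightarrow> (nat list \<times> nat list) set" where
  "fence_edges n f = (case f of (a,b,L) \<Rightarrow>
     {(u, swap_adj u i) | u i. u \<in> perms n \<and> Suc i < length u \<and> u ! i = a \<and> u ! Suc i = b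
        \<and> set (take i u) \<inter> {a<..<b} = L})"

definition forces :: "fence \<Rightarrow> fence \<Rightarrow> bool" (infix "\<prec>\<^sub>f" 50) where
  "forces f g \<longleftrightarrow> (case f of (a,b,L) \<Rightarrow> case g of (c,d,M) \<Rightarrow>
     a \<le> c \<and> c < d \<and> d \<le> b \<and> (a,b) \<noteq> (c,d) \<and> M = L \<inter> {c<..<d})"

definition FR :: "nat \<Rightarrow> (nat list \<times> nat list) set \<Rightarrow> fence set" where
  "FR n R = {f \<in> fences n. \<forall>e \<in> fence_edges n f. e \<in> R}"

definition ess_congs :: "nat \<Rightarrow> (nat list \<times> nat list) set set" where
  "ess_congs n = {R. lattice_cong n R \<and> (\<forall>a. (a, Suc a, {}) \<notin> FR n R)}"

definition gen_downset :: "nat \<Rightarrow> fence set \<Rightarrow> fence set" where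
  "gen_downset n G = {g \<in> fences n. \<exists>f \<in> G. g = f \<or> g \<prec>\<^sub>f f}"

type_synonym 'v graph = "'v set \<times> ('v \<Rightarrow> 'v \<Rightarrow> bool)"

definition cover_graph :: "'v set \<Rightarrow> ('v \<Rightarrow> 'v \<Rightarrow> bool) \<Rightarrow> 'v graph" where
  "cover_graph V le = (V, \<lambda>x y.
     (let cov = (\<lambda>x y. x \<noteq> y \<and> le x y \<and> \<not> (\<exists>z\<in>V. z \<noteq> x \<and> z \<noteq> y \<and> le x z \<and> le z y))
      in cov x y \<or> cov y x))"

definition weak_graph :: "nat \<Rightarrow> nat list graph" where
  "weak_graph m = cover_graph (perms m) weak_le"

definition quot_le :: "nat list set \<Rightarrow> nat list set \<Rightarrow> bool" where
  "quot_le C D \<longleftrightarrow> (\<exists>x\<in>C. \<exists>y\<in>D. weak_le x y)"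

definition Q :: "nat \<Rightarrow> (nat list \<times> nat list) set \<Rightarrow> nat list set graph" where
  "Q n R = cover_graph (perms n // R) quot_le"

definition vertex_transitive :: "'v graph \<Rightarrow> bool" where
  "vertex_transitive G \<longleftrightarrow> (case G of (V,E) \<Rightarrow>
     (\<forall>u\<in>V. \<forall>v\<in>V. \<exists>\<phi>. bij_betw \<phi> V V \<and> (\<forall>x\<in>V. \<forall>y\<in>V. E x y \<longleftrightarrow> E (\<phi> x) (\<phi> y)) \<and> \<phi> u = v))"

definition graph_iso :: "'v graph \<Rightarrow> 'w graph \<Rightarrow> bool" where
  "graph_iso G H \<longleftrightarrow> (case G of (V,E) \<Rightarrow> case H of (W,F) \<Rightarrow>
     (\<exists>\<phi>. bij_betw \<phi> V W \<and> (\<forall>x\<in>V. \<forall>y\<in>V. E x y \<longleftrightarrow> F (\<phi> x) (\<phi> y))))"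

definition cart_prod :: "'v graph list \<Rightarrow> 'v list graph" where
  "cart_prod Gs = ({xs. length xs = length Gs \<and> (\<forall>i<length Gs. xs ! i \<in> fst (Gs ! i))},
     \<lambda>xs ys. \<exists>i<length Gs. snd (Gs ! i) (xs ! i) (ys ! i) \<and>
        (\<forall>j<length Gs. j \<noteq> i \<longrightarrow> xs ! j = ys ! j))"

definition C5 :: "nat list graph" where
  "C5 = ({[k] | k. k < 5}, \<lambda>x y. \<exists>k<5. (x = [k] \<and> y = [Suc k mod 5]) \<or> (y = [k] \<and> x = [Suc k mod 5]))"

datatype eps = ENone | ELeft | ERight

text \<open>Composition a (0-indexed list, a!j = a_(j+1)) and choices eps (eps!j = ENone whenever
  a!j is not 2, so that the choice is only recorded when a_(j+1) = 2).\<close>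
definition valid_data :: "nat \<Rightarrow> nat list \<Rightarrow> eps list \<Rightarrow> bool" where
  "valid_data n a e \<longleftrightarrow> (\<forall>x\<in>set a. 0 < x) \<and> sum_list a = n - 1 \<and> length e = length a \<and>
     (\<forall>j<length a. a ! j \<noteq> 2 \<longrightarrow> e ! j = ENone)"

definition spos :: "nat list \<Rightarrow> nat \<Rightarrow> nat" where
  "spos a i = 1 + sum_list (take i a)"

definition gens :: "nat list \<Rightarrow> eps list \<Rightarrow> fence set" where
  "gens a e =
     {(spos a i - 1, spos a i + 1, {}) | i. 1 \<le> i \<and> i < length a} \<union>
     {(spos a i - 1, spos a i + 1, {spos a i}) | i. 1 \<le> i \<and> i < length a} \<union>
     {(spos a j, spos a (Suc j), {}) | j. j < length a \<and> a ! j = 2 \<and> e ! j = ELeft} \<union>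
     {(spos a j, spos a (Suc j), {spos a j + 1}) | j. j < length a \<and> a ! j = 2 \<and> e ! j = ERight}"

definition factors :: "nat list \<Rightarrow> eps list \<Rightarrow> nat list graph list" where
  "factors a e = map (\<lambda>j. if a ! j = 2 \<and> e ! j \<noteq> ENone then C5 else weak_graph (a ! j + 1))
                     [0..<length a]"

definition compositions :: "nat \<Rightarrow> nat list set" where
  "compositions m = {c. (\<forall>x\<in>set c. 0 < x) \<and> sum_list c = m}"

definition comp_count :: "nat \<Rightarrow> nat \<Rightarrow> nat" where
  "comp_count m k = card {c \<in> compositions m. count_list c 2 = k}"

end

(*
Permutations are replaced by their inversion sets, the sets of pairs that are transitive and
cotransitive ("ok" below), where join is transitive closure of the union and meet is dual; a fence
is "dead" when its edges are contracted.

Necessity. In Q_R the bottom class has the n-1 neighbours s_i, one for each simple transposition,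
and s_i, s_j have a second common neighbour exactly when |i-j| > 1 or the value between them is a
cut, i.e. both fences of length 2 around it are dead. Vertex transitivity therefore forces every
degree to be n-1, forbids three neighbours of a vertex that are pairwise in no common square, and
makes the number of squares at a vertex constant. The degree condition shows that a minimal dead
fence (a,b,L) has L empty or full. A long one with no cut inside yields three neighbours as
forbidden; a dead fence of length 2 whose partner is alive yields the same unless both its ends
are cuts or boundary values, or else a configuration ("bad") that is moved to the left by mirroring
until it meets a cut, where the square count excludes it. So up to the fences crossing a
cut only the isolated fences of length 2 between consecutive cuts can be dead.

Sufficiency. For given data the congruence is the intersection of the kernels of the restrictions to
the blocks between consecutive cuts, followed by a contraction of one edge of the hexagon
where a choice was made. The quotient is the product of the block quotients, and the cover graph of
a product is the Cartesian product of the cover graphs of the factors, each of which is vertex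
transitive.
*)

theory Submission
  imports Defs
begin

subsection \<open>Permutations and inversion sets\<close>

text \<open>A missing square restricts labels: the neighbours of the bottom are numbered 1, ...,
  n-1, an automorphism carries this numbering to any class, and two neighbours in no common square
  must have consecutive numbers. Three integers are never pairwise consecutive, hence the forbidden
  triples. They arise from hexagons: contracting one middle edge gives a pentagon, whose short side
  is a path of length two on no square, and the third neighbour is chosen so that a further hexagon
  keeps an alive middle edge. On four consecutive values these triples leave over the pattern
  \<open>bad\<close>. It is excluded only by a global count of squares, which needs a block whose
  left end is 1 or a cut, so that everything to the left splits off by restriction. Reversing words
  exchanges L with its complement, and reversing values moves a fence to the other end; each
  configuration is therefore treated in one orientation and transported. A block of three values
  gives a hexagon; it may stay whole or lose either of its two middle edges, which is the 3 in the
  count.\<close>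

definition prs :: "nat \<Rightarrow> (nat \<times> nat) set" where
  "prs n = {(p,q). 1 \<le> p \<and> p < q \<and> q \<le> n}"

definition cotrans :: "(nat \<times> nat) set \<Rightarrow> bool" where
  "cotrans I \<longleftrightarrow> (\<forall>p r q. (p,q) \<in> I \<longrightarrow> p < r \<longrightarrow> r < q \<longrightarrow> (p,r) \<in> I \<or> (r,q) \<in> I)"

definition ok :: "nat \<Rightarrow> (nat \<times> nat) set \<Rightarrow> bool" where
  "ok n I \<longleftrightarrow> I \<subseteq> prs n \<and> trans I \<and> cotrans I"

lemma finite_prs: "finite (prs n)"
  by (rule finite_subset[of _ "{1..n} \<times> {1..n}"]) (auto simp: prs_def)

lemma ok_finite: "ok n I \<Longrightarrow> finite I"
  using finite_prs finite_subset unfolding ok_def by blast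

lemma okD:
  assumes "ok n I" "(p,q) \<in> I" shows "1 \<le> p" "p < q" "q \<le> n"
  using assms by (auto simp: ok_def prs_def)

lemma ok_trans: "ok n I \<Longrightarrow> (p,q) \<in> I \<Longrightarrow> (q,r) \<in> I \<Longrightarrow> (p,r) \<in> I"
  unfolding ok_def trans_def by blast

lemma ok_cotrans: "ok n I \<Longrightarrow> (p,q) \<in> I \<Longrightarrow> p < r \<Longrightarrow> r < q \<Longrightarrow> (p,r) \<in> I \<or> (r,q) \<in> I"
  unfolding ok_def cotrans_def by blast

lemma okI:
  assumes "\<And>p q. (p,q) \<in> I \<Longrightarrow> 1 \<le> p \<and> p < q \<and> q \<le> n"
    and "\<And>p q r. (p,q) \<in> I \<Longrightarrow> (q,r) \<in> I \<Longrightarrow> (p,r) \<in> I"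
    and "\<And>p r q. (p,q) \<in> I \<Longrightarrow> p < r \<Longrightarrow> r < q \<Longrightarrow> (p,r) \<in> I \<or> (r,q) \<in> I"
  shows "ok n I"
  using assms unfolding ok_def prs_def cotrans_def trans_def by blast

text \<open>\<open>before I x y\<close> means that x stands left of y in the word with inversion set
  I. The word does not exist yet, so its order is read off from I.\<close>

definition before :: "(nat \<times> nat) set \<Rightarrow> nat \<Rightarrow> nat \<Rightarrow> bool" where
  "before I x y \<longleftrightarrow> (x < y \<and> (x,y) \<notin> I) \<or> (y < x \<and> (y,x) \<in> I)"

lemma before_total: "x \<noteq> y \<Longrightarrow> before I x y \<or> before I y x"
  unfolding before_def by auto

lemma before_asym: "before I x y \<Longrightarrow> \<not> before I y x"
  unfolding before_def by auto

text \<open>Of the six relative orders of the three values, three are settled by transitivity and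
  three by cotransitivity. This is how \<open>ok\<close> makes \<open>before I\<close> a linear
  order.\<close>

lemma before_trans:
  assumes "ok n I" "before I x y" "before I y z" shows "before I x z"
proof -
  note t = ok_trans[OF assms(1)] and c = ok_cotrans[OF assms(1)]
  have "x \<noteq> z" "x \<noteq> y" "y \<noteq> z" using assms(2,3) by (auto simp: before_def)
  then consider "x < y" "y < z" | "x < z" "z < y" | "y < x" "x < z" | "y < z" "z < x"
    | "z < x" "x < y" | "z < y" "y < x" by linarith
  then show ?thesis
  proof cases
    case 1 then show ?thesis using assms(2,3) c[of x z y] by (auto simp: before_def)
  next
    case 2 then show ?thesis using assms(2,3) t[of x z y] by (auto simp: before_def)
  next
    case 3 then show ?thesis using assms(2,3) t[of y x z] by (auto simp: before_def)
  next
    case 4 then show ?thesis using assms(2,3) c[of y x z] by (auto simp: before_def)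
  next
    case 5 then show ?thesis using assms(2,3) c[of z y x] by (auto simp: before_def)
  next
    case 6 then show ?thesis using assms(2,3) t[of z y x] by (auto simp: before_def)
  qed
qed

text \<open>The number of entries left of v, that is, its zero-based position; sorting the values by
  it produces the word.\<close>

definition rk :: "nat \<Rightarrow> (nat \<times> nat) set \<Rightarrow> nat \<Rightarrow> nat" where
  "rk n I v = card {y \<in> {1..n}. before I y v}"

lemma rk_less:
  assumes "ok n I" "x \<in> {1..n}" "before I x y" shows "rk n I x < rk n I y"
  unfolding rk_def
proof (rule psubset_card_mono)
  show "{z \<in> {1..n}. before I z x} \<subset> {z \<in> {1..n}. before I z y}"
    using assms before_trans[OF assms(1)] before_asym[of I] by blast
qed simp

definition perm_of :: "nat \<Rightarrow> (nat \<times> nat) set \<Rightarrow> nat list" where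
  "perm_of n I = sort_key (rk n I) [1..<n+1]"

lemma perms_length: "x \<in> perms n \<Longrightarrow> length x = n"
  unfolding perms_def using distinct_card by fastforce

lemma perm_of_perms: "perm_of n I \<in> perms n"
  unfolding perm_of_def perms_def by auto

lemma perms_pos:
  assumes "x \<in> perms n"
  obtains f where "bij_betw f {1..n} {..<n}" "\<And>v. v \<in> {1..n} \<Longrightarrow> x ! f v = v"
    "\<And>i. i < n \<Longrightarrow> f (x ! i) = i"
    "invs x = {(p,q). 1 \<le> p \<and> p < q \<and> q \<le> n \<and> f q < f p}"
proof -
  have len: "length x = n" using perms_length[OF assms] .
  have bx: "bij_betw ((!) x) {..<n} {1..n}"
    using assms len bij_betw_nth[of x "{..<n}" "{1..n}"] unfolding perms_def by auto
  define f where "f = inv_into {..<n} ((!) x)"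
  have f1: "bij_betw f {1..n} {..<n}" unfolding f_def by (rule bij_betw_inv_into[OF bx])
  have f2: "\<And>v. v \<in> {1..n} \<Longrightarrow> x ! f v = v"
    unfolding f_def using bx by (meson bij_betw_inv_into_right)
  have f3: "\<And>i. i < n \<Longrightarrow> f (x ! i) = i"
    unfolding f_def using bx by (meson bij_betw_inv_into_left lessThan_iff)
  have f4: "\<And>v. v \<in> {1..n} \<Longrightarrow> f v < n" using f1 bij_betwE by blast
  have x1: "\<And>i. i < n \<Longrightarrow> x ! i \<in> {1..n}" using bx bij_betwE by blast
  have "invs x = {(p,q). 1 \<le> p \<and> p < q \<and> q \<le> n \<and> f q < f p}"
  proof (intro set_eqI iffI; clarify)
    fix p q assume "(p,q) \<in> invs x"
    then obtain i j where "p < q" "i < j" "j < n" "x ! i = q" "x ! j = p"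
      unfolding invs_def len by auto
    then show "1 \<le> p \<and> p < q \<and> q \<le> n \<and> f q < f p"
      using x1[of i] x1[of j] f3[of i] f3[of j] by auto
  next
    fix p q assume "1 \<le> p" "p < q" "q \<le> n" "f q < f p"
    moreover from this have "x ! f p = p" "x ! f q = q" "f p < n"
      using f2[of p] f2[of q] f4[of p] by auto
    ultimately show "(p,q) \<in> invs x" unfolding invs_def len
      by (intro CollectI case_prodI conjI exI[of _ "f q"] exI[of _ "f p"])
  qed
  note f5 = this
  show ?thesis by (rule that[OF f1 f2 f3 f5])
qed

lemma invs_ok:
  assumes "x \<in> perms n" shows "ok n (invs x)"
proof -
  obtain f where f: "bij_betw f {1..n} {..<n}" "\<And>v. v \<in> {1..n} \<Longrightarrow> x ! f v = v"
    "\<And>i. i < n \<Longrightarrow> f (x ! i) = i"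
    "invs x = {(p,q). 1 \<le> p \<and> p < q \<and> q \<le> n \<and> f q < f p}"
    by (rule perms_pos[OF assms]) (rule that)
  show ?thesis unfolding f(4) by (rule okI) auto
qed

lemma rk_invs:
  assumes "x \<in> perms n" "i < n" shows "rk n (invs x) (x ! i) = i"
proof -
  obtain f where f: "bij_betw f {1..n} {..<n}" "\<And>v. v \<in> {1..n} \<Longrightarrow> x ! f v = v"
    "\<And>i. i < n \<Longrightarrow> f (x ! i) = i"
    "invs x = {(p,q). 1 \<le> p \<and> p < q \<and> q \<le> n \<and> f q < f p}"
    by (rule perms_pos[OF assms(1)]) (rule that)
  have xi: "x ! i \<in> {1..n}" using assms perms_length[OF assms(1)] nth_mem[of i x]
    unfolding perms_def by auto
  have inj: "\<And>u v. u \<in> {1..n} \<Longrightarrow> v \<in> {1..n} \<Longrightarrow> f u = f v \<Longrightarrow> u = v"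
    using f(1) unfolding bij_betw_def inj_on_def by blast
  have e: "before (invs x) y (x ! i) \<longleftrightarrow> f y < i" if y: "y \<in> {1..n}" for y
  proof -
    have "f y \<noteq> i \<or> y = x ! i" using f(2)[OF y] by auto
    moreover have "x ! i < y \<or> y < x ! i \<or> y = x ! i" by linarith
    ultimately show ?thesis
      unfolding before_def f(4) using xi y f(3)[OF assms(2)] by (auto simp: not_less)
  qed
  have "{y \<in> {1..n}. before (invs x) y (x ! i)} = {y \<in> {1..n}. f y < i}"
    using e by blast
  also have "\<dots> = (!) x ` {..<i}"
  proof (intro set_eqI iffI)
    fix y assume "y \<in> {y \<in> {1..n}. f y < i}"
    then show "y \<in> (!) x ` {..<i}" using f(2)[of y] by force
  next
    fix y assume "y \<in> (!) x ` {..<i}"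
    then obtain j where "j < i" "y = x ! j" by blast
    then show "y \<in> {y \<in> {1..n}. f y < i}"
      using assms f(3)[of j] perms_length[OF assms(1)] nth_mem[of j x] unfolding perms_def by auto
  qed
  also have "card \<dots> = i"
  proof -
    have "inj_on ((!) x) {..<i}"
      using assms(1) perms_length[OF assms(1)] assms(2) inj_on_nth[of x "{..<i}"]
      unfolding perms_def by auto
    then show ?thesis using card_image by fastforce
  qed
  finally show ?thesis unfolding rk_def .
qed

text \<open>By \<open>rk_invs\<close> the position of every value is computed from the inversion set
  alone.\<close>

lemma invs_inj:
  assumes "x \<in> perms n" "y \<in> perms n" "invs x = invs y" shows "x = y"
proof (rule nth_equalityI)
  show "length x = length y" using assms perms_length by metis
  fix i assume "i < length x"
  then have i: "i < n" using assms(1) perms_length by blast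
  have "x ! i \<in> set y" using assms i perms_length[OF assms(1)] nth_mem[of i x]
    unfolding perms_def by auto
  then obtain j where j: "j < n" "y ! j = x ! i" using perms_length[OF assms(2)]
    by (metis in_set_conv_nth)
  have "j = i" using rk_invs[OF assms(2) j(1)] rk_invs[OF assms(1) i] j(2) assms(3) by simp
  then show "x ! i = y ! i" using j by simp
qed

lemma invs_perm_of:
  assumes "ok n I" shows "invs (perm_of n I) = I"
proof -
  let ?x = "perm_of n I"
  have len: "length ?x = n" using perm_of_perms perms_length by blast
  have el: "\<And>i. i < n \<Longrightarrow> ?x ! i \<in> {1..n}"
    using perm_of_perms[of n I] len nth_mem[of _ ?x] unfolding perms_def by auto
  have so: "rk n I (?x ! i) \<le> rk n I (?x ! j)" if "i < j" "j < n" for i j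
    using sorted_nth_mono[of "map (rk n I) ?x" i j] that len
    by (simp add: perm_of_def)
  have di: "?x ! i \<noteq> ?x ! j" if "i < j" "j < n" for i j
    using perm_of_perms[of n I] len that unfolding perms_def by (auto simp: nth_eq_iff_index_eq)
  have b: "before I (?x ! i) (?x ! j)" if "i < j" "j < n" for i j
  proof (rule ccontr)
    assume "\<not> ?thesis"
    then have "before I (?x ! j) (?x ! i)" using before_total di that by blast
    then have "rk n I (?x ! j) < rk n I (?x ! i)" using rk_less[OF assms] el that by auto
    then show False using so[OF that] by simp
  qed
  show ?thesis
  proof (intro set_eqI iffI; clarify)
    fix p q assume "(p,q) \<in> invs ?x"
    then obtain i j where "p < q" "i < j" "j < n" "?x ! i = q" "?x ! j = p"
      unfolding invs_def len by auto
    then show "(p,q) \<in> I" using b[of i j] unfolding before_def by auto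
  next
    fix p q assume pq: "(p,q) \<in> I"
    then have r: "1 \<le> p" "p < q" "q \<le> n" using okD[OF assms] by auto
    then have "p \<in> set ?x" "q \<in> set ?x" using perm_of_perms[of n I] unfolding perms_def by auto
    then obtain i j where ij: "i < n" "j < n" "?x ! i = q" "?x ! j = p"
      by (metis in_set_conv_nth len)
    have "i < j"
    proof (rule ccontr)
      assume "\<not> i < j"
      then have "j < i" using ij r by (metis linorder_neqE_nat less_irrefl)
      then show False using b[of j i] ij pq r unfolding before_def by auto
    qed
    then show "(p,q) \<in> invs ?x" unfolding invs_def len using ij r by auto
  qed
qed

lemma perm_of_invs: "x \<in> perms n \<Longrightarrow> perm_of n (invs x) = x"
  using invs_inj perm_of_perms invs_perm_of invs_ok by blast

lemma perms_nth_eq: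
  assumes "x \<in> perms n" "i < n" "j < n" "x ! i = x ! j" shows "i = j"
  using assms perms_length[OF assms(1)] unfolding perms_def by (auto simp: nth_eq_iff_index_eq)

lemma nth_invs:
  assumes "x \<in> perms n" "k < n" "l < n"
  shows "(x ! l, x ! k) \<in> invs x \<longleftrightarrow> x ! l < x ! k \<and> k < l"
proof
  assume "(x ! l, x ! k) \<in> invs x"
  then obtain i j where "x ! l < x ! k" "i < j" "j < n" "x ! i = x ! k" "x ! j = x ! l"
    unfolding invs_def perms_length[OF assms(1)] by auto
  moreover have "i = k" "j = l" using calculation assms perms_nth_eq[OF assms(1)] by auto
  ultimately show "x ! l < x ! k \<and> k < l" by simp
next
  assume "x ! l < x ! k \<and> k < l"
  then show "(x ! l, x ! k) \<in> invs x"
    unfolding invs_def perms_length[OF assms(1)] using assms by blast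
qed

lemma swap_adj_perms:
  assumes "x \<in> perms n" "Suc i < length x" shows "swap_adj x i \<in> perms n"
  using assms unfolding perms_def swap_adj_def by auto

lemma swap_adj_invs:
  assumes x: "x \<in> perms n" and i: "Suc i < length x" and lt: "x ! i < x ! Suc i"
  shows "invs (swap_adj x i) = insert (x ! i, x ! Suc i) (invs x)"
    and "(x ! i, x ! Suc i) \<notin> invs x"
proof -
  have len: "length x = n" using perms_length[OF x] .
  have d: "\<And>i j. i < n \<Longrightarrow> j < n \<Longrightarrow> x ! i = x ! j \<Longrightarrow> i = j"
    using x len unfolding perms_def by (auto simp: nth_eq_iff_index_eq)
  let ?y = "swap_adj x i"
  define \<tau> where "\<tau> j = (if j = i then Suc i else if j = Suc i then i else j)" for j
  have y: "?y ! j = x ! \<tau> j" if "j < n" for j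
    using that i len unfolding swap_adj_def \<tau>_def by (auto simp: nth_list_update)
  have ly: "length ?y = n" using len unfolding swap_adj_def by simp
  have tn: "\<tau> j < n" if "j < n" for j using that i len unfolding \<tau>_def by auto
  have tt: "\<tau> (\<tau> j) = j" for j unfolding \<tau>_def by auto
  show nin: "(x ! i, x ! Suc i) \<notin> invs x"
  proof
    assume "(x ! i, x ! Suc i) \<in> invs x"
    then obtain k j where "k < j" "j < n" "x ! k = x ! Suc i" "x ! j = x ! i"
      unfolding invs_def len by auto
    then have "k = Suc i" "j = i" using d[of k "Suc i"] d[of j i] i len by auto
    then show False using \<open>k < j\<close> by simp
  qed
  show "invs ?y = insert (x ! i, x ! Suc i) (invs x)"
  proof (rule set_eqI)
    fix r :: "nat \<times> nat"
    obtain p q where r: "r = (p,q)" by fastforce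
    show "r \<in> invs ?y \<longleftrightarrow> r \<in> insert (x ! i, x ! Suc i) (invs x)" unfolding r
    proof
    assume "(p,q) \<in> invs ?y"
    then obtain k j where "p < q" "k < j" "j < n" "?y ! k = q" "?y ! j = p"
      unfolding invs_def ly by auto
    then have kj: "p < q" "k < j" "j < n" "x ! \<tau> k = q" "x ! \<tau> j = p" using y by auto
    show "(p,q) \<in> insert (x ! i, x ! Suc i) (invs x)"
    proof (cases "(p,q) \<in> invs x")
    case False
    have "\<not> \<tau> k < \<tau> j" using kj tn False unfolding invs_def len by auto
    then have "k = i \<and> j = Suc i" using kj(2) unfolding \<tau>_def by (auto split: if_splits)
    then show ?thesis using kj unfolding \<tau>_def by auto
    qed simp
    next
    assume "(p,q) \<in> insert (x ! i, x ! Suc i) (invs x)"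
    moreover have "?y ! i = x ! Suc i" "?y ! Suc i = x ! i" using y i len by (auto simp: \<tau>_def)
    then have "(x ! i, x ! Suc i) \<in> invs ?y" unfolding invs_def ly using lt i len
      by (intro CollectI case_prodI conjI exI[of _ i] exI[of _ "Suc i"]) auto
    moreover have "(p,q) \<in> invs ?y" if inv: "(p,q) \<in> invs x"
    proof -
    obtain k j where kj: "p < q" "k < j" "j < n" "x ! k = q" "x ! j = p"
      using inv unfolding invs_def len by auto
    have "\<not> (k = i \<and> j = Suc i)" using kj lt by auto
    then have "\<tau> k < \<tau> j" using kj unfolding \<tau>_def by auto
    then show "(p,q) \<in> invs ?y" unfolding invs_def ly
      using kj y[of "\<tau> k"] y[of "\<tau> j"] tn[of j] tn[of k] tt
      by (intro CollectI case_prodI conjI exI[of _ "\<tau> k"] exI[of _ "\<tau> j"]) auto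
    qed
    ultimately show "(p,q) \<in> invs ?y" by auto
    qed
  qed
qed

text \<open>An entry c standing between a and b, whether its value is below a, between them or above
  b, would force one more pair into the larger inversion set by transitivity or cotransitivity.
  Hence a and b are adjacent.\<close>

lemma insert_swap_adj:
  assumes u: "u \<in> perms n" and v: "v \<in> perms n" and nin: "(a,b) \<notin> invs u"
    and iv: "invs v = insert (a,b) (invs u)"
  obtains i where "Suc i < length u" "u ! i = a" "u ! Suc i = b" "v = swap_adj u i"
proof -
  have len: "length u = n" using perms_length[OF u] .
  have okv: "ok n (invs v)" using invs_ok[OF v] .
  have ab: "1 \<le> a" "a < b" "b \<le> n" using okD[OF okv, of a b] iv by auto
  have "a \<in> set u" "b \<in> set u" using ab u unfolding perms_def by auto
  then obtain i j where ij: "i < n" "j < n" "u ! i = a" "u ! j = b"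
    by (metis in_set_conv_nth len)
  have "i < j"
  proof (rule ccontr)
    assume "\<not> i < j"
    then have "j < i" using ij ab by (metis linorder_neqE_nat less_irrefl)
    then show False using nin ij ab unfolding invs_def len by auto
  qed
  have "j = Suc i"
  proof (rule ccontr)
    assume "j \<noteq> Suc i"
    then have s: "Suc i < j" using \<open>i < j\<close> by simp
    \<comment> \<open>The entry directly right of a serves as the witness c.\<close>
    obtain c where c: "u ! Suc i = c" by blast
    have d: "\<And>i j. i < n \<Longrightarrow> j < n \<Longrightarrow> u ! i = u ! j \<Longrightarrow> i = j"
      using u len unfolding perms_def by (auto simp: nth_eq_iff_index_eq)
    have ca: "c \<noteq> a" "c \<noteq> b" using d[of "Suc i" i] d[of "Suc i" j] s ij c by auto
    have inv_iff: "(p,q) \<in> invs u \<longleftrightarrow> k < l"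
      if "p < q" "u ! k = q" "u ! l = p" "k < n" "l < n" for p q k l
      using nth_invs[OF u that(4,5)] that(1-3) by simp
    consider "c < a" | "a < c" "c < b" | "b < c" using ca by linarith
    then show False
    proof cases
      case 1
      have "(c,a) \<in> invs u" using inv_iff[of c a i "Suc i"] 1 ij s c by auto
      then have "(c,b) \<in> invs v" using ok_trans[OF okv, of c a b] iv by auto
      moreover have "(c,b) \<notin> invs u" using inv_iff[of c b j "Suc i"] 1 ij s c ab by auto
      ultimately show False using iv ca by auto
    next
      case 2
      have "(a,c) \<notin> invs u" using inv_iff[of a c "Suc i" i] 2 ij s c by auto
      moreover have "(c,b) \<notin> invs u" using inv_iff[of c b j "Suc i"] 2 ij s c ab by auto
      moreover have "(a,c) \<in> invs v \<or> (c,b) \<in> invs v"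
        using ok_cotrans[OF okv, of a b c] iv 2 by auto
      ultimately show False using iv ca by auto
    next
      case 3
      have "(b,c) \<in> invs u" using inv_iff[of b c "Suc i" j] 3 ij s c by auto
      then have "(a,c) \<in> invs v" using ok_trans[OF okv, of a b c] iv by auto
      moreover have "(a,c) \<notin> invs u" using inv_iff[of a c "Suc i" i] 3 ij s c ab by auto
      ultimately show False using iv ca by auto
    qed
  qed
  then have *: "Suc i < length u" "u ! i = a" "u ! Suc i = b" using ij len by auto
  have "v = swap_adj u i"
    using invs_inj[OF v swap_adj_perms[OF u *(1)]] swap_adj_invs[OF u *(1)] * ab iv by simp
  with * show ?thesis using that by blast
qed

text \<open>An entry c > a stands left of a exactly when (a,c) is an inversion, so the set L of an
  edge is visible in the inversion set of its lower end.\<close>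

lemma fence_edges_iff:
  assumes "(a,b,L) \<in> fences n"
  shows "(u,v) \<in> fence_edges n (a,b,L) \<longleftrightarrow> u \<in> perms n \<and> v \<in> perms n \<and> (a,b) \<notin> invs u
    \<and> invs v = insert (a,b) (invs u) \<and> L = {c. a < c \<and> c < b \<and> (a,c) \<in> invs u}"
proof -
  have ab: "1 \<le> a" "a < b" "b \<le> n" using assms unfolding fences_def by auto
  have L: "set (take i u) \<inter> {a<..<b} = {c. a < c \<and> c < b \<and> (a,c) \<in> invs u}"
    if u: "u \<in> perms n" and i: "Suc i < length u" "u ! i = a" for i
  proof -
    have len: "length u = n" using perms_length[OF u] .
    have d: "\<And>i j. i < n \<Longrightarrow> j < n \<Longrightarrow> u ! i = u ! j \<Longrightarrow> i = j"
      using u len unfolding perms_def by (auto simp: nth_eq_iff_index_eq)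
    have st: "c \<in> set (take i u) \<longleftrightarrow> (\<exists>k<i. u ! k = c)" for c
      using i len by (auto simp: in_set_conv_nth)
    have "c \<in> set (take i u) \<longleftrightarrow> (a,c) \<in> invs u" if "a < c" for c
    proof
      assume "c \<in> set (take i u)"
      then obtain k where "k < i" "u ! k = c" using st by blast
      then show "(a,c) \<in> invs u" using nth_invs[OF u, of k i] i len that by auto
    next
      assume "(a,c) \<in> invs u"
      then obtain k j where "k < j" "j < n" "u ! k = c" "u ! j = a" unfolding invs_def len by auto
      then have "j = i" using d[of j i] i len by auto
      then show "c \<in> set (take i u)" using st \<open>k < j\<close> \<open>u ! k = c\<close> by blast
    qed
    then show ?thesis by auto
  qed
  show ?thesis
  proof
    assume "(u,v) \<in> fence_edges n (a,b,L)"
    then obtain i where i: "u \<in> perms n" "Suc i < length u" "u ! i = a" "u ! Suc i = b"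
      "set (take i u) \<inter> {a<..<b} = L" "v = swap_adj u i"
      unfolding fence_edges_def by auto
    have "L = {c. a < c \<and> c < b \<and> (a,c) \<in> invs u}"
      by (rule trans[OF i(5)[symmetric] L[OF i(1-3)]])
    moreover have "(a,b) \<notin> invs u" "invs v = insert (a,b) (invs u)"
      using swap_adj_invs[OF i(1,2)] i(3,4,6) ab(2) by simp_all
    moreover have "v \<in> perms n" using swap_adj_perms[OF i(1,2)] i(6) by simp
    ultimately show "u \<in> perms n \<and> v \<in> perms n \<and> (a,b) \<notin> invs u
      \<and> invs v = insert (a,b) (invs u) \<and> L = {c. a < c \<and> c < b \<and> (a,c) \<in> invs u}"
      using i(1) by blast
  next
    assume "u \<in> perms n \<and> v \<in> perms n \<and> (a,b) \<notin> invs u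
    \<and> invs v = insert (a,b) (invs u) \<and> L = {c. a < c \<and> c < b \<and> (a,c) \<in> invs u}"
    then have *: "u \<in> perms n" "v \<in> perms n" "(a,b) \<notin> invs u" "invs v = insert (a,b) (invs u)"
      "L = {c. a < c \<and> c < b \<and> (a,c) \<in> invs u}" by blast+
    obtain i where i: "Suc i < length u" "u ! i = a" "u ! Suc i = b" "v = swap_adj u i"
      by (rule insert_swap_adj[OF *(1-4)]) (rule that)
    have tk: "set (take i u) \<inter> {a<..<b} = L" 
      by (rule trans[OF L[OF *(1) i(1,2)] *(5)[symmetric]])
    have "\<exists>u' i'. (u,v) = (u', swap_adj u' i') \<and> u' \<in> perms n \<and> Suc i' < length u' \<and> u' ! i' = a
      \<and> u' ! Suc i' = b \<and> set (take i' u') \<inter> {a<..<b} = L"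
      by (rule exI[of _ u], rule exI[of _ i]) (intro conjI tk *(1) i(1-3), simp only: i(4))
    then show "(u,v) \<in> fence_edges n (a,b,L)" unfolding fence_edges_def prod.case mem_Collect_eq .
  qed
qed

subsection \<open>Congruences on inversion sets\<close>

definition jn :: "(nat \<times> nat) set \<Rightarrow> (nat \<times> nat) set \<Rightarrow> (nat \<times> nat) set" where
  "jn I J = (I \<union> J)\<^sup>+"

definition mt :: "nat \<Rightarrow> (nat \<times> nat) set \<Rightarrow> (nat \<times> nat) set \<Rightarrow> (nat \<times> nat) set" where
  "mt n I J = prs n - jn (prs n - I) (prs n - J)"

text \<open>Paths in U ascend. A value r inside the range of a path is one of its vertices or lies
  inside one step; cotransitivity of U splits that step and the path supplies the rest.\<close>

lemma trancl_ok:
  assumes U: "U \<subseteq> prs n" and co: "cotrans U" shows "ok n (U\<^sup>+)"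
proof (rule okI)
  fix p q assume "(p,q) \<in> U\<^sup>+"
  then show "1 \<le> p \<and> p < q \<and> q \<le> n"
    by induction (use U in \<open>auto simp: prs_def\<close>)
next
  fix p r q assume "(p,q) \<in> U\<^sup>+" "p < r" "r < q"
  then show "(p,r) \<in> U\<^sup>+ \<or> (r,q) \<in> U\<^sup>+"
  proof (induction rule: trancl.induct)
    case (r_into_trancl p q)
    then have "(p,r) \<in> U \<or> (r,q) \<in> U" using co unfolding cotrans_def by blast
    then show ?case by blast
  next
    case (trancl_into_trancl p y z)
    consider "r < y" | "r = y" | "y < r" by linarith
    then show ?case
    proof cases
      case 1
      then have "(p,r) \<in> U\<^sup>+ \<or> (r,y) \<in> U\<^sup>+"
        using trancl_into_trancl.IH trancl_into_trancl.prems by simp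
      then show ?thesis using trancl.trancl_into_trancl[OF _ trancl_into_trancl.hyps(2)] by blast
    next
      case 2 then show ?thesis using trancl_into_trancl.hyps by simp
    next
      case 3
      then have "(y,r) \<in> U \<or> (r,z) \<in> U"
        using co trancl_into_trancl.hyps(2) trancl_into_trancl.prems unfolding cotrans_def by simp
      then show ?thesis
        using trancl.trancl_into_trancl[OF trancl_into_trancl.hyps(1)] trancl.r_into_trancl by blast
    qed
  qed
qed (rule trancl_trans)

lemma ok_empty: "ok n {}"
  by (rule okI) auto

lemma ok_compl: assumes "ok n I" shows "ok n (prs n - I)"
proof (rule okI)
  fix p q r assume h: "(p,q) \<in> prs n - I" "(q,r) \<in> prs n - I"
  then have "p < q" "q < r" by (auto simp: prs_def)
  then show "(p,r) \<in> prs n - I" using h ok_cotrans[OF assms, of p r q] by (auto simp: prs_def)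
next
  fix p r q assume h: "(p,q) \<in> prs n - I" "p < r" "r < q"
  then show "(p,r) \<in> prs n - I \<or> (r,q) \<in> prs n - I"
    using ok_trans[OF assms, of p r q] by (auto simp: prs_def)
qed (auto simp: prs_def)

lemma compl_compl: "ok n I \<Longrightarrow> prs n - (prs n - I) = I"
  unfolding ok_def by blast

lemma ok_prs: "ok n I \<Longrightarrow> I \<subseteq> prs n"
  unfolding ok_def by blast

lemma ok_jn: assumes "ok n I" "ok n J" shows "ok n (jn I J)"
  unfolding jn_def
proof (rule trancl_ok)
  show "cotrans (I \<union> J)" unfolding cotrans_def
    using ok_cotrans[OF assms(1)] ok_cotrans[OF assms(2)] by (metis Un_iff)
qed (use assms in \<open>auto simp: ok_def\<close>)

lemma jn_upper: "I \<subseteq> jn I J" "J \<subseteq> jn I J"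
  unfolding jn_def by auto

lemma jn_least: assumes "ok n K" "I \<subseteq> K" "J \<subseteq> K" shows "jn I J \<subseteq> K"
proof -
  have "jn I J \<subseteq> K\<^sup>+" unfolding jn_def using trancl_mono_subset[of "I \<union> J" K] assms by blast
  then show ?thesis using assms(1) trancl_id[of K] unfolding ok_def by simp
qed

lemma jn_absorb: "ok n J \<Longrightarrow> I \<subseteq> J \<Longrightarrow> jn I J = J"
  by (intro equalityI jn_least jn_upper) auto

lemma jn_commute: "jn I J = jn J I"
  unfolding jn_def by (simp add: Un_commute)

lemma ok_mt: "ok n I \<Longrightarrow> ok n J \<Longrightarrow> ok n (mt n I J)"
  unfolding mt_def by (intro ok_compl ok_jn)

lemma mt_lower: assumes "ok n I" "ok n J" shows "mt n I J \<subseteq> I" "mt n I J \<subseteq> J"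
  using jn_upper(1)[of "prs n - I" "prs n - J"] jn_upper(2)[of "prs n - J" "prs n - I"]
  unfolding mt_def by auto

lemma mt_greatest: assumes "ok n K" "K \<subseteq> I" "K \<subseteq> J" shows "K \<subseteq> mt n I J"
proof -
  have "jn (prs n - I) (prs n - J) \<subseteq> prs n - K"
    by (rule jn_least[OF ok_compl[OF assms(1)]]) (use assms(2,3) in auto)
  then show ?thesis unfolding mt_def using ok_prs[OF assms(1)] by auto
qed

lemma mt_absorb: "ok n I \<Longrightarrow> ok n J \<Longrightarrow> I \<subseteq> J \<Longrightarrow> mt n I J = I"
  by (intro equalityI mt_greatest mt_lower) auto

lemma mt_absorb2: "ok n I \<Longrightarrow> ok n J \<Longrightarrow> J \<subseteq> I \<Longrightarrow> mt n I J = J"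
  by (intro equalityI mt_greatest mt_lower) auto

text \<open>The assumption says that p and q are adjacent in the word of I, so the insertion is an
  adjacent swap. A failure of transitivity or cotransitivity would exhibit an entry between
  them.\<close>

lemma ok_insertI:
  assumes I: "ok n I" and pq: "1 \<le> p" "p < q" "q \<le> n"
    and adj: "\<And>c. 1 \<le> c \<Longrightarrow> c \<le> n \<Longrightarrow> c \<noteq> p \<Longrightarrow> c \<noteq> q \<Longrightarrow> before I p c \<Longrightarrow> before I c q \<Longrightarrow> False"
  shows "ok n (insert (p,q) I)"
proof (rule okI)
  fix x y z assume h: "(x,y) \<in> insert (p,q) I" "(y,z) \<in> insert (p,q) I"
  show "(x,z) \<in> insert (p,q) I"
  proof (cases "(x,y) = (p,q)")
    case True
    then have yz: "(q,z) \<in> I" using h(2) pq by auto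
    show ?thesis
    proof (rule ccontr)
      assume "\<not> ?thesis"
      then have "(p,z) \<notin> I" using True by auto
      then show False using adj[of z] okD[OF I yz] yz pq unfolding before_def by auto
    qed
  next
    case xy: False
    then have xy: "(x,y) \<in> I" using h by auto
    show ?thesis
    proof (cases "(y,z) = (p,q)")
      case True
      then have xp: "(x,p) \<in> I" using xy by auto
      show ?thesis
      proof (rule ccontr)
        assume "\<not> ?thesis"
        then have "(x,q) \<notin> I" using True by auto
        then show False using adj[of x] okD[OF I xp] xp pq unfolding before_def by auto
      qed
    next
      case False
      then show ?thesis using ok_trans[OF I xy] h(2) by auto
    qed
  qed
next
  fix x r y assume h: "(x,y) \<in> insert (p,q) I" "x < r" "r < y"
  show "(x,r) \<in> insert (p,q) I \<or> (r,y) \<in> insert (p,q) I"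
  proof (cases "(x,y) = (p,q)")
    case True
    then show ?thesis using adj[of r] h pq unfolding before_def by auto
  next
    case False then show ?thesis using ok_cotrans[OF I, of x y r] h by auto
  qed
qed (use okD[OF I] pq in auto)

text \<open>Among the pairs of J - I, take one with the fewest entries of the word of I between its
  two values. An entry c between p and q would leave (p,c) or (c,q) in J - I with fewer entries in
  between, so p and q are adjacent.\<close>

lemma exists_ascent:
  assumes I: "ok n I" and J: "ok n J" and "I \<subset> J"
  obtains p q where "(p,q) \<in> J" "(p,q) \<notin> I" "ok n (insert (p,q) I)"
proof -
  define m where "m = (\<lambda>(p,q). card {c \<in> {1..n}. before I p c \<and> before I c q})"
  obtain e where e: "e \<in> J - I" using assms(3) by blast
  obtain x where x: "x \<in> J - I" and min: "\<And>y. y \<in> J - I \<Longrightarrow> m x \<le> m y"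
    using ex_has_least_nat[of "\<lambda>x. x \<in> J - I" e m] e by blast
  obtain p q where pq: "x = (p,q)" by fastforce
  have d: "(p,q) \<in> J" "(p,q) \<notin> I" using x pq by auto
  have r: "1 \<le> p" "p < q" "q \<le> n" using okD[OF J d(1)] by auto
  have bpq: "before I p q" using d r unfolding before_def by auto
  have "ok n (insert (p,q) I)"
  proof (rule ok_insertI[OF I r])
    fix c assume c: "1 \<le> c" "c \<le> n" "c \<noteq> p" "c \<noteq> q" "before I p c" "before I c q"
    have l: "m (p,c) < m (p,q)" unfolding m_def prod.case
    proof (rule psubset_card_mono)
      show "{d \<in> {1..n}. before I p d \<and> before I d c} \<subset> {c \<in> {1..n}. before I p c \<and> before I c q}"
        using c before_trans[OF I, of _ c q] before_asym[of I c c] by auto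
    qed simp
    have l2: "m (c,q) < m (p,q)" unfolding m_def prod.case
    proof (rule psubset_card_mono)
      show "{d \<in> {1..n}. before I c d \<and> before I d q} \<subset> {c \<in> {1..n}. before I p c \<and> before I c q}"
        using c before_trans[OF I, of p c] before_asym[of I c c] by auto
    qed simp
    have "(p,c) \<in> J - I \<or> (c,q) \<in> J - I"
    proof -
      consider "c < p" | "p < c" "c < q" | "q < c" using c by linarith
      then show ?thesis
      proof cases
        case 1
        then have "(c,p) \<in> J" using c assms(3) unfolding before_def by auto
        then show ?thesis using ok_trans[OF J, of c p q] d c 1 r unfolding before_def by auto
      next
        case 2
        then show ?thesis using ok_cotrans[OF J, of p q c] d c unfolding before_def by auto
      next
        case 3
        then have "(q,c) \<in> J" using c assms(3) unfolding before_def by auto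
        then show ?thesis using ok_trans[OF J, of p q c] d c 3 r unfolding before_def by auto
      qed
    qed
    then show False using min l l2 pq by fastforce
  qed
  then show ?thesis using that d by blast
qed

text \<open>The join-irreducible word of the fence: the values below a, then L and b in increasing
  order, then a and the values of ]a,b[ outside L in increasing order, then the values above b. Its
  only descent is b a.\<close>

definition jv :: "nat \<Rightarrow> nat \<Rightarrow> nat set \<Rightarrow> (nat \<times> nat) set" where
  "jv a b L = {(p,q). a \<le> p \<and> p < q \<and> q \<le> b \<and> p \<notin> L \<and> (q \<in> L \<or> q = b)}"

text \<open>The unique lower cover of \<open>jv a b L\<close>, in which b a is swapped back; the two
  form the lowest edge of the fence.\<close>

definition ju :: "nat \<Rightarrow> nat \<Rightarrow> nat set \<Rightarrow> (nat \<times> nat) set" where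
  "ju a b L = jv a b L - {(a,b)}"

lemma mem_jv: "(p,q) \<in> jv a b L \<longleftrightarrow> a \<le> p \<and> p < q \<and> q \<le> b \<and> p \<notin> L \<and> (q \<in> L \<or> q = b)"
  unfolding jv_def by simp

lemma fence_iff: "(a,b,L) \<in> fences n \<longleftrightarrow> 1 \<le> a \<and> a < b \<and> b \<le> n \<and> L \<subseteq> {a<..<b}"
  unfolding fences_def by simp

lemma ok_jv: "(a,b,L) \<in> fences n \<Longrightarrow> ok n (jv a b L)"
  by (rule okI) (auto simp: mem_jv fence_iff)

lemma ok_ju: "(a,b,L) \<in> fences n \<Longrightarrow> ok n (ju a b L)"
  unfolding ju_def by (rule okI) (auto simp: mem_jv fence_iff)

lemma insert_ju: "(a,b,L) \<in> fences n \<Longrightarrow> insert (a,b) (ju a b L) = jv a b L"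
  unfolding ju_def by (auto simp: mem_jv fence_iff)

definition lset :: "nat \<Rightarrow> nat \<Rightarrow> (nat \<times> nat) set \<Rightarrow> nat set" where
  "lset a b I = {c. a < c \<and> c < b \<and> (a,c) \<in> I}"

lemma lset_ju: "(a,b,L) \<in> fences n \<Longrightarrow> lset a b (ju a b L) = L"
  unfolding lset_def ju_def by (auto simp: mem_jv fence_iff)

text \<open>Complementing an inversion set reverses the word, so the lowest edge of a fence becomes
  the highest edge of the fence with complementary L.\<close>

lemma lset_compl_jv:
  "(a,b,L) \<in> fences n \<Longrightarrow> lset a b (prs n - jv a b L) = {a<..<b} - L"
  unfolding lset_def by (auto simp: mem_jv fence_iff prs_def)

lemma insert_compl_jv:
  "(a,b,L) \<in> fences n \<Longrightarrow> insert (a,b) (prs n - jv a b L) = prs n - ju a b L"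
  unfolding ju_def by (auto simp: mem_jv fence_iff prs_def)

lemma fence_compl: "(a,b,L) \<in> fences n \<Longrightarrow> (a,b,{a<..<b} - L) \<in> fences n"
  by (auto simp: fence_iff)

lemma edge_fence:
  assumes "ok n (insert (a,b) I)" shows "(a,b,lset a b I) \<in> fences n"
  using okD[OF assms, of a b] by (auto simp: fence_iff lset_def)

text \<open>A value of ]a,b[ that is not left of a stands right of b, because a and b are adjacent.
  This already yields all inversions of the lowest edge of the fence.\<close>

lemma edge_ju:
  assumes I: "ok n I" and J: "ok n (insert (a,b) I)" and nin: "(a,b) \<notin> I"
  shows "ju a b (lset a b I) \<subseteq> I"
proof
  fix x assume x: "x \<in> ju a b (lset a b I)"
  obtain p q where pq: "x = (p,q)" by fastforce
  have h: "a \<le> p" "p < q" "q \<le> b" "p \<notin> lset a b I" "q \<in> lset a b I \<or> q = b" "(p,q) \<noteq> (a,b)"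
    using x unfolding pq ju_def by (auto simp: mem_jv)
  show "x \<in> I" unfolding pq
  proof (cases "p = a")
    case True then show "(p,q) \<in> I" using h by (auto simp: lset_def)
  next
    case False
    then have "(a,p) \<notin> I" using h by (auto simp: lset_def)
    moreover have "(a,p) \<in> insert (a,b) I \<or> (p,b) \<in> insert (a,b) I"
      using ok_cotrans[OF J, of a b p] h False by auto
    ultimately have pb: "(p,b) \<in> I" using False h by auto
    show "(p,q) \<in> I"
    proof (cases "q = b")
      case False
      then have "(a,q) \<in> I" using h by (auto simp: lset_def)
      then show ?thesis using ok_cotrans[OF I, of a q p] \<open>(a,p) \<notin> I\<close> h \<open>p \<noteq> a\<close> by auto
    qed (use pb in simp)
  qed
qed

section \<open>Fences under a congruence and the forcing order\<close>

locale wcong =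
  fixes n :: nat and C :: "(nat \<times> nat) set \<Rightarrow> (nat \<times> nat) set \<Rightarrow> bool"
  assumes Cok: "C I J \<Longrightarrow> ok n I \<and> ok n J"
    and Crefl: "ok n I \<Longrightarrow> C I I"
    and Csym: "C I J \<Longrightarrow> C J I"
    and Ctrans: "C I J \<Longrightarrow> C J K \<Longrightarrow> C I K"
    and Cjn: "C I J \<Longrightarrow> ok n K \<Longrightarrow> C (jn I K) (jn J K)"
    and Cmt: "C I J \<Longrightarrow> ok n K \<Longrightarrow> C (mt n I K) (mt n J K)"
begin

text \<open>Only the lowest edge of the fence is tested; \<open>edge_iff\<close> transfers the
  answer to all of its edges.\<close>

definition dead :: "nat \<Rightarrow> nat \<Rightarrow> nat set \<Rightarrow> bool" where
  "dead a b L \<longleftrightarrow> C (ju a b L) (jv a b L)"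

lemma convex:
  assumes "C I J" "I \<subseteq> K" "K \<subseteq> J" "ok n K" shows "C I K" "C K J"
proof -
  have "C (mt n I K) (mt n J K)" using Cmt assms by blast
  then show "C I K" using mt_absorb[of n I K] mt_absorb2[of n J K] assms Cok by auto
  then show "C K J" using assms Csym Ctrans by blast
qed

text \<open>The edge at I and the lowest edge of its fence are perspective: meeting with
  \<open>jv\<close> carries the first to the second, joining with I carries it back.\<close>

lemma edge_iff:
  assumes I: "ok n I" and J: "ok n (insert (a,b) I)" and nin: "(a,b) \<notin> I"
  shows "C I (insert (a,b) I) \<longleftrightarrow> dead a b (lset a b I)"
proof -
  let ?L = "lset a b I"
  have f: "(a,b,?L) \<in> fences n" using edge_fence[OF J] .
  have s: "ju a b ?L \<subseteq> I" using edge_ju[OF I J nin] .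
  have s2: "jv a b ?L \<subseteq> insert (a,b) I" using s insert_ju[OF f] by blast
  have ab: "(a,b) \<in> jv a b ?L" using f by (auto simp: mem_jv fence_iff lset_def)
  note oks = ok_ju[OF f] ok_jv[OF f]
  show ?thesis
  proof
    assume "C I (insert (a,b) I)"
    then have "C (mt n I (jv a b ?L)) (mt n (insert (a,b) I) (jv a b ?L))" using Cmt oks by blast
    moreover have "mt n (insert (a,b) I) (jv a b ?L) = jv a b ?L"
      using mt_absorb2[OF J oks(2) s2] .
    moreover have "mt n I (jv a b ?L) = ju a b ?L"
    proof
      show "mt n I (jv a b ?L) \<subseteq> ju a b ?L"
        using mt_lower[OF I oks(2)] nin unfolding ju_def by blast
      show "ju a b ?L \<subseteq> mt n I (jv a b ?L)"
        by (rule mt_greatest[OF oks(1) s]) (auto simp: ju_def)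
    qed
    ultimately show "dead a b ?L" unfolding dead_def by simp
  next
    assume "dead a b ?L"
    then have "C (jn (ju a b ?L) I) (jn (jv a b ?L) I)" using Cjn I unfolding dead_def by blast
    moreover have "jn (ju a b ?L) I = I" using jn_absorb[OF I s] .
    moreover have "jn (jv a b ?L) I = insert (a,b) I"
    proof
      show "jn (jv a b ?L) I \<subseteq> insert (a,b) I" by (rule jn_least[OF J s2]) auto
      show "insert (a,b) I \<subseteq> jn (jv a b ?L) I"
        using jn_upper(1)[of "jv a b ?L" I] jn_upper(2)[of I "jv a b ?L"] ab by blast
    qed
    ultimately show "C I (insert (a,b) I)" by simp
  qed
qed

lemma dead_upper:
  assumes f: "(a,b,L) \<in> fences n"
  shows "dead a b L \<longleftrightarrow> C (prs n - jv a b ({a<..<b} - L)) (prs n - ju a b ({a<..<b} - L))"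
proof -
  let ?M = "{a<..<b} - L"
  have f': "(a,b,?M) \<in> fences n" using fence_compl[OF f] .
  have "C (prs n - jv a b ?M) (insert (a,b) (prs n - jv a b ?M))
      \<longleftrightarrow> dead a b (lset a b (prs n - jv a b ?M))"
  proof (rule edge_iff)
    show "ok n (prs n - jv a b ?M)" by (intro ok_compl ok_jv f')
    show "ok n (insert (a,b) (prs n - jv a b ?M))"
      unfolding insert_compl_jv[OF f'] by (intro ok_compl ok_ju f')
    show "(a,b) \<notin> prs n - jv a b ?M" using f' by (auto simp: mem_jv fence_iff)
  qed
  then show ?thesis unfolding insert_compl_jv[OF f'] lset_compl_jv[OF f']
    using f by (simp add: fence_iff double_diff)
qed

text \<open>The highest edge of the inner fence is met with \<open>jv a b L\<close>. Its upper end
  contains \<open>jv a b L\<close>, while its lower end lacks (c,d); by cotransitivity the meet K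
  then lacks (a,b) as well. So K lies below \<open>ju a b L\<close>, and convexity contracts the
  edge.\<close>

lemma forcing1:
  assumes f: "(a,b,L) \<in> fences n" and cd: "a \<le> c" "c < d" "d \<le> b"
    and c: "c \<notin> L" and d: "d = b \<or> d \<in> L"
    and dead: "dead c d (L \<inter> {c<..<d})"
  shows "dead a b L"
proof -
  let ?M = "L \<inter> {c<..<d}"
  let ?N = "{c<..<d} - ?M"
  have f': "(c,d,?M) \<in> fences n" using f cd by (auto simp: fence_iff)
  let ?x = "prs n - jv c d ?N" and ?y = "prs n - ju c d ?N"
  have xy: "C ?x ?y" using dead dead_upper[OF f'] by blast
  have oks: "ok n ?x" "ok n ?y" "ok n (jv a b L)" "ok n (ju a b L)"
    using Cok[OF xy] ok_jv[OF f] ok_ju[OF f] by auto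
  have vy: "jv a b L \<subseteq> ?y"
    using ok_prs[OF oks(3)] cd c d f by (auto simp: ju_def mem_jv fence_iff)
  define K where "K = mt n ?x (jv a b L)"
  have "C K (jv a b L)" using Cmt[OF xy oks(3)] mt_absorb2[OF oks(2,3) vy] unfolding K_def by simp
  have K: "ok n K" "K \<subseteq> ?x" "K \<subseteq> jv a b L" using ok_mt mt_lower oks unfolding K_def by blast+
  have cdK: "(c,d) \<notin> K" using K(2) cd by (auto simp: mem_jv)
  have "(a,b) \<notin> K"
  proof
    assume ab: "(a,b) \<in> K"
    have cb: "(c,b) \<in> K"
    proof (cases "c = a")
      case False
      then have "(a,c) \<in> K \<or> (c,b) \<in> K" using ok_cotrans[OF K(1) ab, of c] cd by auto
      moreover have "(a,c) \<notin> K" using K(3) c cd by (auto simp: mem_jv)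
      ultimately show ?thesis by blast
    qed (use ab in simp)
    have "(c,d) \<in> K"
    proof (cases "d = b")
      case False
      then have "(c,d) \<in> K \<or> (d,b) \<in> K" using ok_cotrans[OF K(1) cb, of d] cd by auto
      moreover have "(d,b) \<notin> K" using K(3) d False by (auto simp: mem_jv)
      ultimately show ?thesis by blast
    qed (use cb in simp)
    then show False using cdK by blast
  qed
  then have "K \<subseteq> ju a b L" using K(3) unfolding ju_def by blast
  moreover have "ju a b L \<subseteq> jv a b L" unfolding ju_def by blast
  ultimately show ?thesis unfolding dead_def
    by (rule convex(2)[OF \<open>C K (jv a b L)\<close> _ _ oks(4)])
qed

text \<open>Dual to \<open>forcing1\<close>: the lowest edge of the inner fence is joined with the
  lower end of the highest edge of the outer one, and transitivity brings in (a,b).\<close>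

lemma forcing2:
  assumes f: "(a,b,L) \<in> fences n" and cd: "a \<le> c" "c < d" "d \<le> b"
    and c: "c = a \<or> c \<in> L" and d: "d \<notin> L"
    and dead: "dead c d (L \<inter> {c<..<d})"
  shows "dead a b L"
proof -
  let ?M = "L \<inter> {c<..<d}" and ?N = "{a<..<b} - L"
  have f': "(c,d,?M) \<in> fences n" using f cd by (auto simp: fence_iff)
  have fN: "(a,b,?N) \<in> fences n" using fence_compl[OF f] .
  let ?x = "prs n - jv a b ?N" and ?y = "prs n - ju a b ?N"
  have oks: "ok n ?x" "ok n ?y" "ok n (ju c d ?M)" "ok n (jv c d ?M)"
    using ok_jv[OF fN] ok_ju[OF fN] ok_jv[OF f'] ok_ju[OF f'] ok_compl by auto
  have s: "ju c d ?M \<subseteq> ?x"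
    using ok_prs[OF oks(3)] cd c d f by (auto simp: ju_def mem_jv fence_iff)
  define K where "K = jn (jv c d ?M) ?x"
  have xK: "C ?x K" using Cjn[OF dead[unfolded dead_def] oks(1)] jn_absorb[OF oks(1) s]
    unfolding K_def by simp
  have "(c,d) \<in> jv c d ?M" using cd by (auto simp: mem_jv)
  then have K: "ok n K" "?x \<subseteq> K" "(c,d) \<in> K"
    using Cok[OF xK] subsetD[OF jn_upper(1)[of "jv c d ?M" ?x]]
    by (auto simp: K_def intro!: jn_upper)
  have cr: "1 \<le> a" "b \<le> n" using f by (auto simp: fence_iff)
  have ad: "(a,d) \<in> K"
  proof (cases "c = a")
    case False
    then have "(a,c) \<in> ?x" using c cd cr f by (auto simp: mem_jv prs_def fence_iff)
    then show ?thesis using ok_trans[OF K(1) subsetD[OF K(2)] K(3)] by simp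
  qed (use K in simp)
  have ab: "(a,b) \<in> K"
  proof (cases "d = b")
    case False
    then have "(d,b) \<in> ?x" using d cd cr f by (auto simp: mem_jv prs_def fence_iff)
    then show ?thesis using ok_trans[OF K(1) ad subsetD[OF K(2)]] by simp
  qed (use ad in simp)
  have "?y \<subseteq> K" unfolding insert_compl_jv[OF fN, symmetric] using ab K(2) by simp
  moreover have "?x \<subseteq> ?y" unfolding ju_def by blast
  ultimately have "C ?x ?y" by (rule convex(1)[OF xK _ _ oks(2), rotated])
  then show ?thesis by (rule dead_upper[OF f, THEN iffD2])
qed

text \<open>The interval is enlarged through (a,d), one endpoint at a time. Whether the endpoint
  left behind belongs to L decides between \<open>forcing1\<close> and
  \<open>forcing2\<close>.\<close>

lemma forcing:
  assumes f: "(a,b,L) \<in> fences n" and cd: "a \<le> c" "c < d" "d \<le> b"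
    and dead: "dead c d (L \<inter> {c<..<d})"
  shows "dead a b L"
proof -
  let ?M = "L \<inter> {a<..<d}"
  have f': "(a,d,?M) \<in> fences n" using f cd by (auto simp: fence_iff)
  have e: "?M \<inter> {c<..<d} = L \<inter> {c<..<d}" using cd by auto
  have ad: "dead a d ?M"
  proof (cases "c \<in> ?M")
    case True
    show ?thesis by (rule forcing2[OF f' cd(1,2)]) (use True dead e in simp_all)
  next
    case False
    show ?thesis by (rule forcing1[OF f' cd(1,2)]) (use False dead e in simp_all)
  qed
  have aL: "a \<notin> L" "a < d" using f cd by (auto simp: fence_iff)
  show ?thesis
  proof (cases "d \<in> L")
    case True
    show ?thesis by (rule forcing1[OF f order_refl aL(2) cd(3)]) (use True ad aL in simp_all)
  next
    case False
    show ?thesis by (rule forcing2[OF f order_refl aL(2) cd(3)]) (use False ad in simp_all)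
  qed
qed

end

subsection \<open>The cover graph of the quotient\<close>

definition covers :: "'v set \<Rightarrow> ('v \<Rightarrow> 'v \<Rightarrow> bool) \<Rightarrow> 'v \<Rightarrow> 'v \<Rightarrow> bool" where
  "covers V le x y \<longleftrightarrow> x \<noteq> y \<and> le x y \<and> \<not> (\<exists>z\<in>V. z \<noteq> x \<and> z \<noteq> y \<and> le x z \<and> le z y)"

lemma cover_graph_covers: "cover_graph V le = (V, \<lambda>x y. covers V le x y \<or> covers V le y x)"
  unfolding cover_graph_def covers_def Let_def by (rule refl)

lemma cover_graph_iso:
  assumes b: "bij_betw f V W"
    and le: "(\<forall>x\<in>V. \<forall>y\<in>V. le x y \<longleftrightarrow> le' (f x) (f y)) \<or> (\<forall>x\<in>V. \<forall>y\<in>V. le x y \<longleftrightarrow> le' (f y) (f x))"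
  shows "graph_iso (cover_graph V le) (cover_graph W le')"
proof -
  have inj: "\<And>x y. x \<in> V \<Longrightarrow> y \<in> V \<Longrightarrow> f x = f y \<longleftrightarrow> x = y"
    using b unfolding bij_betw_def inj_on_def by auto
  have W: "W = f ` V" using b unfolding bij_betw_def by simp
  have "covers V le x y \<or> covers V le y x \<longleftrightarrow> covers W le' (f x) (f y) \<or> covers W le' (f y) (f x)"
    if "x \<in> V" "y \<in> V" for x y
    using le
  proof
    assume l: "\<forall>x\<in>V. \<forall>y\<in>V. le x y \<longleftrightarrow> le' (f x) (f y)"
    have "covers V le x y \<longleftrightarrow> covers W le' (f x) (f y)" if "x \<in> V" "y \<in> V" for x y
      unfolding covers_def W using that l inj by simp
    then show ?thesis using that by simp
  next
    assume l: "\<forall>x\<in>V. \<forall>y\<in>V. le x y \<longleftrightarrow> le' (f y) (f x)"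
    have "covers V le x y \<longleftrightarrow> covers W le' (f y) (f x)" if "x \<in> V" "y \<in> V" for x y
      unfolding covers_def W using that l inj by auto
    then show ?thesis using that by auto
  qed
  then show ?thesis unfolding graph_iso_def cover_graph_covers prod.case
    by (intro exI[of _ f] conjI b) simp
qed

lemma vertex_transitive_iso:
  assumes iso: "graph_iso G H" and vt: "vertex_transitive G"
  shows "vertex_transitive H"
proof -
  obtain V E where G: "G = (V,E)" by fastforce
  obtain W F where H: "H = (W,F)" by fastforce
  obtain f where f: "bij_betw f V W" and ef: "\<forall>x\<in>V. \<forall>y\<in>V. E x y \<longleftrightarrow> F (f x) (f y)"
    using iso unfolding graph_iso_def G H by auto
  define g where "g = inv_into V f"
  have gb: "bij_betw g W V" unfolding g_def by (rule bij_betw_inv_into[OF f])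
  have fg: "\<And>w. w \<in> W \<Longrightarrow> f (g w) = w" unfolding g_def by (rule bij_betw_inv_into_right[OF f])
  have gV: "\<And>w. w \<in> W \<Longrightarrow> g w \<in> V" by (rule bij_betw_apply[OF gb])
  have fW: "\<And>v. v \<in> V \<Longrightarrow> f v \<in> W" by (rule bij_betw_apply[OF f])
  show ?thesis unfolding vertex_transitive_def H prod.case
  proof (intro ballI)
    fix u v assume uv: "u \<in> W" "v \<in> W"
    obtain p where p: "bij_betw p V V" "\<forall>x\<in>V. \<forall>y\<in>V. E x y \<longleftrightarrow> E (p x) (p y)" "p (g u) = g v"
      using vt[unfolded vertex_transitive_def G prod.case, rule_format, OF gV[OF uv(1)] gV[OF uv(2)]]
      by (elim exE conjE)
    have pV: "\<And>v. v \<in> V \<Longrightarrow> p v \<in> V" by (rule bij_betw_apply[OF p(1)])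
    show "\<exists>\<phi>. bij_betw \<phi> W W \<and> (\<forall>x\<in>W. \<forall>y\<in>W. F x y \<longleftrightarrow> F (\<phi> x) (\<phi> y)) \<and> \<phi> u = v"
    proof (intro exI[of _ "f \<circ> p \<circ> g"] conjI ballI)
      show "bij_betw (f \<circ> p \<circ> g) W W"
        by (rule bij_betw_trans[OF gb]) (rule bij_betw_trans[OF p(1) f])
      show "(f \<circ> p \<circ> g) u = v" using p(3) fg uv by simp
      fix x y assume xy: "x \<in> W" "y \<in> W"
      have "F x y \<longleftrightarrow> E (g x) (g y)" using ef gV xy fg by simp
      also have "\<dots> \<longleftrightarrow> E (p (g x)) (p (g y))" using p(2) gV xy by simp
      also have "\<dots> \<longleftrightarrow> F (f (p (g x))) (f (p (g y)))" using ef pV gV xy by simp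
      finally show "F x y \<longleftrightarrow> F ((f \<circ> p \<circ> g) x) ((f \<circ> p \<circ> g) y)" by simp
    qed
  qed
qed

section \<open>Order, covers and squares of the quotient lattice\<close>

context wcong
begin

text \<open>The order of classes expressed on representatives; by \<open>le_iff\<close> it agrees
  with the existence of comparable members.\<close>

definition le :: "(nat \<times> nat) set \<Rightarrow> (nat \<times> nat) set \<Rightarrow> bool" where
  "le I J \<longleftrightarrow> ok n I \<and> ok n J \<and> C (jn I J) J"

definition lt :: "(nat \<times> nat) set \<Rightarrow> (nat \<times> nat) set \<Rightarrow> bool" where
  "lt I J \<longleftrightarrow> le I J \<and> \<not> C I J"

definition cov :: "(nat \<times> nat) set \<Rightarrow> (nat \<times> nat) set \<Rightarrow> bool" where
  "cov I J \<longleftrightarrow> lt I J \<and> \<not> (\<exists>K. lt I K \<and> lt K J)"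

definition adj :: "(nat \<times> nat) set \<Rightarrow> (nat \<times> nat) set \<Rightarrow> bool" where
  "adj I J \<longleftrightarrow> cov I J \<or> cov J I"

lemma le_ok: "le I J \<Longrightarrow> ok n I" "le I J \<Longrightarrow> ok n J"
  unfolding le_def by auto

lemma le_sub: "I \<subseteq> J \<Longrightarrow> ok n I \<Longrightarrow> ok n J \<Longrightarrow> le I J"
  unfolding le_def by (simp add: jn_absorb Crefl)

lemma le_lift: assumes "le I J" obtains J' where "C J J'" "I \<subseteq> J'" "ok n J'"
proof (rule that)
  show "C J (jn I J)" using assms Csym unfolding le_def by auto
  then show "ok n (jn I J)" using Cok by auto
qed (rule jn_upper)

lemma le_C1: assumes "C I I'" "le I J" shows "le I' J"
proof -
  have ok: "ok n I'" "ok n J" "ok n I" using assms Cok le_ok by auto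
  have "C (jn I J) (jn I' J)" using Cjn[OF assms(1)] ok by simp
  then have "C (jn I' J) J" using assms(2) Csym Ctrans unfolding le_def by meson
  then show ?thesis using ok unfolding le_def by simp
qed

lemma le_C2: assumes "C J J'" "le I J" shows "le I J'"
proof -
  have ok: "ok n I" "ok n J'" "ok n J" using assms Cok le_ok by auto
  have "C (jn J I) (jn J' I)" using Cjn[OF assms(1)] ok by simp
  then have "C (jn I J) (jn I J')" by (simp add: jn_commute)
  then have "C (jn I J') J'" using assms Csym Ctrans unfolding le_def by meson
  then show ?thesis using ok unfolding le_def by simp
qed

lemma le_trans: assumes "le I J" "le J K" shows "le I K"
proof -
  obtain J' where J': "C J J'" "I \<subseteq> J'" "ok n J'" using le_lift[OF assms(1)] .
  obtain K' where K': "C K K'" "J' \<subseteq> K'" "ok n K'" using le_lift[OF le_C1[OF J'(1) assms(2)]] .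
  have "le I K'" using le_sub[of I K'] J' K' le_ok(1)[OF assms(1)] by auto
  then show ?thesis using le_C2 Csym K'(1) by blast
qed

lemma le_antisym: "le I J \<Longrightarrow> le J I \<Longrightarrow> C I J"
  unfolding le_def using Csym Ctrans jn_commute by metis

lemma C_le: "C I J \<Longrightarrow> le I J"
  using le_C2[of I J I] le_sub[of I I] Cok by blast

lemma le_iff: assumes "ok n I" "ok n J"
  shows "le I J \<longleftrightarrow> (\<exists>I' J'. C I I' \<and> C J J' \<and> I' \<subseteq> J')"
proof
  assume "le I J"
  then obtain J' where "C J J'" "I \<subseteq> J'" "ok n J'" by (rule le_lift)
  then show "\<exists>I' J'. C I I' \<and> C J J' \<and> I' \<subseteq> J'" using Crefl[OF assms(1)] by blast
next
  assume "\<exists>I' J'. C I I' \<and> C J J' \<and> I' \<subseteq> J'"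
  then obtain I' J' where h: "C I I'" "C J J'" "I' \<subseteq> J'" by blast
  then have "le I' J'" using le_sub Cok by auto
  then show "le I J" using le_C1[OF Csym[OF h(1)]] le_C2[OF Csym[OF h(2)]] by blast
qed

lemma le_drop: assumes "le I J" obtains I' where "C I I'" "I' \<subseteq> J" "ok n I'"
proof -
  have ok: "ok n I" "ok n J" using le_ok[OF assms] .
  obtain J' where J': "C J J'" "I \<subseteq> J'" "ok n J'" using le_lift[OF assms] .
  have "C (mt n J' I) (mt n J I)" using Cmt[OF Csym[OF J'(1)] ok(1)] .
  moreover have "mt n J' I = I" using mt_absorb2[OF J'(3) ok(1) J'(2)] .
  ultimately have "C I (mt n J I)" by simp
  then show ?thesis using that[of "mt n J I"] mt_lower(1)[OF ok(2,1)] Cok by auto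
qed

text \<open>A member above I is replaced by an equivalent one below J; joining that with I stays in
  the class and stays below J.\<close>

lemma between:
  assumes "le I K" "le K J" "I \<subseteq> J"
  obtains K' where "C K K'" "I \<subseteq> K'" "K' \<subseteq> J" "ok n K'"
proof -
  obtain K1 where K1: "C K K1" "I \<subseteq> K1" "ok n K1" using le_lift[OF assms(1)] .
  have l: "le K1 J" using le_C1[OF K1(1) assms(2)] .
  have okJ: "ok n J" "ok n I" using le_ok assms by auto
  obtain K2 where K2: "C K1 K2" "K2 \<subseteq> J" "ok n K2" using le_drop[OF l] .
  have "C (jn K1 I) (jn K2 I)" using Cjn[OF K2(1) okJ(2)] .
  moreover have "jn K1 I = K1" using jn_absorb[OF K1(3,2)] jn_commute by metis
  ultimately have "C K (jn K2 I)" using K1(1) Ctrans by metis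
  moreover have "jn K2 I \<subseteq> J" using jn_least[OF okJ(1) K2(2) assms(3)] .
  moreover have "I \<subseteq> jn K2 I" by (rule jn_upper)
  ultimately show ?thesis using that Cok by blast
qed

lemma le_jn: assumes "le I K" "le J K" shows "le (jn I J) K"
proof -
  obtain K1 where K1: "C K K1" "I \<subseteq> K1" "ok n K1" using le_lift[OF assms(1)] .
  obtain K2 where K2: "C K1 K2" "J \<subseteq> K2" "ok n K2" using le_lift[OF le_C2[OF K1(1) assms(2)]] .
  have "C (jn K2 K1) (jn K1 K1)" using Cjn[OF Csym[OF K2(1)] K1(3)] .
  then have "C (jn K2 K1) K1" unfolding jn_absorb[OF K1(3) order_refl] .
  then have c: "C (jn K2 K1) K" by (rule Ctrans[OF _ Csym[OF K1(1)]])
  have o: "ok n (jn K2 K1)" "ok n I" "ok n J" using Cok[OF c] le_ok(1)[OF assms(1)] le_ok(1)[OF assms(2)] by auto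
  have "jn I J \<subseteq> jn K2 K1"
    by (rule jn_least[OF o(1)]) (use K1(2) K2(2) jn_upper(1)[of K2 K1] jn_upper(2)[of K1 K2] in auto)
  then have "le (jn I J) (jn K2 K1)" by (rule le_sub[OF _ ok_jn[OF o(2,3)] o(1)])
  then show ?thesis by (rule le_C2[OF c])
qed

lemma le_mt: assumes "le K I" "le K J" shows "le K (mt n I J)"
proof -
  obtain K1 where K1: "C K K1" "K1 \<subseteq> I" "ok n K1" using le_drop[OF assms(1)] .
  obtain K2 where K2: "C K1 K2" "K2 \<subseteq> J" "ok n K2" using le_drop[OF le_C1[OF K1(1) assms(2)]] .
  have "C (mt n K2 K1) (mt n K1 K1)" using Cmt[OF Csym[OF K2(1)] K1(3)] .
  then have "C (mt n K2 K1) K1" unfolding mt_absorb[OF K1(3) K1(3) order_refl] .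
  then have c: "C (mt n K2 K1) K" by (rule Ctrans[OF _ Csym[OF K1(1)]])
  have o: "ok n (mt n K2 K1)" "ok n I" "ok n J" using Cok[OF c] le_ok(2)[OF assms(1)] le_ok(2)[OF assms(2)] by auto
  have "mt n K2 K1 \<subseteq> mt n I J"
    by (rule mt_greatest[OF o(1)]) (use K1(2) K2(2) mt_lower[OF K2(3) K1(3)] in auto)
  then have "le (mt n K2 K1) (mt n I J)" by (rule le_sub[OF _ o(1) ok_mt[OF o(2,3)]])
  then show ?thesis by (rule le_C1[OF c])
qed

lemma lt_C1: "C I I' \<Longrightarrow> lt I J \<Longrightarrow> lt I' J"
  unfolding lt_def using le_C1 Ctrans by blast

lemma lt_C2: "C J J' \<Longrightarrow> lt I J \<Longrightarrow> lt I J'"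
  unfolding lt_def using le_C2 Ctrans Csym by blast

lemma lt_le_trans: assumes "lt I J" "le J K" shows "lt I K"
proof -
  have l: "le I J" "\<not> C I J" using assms(1) unfolding lt_def by auto
  have "\<not> C I K"
  proof
    assume "C I K"
    then have "le J I" using le_trans[OF assms(2) C_le[OF Csym]] by simp
    then show False using le_antisym[OF l(1)] l(2) by simp
  qed
  then show ?thesis using le_trans[OF l(1) assms(2)] unfolding lt_def by simp
qed

lemma lt_sub: "I \<subseteq> J \<Longrightarrow> ok n I \<Longrightarrow> ok n J \<Longrightarrow> \<not> C I J \<Longrightarrow> lt I J"
  unfolding lt_def using le_sub by blast

lemma lt_trans: "lt I J \<Longrightarrow> lt J K \<Longrightarrow> lt I K"
  using lt_le_trans[of I J K] lt_def[of J K] by simp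

lemma lt_irrefl: "\<not> lt I I"
  unfolding lt_def using Crefl[of I] le_ok(1)[of I I] by auto

lemma cov_lt: "cov I J \<Longrightarrow> lt I J"
  unfolding cov_def by blast

lemma cov_no: "cov I J \<Longrightarrow> lt I K \<Longrightarrow> lt K J \<Longrightarrow> False"
  unfolding cov_def by blast

lemma cov_C1: "C I I' \<Longrightarrow> cov I J \<Longrightarrow> cov I' J"
  unfolding cov_def using lt_C1 Csym by blast

lemma cov_C2: "C J J' \<Longrightarrow> cov I J \<Longrightarrow> cov I J'"
  unfolding cov_def using lt_C2 Csym by blast

text \<open>By \<open>between\<close>, an intermediate class would have a member in an interval that
  consists of its two ends only.\<close>

lemma cov_edge:
  assumes I: "ok n I" and J: "ok n (insert e I)" and nC: "\<not> C I (insert e I)"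
  shows "cov I (insert e I)"
proof -
  have "lt I (insert e I)" using lt_sub[OF _ I J nC] by blast
  moreover have False if "lt I K" "lt K (insert e I)" for K
  proof -
    have l: "le I K" "le K (insert e I)" "I \<subseteq> insert e I" using that unfolding lt_def by auto
    obtain K' where K': "C K K'" "I \<subseteq> K'" "K' \<subseteq> insert e I" "ok n K'"
      by (rule between[OF l]) (rule that)
    then have "K' = I \<or> K' = insert e I" by blast
    then show False using that K'(1) Csym unfolding lt_def by blast
  qed
  ultimately show ?thesis unfolding cov_def by blast
qed

lemma adj_sym: "adj I J \<Longrightarrow> adj J I"
  unfolding adj_def by blast

lemma adj_C2: "C J J' \<Longrightarrow> adj I J \<Longrightarrow> adj I J'"
  unfolding adj_def using cov_C1[of J J' I] cov_C2[of J J' I] by auto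

lemma adj_C1: "C I I' \<Longrightarrow> adj I J \<Longrightarrow> adj I' J"
  unfolding adj_def using cov_C1[of I I' J] cov_C2[of I I' J] by auto

lemma adj_ok: "adj I J \<Longrightarrow> ok n I \<and> ok n J"
  unfolding adj_def cov_def lt_def using le_ok[of I J] le_ok[of J I] by auto

lemma adj_nC: "adj I J \<Longrightarrow> \<not> C I J"
  unfolding adj_def cov_def lt_def using Csym[of I J] by auto

lemma adj_up: "ok n I \<Longrightarrow> ok n (insert e I) \<Longrightarrow> \<not> C I (insert e I) \<Longrightarrow> adj I (insert e I)"
  unfolding adj_def using cov_edge[of I e] by simp

definition cl :: "(nat \<times> nat) set \<Rightarrow> (nat \<times> nat) set set" where
  "cl I = {J. C I J}"

lemma cl_eq: "ok n I \<Longrightarrow> ok n J \<Longrightarrow> cl I = cl J \<longleftrightarrow> C I J"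
  unfolding cl_def using Csym Ctrans Crefl by blast

definition G :: "(nat \<times> nat) set set graph" where
  "G = cover_graph (cl ` {I. ok n I}) (\<lambda>X Y. \<exists>I\<in>X. \<exists>J\<in>Y. I \<subseteq> J)"

lemma G_vertices: "fst G = cl ` {I. ok n I}"
  unfolding G_def cover_graph_def by simp

lemma cl_le: "ok n I \<Longrightarrow> ok n J \<Longrightarrow> (\<exists>I'\<in>cl I. \<exists>J'\<in>cl J. I' \<subseteq> J') \<longleftrightarrow> le I J"
  unfolding le_iff cl_def by auto

lemma covers_cl: assumes o: "ok n I" "ok n J"
  shows "covers (cl ` {I. ok n I}) (\<lambda>X Y. \<exists>I\<in>X. \<exists>J\<in>Y. I \<subseteq> J) (cl I) (cl J) \<longleftrightarrow> cov I J"
proof -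
  have k: "ok n K \<and> cl K \<noteq> cl I \<and> cl K \<noteq> cl J \<and> (\<exists>I'\<in>cl I. \<exists>J'\<in>cl K. I' \<subseteq> J')
      \<and> (\<exists>I'\<in>cl K. \<exists>J'\<in>cl J. I' \<subseteq> J') \<longleftrightarrow> lt I K \<and> lt K J" for K
  proof (cases "ok n K")
    case True
    then show ?thesis unfolding lt_def cl_le[OF o(1) True] cl_le[OF True o(2)] cl_eq[OF True o(1)]
      cl_eq[OF True o(2)] using Csym[of I K] Csym[of K I] by auto
  next
    case False
    then show ?thesis unfolding lt_def using le_ok(2)[of I K] by auto
  qed
  have e: "(\<exists>z\<in>cl ` {I. ok n I}. P z) \<longleftrightarrow> (\<exists>K. ok n K \<and> P (cl K))" for P by auto
  show ?thesis unfolding covers_def e k cov_def unfolding lt_def cl_le[OF o] cl_eq[OF o] by auto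
qed

lemma G_edges: "ok n I \<Longrightarrow> ok n J \<Longrightarrow> snd G (cl I) (cl J) \<longleftrightarrow> adj I J"
  unfolding G_def cover_graph_covers snd_conv adj_def by (simp add: covers_cl)

text \<open>Applied to neighbours J and K of I: the path J, I, K closes up to a 4-cycle.\<close>

definition sqr :: "(nat \<times> nat) set \<Rightarrow> (nat \<times> nat) set \<Rightarrow> (nat \<times> nat) set \<Rightarrow> bool" where
  "sqr I J K \<longleftrightarrow> (\<exists>W. \<not> C W I \<and> adj W J \<and> adj W K)"

lemma sqr_sym: "sqr I J K \<Longrightarrow> sqr I K J"
  unfolding sqr_def by blast

lemma sqr_C1: "C I I' \<Longrightarrow> sqr I J K \<Longrightarrow> sqr I' J K"
  unfolding sqr_def using Ctrans Csym by blast

lemma sqr_C2: "C J J' \<Longrightarrow> sqr I J K \<Longrightarrow> sqr I J' K"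
  unfolding sqr_def using adj_C2 by blast

lemma sqr_C3: "C K K' \<Longrightarrow> sqr I J K \<Longrightarrow> sqr I J K'"
  unfolding sqr_def using adj_C2 by blast

text \<open>Climb from I towards J one pair at a time; K is the last word reached before the first
  alive edge, so it is still in the class of I.\<close>

lemma first_edge:
  assumes "ok n I" "ok n J" "I \<subseteq> J" "\<not> C I J"
  obtains K p q where "ok n K" "ok n (insert (p,q) K)" "(p,q) \<notin> K" "I \<subseteq> K" "insert (p,q) K \<subseteq> J"
    "C I K" "\<not> C K (insert (p,q) K)"
  using assms
proof (induction "card (J - I)" arbitrary: I thesis rule: less_induct)
  case less
  have "I \<noteq> J" using less.prems Crefl by blast
  then have "I \<subset> J" using less.prems by blast
  then obtain p q where pq: "(p,q) \<in> J" "(p,q) \<notin> I" "ok n (insert (p,q) I)"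
    by (rule exists_ascent[OF less.prems(2,3)]) (rule that)
  let ?I = "insert (p,q) I"
  show ?case
  proof (cases "C I ?I")
    case False
    then show ?thesis using less.prems(1)[of I p q] less.prems pq Crefl by auto
  next
    case True
    have c: "card (J - ?I) < card (J - I)"
      by (rule psubset_card_mono) (use pq ok_finite[OF less.prems(3)] in auto)
    have nc: "\<not> C ?I J" using True less.prems Ctrans by metis
    show ?thesis
    proof (rule less.hyps[OF c _ pq(3) less.prems(3) _ nc])
      fix K p' q' assume "ok n K" "ok n (insert (p',q') K)" "(p',q') \<notin> K" "?I \<subseteq> K"
        "insert (p',q') K \<subseteq> J" "C ?I K" "\<not> C K (insert (p',q') K)"
      then show thesis using less.prems(1)[of K p' q'] True Ctrans[of I ?I K] by blast
    qed (use pq less.prems in auto)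
  qed
qed

text \<open>The meet of K with the upper end of the edge lies below the lower end. If K were
  equivalent to the upper end, convexity would contract the alive edge.\<close>

lemma insert_not_C:
  assumes y: "ok n (insert e I)" and I: "ok n I" and nC: "\<not> C I (insert e I)"
    and K: "e \<notin> K"
  shows "\<not> C K (insert e I)"
proof
  assume c: "C K (insert e I)"
  have okK: "ok n K" using Cok[OF c] by simp
  have "C (mt n K (insert e I)) (mt n (insert e I) (insert e I))" using Cmt[OF c y] .
  then have c': "C (mt n K (insert e I)) (insert e I)" unfolding mt_absorb[OF y y order_refl] .
  have "mt n K (insert e I) \<subseteq> I" using mt_lower[OF okK y] K by auto
  then show False using convex(2)[OF c' _ subset_insertI I] nC by simp
qed

end

section \<open>Essential congruences and the neighbours of the bottom class\<close>

locale ess_wcong = wcong +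
  assumes ess: "1 \<le> a \<Longrightarrow> a < n \<Longrightarrow> \<not> dead a (Suc a) {}"
begin

definition s :: "nat \<Rightarrow> (nat \<times> nat) set" where
  "s i = {(i, Suc i)}"

lemma ok_s: "1 \<le> i \<Longrightarrow> i < n \<Longrightarrow> ok n (s i)"
  unfolding s_def by (rule okI) auto

text \<open>A fence of length one has only the empty set as L, so essentiality concerns every edge
  that swaps two consecutive values.\<close>

lemma alive_unit:
  assumes "ok n I" "ok n (insert (i, Suc i) I)" "(i, Suc i) \<notin> I"
  shows "\<not> C I (insert (i, Suc i) I)"
proof -
  have "lset i (Suc i) I = {}" unfolding lset_def by auto
  moreover have "1 \<le> i" "i < n" using okD[OF assms(2), of i "Suc i"] by auto
  ultimately show ?thesis using edge_iff[OF assms] ess by simp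
qed

lemma ok_singleton: assumes "ok n {(p,q)}" shows "q = Suc p" "1 \<le> p" "p < n"
proof -
  have "p < q" "1 \<le> p" "q \<le> n" using okD[OF assms, of p q] by auto
  moreover have "\<not> Suc p < q" using ok_cotrans[OF assms, of p q "Suc p"] by auto
  ultimately show "q = Suc p" "1 \<le> p" "p < n" by auto
qed

text \<open>The first pair on a chain leaving the identity is a unit pair, and its edge is
  alive.\<close>

lemma zero_class: assumes "C {} K" shows "K = {}"
proof (rule ccontr)
  assume "K \<noteq> {}"
  then have "{} \<subset> K" by blast
  have "ok n K" using Cok[OF assms] by blast
  obtain p q where pq: "(p,q) \<in> K" "(p,q) \<notin> {}" "ok n (insert (p,q) {})"
    by (rule exists_ascent[OF ok_empty \<open>ok n K\<close> \<open>{} \<subset> K\<close>]) (rule that)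
  then have q: "q = Suc p" using ok_singleton(1) by simp
  have "C {} (insert (p,q) {})" using convex(1)[OF assms _ _ pq(3)] pq(1) by blast
  then show False using alive_unit[OF ok_empty, of p] pq(3) q by simp
qed

text \<open>Since the bottom class has the identity as its only member, the first alive edge towards
  J starts at the identity itself and adds a unit pair.\<close>

lemma nb_zero:
  assumes "adj {} J"
  obtains i where "1 \<le> i" "i < n" "C (s i) J"
proof -
  have ok: "ok n J" using adj_ok[OF assms] by blast
  have ncz: "\<not> C {} J" using adj_nC[OF assms] .
  have "\<not> cov J {}"
  proof
    assume "cov J {}"
    then have "C (jn J {}) {}" unfolding cov_def lt_def le_def by blast
    moreover have "jn {} J = J" using jn_absorb[OF ok] by blast
    ultimately show False using ncz Csym jn_commute by metis
  qed
  then have cov: "cov {} J" using assms unfolding adj_def by blast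
  obtain K p q where K: "ok n K" "ok n (insert (p,q) K)" "(p,q) \<notin> K" "insert (p,q) K \<subseteq> J"
    "C {} K" "\<not> C K (insert (p,q) K)"
    by (rule first_edge[OF ok_empty ok empty_subsetI ncz]) (rule that)
  have K0: "K = {}" using zero_class[OF K(5)] .
  have o: "ok n {(p,q)}" using K(2) K0 by simp
  have sp: "s p = {(p,q)}" using ok_singleton[OF o] unfolding s_def by simp
  have "lt {} (s p)" unfolding sp using lt_sub[of "{}" "{(p,q)}"] o ok_empty K(6) K0 by auto
  moreover have l: "le (s p) J" unfolding sp using le_sub[OF _ o ok] K(4) K0 by simp
  ultimately have "C (s p) J" using cov_no[OF cov, of "s p"] unfolding lt_def by blast
  then show ?thesis using that ok_singleton[OF o] by blast
qed

lemma adj_zero: "1 \<le> i \<Longrightarrow> i < n \<Longrightarrow> adj {} (s i)"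
  using adj_up[OF ok_empty, of "(i, Suc i)"] ok_s[of i] alive_unit[OF ok_empty, of i]
  unfolding s_def by simp

lemma s_eq: assumes "1 \<le> i" "i < n" "1 \<le> j" "j < n" "C (s i) (s j)" shows "i = j"
proof (rule ccontr)
  assume "i \<noteq> j"
  have "C (mt n (s i) (s j)) (mt n (s j) (s j))" using Cmt[OF assms(5)] ok_s assms by blast
  moreover have "mt n (s i) (s j) = {}"
    using mt_lower[OF ok_s[OF assms(1,2)] ok_s[OF assms(3,4)]] \<open>i \<noteq> j\<close> unfolding s_def by auto
  moreover have "mt n (s j) (s j) = s j" by (intro mt_absorb ok_s assms order_refl)
  ultimately have "s j = {}" using zero_class by simp
  then show False unfolding s_def by simp
qed

lemma sqr_zero_far:
  assumes ij: "1 \<le> i" "Suc i < j" "j < n"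
  shows "sqr {} (s i) (s j)"
proof -
  let ?W = "{(i, Suc i), (j, Suc j)}"
  have okW: "ok n ?W" by (rule okI) (use ij in auto)
  have "adj (s i) ?W" using adj_up[OF ok_s, of i "(j, Suc j)"] alive_unit[OF ok_s, of i j] okW ij
    unfolding s_def by (simp add: insert_commute)
  moreover have "adj (s j) ?W" using adj_up[OF ok_s, of j "(i, Suc i)"] alive_unit[OF ok_s, of j i] okW ij
    unfolding s_def by simp
  moreover have "\<not> C ?W {}" using zero_class[OF Csym] by blast
  ultimately show ?thesis unfolding sqr_def using adj_sym by blast
qed

text \<open>An automorphism moving the class of the identity to the class of \<open>I\<close> labels the
  neighbours of the latter by \<open>1, \<dots>, n-1\<close>, compatibly with 4-cycles.\<close>
lemma vt_match:
  assumes vt: "vertex_transitive G" and I: "ok n I"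
  obtains g where "\<And>J. adj I J \<Longrightarrow> 1 \<le> g J \<and> g J < n"
    "\<And>J K. adj I J \<Longrightarrow> adj I K \<Longrightarrow> g J = g K \<longleftrightarrow> C J K"
    "\<And>J K. adj I J \<Longrightarrow> adj I K \<Longrightarrow> sqr I J K \<longleftrightarrow> sqr {} (s (g J)) (s (g K))"
proof -
  let ?V = "cl ` {I. ok n I}" and ?E = "snd G"
  have Gd: "G = (?V, ?E)" using G_vertices by (metis prod.collapse)
  have v: "vertex_transitive (?V, ?E)" using vt Gd by metis
  have m0: "cl {} \<in> ?V" "cl I \<in> ?V" using I ok_empty[of n] by auto
  obtain f where f: "bij_betw f ?V ?V" "\<forall>x\<in>?V. \<forall>y\<in>?V. ?E x y \<longleftrightarrow> ?E (f x) (f y)" "f (cl {}) = cl I"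
    using v[unfolded vertex_transitive_def prod.case, rule_format, OF m0] by (elim exE conjE)
  have inj: "\<And>x y. x \<in> ?V \<Longrightarrow> y \<in> ?V \<Longrightarrow> f x = f y \<longleftrightarrow> x = y"
    using f(1) unfolding bij_betw_def inj_on_def by auto
  have clV: "ok n J \<Longrightarrow> cl J \<in> ?V" for J by simp
  \<comment> \<open>The automorphism acts on classes; h chooses a representative of the image
    class.\<close>
  define h where "h J = (SOME K. ok n K \<and> f (cl J) = cl K)" for J
  have h: "ok n (h J) \<and> f (cl J) = cl (h J)" if "ok n J" for J
  proof -
    have "f (cl J) \<in> ?V" by (rule bij_betw_apply[OF f(1)]) (use that in simp)
    then have "\<exists>K. ok n K \<and> f (cl J) = cl K" by auto
    then show ?thesis unfolding h_def by (rule someI_ex)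
  qed
  have hok: "ok n J \<Longrightarrow> ok n (h J)" and hf: "ok n J \<Longrightarrow> f (cl J) = cl (h J)" for J using h by auto
  have hC: "C (h J) (h K) \<longleftrightarrow> C J K" if o: "ok n J" "ok n K" for J K
  proof -
    have "C (h J) (h K) \<longleftrightarrow> f (cl J) = f (cl K)" using cl_eq hok hf o by simp
    also have "\<dots> \<longleftrightarrow> C J K" using inj[OF clV[OF o(1)] clV[OF o(2)]] cl_eq[OF o] by simp
    finally show ?thesis .
  qed
  have hadj: "adj (h J) (h K) \<longleftrightarrow> adj J K" if o: "ok n J" "ok n K" for J K
  proof -
    have "adj J K \<longleftrightarrow> ?E (cl J) (cl K)" using G_edges[OF o] by simp
    also have "\<dots> \<longleftrightarrow> ?E (f (cl J)) (f (cl K))" by (rule f(2)[rule_format, OF clV[OF o(1)] clV[OF o(2)]])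
    also have "\<dots> \<longleftrightarrow> adj (h J) (h K)" using G_edges hf hok o by simp
    finally show ?thesis by simp
  qed
  have hsurj: "\<exists>J. ok n J \<and> C (h J) K" if o: "ok n K" for K
  proof -
    have "cl K \<in> f ` ?V" using f(1) clV[OF o] unfolding bij_betw_def by simp
    then obtain J where J: "ok n J" "cl K = f (cl J)" by auto
    then have "C (h J) K" using hf[OF J(1)] cl_eq[OF hok[OF J(1)] o] by simp
    then show ?thesis using J(1) by auto
  qed
  have h0: "C (h {}) I" using hf[OF ok_empty] hok[OF ok_empty] f(3) cl_eq[of "h {}" I] I by simp
  have ex: "\<exists>i. 1 \<le> i \<and> i < n \<and> C (h (s i)) J" if a: "adj I J" for J
  proof -
    have "ok n J" using adj_ok[OF a] by simp
    then obtain J' where J': "ok n J'" "C (h J') J" using hsurj by auto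
    have "adj (h {}) (h J')" by (rule adj_C1[OF Csym[OF h0] adj_C2[OF Csym[OF J'(2)] a]])
    then have "adj {} J'" using hadj[OF ok_empty J'(1)] by simp
    then obtain i where i: "1 \<le> i" "i < n" "C (s i) J'" by (rule nb_zero)
    then have "C (h (s i)) (h J')" using hC[OF ok_s[OF i(1,2)] J'(1)] by simp
    then have "C (h (s i)) J" by (rule Ctrans[OF _ J'(2)])
    then show ?thesis using i by auto
  qed
  \<comment> \<open>The label of J is the index of the simple transposition whose image under the
    automorphism is the class of J.\<close>
  define g where "g J = (SOME i. 1 \<le> i \<and> i < n \<and> C (h (s i)) J)" for J
  have g: "1 \<le> g J \<and> g J < n \<and> C (h (s (g J))) J" if "adj I J" for J
    unfolding g_def using someI_ex[OF ex[OF that]] .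
  have gs: "ok n (s (g J))" if "adj I J" for J using g[OF that] ok_s by simp
  have sq: "sqr (h A) (h B) (h D) \<longleftrightarrow> sqr A B D" if o: "ok n A" "ok n B" "ok n D" for A B D
  proof
    assume "sqr (h A) (h B) (h D)"
    then obtain W where W: "\<not> C W (h A)" "adj W (h B)" "adj W (h D)" unfolding sqr_def by auto
    have "ok n W" using adj_ok[OF W(2)] by simp
    then obtain W' where W': "ok n W'" "C (h W') W" using hsurj by auto
    have "\<not> C (h W') (h A)" using W(1) Ctrans[OF Csym[OF W'(2)]] by auto
    then have "\<not> C W' A" using hC[OF W'(1) o(1)] by simp
    moreover have "adj W' B" "adj W' D"
      using adj_C1[OF Csym[OF W'(2)] W(2)] adj_C1[OF Csym[OF W'(2)] W(3)] hadj W'(1) o by auto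
    ultimately show "sqr A B D" unfolding sqr_def by auto
  next
    assume "sqr A B D"
    then obtain W where W: "\<not> C W A" "adj W B" "adj W D" unfolding sqr_def by auto
    have oW: "ok n W" using adj_ok[OF W(2)] by simp
    have "\<not> C (h W) (h A) \<and> adj (h W) (h B) \<and> adj (h W) (h D)" using W hC hadj o oW by simp
    then show "sqr (h A) (h B) (h D)" unfolding sqr_def by (rule exI)
  qed
  show ?thesis
  proof (rule that[of g])
    show "1 \<le> g J \<and> g J < n" if "adj I J" for J using g[OF that] by simp
    show "g J = g K \<longleftrightarrow> C J K" if a: "adj I J" "adj I K" for J K
    proof
      assume e: "g J = g K"
      have c: "C (h (s (g J))) J" "C (h (s (g J))) K" using g[OF a(1)] g[OF a(2)] e by auto
      show "C J K" by (rule Ctrans[OF Csym[OF c(1)] c(2)])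
    next
      assume jk: "C J K"
      have c: "C (h (s (g J))) J" "C (h (s (g K))) K" using g[OF a(1)] g[OF a(2)] by auto
      have "C (h (s (g J))) (h (s (g K)))" by (rule Ctrans[OF Ctrans[OF c(1) jk] Csym[OF c(2)]])
      then have "C (s (g J)) (s (g K))" using hC[OF gs[OF a(1)] gs[OF a(2)]] by simp
      then show "g J = g K" using s_eq g[OF a(1)] g[OF a(2)] by simp
    qed
    show "sqr I J K \<longleftrightarrow> sqr {} (s (g J)) (s (g K))" if a: "adj I J" "adj I K" for J K
    proof -
      have e: "sqr {} (s (g J)) (s (g K)) \<longleftrightarrow> sqr (h {}) (h (s (g J))) (h (s (g K)))"
        using sq[OF ok_empty gs[OF a(1)] gs[OF a(2)]] by simp
      have c: "C (h (s (g J))) J" "C (h (s (g K))) K" using g[OF a(1)] g[OF a(2)] by auto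
      show ?thesis unfolding e
      proof
        assume "sqr I J K"
        from sqr_C1[OF Csym[OF h0] this]
        show "sqr (h {}) (h (s (g J))) (h (s (g K)))"
          by (rule sqr_C2[OF Csym[OF c(1)] sqr_C3[OF Csym[OF c(2)]]])
      next
        assume "sqr (h {}) (h (s (g J))) (h (s (g K)))"
        from sqr_C1[OF h0 this] show "sqr I J K" by (rule sqr_C2[OF c(1) sqr_C3[OF c(2)]])
      qed
    qed
  qed
qed

text \<open>Each missing square makes two labels differ by exactly one, by
  \<open>sqr_zero_far\<close>; this cannot hold for all three pairs.\<close>

lemma no_tri:
  assumes vt: "vertex_transitive G"
    and a: "adj I J1" "adj I J2" "adj I J3"
    and d: "\<not> C J1 J2" "\<not> C J2 J3" "\<not> C J1 J3"
    and sq: "\<not> sqr I J1 J2" "\<not> sqr I J2 J3" "\<not> sqr I J1 J3"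
  shows False
proof -
  have I: "ok n I" using adj_ok[OF a(1)] by blast
  obtain g where g: "\<And>J. adj I J \<Longrightarrow> 1 \<le> g J \<and> g J < n"
    "\<And>J K. adj I J \<Longrightarrow> adj I K \<Longrightarrow> g J = g K \<longleftrightarrow> C J K"
    "\<And>J K. adj I J \<Longrightarrow> adj I K \<Longrightarrow> sqr I J K \<longleftrightarrow> sqr {} (s (g J)) (s (g K))"
    by (rule vt_match[OF vt I]) (rule that)
  have near: "g J \<le> Suc (g K) \<and> g K \<le> Suc (g J) \<and> g J \<noteq> g K"
    if "adj I J" "adj I K" "\<not> sqr I J K" "\<not> C J K" for J K
  proof -
    have "\<not> sqr {} (s (g J)) (s (g K))" "g J \<noteq> g K" using g(2,3) that by auto
    then show ?thesis
      using sqr_zero_far[of "g J" "g K"] sqr_zero_far[of "g K" "g J", THEN sqr_sym] g(1) that(1,2)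
      by (metis not_less)
  qed
  show False using near[OF a(1,2) sq(1) d(1)] near[OF a(2,3) sq(2) d(2)] near[OF a(1,3) sq(3) d(3)]
    by linarith
qed

end

subsection \<open>Triples of neighbours without squares\<close>

(* Keeps linarith from splitting the many disequalities between positions below. *)
declare [[linarith_neq_limit = 1]]

lemma between_insert3:
  assumes "D \<subseteq> K" "K \<subseteq> insert x (insert y (insert z D))"
  shows "K = D \<or> K = insert x D \<or> K = insert y D \<or> K = insert z D \<or> K = insert x (insert y D)
    \<or> K = insert x (insert z D) \<or> K = insert y (insert z D) \<or> K = insert x (insert y (insert z D))"
proof -
  define S where "S = K \<inter> {x,y,z}"
  have "K = S \<union> D" using assms unfolding S_def by auto
  moreover have "S = {} \<or> S = {x} \<or> S = {y} \<or> S = {z} \<or> S = {x,y} \<or> S = {x,z} \<or> S = {y,z} \<or> S = {x,y,z}"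
    unfolding S_def by auto
  ultimately show ?thesis by (elim disjE) simp_all
qed

section \<open>Criteria for a path of length two to lie on no square\<close>

context wcong
begin

text \<open>With D < X < E, a fourth corner W above both ends, below both ends or below D and above
  E contradicts a cover or the strict order. So W lies between D and E and has a member in that
  interval.\<close>

lemma not_sqr_between:
  assumes sub: "D \<subseteq> E" and DX: "cov D X" and XE: "cov X E"
    and K: "\<And>K. ok n K \<Longrightarrow> D \<subseteq> K \<Longrightarrow> K \<subseteq> E \<Longrightarrow> cov D K \<Longrightarrow> cov K E \<Longrightarrow> C K X"
  shows "\<not> sqr X D E"
proof
  assume "sqr X D E"
  then obtain W where W: "\<not> C W X" "adj W D" "adj W E" unfolding sqr_def by auto
  have DE: "lt D E" by (rule lt_trans[OF cov_lt[OF DX] cov_lt[OF XE]])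
  consider "cov D W" "cov W E" | "cov D W" "cov E W" | "cov W D" "cov W E" | "cov W D" "cov E W"
    using W unfolding adj_def by auto
  then show False
  proof cases
    case 1
    have l: "le D W" "le W E" using 1 unfolding cov_def lt_def by auto
    obtain W' where W': "C W W'" "D \<subseteq> W'" "W' \<subseteq> E" "ok n W'"
      by (rule between[OF l sub]) (rule that)
    have "C W' X" by (rule K[OF W'(4,2,3) cov_C2[OF W'(1) 1(1)] cov_C1[OF W'(1) 1(2)]])
    then show False using W(1) Ctrans[OF W'(1)] by simp
  next
    case 2 then show False using cov_no[OF 2(1) DE cov_lt] by simp
  next
    case 3 then show False using cov_no[OF 3(2) cov_lt[OF 3(1)] DE] by simp
  next
    case 4
    have "lt E E" by (rule lt_trans[OF lt_trans[OF cov_lt[OF 4(2)] cov_lt[OF 4(1)]] DE])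
    then show False using lt_irrefl by simp
  qed
qed

text \<open>The pair f cannot be added before e, so the interval is a chain with a single middle
  element.\<close>

lemma not_sqr_chain:
  assumes ok: "ok n D" "ok n (insert e D)" "ok n (insert f (insert e D))" "\<not> ok n (insert f D)"
    and nC: "\<not> C D (insert e D)" "\<not> C (insert e D) (insert f (insert e D))"
  shows "\<not> sqr (insert e D) D (insert f (insert e D))"
proof (rule not_sqr_between)
  show "cov D (insert e D)" by (rule cov_edge[OF ok(1,2) nC(1)])
  show "cov (insert e D) (insert f (insert e D))" by (rule cov_edge[OF ok(2,3) nC(2)])
  fix K assume K: "ok n K" "D \<subseteq> K" "K \<subseteq> insert f (insert e D)" "cov D K" "cov K (insert f (insert e D))"
  have "K = D \<or> K = insert e D \<or> K = insert f D \<or> K = insert f (insert e D)"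
    using K(2,3) by (cases "e \<in> K"; cases "f \<in> K") auto
  moreover have "K \<noteq> D" using K(4) lt_irrefl[of D] unfolding cov_def by auto
  moreover have "K \<noteq> insert f (insert e D)"
    using K(5) lt_irrefl[of "insert f (insert e D)"] unfolding cov_def by auto
  moreover have "K \<noteq> insert f D" using K(1) ok(4) by auto
  ultimately have "K = insert e D" by auto
  then show "C K (insert e D)" using Crefl[OF ok(2)] by simp
qed auto

text \<open>The hexagon over D on the values p < q < r loses one edge on the side through X. The
  other side keeps three alive edges, so neither of its inner words both covers D and is covered by
  the top.\<close>

lemma not_sqr_hexagon:
  assumes pqr: "p < q" "q < r"
    and D: "(p,q) \<notin> D" "(q,r) \<notin> D" "(p,r) \<notin> D"
    and ok: "ok n D" "ok n (insert (q,r) D)" "ok n (insert (p,r) (insert (q,r) D))"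
      "ok n (insert (p,q) D)" "ok n (insert (p,r) (insert (p,q) D))"
      "ok n (insert (p,q) (insert (p,r) (insert (q,r) D)))"
    and c: "C (insert (q,r) D) (insert (p,r) (insert (q,r) D))"
    and nC: "\<not> C D (insert (q,r) D)"
      "\<not> C (insert (p,r) (insert (q,r) D)) (insert (p,q) (insert (p,r) (insert (q,r) D)))"
      "\<not> C D (insert (p,q) D)" "\<not> C (insert (p,q) D) (insert (p,r) (insert (p,q) D))"
      "\<not> C (insert (p,r) (insert (p,q) D)) (insert (p,q) (insert (p,r) (insert (q,r) D)))"
  shows "\<not> sqr (insert (q,r) D) D (insert (p,q) (insert (p,r) (insert (q,r) D)))" (is "\<not> sqr ?X D ?H")
proof (rule not_sqr_between)
  show "cov D ?X" by (rule cov_edge[OF ok(1,2) nC(1)])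
  show "cov ?X ?H" by (rule cov_C1[OF Csym[OF c] cov_edge[OF ok(3,6) nC(2)]])
  fix K assume K: "ok n K" "D \<subseteq> K" "K \<subseteq> ?H" "cov D K" "cov K ?H"
  have 1: "lt D (insert (p,q) D)" by (rule lt_sub[OF _ ok(1,4) nC(3)]) auto
  have 2: "lt (insert (p,q) D) (insert (p,r) (insert (p,q) D))" by (rule lt_sub[OF _ ok(4,5) nC(4)]) auto
  have 3: "lt (insert (p,r) (insert (p,q) D)) ?H" by (rule lt_sub[OF _ ok(5,6) nC(5)]) auto
  have n1: "K \<noteq> insert (p,q) D" using cov_no[OF K(5), of "insert (p,r) (insert (p,q) D)"] 2 3 by auto
  have n2: "K \<noteq> insert (p,r) (insert (p,q) D)" using cov_no[OF K(4), of "insert (p,q) D"] 1 2 by auto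
  have n3: "K \<noteq> D" using K(4) lt_irrefl[of D] unfolding cov_def by auto
  have n4: "K \<noteq> ?H" using K(5) lt_irrefl[of ?H] unfolding cov_def by auto
  have n5: "(p,q) \<in> K" if "(p,r) \<in> K" "(q,r) \<notin> K" using ok_cotrans[OF K(1) that(1) pqr] that(2) by auto
  have n6: "(p,r) \<in> K" if "(p,q) \<in> K" "(q,r) \<in> K" using ok_trans[OF K(1) that] .
  have n7: "K \<noteq> insert (p,r) D"
  proof
    assume k: "K = insert (p,r) D"
    have "(p,q) \<in> K" by (rule n5) (use k D pqr in simp_all)
    then show False using k D pqr by simp
  qed
  have n8: "K \<noteq> insert (p,q) (insert (q,r) D)"
  proof
    assume k: "K = insert (p,q) (insert (q,r) D)"
    have "(p,r) \<in> K" by (rule n6) (use k in simp_all)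
    then show False using k D pqr by simp
  qed
  have "K = ?X \<or> K = insert (p,r) ?X"
    using between_insert3[OF K(2,3)] n1 n2 n3 n4 n7 n8 by (simp add: insert_commute)
  then show "C K ?X" using Crefl[OF ok(2)] Csym[OF c] by auto
qed auto

text \<open>A fourth corner above both covers of V is above their join, the top of the hexagon; the
  class M strictly between F and the top then breaks a cover relation. A fourth corner below both
  would lie below V.\<close>

lemma not_sqr_upper:
  assumes pqr: "p < q" "q < r"
    and V: "(p,q) \<notin> V" "(q,r) \<notin> V"
    and ok: "ok n V" "ok n (insert (p,q) V)" "ok n (insert (q,r) V)"
      "ok n (insert (p,q) (insert (p,r) (insert (q,r) V)))"
    and nC: "\<not> C V (insert (p,q) V)" "\<not> C V (insert (q,r) V)"
    and F: "F = insert (p,q) V \<or> F = insert (q,r) V" "lt F M"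
      "lt M (insert (p,q) (insert (p,r) (insert (q,r) V)))"
  shows "\<not> sqr V (insert (p,q) V) (insert (q,r) V)" (is "\<not> sqr V ?E1 ?E2")
proof
  let ?H = "insert (p,q) (insert (p,r) (insert (q,r) V))"
  assume "sqr V ?E1 ?E2"
  then obtain W where W: "\<not> C W V" "adj W ?E1" "adj W ?E2" unfolding sqr_def by auto
  have c1: "cov V ?E1" by (rule cov_edge[OF ok(1,2) nC(1)])
  have c2: "cov V ?E2" by (rule cov_edge[OF ok(1,3) nC(2)])
  consider "cov ?E1 W" "cov ?E2 W" | "cov ?E1 W" "cov W ?E2" | "cov W ?E1" "cov ?E2 W"
    | "cov W ?E1" "cov W ?E2" using W(2,3) unfolding adj_def by auto
  then show False
  proof cases
    case 1
    have l: "le ?E1 W" "le ?E2 W" using 1 unfolding cov_def lt_def by auto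
    have "(p,q) \<in> jn ?E1 ?E2" "(q,r) \<in> jn ?E1 ?E2"
      using jn_upper(1)[of ?E1 ?E2] jn_upper(2)[of ?E2 ?E1] by auto
    moreover have "(p,r) \<in> jn ?E1 ?E2"
      using ok_trans[OF ok_jn[OF ok(2,3)] calculation] .
    ultimately have "?H \<subseteq> jn ?E1 ?E2" using jn_upper(1)[of ?E1 ?E2] by auto
    moreover have "jn ?E1 ?E2 \<subseteq> ?H" by (rule jn_least[OF ok(4)]) auto
    ultimately have "jn ?E1 ?E2 = ?H" by auto
    then have "le ?H W" using le_jn[OF l] by simp
    then have "lt M W" by (rule lt_le_trans[OF F(3)])
    then show False using F(1) cov_no[OF 1(1), of M] cov_no[OF 1(2), of M] F(2) by auto
  next
    case 2 then show False using cov_no[OF c2 cov_lt[OF c1] ] lt_trans[OF cov_lt[OF 2(1)] cov_lt[OF 2(2)]] by simp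
  next
    case 3 then show False using cov_no[OF c1 cov_lt[OF c2] ] lt_trans[OF cov_lt[OF 3(2)] cov_lt[OF 3(1)]] by simp
  next
    case 4
    have l: "le W ?E1" "le W ?E2" using 4 unfolding cov_def lt_def by auto
    have "mt n ?E1 ?E2 \<subseteq> V" using mt_lower[OF ok(2,3)] V pqr by auto
    then have "le (mt n ?E1 ?E2) V" by (rule le_sub[OF _ ok_mt[OF ok(2,3)] ok(1)])
    then have "le W V" by (rule le_trans[OF le_mt[OF l]])
    then have "lt W V" using W(1) unfolding lt_def by simp
    then show False using cov_no[OF 4(1) _ cov_lt[OF c1]] by simp
  qed
qed

end

section \<open>Triples of neighbours produced by a dead fence\<close>

context ess_wcong
begin

lemma edge_alive:
  assumes "ok n I" "ok n (insert (a,b) I)" "\<not> dead a b L" "(a,b) \<notin> I" "lset a b I = L"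
  shows "\<not> C I (insert (a,b) I)"
  using edge_iff[OF assms(1,2,4)] assms(3,5) by simp

lemma edge_dead:
  assumes "ok n I" "ok n (insert (a,b) I)" "dead a b L" "(a,b) \<notin> I" "lset a b I = L"
  shows "C I (insert (a,b) I)"
  using edge_iff[OF assms(1,2,4)] assms(3,5) by simp

text \<open>The three neighbours of the class of \<open>a b (a+1) (a+2) \<dots>\<close> used here are those of
  \<open>a (a+1) b (a+2) \<dots>\<close>, \<open>b (a+1) a (a+2) \<dots>\<close> and \<open>a b (a+2) (a+1) \<dots>\<close>.\<close>
lemma triangle_long:
  assumes vt: "vertex_transitive G" and ab: "1 \<le> a" "a + 3 \<le> b" "b \<le> n"
    and dead: "dead a b {}" and alive: "\<not> dead (a+1) b {}" "\<not> dead a b {a+1}"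
    and nocut: "\<not> dead a (a+2) {} \<or> \<not> dead a (a+2) {a+1}"
  shows False
proof -
  \<comment> \<open>On the values concerned, D reads a (a+1) b (a+2), u reads a b (a+1) (a+2), v
    reads b a (a+1) (a+2) and H reads b (a+1) a (a+2). The words u and v are the two ends of a
    contracted edge, so neighbours may be taken at either.\<close>
  define D where "D = {(p,b) | p. a + 2 \<le> p \<and> p < b}"
  define u where "u = insert (a+1,b) D"
  define v where "v = insert (a,b) u"
  define H where "H = insert (a,a+1) v"
  define f where "f = (a+1, a+2)"
  have okD: "ok n D" unfolding D_def by (rule okI; (use ab in auto); presburger)
  have oku: "ok n u" unfolding u_def D_def by (rule okI; (use ab in auto); presburger)
  have okv: "ok n v" unfolding v_def u_def D_def by (rule okI; (use ab in auto); presburger)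
  have okH: "ok n H" unfolding H_def v_def u_def D_def by (rule okI; (use ab in auto); presburger)
  have okuf: "ok n (insert f u)" unfolding f_def u_def D_def by (rule okI; (use ab in auto); presburger)
  have okvf: "ok n (insert f v)" unfolding f_def v_def u_def D_def by (rule okI; (use ab in auto); presburger)
  have okD3: "ok n (insert (a,a+1) D)" unfolding D_def by (rule okI; (use ab in auto); presburger)
  have okD32: "ok n (insert (a,b) (insert (a,a+1) D))" unfolding D_def by (rule okI; (use ab in auto); presburger)
  have nokD: "\<not> ok n (insert f D)"
    using ok_trans[of n "insert f D" "a+1" "a+2" b] ab unfolding f_def D_def by auto
  have Du: "\<not> C D u" unfolding u_def
    by (rule edge_alive[OF okD oku[unfolded u_def] alive(1)]) (use ab in \<open>auto simp: lset_def D_def\<close>)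
  have uv: "C u v" unfolding v_def
    by (rule edge_dead[OF oku okv[unfolded v_def] dead]) (use ab in \<open>auto simp: lset_def u_def D_def\<close>)
  have vH: "\<not> C v H" unfolding H_def
    using alive_unit[OF okv, of a] okH ab unfolding H_def v_def u_def D_def by auto
  have uf: "\<not> C u (insert f u)"
    using alive_unit[OF oku, of "a+1"] okuf ab unfolding f_def u_def D_def by auto
  have vf: "\<not> C v (insert f v)"
    using alive_unit[OF okv, of "a+1"] okvf ab unfolding f_def v_def u_def D_def by auto
  have D3: "\<not> C D (insert (a,a+1) D)"
    using alive_unit[OF okD, of a] okD3 ab unfolding D_def by auto
  have D32: "\<not> C (insert (a,a+1) D) (insert (a,b) (insert (a,a+1) D))"
    by (rule edge_alive[OF okD3 okD32 alive(2)]) (use ab in \<open>auto simp: lset_def D_def\<close>)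
  have Hc: "H = insert (a+1,b) (insert (a,b) (insert (a,a+1) D))"
    unfolding H_def v_def u_def by auto
  have D321: "\<not> C (insert (a,b) (insert (a,a+1) D)) H"
    unfolding Hc
    by (rule edge_alive[OF okD32 okH[unfolded Hc] alive(1)]) (use ab in \<open>auto simp: lset_def D_def\<close>)
  have fv: "insert f v = insert (a,b) (insert f u)" unfolding v_def by auto
  have ufvf: "C (insert f u) (insert f v)" unfolding fv
    by (rule edge_dead[OF okuf okvf[unfolded fv] dead]) (use ab in \<open>auto simp: lset_def f_def u_def D_def\<close>)
  have aD: "adj u D" unfolding u_def
    by (rule adj_sym[OF adj_up[OF okD oku[unfolded u_def] Du[unfolded u_def]]])
  have aH: "adj u H" by (rule adj_C1[OF Csym[OF uv]]) (use adj_up okv okH vH in \<open>simp add: H_def\<close>)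
  have af: "adj u (insert f u)" by (rule adj_up[OF oku okuf uf])
  have s1: "\<not> sqr u D H"
    unfolding H_def v_def u_def
    by (rule not_sqr_hexagon)
      (use okD oku okv okH okD3 okD32 uv Du vH D3 D32 D321 ab in \<open>simp_all add: H_def v_def u_def D_def\<close>)
  have s2: "\<not> sqr u D (insert f u)"
    unfolding u_def by (rule not_sqr_chain) (use okD oku okuf nokD Du uf in \<open>simp_all add: u_def\<close>)
  \<comment> \<open>The last of the three pairs is tested at v, in the hexagon on a, a+1, a+2 with
    top H2. M1 and M2 are the words behind the middle edges of its two sides, and
    \<open>nocut\<close> keeps one of these edges alive.\<close>
  define M2 where "M2 = insert (a,a+2) (insert (a,a+1) v)"
  define M1 where "M1 = insert (a,a+2) (insert (a+1,a+2) v)"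
  define H2 where "H2 = insert (a,a+1) (insert (a,a+2) (insert (a+1,a+2) v))"
  have okM1: "ok n M1" unfolding M1_def f_def[symmetric]
    by (rule ok_insertI[OF okvf]) (use ab in \<open>auto simp: before_def f_def v_def u_def D_def\<close>)
  have okM2: "ok n M2" unfolding M2_def H_def[symmetric]
    by (rule ok_insertI[OF okH]) (use ab in \<open>auto simp: before_def H_def v_def u_def D_def\<close>)
  have okH2: "ok n H2" unfolding H2_def M1_def[symmetric]
    by (rule ok_insertI[OF okM1]) (use ab in \<open>auto simp: before_def M1_def v_def u_def D_def\<close>)
  have s3: "\<not> sqr v H (insert f v)"
  proof -
    have "\<exists>F M. (F = insert (a,a+1) v \<or> F = insert (a+1,a+2) v) \<and> lt F M \<and> lt M H2"
      using nocut
    proof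
      assume al: "\<not> dead a (a+2) {}"
      have 1: "\<not> C (insert f v) M1" unfolding M1_def f_def
        by (rule edge_alive[OF okvf[unfolded f_def] okM1[unfolded M1_def] al])
          (use ab in \<open>auto simp: lset_def v_def u_def D_def\<close>)
      have 2: "\<not> C M1 H2"
        using alive_unit[OF okM1, of a] okH2 ab unfolding M1_def H2_def v_def u_def D_def by auto
      have "lt (insert f v) M1" by (rule lt_sub[OF _ okvf okM1 1]) (auto simp: M1_def f_def)
      moreover have "lt M1 H2" by (rule lt_sub[OF _ okM1 okH2 2]) (auto simp: M1_def H2_def)
      ultimately show ?thesis unfolding f_def by auto
    next
      assume al: "\<not> dead a (a+2) {a+1}"
      have 1: "\<not> C H M2" unfolding M2_def H_def
        by (rule edge_alive[OF okH[unfolded H_def] okM2[unfolded M2_def] al])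
          (use ab in \<open>auto simp: lset_def v_def u_def D_def\<close>)
      have e: "H2 = insert (a+1, Suc (a+1)) M2" unfolding H2_def M2_def by auto
      have 2: "\<not> C M2 H2" unfolding e
        by (rule alive_unit[OF okM2 okH2[unfolded e]]) (use ab in \<open>auto simp: M2_def v_def u_def D_def\<close>)
      have "lt H M2" by (rule lt_sub[OF _ okH okM2 1]) (auto simp: M2_def H_def)
      moreover have "lt M2 H2" by (rule lt_sub[OF _ okM2 okH2 2]) (auto simp: M2_def H2_def)
      ultimately show ?thesis unfolding H_def by auto
    qed
    then obtain F M where FM: "F = insert (a,a+1) v \<or> F = insert (a+1,a+2) v" "lt F M" "lt M H2" by auto
    show ?thesis unfolding H_def f_def
      by (rule not_sqr_upper[OF _ _ _ _ _ _ _ _ _ _ FM[unfolded H2_def]])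
        (use okv okH okvf okH2 vH vf ab in \<open>simp_all add: H_def f_def H2_def v_def u_def D_def\<close>)
  qed
  have s3': "\<not> sqr u H (insert f u)"
    using s3 sqr_C1[OF uv sqr_C3[OF ufvf, of u H]] by auto
  have d1: "\<not> C D H" using convex(1)[of D H u] Du oku unfolding H_def v_def u_def by auto
  have d2: "\<not> C D (insert f u)" using convex(1)[of D "insert f u" u] Du oku unfolding u_def by auto
  have "\<not> C H (insert f v)"
    by (rule insert_not_C[OF okvf okv vf]) (use ab in \<open>auto simp: f_def H_def v_def u_def D_def\<close>)
  then have d3: "\<not> C H (insert f u)" using Ctrans[OF _ ufvf] by auto
  show False by (rule no_tri[OF vt aD aH af d1 d3 d2 s1 s3' s2])
qed

text \<open>The case b = a+2 of the same construction. No value is left between a+1 and b, so the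
  third neighbour of a (a+2) (a+1) (a+3) swaps a+1 with a+3; the other two are a (a+1) (a+2) (a+3)
  and (a+2) (a+1) a (a+3).\<close>

lemma triangle_short:
  assumes vt: "vertex_transitive G" and ab: "1 \<le> a" "a + 3 \<le> n"
    and dead: "dead a (a+2) {}" and alive: "\<not> dead a (a+2) {a+1}" "\<not> dead (a+1) (a+3) {a+2}"
      "\<not> dead a (a+3) {a+1,a+2}"
  shows False
proof -
  define u where "u = {(a+1,a+2)}"
  define v where "v = insert (a,a+2) u"
  define H where "H = insert (a,a+1) v"
  define f where "f = (a+1, a+3)"
  note defs = u_def v_def H_def f_def
  have okD: "ok n {}" by (rule ok_empty)
  have oku: "ok n u" unfolding u_def by (rule okI; (use ab in auto); presburger)
  have okv: "ok n v" unfolding v_def u_def by (rule okI; (use ab in auto); presburger)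
  have okH: "ok n H" unfolding H_def v_def u_def by (rule okI; (use ab in auto); presburger)
  have okuf: "ok n (insert f u)" unfolding f_def u_def by (rule okI; (use ab in auto); presburger)
  have okvf: "ok n (insert f v)" unfolding f_def v_def u_def by (rule okI; (use ab in auto); presburger)
  have okD3: "ok n {(a,a+1)}" by (rule okI; (use ab in auto); presburger)
  have okD32: "ok n {(a,a+2), (a,a+1)}" by (rule okI; (use ab in auto); presburger)
  have nokD: "\<not> ok n {f}"
    using ok_cotrans[of n "{f}" "a+1" "a+3" "a+2"] ab unfolding f_def by auto
  have Du: "\<not> C {} u" unfolding u_def
    using alive_unit[OF okD, of "a+1"] oku ab unfolding u_def by auto
  have uv: "C u v" unfolding v_def
    by (rule edge_dead[OF oku okv[unfolded v_def] dead]) (use ab in \<open>auto simp: lset_def u_def\<close>)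
  have vH: "\<not> C v H" unfolding H_def
    using alive_unit[OF okv, of a] okH ab unfolding defs by auto
  have uf: "\<not> C u (insert f u)" unfolding f_def
    by (rule edge_alive[OF oku okuf[unfolded f_def] alive(2)]) (use ab in \<open>auto simp: lset_def u_def\<close>)
  have vf: "\<not> C v (insert f v)" unfolding f_def
    by (rule edge_alive[OF okv okvf[unfolded f_def] alive(2)]) (use ab in \<open>auto simp: lset_def v_def u_def\<close>)
  have D3: "\<not> C {} {(a,a+1)}"
    using alive_unit[OF okD, of a] okD3 ab by auto
  have D32: "\<not> C {(a,a+1)} {(a,a+2), (a,a+1)}"
    by (rule edge_alive[OF okD3 okD32 alive(1)]) (use ab in \<open>auto simp: lset_def\<close>)
  have Hc: "H = insert (a+1,Suc (a+1)) {(a,a+2), (a,a+1)}" unfolding defs by auto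
  have D321: "\<not> C {(a,a+2), (a,a+1)} H"
    unfolding Hc using alive_unit[OF okD32 okH[unfolded Hc]] by auto
  have fv: "insert f v = insert (a,a+2) (insert f u)" unfolding v_def by auto
  have ufvf: "C (insert f u) (insert f v)" unfolding fv
    by (rule edge_dead[OF okuf okvf[unfolded fv] dead]) (use ab in \<open>auto simp: lset_def f_def u_def\<close>)
  have aD: "adj u {}" unfolding u_def
    by (rule adj_sym[OF adj_up[OF okD oku[unfolded u_def] Du[unfolded u_def]]])
  have aH: "adj u H" by (rule adj_C1[OF Csym[OF uv]]) (use adj_up okv okH vH in \<open>simp add: H_def\<close>)
  have af: "adj u (insert f u)" by (rule adj_up[OF oku okuf uf])
  have s1: "\<not> sqr u {} H"
    unfolding H_def v_def u_def
    by (rule not_sqr_hexagon)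
      (use okD oku okv okH okD3 okD32 uv Du vH D3 D32 D321 ab in \<open>simp_all add: H_def v_def u_def\<close>)
  have s2: "\<not> sqr u {} (insert f u)"
    unfolding u_def by (rule not_sqr_chain) (use okD oku okuf nokD Du uf in \<open>simp_all add: u_def\<close>)
  \<comment> \<open>The hexagon above v now uses the values a, a+1, a+3; the edge from H to M is its
    middle edge in the fence (a, a+3, {a+1,a+2}).\<close>
  define M where "M = insert (a,a+3) H"
  define H2 where "H2 = insert (a,a+1) (insert (a,a+3) (insert (a+1,a+3) v))"
  have okM: "ok n M" unfolding M_def
    by (rule ok_insertI[OF okH]; (use ab in \<open>auto simp: before_def defs\<close>); presburger)
  have e: "H2 = insert (a+1,a+3) M" unfolding H2_def M_def H_def by auto
  have okH2: "ok n H2" unfolding e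
    by (rule ok_insertI[OF okM]) (use ab in \<open>auto simp: before_def M_def defs\<close>)
  have HM: "\<not> C H M" unfolding M_def
    by (rule edge_alive[OF okH okM[unfolded M_def] alive(3)]) (use ab in \<open>auto simp: lset_def defs\<close>)
  have e: "H2 = insert (a+1,a+3) M" unfolding H2_def M_def H_def by auto
  have MH2: "\<not> C M H2" unfolding e
    by (rule edge_alive[OF okM okH2[unfolded e] alive(2)]) (use ab in \<open>auto simp: lset_def M_def defs\<close>)
  have FM: "lt H M" "lt M H2"
    using lt_sub[OF _ okH okM HM] lt_sub[OF _ okM okH2 MH2] unfolding e M_def by auto
  have s3: "\<not> sqr v H (insert f v)" unfolding H_def f_def
    by (rule not_sqr_upper[OF _ _ _ _ _ _ _ _ _ _ _ FM[unfolded H2_def]])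
      (use okv okH okvf okH2 vH vf ab in \<open>simp_all add: H_def f_def H2_def v_def u_def\<close>)
  have s3': "\<not> sqr u H (insert f u)"
    using s3 sqr_C1[OF uv sqr_C3[OF ufvf, of u H]] by auto
  have d1: "\<not> C {} H" using zero_class[of H] unfolding H_def by auto
  have d2: "\<not> C {} (insert f u)" using zero_class[of "insert f u"] by auto
  have "\<not> C H (insert f v)"
    by (rule insert_not_C[OF okvf okv vf]) (use ab in \<open>auto simp: defs\<close>)
  then have d3: "\<not> C H (insert f u)" using Ctrans[OF _ ufvf] by auto
  show False by (rule no_tri[OF vt aD aH af d1 d3 d2 s1 s3' s2])
qed

end

subsection \<open>Minimal dead fences\<close>

context ess_wcong
begin

text \<open>Fences reaching beyond [a,b] may contract some of the pairs in M, so the neighbour is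
  taken at the first alive edge towards v \<union> M. There is one: the meet with \<open>s i\<close>
  is the bottom for v and \<open>s i\<close> for v \<union> M.\<close>

lemma outer_neighbour:
  assumes v: "ok n v" and v': "ok n (v \<union> M)" and i: "1 \<le> i" "i < n" "(i, Suc i) \<in> M" "(i, Suc i) \<notin> v"
  obtains K e where "ok n K" "ok n (insert e K)" "e \<notin> K" "v \<subseteq> K" "C v K" "\<not> C K (insert e K)"
    "e \<in> M" "insert e K \<subseteq> v \<union> M"
proof -
  have nC: "\<not> C v (v \<union> M)"
  proof
    assume "C v (v \<union> M)"
    then have c: "C (mt n v (s i)) (mt n (v \<union> M) (s i))" using Cmt ok_s[OF i(1,2)] by simp
    have "mt n (v \<union> M) (s i) = s i"
      by (rule mt_absorb2[OF v' ok_s[OF i(1,2)]]) (use i in \<open>simp add: s_def\<close>)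
    moreover have "mt n v (s i) = {}"
      using mt_lower[OF v ok_s[OF i(1,2)]] i(4) unfolding s_def by auto
    ultimately have "s i = {}" using zero_class c by simp
    then show False unfolding s_def by simp
  qed
  obtain K p q where K: "ok n K" "ok n (insert (p,q) K)" "(p,q) \<notin> K" "v \<subseteq> K" "insert (p,q) K \<subseteq> v \<union> M"
    "C v K" "\<not> C K (insert (p,q) K)"
    by (rule first_edge[OF v v' Un_upper1 nC]) (rule that)
  moreover have "(p,q) \<in> M" using K(3,4,5) by auto
  ultimately show ?thesis by (intro that[of K "(p,q)"])
qed

text \<open>If both sides of a minimal dead fence were nonempty, then the class \<open>{ju a b L, jv a b L}\<close>
  would have \<open>n\<close> neighbours: two below, the others above, one for each simple transposition
  other than \<open>a\<close>.\<close>
lemma minimal_dead_extreme: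
  assumes vt: "vertex_transitive G" and f: "(a,b,L) \<in> fences n" and dead: "dead a b L"
    and sub: "\<And>c d. a \<le> c \<Longrightarrow> c < d \<Longrightarrow> d \<le> b \<Longrightarrow> (c,d) \<noteq> (a,b) \<Longrightarrow> \<not> dead c d (L \<inter> {c<..<d})"
  shows "L = {} \<or> L = {a<..<b}"
proof (rule ccontr)
  assume "\<not> ?thesis"
  then have ne: "L \<noteq> {}" "{a<..<b} - L \<noteq> {}" using f by (auto simp: fence_iff)
  have ab: "1 \<le> a" "a < b" "b \<le> n" and L: "L \<subseteq> {a<..<b}" using f by (auto simp: fence_iff)
  define v where "v = jv a b L"
  define u where "u = ju a b L"
  have mv: "(p,q) \<in> v \<longleftrightarrow> a \<le> p \<and> p < q \<and> q \<le> b \<and> p \<notin> L \<and> (q \<in> L \<or> q = b)" for p q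
    unfolding v_def mem_jv ..
  have mu: "(p,q) \<in> u \<longleftrightarrow> (p,q) \<noteq> (a,b) \<and> a \<le> p \<and> p < q \<and> q \<le> b \<and> p \<notin> L \<and> (q \<in> L \<or> q = b)" for p q
    unfolding u_def ju_def using mem_jv by auto
  have okv: "ok n v" unfolding v_def by (rule ok_jv[OF f])
  have oku: "ok n u" unfolding u_def by (rule ok_ju[OF f])
  have uv: "C u v" using dead unfolding dead_def u_def v_def .
  have finL: "finite L" using L finite_subset by auto
  \<comment> \<open>In the word of u the entry l stands directly left of a, and b stands directly
    left of r. Undoing these two descents gives the lower neighbours D1 and D2.\<close>
  define l where "l = Max L"
  have l: "l \<in> L" "\<And>x. x \<in> L \<Longrightarrow> x \<le> l" unfolding l_def using finL ne by auto
  have lab: "a < l" "l < b" using l(1) L by auto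
  define r where "r = Min ({a<..<b} - L)"
  have r: "r \<in> {a<..<b} - L" "\<And>x. x \<in> {a<..<b} - L \<Longrightarrow> r \<le> x" 
  proof -
    have fin: "finite ({a<..<b} - L)" by simp
    show "r \<in> {a<..<b} - L" unfolding r_def by (rule Min_in[OF fin ne(2)])
    show "r \<le> x" if "x \<in> {a<..<b} - L" for x unfolding r_def by (rule Min_le[OF fin that])
  qed
  have rab: "a < r" "r < b" "r \<notin> L" using r(1) by auto
  define D1 where "D1 = u - {(a,l)}"
  define D2 where "D2 = u - {(r,b)}"
  have i1: "insert (a,l) D1 = u" unfolding D1_def using mu[of a l] l lab L by auto
  have i2: "insert (r,b) D2 = u" unfolding D2_def using mu[of r b] rab by auto
  have okD1: "ok n D1"
  proof (rule okI)
    fix p q assume "(p,q) \<in> D1" then show "1 \<le> p \<and> p < q \<and> q \<le> n" using okD[OF oku] unfolding D1_def by auto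
  next
    fix p q s assume "(p,q) \<in> D1" "(q,s) \<in> D1"
    then show "(p,s) \<in> D1" unfolding D1_def using mu by auto
  next
    fix p s q assume h: "(p,q) \<in> D1" "p < s" "s < q"
    then have "(p,s) \<in> u \<or> (s,q) \<in> u" using ok_cotrans[OF oku] unfolding D1_def by auto
    moreover have "s \<noteq> l" if "p = a"
    proof
      assume "s = l"
      have "q \<in> L \<or> q = b" "q \<noteq> b" using h(1) mu[of p q] that unfolding D1_def by auto
      then show False using l(2)[of q] h(3) \<open>s = l\<close> by auto
    qed
    moreover have "s \<noteq> a" using h mu[of p q] unfolding D1_def by auto
    ultimately show "(p,s) \<in> D1 \<or> (s,q) \<in> D1" unfolding D1_def by auto
  qed
  have okD2: "ok n D2"
  proof (rule okI)
    fix p q assume "(p,q) \<in> D2" then show "1 \<le> p \<and> p < q \<and> q \<le> n" using okD[OF oku] unfolding D2_def by auto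
  next
    fix p q s assume "(p,q) \<in> D2" "(q,s) \<in> D2"
    then show "(p,s) \<in> D2" unfolding D2_def using mu by auto
  next
    fix p s q assume h: "(p,q) \<in> D2" "p < s" "s < q"
    then have "(p,s) \<in> u \<or> (s,q) \<in> u" using ok_cotrans[OF oku] unfolding D2_def by auto
    moreover have "s \<noteq> r" if "q = b"
    proof
      assume "s = r"
      have "a \<le> p" "p \<notin> L" "p \<noteq> a" "p < b" using h(1) mu[of p q] that unfolding D2_def by auto
      then show False using r(2)[of p] h(2) \<open>s = r\<close> by auto
    qed
    moreover have "s \<noteq> b" using h mu[of p q] unfolding D2_def by auto
    ultimately show "(p,s) \<in> D2 \<or> (s,q) \<in> D2" unfolding D2_def by auto
  qed
  have n1: "\<not> C D1 u"
  proof -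
    have "\<not> C D1 (insert (a,l) D1)"
    proof (rule edge_alive[OF okD1])
      show "ok n (insert (a,l) D1)" using i1 oku by simp
      show "\<not> dead a l (L \<inter> {a<..<l})" by (rule sub) (use lab in auto)
      show "lset a l D1 = L \<inter> {a<..<l}" unfolding lset_def D1_def using mu lab L by auto
    qed (simp add: D1_def)
    then show ?thesis using i1 by simp
  qed
  have n2: "\<not> C D2 u"
  proof -
    have "\<not> C D2 (insert (r,b) D2)"
    proof (rule edge_alive[OF okD2])
      show "ok n (insert (r,b) D2)" using i2 oku by simp
      show "\<not> dead r b (L \<inter> {r<..<b})" by (rule sub) (use rab in auto)
      show "lset r b D2 = L \<inter> {r<..<b}" unfolding lset_def D2_def using mu rab L by auto
    qed (simp add: D2_def)
    then show ?thesis using i2 by simp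
  qed
  have D12: "\<not> C D1 D2"
  proof
    assume "C D1 D2"
    then have "C (jn D1 D2) (jn D2 D2)" using Cjn okD2 by simp
    moreover have "jn D1 D2 = u"
    proof
      show "jn D1 D2 \<subseteq> u" by (rule jn_least[OF oku]) (auto simp: D1_def D2_def)
      show "u \<subseteq> jn D1 D2" using jn_upper(1)[of D1 D2] jn_upper(2)[of D2 D1] lab rab
        unfolding D1_def D2_def by auto
    qed
    moreover have "jn D2 D2 = D2" by (rule jn_absorb[OF okD2 order_refl])
    ultimately show False using n2 Csym by simp
  qed
  \<comment> \<open>In the word of v, an entry of L is followed by its \<open>nx\<close>, and an
    entry of ]a,b[ outside L is preceded by its \<open>pv\<close>. These are the ascents between
    values of [a,b].\<close>
  define nx where "nx c = Min {d. d \<in> insert b L \<and> c < d}" for c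
  have nx: "nx c \<in> insert b L \<and> c < nx c \<and> (\<forall>x. c < x \<and> x < nx c \<longrightarrow> x \<notin> L)" if "c < b" for c
  proof -
    let ?S = "{d. d \<in> insert b L \<and> c < d}"
    have fin: "finite ?S" and "?S \<noteq> {}" using finL that by auto
    then have "nx c \<in> ?S" unfolding nx_def by (rule Min_in)
    moreover have "x \<notin> L" if "c < x" "x < nx c" for x
      using Min_le[OF fin, of x] that unfolding nx_def by auto
    ultimately show ?thesis by auto
  qed
  define pv where "pv c = Max {d. a \<le> d \<and> d \<notin> L \<and> d < c}" for c
  have pv: "a \<le> pv c \<and> pv c \<notin> L \<and> pv c < c \<and> (\<forall>x. pv c < x \<and> x < c \<longrightarrow> x \<in> L)" if "a < c" for c
  proof -
    let ?S = "{d. a \<le> d \<and> d \<notin> L \<and> d < c}"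
    have fin: "finite ?S" by simp
    have "a \<in> ?S" using that L by auto
    then have "?S \<noteq> {}" by (metis empty_iff)
    then have "pv c \<in> ?S" unfolding pv_def by (rule Max_in[OF fin])
    moreover have "x \<in> L" if "pv c < x" "x < c" for x
      using Max_ge[OF fin, of x] that \<open>pv c \<in> ?S\<close> unfolding pv_def by (auto simp: not_le[symmetric])
    ultimately show ?thesis by auto
  qed
  \<comment> \<open>N i is large enough to contain every pair that the neighbour with index i may
    add. Disjointness of these sets later separates the neighbours.\<close>
  define N where "N i = (if a < i \<and> i < b then {if i \<in> L then (i, nx i) else (pv i, i)}
    else if b \<le> i then {(p, Suc i) | p. a \<le> p} else {(i, q) | q. q \<le> b})" for i
  have up: "\<exists>K e. ok n K \<and> ok n (insert e K) \<and> e \<notin> K \<and> v \<subseteq> K \<and> C v K \<and> \<not> C K (insert e K)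
      \<and> e \<in> N i \<and> insert e K \<subseteq> v \<union> N i" if i: "1 \<le> i" "i < n" "i \<noteq> a" for i
  proof -
    consider "a < i" "i < b" "i \<in> L" | "a < i" "i < b" "i \<notin> L" | "b \<le> i" | "i < a" using i by linarith
    then show ?thesis
    proof cases
      case 1
      define d where "d = nx i"
      have d: "d \<in> L \<or> d = b" "i < d" "\<And>x. i < x \<Longrightarrow> x < d \<Longrightarrow> x \<notin> L" "d \<le> b"
        using nx[OF 1(2)] L unfolding d_def by auto
      have nin: "(i,d) \<notin> v" using mv 1 by auto
      have okd: "ok n (insert (i,d) v)"
      proof (rule okI)
        fix p q assume "(p,q) \<in> insert (i,d) v" then show "1 \<le> p \<and> p < q \<and> q \<le> n" using mv ab 1 d by auto
      next
        fix p q s assume "(p,q) \<in> insert (i,d) v" "(q,s) \<in> insert (i,d) v"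
        then show "(p,s) \<in> insert (i,d) v" using mv 1 d ab by auto
      next
        fix p s q assume "(p,q) \<in> insert (i,d) v" "p < s" "s < q"
        then show "(p,s) \<in> insert (i,d) v \<or> (s,q) \<in> insert (i,d) v" using mv 1 d ab by auto
      qed
      have "\<not> C v (insert (i,d) v)"
      proof (rule edge_alive[OF okv okd _ nin])
        show "\<not> dead i d (L \<inter> {i<..<d})" by (rule sub) (use 1 d in auto)
        show "lset i d v = L \<inter> {i<..<d}" unfolding lset_def using mv 1 d by auto
      qed
      then show ?thesis using okv okd nin Crefl[OF okv] 1
        by (intro exI[of _ v] exI[of _ "(i,d)"]) (auto simp: N_def d_def)
    next
      case 2
      define p0 where "p0 = pv i"
      have d: "a \<le> p0" "p0 \<notin> L" "p0 < i" "\<And>x. p0 < x \<Longrightarrow> x < i \<Longrightarrow> x \<in> L"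
        using pv[OF 2(1)] unfolding p0_def by auto
      have nin: "(p0,i) \<notin> v" using mv 2 by auto
      have okd: "ok n (insert (p0,i) v)"
      proof (rule okI)
        fix p q assume "(p,q) \<in> insert (p0,i) v" then show "1 \<le> p \<and> p < q \<and> q \<le> n" using mv ab 2 d by auto
      next
        fix p q s assume "(p,q) \<in> insert (p0,i) v" "(q,s) \<in> insert (p0,i) v"
        then show "(p,s) \<in> insert (p0,i) v" using mv 2 d ab by auto
      next
        fix p s q assume "(p,q) \<in> insert (p0,i) v" "p < s" "s < q"
        then show "(p,s) \<in> insert (p0,i) v \<or> (s,q) \<in> insert (p0,i) v" using mv 2 d ab by auto
      qed
      have "\<not> C v (insert (p0,i) v)"
      proof (rule edge_alive[OF okv okd _ nin])
        show "\<not> dead p0 i (L \<inter> {p0<..<i})" by (rule sub) (use 2 d in auto)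
        show "lset p0 i v = L \<inter> {p0<..<i}" unfolding lset_def using mv 2 d by auto
      qed
      then show ?thesis using okv okd nin Crefl[OF okv] 2
        by (intro exI[of _ v] exI[of _ "(p0,i)"]) (auto simp: N_def p0_def)
    next
      case 3
      \<comment> \<open>Moving i+1 to the left of i takes it past i and past the smaller entries
        that stand right of i, which exist only for i = b.\<close>
      let ?M = "{(p, Suc i) | p. p = i \<or> (p,i) \<in> v}"
      have okM: "ok n (v \<union> ?M)"
      proof (rule okI)
        fix p q assume "(p,q) \<in> v \<union> ?M" then show "1 \<le> p \<and> p < q \<and> q \<le> n" using mv ab 3 i by auto
      next
        fix p q s assume "(p,q) \<in> v \<union> ?M" "(q,s) \<in> v \<union> ?M"
        then show "(p,s) \<in> v \<union> ?M" using mv 3 i ab by auto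
      next
        fix p s q assume h: "(p,q) \<in> v \<union> ?M" "p < s" "s < q"
        show "(p,s) \<in> v \<union> ?M \<or> (s,q) \<in> v \<union> ?M"
        proof (cases "(p,q) \<in> v")
          case True then show ?thesis using ok_cotrans[OF okv True h(2,3)] by auto
        next
          case False
          then have q: "q = Suc i" "(p,i) \<in> v" using h by auto
          then show ?thesis using ok_cotrans[OF okv q(2) h(2)] h by (cases "s = i") auto
        qed
      qed
      have "(i, Suc i) \<in> ?M" "(i, Suc i) \<notin> v" using mv 3 by auto
      then obtain K e where K: "ok n K" "ok n (insert e K)" "e \<notin> K" "v \<subseteq> K" "C v K" "\<not> C K (insert e K)"
        "e \<in> ?M" "insert e K \<subseteq> v \<union> ?M"
        by (rule outer_neighbour[OF okv okM i(1,2)]) (rule that)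
      have MN: "?M \<subseteq> N i" unfolding N_def using 3 mv ab by auto
      have "e \<in> N i" by (rule subsetD[OF MN K(7)])
      moreover have "insert e K \<subseteq> v \<union> N i" by (rule subset_trans[OF K(8) Un_mono[OF order_refl MN]])
      ultimately show ?thesis by (intro exI[of _ K] exI[of _ e]) (simp add: K(1-6))
    next
      case 4
      let ?M = "{(i, q) | q. q = Suc i \<or> (Suc i, q) \<in> v}"
      have okM: "ok n (v \<union> ?M)"
      proof (rule okI)
        fix p q assume "(p,q) \<in> v \<union> ?M" then show "1 \<le> p \<and> p < q \<and> q \<le> n" using mv ab 4 i by auto
      next
        fix p q s assume "(p,q) \<in> v \<union> ?M" "(q,s) \<in> v \<union> ?M"
        then show "(p,s) \<in> v \<union> ?M" using mv 4 i ab by auto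
      next
        fix p s q assume h: "(p,q) \<in> v \<union> ?M" "p < s" "s < q"
        show "(p,s) \<in> v \<union> ?M \<or> (s,q) \<in> v \<union> ?M"
        proof (cases "(p,q) \<in> v")
          case True then show ?thesis using ok_cotrans[OF okv True h(2,3)] by auto
        next
          case False
          then have q: "p = i" "(Suc i,q) \<in> v" using h by auto
          then show ?thesis using ok_cotrans[OF okv q(2) _ h(3)] h by (cases "s = Suc i") auto
        qed
      qed
      have "(i, Suc i) \<in> ?M" "(i, Suc i) \<notin> v" using mv 4 by auto
      then obtain K e where K: "ok n K" "ok n (insert e K)" "e \<notin> K" "v \<subseteq> K" "C v K" "\<not> C K (insert e K)"
        "e \<in> ?M" "insert e K \<subseteq> v \<union> ?M"
        by (rule outer_neighbour[OF okv okM i(1,2)]) (rule that)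
      have MN: "?M \<subseteq> N i" unfolding N_def using 4 mv ab by auto
      have "e \<in> N i" by (rule subsetD[OF MN K(7)])
      moreover have "insert e K \<subseteq> v \<union> N i" by (rule subset_trans[OF K(8) Un_mono[OF order_refl MN]])
      ultimately show ?thesis by (intro exI[of _ K] exI[of _ e]) (simp add: K(1-6))
    qed
  qed
  define U where "U = {1..<n} - {a}"
  have ex: "\<forall>i\<in>U. \<exists>K e. ok n (K) \<and> ok n (insert (e) (K)) \<and> (e) \<notin> (K) \<and> v \<subseteq> (K) \<and> C v (K) \<and> \<not> C (K) (insert (e) (K))
      \<and> (e) \<in> N i \<and> insert (e) (K) \<subseteq> v \<union> N i"
    using up unfolding U_def by simp
  from bchoice[OF ex] obtain K where ex2: "\<forall>i\<in>U. \<exists>e. ok n (K i) \<and> ok n (insert (e) (K i)) \<and> (e) \<notin> (K i) \<and> v \<subseteq> (K i) \<and> C v (K i) \<and> \<not> C (K i) (insert (e) (K i))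
      \<and> (e) \<in> N i \<and> insert (e) (K i) \<subseteq> v \<union> N i" ..
  from bchoice[OF ex2] obtain e where ex3: "\<forall>i\<in>U. ok n (K i) \<and> ok n (insert (e i) (K i)) \<and> (e i) \<notin> (K i) \<and> v \<subseteq> (K i) \<and> C v (K i) \<and> \<not> C (K i) (insert (e i) (K i))
      \<and> (e i) \<in> N i \<and> insert (e i) (K i) \<subseteq> v \<union> N i" ..
  have Ke: "ok n (K i) \<and> ok n (insert (e i) (K i)) \<and> (e i) \<notin> (K i) \<and> v \<subseteq> (K i) \<and> C v (K i) \<and> \<not> C (K i) (insert (e i) (K i))
      \<and> (e i) \<in> N i \<and> insert (e i) (K i) \<subseteq> v \<union> N i" if "i \<in> U" for i
    using ex3 that by (rule bspec)
  have KU: "ok n (K i)" "ok n (insert (e i) (K i))" "e i \<notin> K i" "v \<subseteq> K i" "C v (K i)"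
    "\<not> C (K i) (insert (e i) (K i))" "e i \<in> N i" "insert (e i) (K i) \<subseteq> v \<union> N i" if "i \<in> U" for i
    using Ke[OF that] by blast+
  have dis: "N i \<inter> N j = {}" if ij: "i \<noteq> j" "i \<in> U" "j \<in> U" for i j
  proof -
    have N1: "fst x = i \<and> i \<in> L \<and> a < i \<and> i < b \<and> snd x \<le> b
        \<or> snd x = i \<and> i \<notin> L \<and> a < i \<and> i < b \<and> a \<le> fst x \<and> fst x \<notin> L
        \<or> b \<le> i \<and> snd x = Suc i \<and> a \<le> fst x \<or> i < a \<and> fst x = i \<and> snd x \<le> b"
      if "x \<in> N i" "i \<in> U" for i x
    proof -
      have ia: "i \<noteq> a" using that(2) unfolding U_def by simp
      consider "a < i" "i < b" "i \<in> L" | "a < i" "i < b" "i \<notin> L" | "b \<le> i" | "i < a" using ia by linarith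
      then show ?thesis
      proof cases
        case 1
        then have "x = (i, nx i)" using that(1) by (simp add: N_def)
        then show ?thesis using 1 nx[OF 1(2)] L by auto
      next
        case 2
        then have "x = (pv i, i)" using that(1) by (simp add: N_def)
        then show ?thesis using 2 pv[OF 2(1)] by simp
      next
        case 3 then show ?thesis using that(1) ab by (auto simp: N_def)
      next
        case 4 then show ?thesis using that(1) ab by (auto simp: N_def)
      qed
    qed
    show ?thesis
    proof (rule ccontr)
      assume "N i \<inter> N j \<noteq> {}"
      then obtain x where "x \<in> N i" "x \<in> N j" by auto
      from N1[OF this(1) ij(2)] N1[OF this(2) ij(3)] ij(1) show False by auto
    qed
  qed
  \<comment> \<open>The indices 0 and a, which lie outside \<open>U\<close>, are given to the two
    lower neighbours; this makes n distinct neighbours for n-1 labels.\<close>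
  define z where "z i = (if i = 0 then D1 else if i = a then D2 else insert (e i) (K i))" for i
  have zU: "z i = insert (e i) (K i)" if "i \<in> U" for i using that unfolding z_def U_def by auto
  have az: "adj v (z i)" if "i < n" for i
  proof (cases "i \<in> U")
    case True
    have "adj (K i) (z i)" unfolding zU[OF True] by (rule adj_up[OF KU(1,2,6)[OF True]])
    moreover have "C (K i) v" by (rule Csym[OF KU(5)[OF True]])
    ultimately show ?thesis by (rule adj_C1[rotated])
  next
    case False
    then have "z i = D1 \<or> z i = D2" using that unfolding z_def U_def by auto
    moreover have "adj u D1" "adj u D2"
      using adj_sym[OF adj_up[OF okD1, of "(a,l)"]] adj_sym[OF adj_up[OF okD2, of "(r,b)"]]
      unfolding i1 i2 using oku n1 n2 by simp_all
    ultimately have "adj u (z i)" by auto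
    then show ?thesis using adj_C1[OF uv] by simp
  qed
  have DU: "\<not> C D1 (z i)" "\<not> C D2 (z i)" if "i \<in> U" for i
  proof -
    have "v \<subseteq> K i" by (rule KU(4)[OF that])
    then have sz: "u \<subseteq> z i" unfolding zU[OF that] u_def v_def ju_def by auto
    have "D1 \<subseteq> u" "D2 \<subseteq> u" unfolding D1_def D2_def by auto
    then show "\<not> C D1 (z i)" "\<not> C D2 (z i)"
      using convex(1)[OF _ _ sz oku, of D1] convex(1)[OF _ _ sz oku, of D2] n1 n2 by auto
  qed
  have zz: "\<not> C (z i) (z j)" if ij: "i \<noteq> j" "i < n" "j < n" for i j
  proof -
    consider "i \<in> U" "j \<in> U" | "i \<notin> U" "j \<in> U" | "i \<in> U" "j \<notin> U" | "i \<notin> U" "j \<notin> U" by auto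
    then show ?thesis
    proof cases
      case 1
      have "e j \<notin> z i"
      proof
        assume "e j \<in> z i"
        then have "e j \<in> v \<union> N i" using zU[OF 1(1)] subsetD[OF KU(8)[OF 1(1)]] by simp
        moreover have "e j \<notin> v" "e j \<in> N j" using KU(3,4,7)[OF 1(2)] by auto
        ultimately show False using dis[OF ij(1) 1] by auto
      qed
      then show ?thesis unfolding zU[OF 1(2)] by (rule insert_not_C[OF KU(2,1,6)[OF 1(2)]])
    next
      case 2
      then have "z i = D1 \<or> z i = D2" using ij unfolding z_def U_def by auto
      then show ?thesis using DU[OF 2(2)] by auto
    next
      case 3
      then have "z j = D1 \<or> z j = D2" using ij unfolding z_def U_def by auto
      then show ?thesis using DU[OF 3(1)] Csym[of "z i" "z j"] by auto
    next
      case 4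
      then have "(z i = D1 \<and> z j = D2) \<or> (z i = D2 \<and> z j = D1)" using ij ab unfolding z_def U_def by auto
      then show ?thesis using D12 Csym[of D2 D1] by auto
    qed
  qed
  obtain g where g: "\<And>J. adj v J \<Longrightarrow> 1 \<le> g J \<and> g J < n"
    "\<And>J K. adj v J \<Longrightarrow> adj v K \<Longrightarrow> g J = g K \<longleftrightarrow> C J K"
    "\<And>J K. adj v J \<Longrightarrow> adj v K \<Longrightarrow> sqr v J K \<longleftrightarrow> sqr {} (s (g J)) (s (g K))"
    by (rule vt_match[OF vt okv]) (rule that)
  have "inj_on (\<lambda>i. g (z i)) {0..<n}"
  proof (rule inj_onI)
    fix i j assume h: "i \<in> {0..<n}" "j \<in> {0..<n}" "g (z i) = g (z j)"
    have "C (z i) (z j)" using g(2)[OF az[of i] az[of j]] h by simp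
    then show "i = j" using zz[of i j] h by auto
  qed
  moreover have "(\<lambda>i. g (z i)) ` {0..<n} \<subseteq> {1..<n}" using g(1)[OF az] by auto
  ultimately have "card {0..<n} \<le> card {1..<n}" by (intro card_inj_on_le) auto
  then show False using ab by simp
qed

end

subsection \<open>Reversal and mirror symmetry\<close>

text \<open>Each value p becomes n+1-p and the word is read backwards. The two reversals together
  preserve inclusion of inversion sets: this is conjugation by the longest permutation.\<close>

definition mir :: "nat \<Rightarrow> (nat \<times> nat) set \<Rightarrow> (nat \<times> nat) set" where
  "mir n I = {(p,q). p \<le> n \<and> q \<le> n \<and> (Suc n - q, Suc n - p) \<in> I}"

lemma ok_mir: assumes "ok n I" shows "ok n (mir n I)"
proof (rule okI)
  fix p q assume h: "(p,q) \<in> mir n I"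
  then have "(Suc n - q, Suc n - p) \<in> I" "p \<le> n" "q \<le> n" unfolding mir_def by auto
  then show "1 \<le> p \<and> p < q \<and> q \<le> n" using okD[OF assms, of "Suc n - q" "Suc n - p"] by auto
next
  fix p q r assume "(p,q) \<in> mir n I" "(q,r) \<in> mir n I"
  then show "(p,r) \<in> mir n I" using ok_trans[OF assms, of "Suc n - r" "Suc n - q" "Suc n - p"]
    unfolding mir_def by auto
next
  fix p r q assume h: "(p,q) \<in> mir n I" "p < r" "r < q"
  then have "(Suc n - q, Suc n - p) \<in> I" "p \<le> n" "q \<le> n" unfolding mir_def by auto
  then have "(Suc n - q, Suc n - r) \<in> I \<or> (Suc n - r, Suc n - p) \<in> I"
    using ok_cotrans[OF assms, of "Suc n - q" "Suc n - p" "Suc n - r"] h by auto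
  then show "(p,r) \<in> mir n I \<or> (r,q) \<in> mir n I" unfolding mir_def using h \<open>p \<le> n\<close> \<open>q \<le> n\<close> by auto
qed

lemma mir_mir: assumes "ok n I" shows "mir n (mir n I) = I"
proof (rule set_eqI)
  fix x :: "nat \<times> nat"
  obtain p q where x: "x = (p,q)" by fastforce
  show "x \<in> mir n (mir n I) \<longleftrightarrow> x \<in> I"
  proof (cases "1 \<le> p \<and> p \<le> n \<and> 1 \<le> q \<and> q \<le> n")
    case True
    then show ?thesis unfolding x mir_def by auto
  next
    case False
    then have "x \<notin> mir n (mir n I)" "x \<notin> I"
      using okD[OF ok_mir[OF ok_mir[OF assms]], of p q] okD[OF assms, of p q] unfolding x by auto
    then show ?thesis by simp
  qed
qed

lemma mir_mono: "I \<subseteq> J \<Longrightarrow> mir n I \<subseteq> mir n J"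
  unfolding mir_def by auto

section \<open>Transport of a congruence along order-preserving and order-reversing
  involutions\<close>

context wcong
begin

text \<open>An order-reversing involution exchanges joins and meets, so the two compatibility
  conditions trade places.\<close>

lemma wcong_antiauto:
  assumes T: "\<And>I. ok n I \<Longrightarrow> ok n (T I)" "\<And>I. ok n I \<Longrightarrow> T (T I) = I"
    and anti: "\<And>I J. ok n I \<Longrightarrow> ok n J \<Longrightarrow> I \<subseteq> J \<Longrightarrow> T J \<subseteq> T I"
  shows "wcong n (\<lambda>I J. ok n I \<and> ok n J \<and> C (T I) (T J))"
proof -
  have Tjn: "T (jn I K) = mt n (T I) (T K)" if o: "ok n I" "ok n K" for I K
  proof
    show "T (jn I K) \<subseteq> mt n (T I) (T K)"
      by (intro mt_greatest T ok_jn anti jn_upper o)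
    have o': "ok n (mt n (T I) (T K))" by (intro ok_mt T o)
    have "jn I K \<subseteq> T (mt n (T I) (T K))"
    proof (rule jn_least[OF T(1)[OF o']])
      show "I \<subseteq> T (mt n (T I) (T K))"
        using anti[OF o' T(1)[OF o(1)] mt_lower(1)[OF T(1)[OF o(1)] T(1)[OF o(2)]]] T(2)[OF o(1)] by simp
      show "K \<subseteq> T (mt n (T I) (T K))"
        using anti[OF o' T(1)[OF o(2)] mt_lower(2)[OF T(1)[OF o(1)] T(1)[OF o(2)]]] T(2)[OF o(2)] by simp
    qed
    from anti[OF ok_jn[OF o] T(1)[OF o'] this] show "mt n (T I) (T K) \<subseteq> T (jn I K)"
      using T(2)[OF o'] by simp
  qed
  have Tmt: "T (mt n I K) = jn (T I) (T K)" if o: "ok n I" "ok n K" for I K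
    using Tjn[OF T(1)[OF o(1)] T(1)[OF o(2)]] T(2)[OF o(1)] T(2)[OF o(2)]
      T(2)[OF ok_jn[OF T(1)[OF o(1)] T(1)[OF o(2)]]] by simp
  show ?thesis
  proof
    fix I J K assume h: "ok n I \<and> ok n J \<and> C (T I) (T J)" and K: "ok n K"
    show "ok n (jn I K) \<and> ok n (jn J K) \<and> C (T (jn I K)) (T (jn J K))"
      using h K Cmt[of "T I" "T J" "T K"] by (simp add: Tjn ok_jn T)
    show "ok n (mt n I K) \<and> ok n (mt n J K) \<and> C (T (mt n I K)) (T (mt n J K))"
      using h K Cjn[of "T I" "T J" "T K"] by (simp add: Tmt ok_mt T)
  next
    fix I J K assume "ok n I \<and> ok n J \<and> C (T I) (T J)" "ok n J \<and> ok n K \<and> C (T J) (T K)"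
    then show "ok n I \<and> ok n K \<and> C (T I) (T K)" using Ctrans[of "T I" "T J" "T K"] by simp
  next
    fix I assume "ok n I"
    then show "ok n I \<and> ok n I \<and> C (T I) (T I)" using Crefl[OF T(1)] by simp
  next
    fix I J assume "ok n I \<and> ok n J \<and> C (T I) (T J)"
    then show "ok n J \<and> ok n I \<and> C (T J) (T I)" using Csym[of "T I" "T J"] by simp
  qed simp
qed

lemma wcong_auto:
  assumes T: "\<And>I. ok n I \<Longrightarrow> ok n (T I)" "\<And>I. ok n I \<Longrightarrow> T (T I) = I"
    and mono: "\<And>I J. ok n I \<Longrightarrow> ok n J \<Longrightarrow> I \<subseteq> J \<Longrightarrow> T I \<subseteq> T J"
  shows "wcong n (\<lambda>I J. ok n I \<and> ok n J \<and> C (T I) (T J))"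
proof -
  have Tjn: "T (jn I K) = jn (T I) (T K)" if o: "ok n I" "ok n K" for I K
  proof
    show "jn (T I) (T K) \<subseteq> T (jn I K)"
      by (rule jn_least[of n]) (intro T ok_jn mono jn_upper o)+
    have o': "ok n (jn (T I) (T K))" by (intro ok_jn T o)
    have "jn I K \<subseteq> T (jn (T I) (T K))"
    proof (rule jn_least[OF T(1)[OF o']])
      show "I \<subseteq> T (jn (T I) (T K))"
        using mono[OF T(1)[OF o(1)] o' jn_upper(1)] T(2)[OF o(1)] by simp
      show "K \<subseteq> T (jn (T I) (T K))"
        using mono[OF T(1)[OF o(2)] o' jn_upper(2)] T(2)[OF o(2)] by simp
    qed
    from mono[OF ok_jn[OF o] T(1)[OF o'] this] show "T (jn I K) \<subseteq> jn (T I) (T K)"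
      using T(2)[OF o'] by simp
  qed
  have Tmt: "T (mt n I K) = mt n (T I) (T K)" if o: "ok n I" "ok n K" for I K
  proof
    show "T (mt n I K) \<subseteq> mt n (T I) (T K)"
      by (rule mt_greatest) (intro T ok_mt mono mt_lower o)+
    have o': "ok n (mt n (T I) (T K))" by (intro ok_mt T o)
    have "T (mt n (T I) (T K)) \<subseteq> mt n I K"
    proof (rule mt_greatest[OF T(1)[OF o']])
      show "T (mt n (T I) (T K)) \<subseteq> I"
        using mono[OF o' T(1)[OF o(1)] mt_lower(1)[OF T(1)[OF o(1)] T(1)[OF o(2)]]] T(2)[OF o(1)] by simp
      show "T (mt n (T I) (T K)) \<subseteq> K"
        using mono[OF o' T(1)[OF o(2)] mt_lower(2)[OF T(1)[OF o(1)] T(1)[OF o(2)]]] T(2)[OF o(2)] by simp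
    qed
    from mono[OF T(1)[OF o'] ok_mt[OF o] this] show "mt n (T I) (T K) \<subseteq> T (mt n I K)"
      using T(2)[OF o'] by simp
  qed
  show ?thesis
  proof
    fix I J K assume h: "ok n I \<and> ok n J \<and> C (T I) (T J)" and K: "ok n K"
    show "ok n (jn I K) \<and> ok n (jn J K) \<and> C (T (jn I K)) (T (jn J K))"
      using h K Cjn[of "T I" "T J" "T K"] by (simp add: Tjn ok_jn T)
    show "ok n (mt n I K) \<and> ok n (mt n J K) \<and> C (T (mt n I K)) (T (mt n J K))"
      using h K Cmt[of "T I" "T J" "T K"] by (simp add: Tmt ok_mt T)
  next
    fix I J K assume "ok n I \<and> ok n J \<and> C (T I) (T J)" "ok n J \<and> ok n K \<and> C (T J) (T K)"
    then show "ok n I \<and> ok n K \<and> C (T I) (T K)" using Ctrans[of "T I" "T J" "T K"] by simp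
  next
    fix I assume "ok n I"
    then show "ok n I \<and> ok n I \<and> C (T I) (T I)" using Crefl[OF T(1)] by simp
  next
    fix I J assume "ok n I \<and> ok n J \<and> C (T I) (T J)"
    then show "ok n J \<and> ok n I \<and> C (T J) (T I)" using Csym[of "T I" "T J"] by simp
  qed simp
qed

text \<open>Taking images under T is a bijection between the classes of the two congruences which
  preserves or reverses their order, hence an isomorphism of cover graphs.\<close>

lemma transport_vertex_transitive:
  assumes w: "wcong n (\<lambda>I J. ok n I \<and> ok n J \<and> C (T I) (T J))"
    and T: "\<And>I. ok n I \<Longrightarrow> ok n (T I)" "\<And>I. ok n I \<Longrightarrow> T (T I) = I"
    and mono: "(\<forall>I J. ok n I \<longrightarrow> ok n J \<longrightarrow> I \<subseteq> J \<longrightarrow> T I \<subseteq> T J)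
      \<or> (\<forall>I J. ok n I \<longrightarrow> ok n J \<longrightarrow> I \<subseteq> J \<longrightarrow> T J \<subseteq> T I)"
    and vt: "vertex_transitive G"
  shows "vertex_transitive (wcong.G n (\<lambda>I J. ok n I \<and> ok n J \<and> C (T I) (T J)))"
proof -
  let ?C' = "\<lambda>I J. ok n I \<and> ok n J \<and> C (T I) (T J)"
  interpret R: wcong n ?C' by (rule w)
  let ?V = "cl ` {I. ok n I}" and ?W = "R.cl ` {I. ok n I}"
  have clok: "ok n I" if "X \<in> ?V" "I \<in> X" for X I
  proof -
    from that(1) obtain K where "X = cl K" by (rule imageE)
    then have "C K I" using that(2) unfolding cl_def by simp
    then show ?thesis using Cok[of K I] by simp
  qed
  have clT: "(\<lambda>I. T I) ` cl I = R.cl (T I)" if I: "ok n I" for I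
  proof (rule set_eqI)
    fix J
    show "J \<in> T ` cl I \<longleftrightarrow> J \<in> R.cl (T I)"
    proof
      assume "J \<in> T ` cl I"
      then obtain K where K: "J = T K" "K \<in> cl I" by (rule imageE)
      then have c: "C I K" unfolding cl_def by simp
      then have oK: "ok n K" using Cok[OF c] by simp
      show "J \<in> R.cl (T I)" unfolding R.cl_def mem_Collect_eq K(1) T(2)[OF I] T(2)[OF oK]
        using T(1)[OF I] T(1)[OF oK] c by simp
    next
      assume "J \<in> R.cl (T I)"
      then have J: "ok n J" "C I (T J)" unfolding R.cl_def mem_Collect_eq T(2)[OF I] by simp_all
      show "J \<in> T ` cl I"
        by (rule image_eqI[of _ _ "T J"]) (use J T(2)[OF J(1)] in \<open>simp_all add: cl_def\<close>)
    qed
  qed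
  have bij: "bij_betw (\<lambda>X. T ` X) ?V ?W"
  proof (rule bij_betw_imageI)
    show "inj_on (\<lambda>X. T ` X) ?V"
    proof (rule inj_onI)
      fix X Y assume h: "X \<in> ?V" "Y \<in> ?V" "T ` X = T ` Y"
      have e: "T ` T ` X = X" if "X \<in> ?V" for X
      proof -
        have TT: "T (T I) = I" if "I \<in> X" for I by (rule T(2)[OF clok[OF \<open>X \<in> ?V\<close> that]])
        have "T ` T ` X = (\<lambda>I. T (T I)) ` X" by (rule image_image)
        also have "\<dots> = (\<lambda>I. I) ` X" by (rule image_cong[OF refl TT])
        finally show ?thesis by (simp only: image_ident)
      qed
      show "X = Y" by (rule trans[OF e[OF h(1), symmetric] trans[OF arg_cong[OF h(3), of "image T"] e[OF h(2)]]])
    qed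
    show "(\<lambda>X. T ` X) ` ?V = ?W"
    proof (intro equalityI subsetI)
      fix X assume "X \<in> (\<lambda>X. T ` X) ` ?V"
      then obtain Y where Y: "X = T ` Y" "Y \<in> ?V" by (rule imageE)
      from Y(2) obtain I where "Y = cl I" "I \<in> {I. ok n I}" by (rule imageE)
      then have I: "ok n I" "X = T ` cl I" using Y(1) by simp_all
      show "X \<in> ?W" unfolding I(2) clT[OF I(1)] by (rule imageI) (simp add: T(1)[OF I(1)])
    next
      fix X assume "X \<in> ?W"
      then obtain I where "X = R.cl I" "I \<in> {I. ok n I}" by (rule imageE)
      then have I: "ok n I" "X = R.cl I" by simp_all
      have "X = T ` cl (T I)" unfolding clT[OF T(1)[OF I(1)]] T(2)[OF I(1)] by (rule I(2))
      then show "X \<in> (\<lambda>X. T ` X) ` ?V" by (intro image_eqI[of _ _ "cl (T I)"] imageI) (simp_all add: T(1)[OF I(1)])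
    qed
  qed
  have "graph_iso G R.G" unfolding G_def R.G_def
  proof (rule cover_graph_iso[OF bij])
    show "(\<forall>X\<in>?V. \<forall>Y\<in>?V. (\<exists>I\<in>X. \<exists>J\<in>Y. I \<subseteq> J) \<longleftrightarrow> (\<exists>I\<in>T ` X. \<exists>J\<in>T ` Y. I \<subseteq> J))
      \<or> (\<forall>X\<in>?V. \<forall>Y\<in>?V. (\<exists>I\<in>X. \<exists>J\<in>Y. I \<subseteq> J) \<longleftrightarrow> (\<exists>I\<in>T ` Y. \<exists>J\<in>T ` X. I \<subseteq> J))"
      using mono
    proof
      assume m: "\<forall>I J. ok n I \<longrightarrow> ok n J \<longrightarrow> I \<subseteq> J \<longrightarrow> T I \<subseteq> T J"
      have e: "I \<subseteq> J \<longleftrightarrow> T I \<subseteq> T J" if o: "ok n I" "ok n J" for I J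
        using m[rule_format, OF o] m[rule_format, OF T(1)[OF o(1)] T(1)[OF o(2)]] T(2)[OF o(1)] T(2)[OF o(2)] by auto
      have "(\<exists>I\<in>X. \<exists>J\<in>Y. I \<subseteq> J) \<longleftrightarrow> (\<exists>I\<in>T ` X. \<exists>J\<in>T ` Y. I \<subseteq> J)" if h: "X \<in> ?V" "Y \<in> ?V" for X Y
        using e clok[OF h(1)] clok[OF h(2)] by (simp cong: bex_cong)
      then show ?thesis by simp
    next
      assume m: "\<forall>I J. ok n I \<longrightarrow> ok n J \<longrightarrow> I \<subseteq> J \<longrightarrow> T J \<subseteq> T I"
      have e: "I \<subseteq> J \<longleftrightarrow> T J \<subseteq> T I" if o: "ok n I" "ok n J" for I J
        using m[rule_format, OF o] m[rule_format, OF T(1)[OF o(2)] T(1)[OF o(1)]] T(2)[OF o(1)] T(2)[OF o(2)] by auto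
      have "(\<exists>I\<in>X. \<exists>J\<in>Y. I \<subseteq> J) \<longleftrightarrow> (\<exists>I\<in>T ` Y. \<exists>J\<in>T ` X. I \<subseteq> J)" if h: "X \<in> ?V" "Y \<in> ?V" for X Y
      proof -
        have "(\<exists>I\<in>X. \<exists>J\<in>Y. I \<subseteq> J) \<longleftrightarrow> (\<exists>I\<in>X. \<exists>J\<in>Y. T J \<subseteq> T I)"
          using e clok[OF h(1)] clok[OF h(2)] by (simp cong: bex_cong)
        then show ?thesis by auto
      qed
      then show ?thesis by simp
    qed
  qed
  then show ?thesis by (rule vertex_transitive_iso[OF _ vt])
qed

end

section \<open>Reversed and mirrored congruences, cuts, and the bad configuration\<close>

context ess_wcong
begin

definition Crev :: "(nat \<times> nat) set \<Rightarrow> (nat \<times> nat) set \<Rightarrow> bool" where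
  "Crev = (\<lambda>I J. ok n I \<and> ok n J \<and> C (prs n - I) (prs n - J))"

definition Cmir :: "(nat \<times> nat) set \<Rightarrow> (nat \<times> nat) set \<Rightarrow> bool" where
  "Cmir = (\<lambda>I J. ok n I \<and> ok n J \<and> C (mir n I) (mir n J))"

lemma wcong_Crev: "wcong n Crev"
  unfolding Crev_def by (rule wcong_antiauto) (auto simp: ok_compl compl_compl)

lemma wcong_Cmir: "wcong n Cmir"
  unfolding Cmir_def by (rule wcong_auto) (simp_all add: ok_mir mir_mir mir_mono)

text \<open>Complementation sends the lowest edge of the fence to the highest edge of the
  complementary one, and \<open>dead_upper\<close> compares that with its lowest edge.\<close>

lemma dead_Crev: assumes f: "(a,b,L) \<in> fences n"
  shows "wcong.dead Crev a b L \<longleftrightarrow> dead a b ({a<..<b} - L)"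
proof -
  have "{a<..<b} - ({a<..<b} - L) = L" using f by (auto simp: fence_iff)
  then have "dead a b ({a<..<b} - L) \<longleftrightarrow> C (prs n - jv a b L) (prs n - ju a b L)"
    using dead_upper[OF fence_compl[OF f]] by simp
  also have "\<dots> \<longleftrightarrow> C (prs n - ju a b L) (prs n - jv a b L)" using Csym by auto
  finally show ?thesis unfolding wcong.dead_def[OF wcong_Crev] unfolding Crev_def
    using ok_ju[OF f] ok_jv[OF f] by simp
qed

text \<open>The interval is reflected by the reversal of values. Since positions are reversed too,
  what stood left of the pair now stands right of it, so L is complemented besides being
  reflected.\<close>

lemma dead_Cmir: assumes f: "(a,b,L) \<in> fences n"
  shows "wcong.dead Cmir a b L \<longleftrightarrow>
    dead (Suc n - b) (Suc n - a) {c. Suc n - b < c \<and> c < Suc n - a \<and> Suc n - c \<notin> L}"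
proof -
  have ab: "1 \<le> a" "a < b" "b \<le> n" "L \<subseteq> {a<..<b}" using f by (auto simp: fence_iff)
  let ?a = "Suc n - b" and ?b = "Suc n - a"
  have e: "insert (?a,?b) (mir n (ju a b L)) = mir n (jv a b L)"
  proof (rule set_eqI)
    fix x :: "nat \<times> nat"
    obtain p q where x: "x = (p,q)" by fastforce
    show "x \<in> insert (?a,?b) (mir n (ju a b L)) \<longleftrightarrow> x \<in> mir n (jv a b L)"
      unfolding x mir_def ju_def using ab by (auto simp: mem_jv)
  qed
  have o: "ok n (mir n (ju a b L))" "ok n (mir n (jv a b L))" using ok_mir ok_ju[OF f] ok_jv[OF f] by auto
  have "C (mir n (ju a b L)) (insert (?a,?b) (mir n (ju a b L))) \<longleftrightarrow> dead ?a ?b (lset ?a ?b (mir n (ju a b L)))"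
    by (rule edge_iff) (use o e ab in \<open>auto simp: mir_def ju_def\<close>)
  moreover have "lset ?a ?b (mir n (ju a b L)) = {c. ?a < c \<and> c < ?b \<and> Suc n - c \<notin> L}"
  proof (rule set_eqI)
    fix c
    show "c \<in> lset ?a ?b (mir n (ju a b L)) \<longleftrightarrow> c \<in> {c. ?a < c \<and> c < ?b \<and> Suc n - c \<notin> L}"
      unfolding lset_def mir_def ju_def using ab by (auto simp: mem_jv)
  qed
  ultimately show ?thesis unfolding wcong.dead_def[OF wcong_Cmir] unfolding Cmir_def
    using ok_ju[OF f] ok_jv[OF f] e by simp
qed

lemma dead_Cmir_eq:
  assumes "(a,b,L) \<in> fences n" "Suc n - b = c" "Suc n - a = d" "M = {x. c < x \<and> x < d \<and> Suc n - x \<notin> L}"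
  shows "wcong.dead Cmir a b L \<longleftrightarrow> dead c d M"
  unfolding dead_Cmir[OF assms(1)] assms(2-4) ..

lemma ess_Crev: "ess_wcong n Crev"
proof (intro ess_wcong.intro wcong_Crev ess_wcong_axioms.intro)
  fix a assume "1 \<le> a" "a < n"
  moreover have "{a<..<Suc a} - {} = ({} :: nat set)" by auto
  ultimately show "\<not> wcong.dead Crev a (Suc a) {}" using dead_Crev[of a "Suc a" "{}"] ess[of a] by (simp add: fence_iff)
qed

lemma ess_Cmir: "ess_wcong n Cmir"
proof (intro ess_wcong.intro wcong_Cmir ess_wcong_axioms.intro)
  fix a assume a: "1 \<le> a" "a < n"
  have e: "{c. n - a < c \<and> c < Suc (n - a)} = {}" by auto
  have "Suc n - a = Suc (n - a)" using a by simp
  then show "\<not> wcong.dead Cmir a (Suc a) {}"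
    using dead_Cmir[of a "Suc a" "{}"] ess[of "Suc n - Suc a"] a by (simp add: fence_iff e)
qed

lemma vt_Crev: "vertex_transitive G \<Longrightarrow> vertex_transitive (wcong.G n Crev)"
  unfolding Crev_def
  by (rule transport_vertex_transitive[OF wcong_Crev[unfolded Crev_def]]) (auto simp: ok_compl compl_compl)

lemma vt_Cmir: "vertex_transitive G \<Longrightarrow> vertex_transitive (wcong.G n Cmir)"
  unfolding Cmir_def
  by (rule transport_vertex_transitive[OF wcong_Cmir[unfolded Cmir_def]])
    (simp_all add: ok_mir mir_mir mir_mono)

definition cut :: "nat \<Rightarrow> bool" where
  "cut c \<longleftrightarrow> 1 < c \<and> c < n \<and> dead (c-1) (c+1) {} \<and> dead (c-1) (c+1) {c}"

text \<open>The configuration on a, ..., a+3 that \<open>bad_step\<close> arrives at when the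
  triples give no contradiction. The last two conditions contract the middle edges that produce the
  additional square in \<open>bad_first_block\<close>.\<close>

definition bad :: "nat \<Rightarrow> bool" where
  "bad a \<longleftrightarrow> 1 \<le> a \<and> a + 3 \<le> n \<and> dead a (a+2) {} \<and> \<not> dead a (a+2) {a+1}
    \<and> dead (a+1) (a+3) {} \<and> \<not> dead (a+1) (a+3) {a+2}
    \<and> dead a (a+3) {a+1} \<and> dead a (a+3) {a+1,a+2}"

text \<open>\<open>triangle_long\<close> for the mirrored congruence on an interval of length three;
  a' is the mirror image of a+3.\<close>

lemma triangle_mirror:
  assumes vt: "vertex_transitive G" and a: "1 \<le> a" "a + 3 \<le> n"
    and d: "dead a (a+3) {a+1,a+2}" "\<not> dead a (a+2) {a+1}" "\<not> dead a (a+3) {a+1}"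
    and nc: "\<not> dead (a+1) (a+3) {} \<or> \<not> dead (a+1) (a+3) {a+2}"
  shows False
proof -
  interpret M: ess_wcong n Cmir by (rule ess_Cmir)
  define a' where "a' = Suc n - (a + 3)"
  have a': "1 \<le> a'" "a' + 3 \<le> n" "Suc n - (a' + 3) = a" "Suc n - a' = a + 3" "Suc n - (a' + 2) = a + 1"
    "Suc n - (a' + 1) = a + 2" unfolding a'_def using a by auto
  have na: "Suc n = a' + a + 3" unfolding a'_def using a by simp
  have "M.dead a' (a'+3) {} \<longleftrightarrow> dead a (a+3) {a+1,a+2}"
    by (rule dead_Cmir_eq) (use na a a'(1) in \<open>simp_all add: fence_iff set_eq_iff a', (presburger+)?\<close>)
  moreover have "M.dead (a'+1) (a'+3) {} \<longleftrightarrow> dead a (a+2) {a+1}"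
    by (rule dead_Cmir_eq) (use na a a'(1) in \<open>simp_all add: fence_iff set_eq_iff a', (presburger+)?\<close>)
  moreover have "M.dead a' (a'+3) {a'+1} \<longleftrightarrow> dead a (a+3) {a+1}"
    by (rule dead_Cmir_eq) (use na a a'(1) in \<open>simp_all add: fence_iff set_eq_iff a', (presburger+)?\<close>)
  moreover have "M.dead a' (a'+2) {} \<longleftrightarrow> dead (a+1) (a+3) {a+2}"
    by (rule dead_Cmir_eq) (use na a a'(1) in \<open>simp_all add: fence_iff set_eq_iff a', (presburger+)?\<close>)
  moreover have "M.dead a' (a'+2) {a'+1} \<longleftrightarrow> dead (a+1) (a+3) {}"
    by (rule dead_Cmir_eq) (use na a a'(1) in \<open>simp_all add: fence_iff set_eq_iff a', (presburger+)?\<close>)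
  ultimately show False
    using M.triangle_long[OF vt_Cmir[OF vt] a'(1), of "a'+3"] a'(2) d nc by auto
qed

text \<open>If (a+1, a+3, {a+2}) is dead, then (a+1, a+3, {}) is alive and
  \<open>triangle_long\<close> with b = a+3 is contradicted. If it is alive,
  \<open>triangle_short\<close> makes (a, a+3, {a+1,a+2}) dead, and \<open>triangle_mirror\<close>
  then makes (a+1, a+3, {}) dead.\<close>

lemma bad_step:
  assumes vt: "vertex_transitive G" and a: "1 \<le> a" "a + 3 \<le> n"
    and d: "dead a (a+2) {}" "\<not> dead a (a+2) {a+1}"
    and nc: "\<not> dead (a+1) (a+3) {} \<or> \<not> dead (a+1) (a+3) {a+2}"
  shows "bad a"
proof -
  have sub: "(c = a \<and> d = a + 1) \<or> (c = a \<and> d = a + 2) \<or> (c = a + 1 \<and> d = a + 2)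
      \<or> (c = a + 1 \<and> d = a + 3) \<or> (c = a + 2 \<and> d = a + 3)"
    if "a \<le> c" "c < d" "d \<le> a + 3" "(c,d) \<noteq> (a,a+3)" for c d
  proof -
    have "c = a \<or> c = a + 1 \<or> c = a + 2" using that(1-3) by presburger
    moreover have "d = c + 1 \<or> d = c + 2 \<or> d = c + 3" using that(1-3) by presburger
    ultimately show ?thesis using that by auto
  qed
  \<comment> \<open>With (a+1, a+3, {}) alive, the fence (a, a+3, {a+1}) would be a minimal dead one
    with a+1 on one side and a+2 on the other, against the degree count.\<close>
  have deg: "\<not> dead a (a+3) {a+1}" if b: "\<not> dead (a+1) (a+3) {}"
  proof
    assume dd: "dead a (a+3) {a+1}"
    have "{a+1} = ({}::nat set) \<or> {a+1} = {a<..<a+3}"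
    proof (rule minimal_dead_extreme[OF vt _ dd])
      show "(a, a+3, {a+1}) \<in> fences n" using a by (simp add: fence_iff)
      fix c d' assume h: "a \<le> c" "c < d'" "d' \<le> a + 3" "(c,d') \<noteq> (a,a+3)"
      have e: "{a+1} \<inter> {a<..<a+1} = {}" "{a+1} \<inter> {a<..<a+2} = {a+1}" "{a+1} \<inter> {a+1<..<a+2} = {}"
        "{a+1} \<inter> {a+1<..<a+3} = {}" "{a+1} \<inter> {a+2<..<a+3} = {}" by auto
      have u: "\<not> dead a (a+1) {}" "\<not> dead (a+1) (a+2) {}" "\<not> dead (a+2) (a+3) {}"
        using ess[of a] ess[of "a+1"] ess[of "a+2"] a by (simp_all add: numeral_3_eq_3)
      show "\<not> dead c d' ({a+1} \<inter> {c<..<d'})"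
        using sub[OF h] u b d(2) by (elim disjE conjE) (simp_all only: e not_False_eq_True)
    qed
    moreover have "a + 2 \<in> {a<..<a+3}" "a + 2 \<notin> {a+1}" by auto
    ultimately show False by auto
  qed
  have f: "(a, a+3, L) \<in> fences n" if "L \<subseteq> {a+1,a+2}" for L using that a by (auto simp: fence_iff)
  show ?thesis
  proof (cases "dead (a+1) (a+3) {a+2}")
    case False
    have dd: "dead a (a+3) {a+1,a+2}"
      using triangle_short[OF vt a d False] by blast
    have b: "dead (a+1) (a+3) {}"
      using triangle_mirror[OF vt a dd d(2) _ nc] deg by blast
    have "{a+1} \<inter> {a+1<..<a+3} = {}" by auto
    then have "dead a (a+3) {a+1}" using forcing[OF f, of "{a+1}" "a+1" "a+3"] b by simp
    then show ?thesis unfolding bad_def using a d b dd False by simp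
  next
    case True
    then have b: "\<not> dead (a+1) (a+3) {}" using nc by simp
    have "{} \<inter> {a<..<a+2} = {}" by auto
    then have "dead a (a+3) {}" using forcing[OF f, of "{}" a "a+2"] d(1) by simp
    then show ?thesis using triangle_long[OF vt a(1), of "a+3"] a(2) b deg[OF b] d(2) by simp
  qed
qed

end

subsection \<open>Gluing along a cut\<close>

context ess_wcong
begin

definition rgt :: "nat \<Rightarrow> (nat \<times> nat) set" where
  "rgt a = {(p,q). a \<le> p}"

text \<open>Whether a belongs to L selects which of the two dead fences around the cut forces
  (p,q,L). For a = 1 no fence crosses.\<close>

lemma crossing_dead:
  assumes a: "a = 1 \<or> cut a" and f: "(p,q,L) \<in> fences n" and pq: "p < a" "a < q"
  shows "dead p q L"
proof -
  have "1 \<le> p" using f by (simp add: fence_iff)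
  then have cut: "cut a" using a pq by auto
  have "L \<inter> {a-1<..<a+1} = L \<inter> {a}" using pq by auto
  moreover have "dead (a-1) (a+1) (L \<inter> {a})"
    using cut unfolding cut_def by (cases "a \<in> L") simp_all
  ultimately show ?thesis using forcing[OF f, of "a-1" "a+1"] pq by simp
qed

lemma ok_left: assumes K: "ok n K" shows "ok n (K \<inter> prs a)"
proof (rule okI)
  fix p q assume "(p,q) \<in> K \<inter> prs a" then show "1 \<le> p \<and> p < q \<and> q \<le> n" using okD[OF K, of p q] by simp
next
  fix p q r assume "(p,q) \<in> K \<inter> prs a" "(q,r) \<in> K \<inter> prs a"
  then show "(p,r) \<in> K \<inter> prs a" using ok_trans[OF K, of p q r] by (auto simp: prs_def)
next
  fix p r q assume "(p,q) \<in> K \<inter> prs a" "p < r" "r < q"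
  then show "(p,r) \<in> K \<inter> prs a \<or> (r,q) \<in> K \<inter> prs a" using ok_cotrans[OF K, of p q r] by (auto simp: prs_def)
qed

lemma ok_right: assumes K: "ok n K" shows "ok n (K \<inter> rgt a)"
proof (rule okI)
  fix p q assume "(p,q) \<in> K \<inter> rgt a" then show "1 \<le> p \<and> p < q \<and> q \<le> n" using okD[OF K, of p q] by simp
next
  fix p q r assume "(p,q) \<in> K \<inter> rgt a" "(q,r) \<in> K \<inter> rgt a"
  then show "(p,r) \<in> K \<inter> rgt a" using ok_trans[OF K, of p q r] by (auto simp: rgt_def)
next
  fix p r q assume "(p,q) \<in> K \<inter> rgt a" "p < r" "r < q"
  then show "(p,r) \<in> K \<inter> rgt a \<or> (r,q) \<in> K \<inter> rgt a" using ok_cotrans[OF K, of p q r] by (auto simp: rgt_def)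
qed

text \<open>Every pair of K missing from the join of its two restrictions crosses a, so the first
  alive edge on the way to K would belong to a crossing fence.\<close>

lemma glue_rep:
  assumes a: "a = 1 \<or> cut a" and K: "ok n K"
  shows "C (jn (K \<inter> prs a) (K \<inter> rgt a)) K"
proof (rule ccontr)
  let ?G = "jn (K \<inter> prs a) (K \<inter> rgt a)"
  assume nC: "\<not> C ?G K"
  have okG: "ok n ?G" by (intro ok_jn ok_left ok_right K)
  have sub: "?G \<subseteq> K" by (rule jn_least[OF K]) auto
  obtain M p q where M: "ok n M" "ok n (insert (p,q) M)" "(p,q) \<notin> M" "?G \<subseteq> M" "insert (p,q) M \<subseteq> K"
    "C ?G M" "\<not> C M (insert (p,q) M)"
    by (rule first_edge[OF okG K sub nC]) (rule that)
  have pqK: "(p,q) \<in> K" using M(5) by auto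
  have nG: "(p,q) \<notin> ?G" using M(3,4) by auto
  have "(p,q) \<notin> K \<inter> prs a" "(p,q) \<notin> K \<inter> rgt a"
    using nG subsetD[OF jn_upper(1)[of "K \<inter> prs a" "K \<inter> rgt a"]]
      subsetD[OF jn_upper(2)[of "K \<inter> rgt a" "K \<inter> prs a"]] by auto
  then have "p < a" "a < q" using pqK okD[OF K pqK] by (auto simp: prs_def rgt_def)
  then have "dead p q (lset p q M)" by (rule crossing_dead[OF a edge_fence[OF M(2)]])
  then show False using edge_iff[OF M(1,2,3)] M(7) by simp
qed

text \<open>Paths in the transitive closure ascend: one that ends at or below a uses pairs of l
  only, and one that starts at or above a uses pairs of r only.\<close>

lemma glue_restrict:
  assumes l: "ok n l" "l \<subseteq> prs a" and r: "ok n r" "r \<subseteq> rgt a"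
  shows "jn l r \<inter> prs a = l" "jn l r \<inter> rgt a = r"
proof -
  have *: "(y \<le> a \<longrightarrow> (x,y) \<in> l) \<and> (a \<le> x \<longrightarrow> (x,y) \<in> r)" if "(x,y) \<in> jn l r" for x y
    using that unfolding jn_def
  proof (induction rule: trancl.induct)
    case (r_into_trancl x y)
    then show ?case using okD[OF l(1), of x y] okD[OF r(1), of x y] l(2) r(2)
      by (auto simp: prs_def rgt_def)
  next
    case (trancl_into_trancl x y z)
    have xy: "x < y" using okD(2)[OF ok_jn[OF l(1) r(1)], of x y] trancl_into_trancl.hyps(1)
      unfolding jn_def by simp
    have yz: "y < z" using trancl_into_trancl.hyps(2) okD[OF l(1), of y z] okD[OF r(1), of y z] by auto
    show ?case
    proof (intro conjI impI)
      assume "z \<le> a"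
      then have "(y,z) \<in> l" "(x,y) \<in> l" using trancl_into_trancl yz r(2) by (auto simp: rgt_def)
      then show "(x,z) \<in> l" using ok_trans[OF l(1)] by simp
    next
      assume "a \<le> x"
      then have "(y,z) \<in> r" "(x,y) \<in> r" using trancl_into_trancl xy yz l(2) by (auto simp: prs_def)
      then show "(x,z) \<in> r" using ok_trans[OF r(1)] by simp
    qed
  qed
  have u: "l \<subseteq> jn l r" "r \<subseteq> jn l r" by (rule jn_upper)+
  show "jn l r \<inter> prs a = l" using * u(1) l(2) by (auto simp: prs_def)
  show "jn l r \<inter> rgt a = r" using * u(2) r(2) by (auto simp: rgt_def)
qed

text \<open>By \<open>glue_rep\<close> an intermediate class is determined by its two restrictions.
  They lie between l and l' and between r and r', where one side is fixed and the other changes by a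
  single pair.\<close>

lemma glue_adj:
  assumes a: "a = 1 \<or> cut a" "a \<le> n"
    and l: "ok n l" "l \<subseteq> prs a" "ok n l'" "l' \<subseteq> prs a" and r: "ok n r" "r \<subseteq> rgt a" "ok n r'" "r' \<subseteq> rgt a"
    and step: "(l' = insert e l \<and> r' = r \<and> \<not> C l l') \<or> (l' = l \<and> r' = insert e r \<and> \<not> C r r')"
  shows "adj (jn l r) (jn l' r')"
proof -
  let ?X = "jn l r" and ?Y = "jn l' r'"
  have okX: "ok n ?X" and okY: "ok n ?Y" by (intro ok_jn l r)+
  have X: "?X \<inter> prs a = l" "?X \<inter> rgt a = r" using glue_restrict[OF l(1,2) r(1,2)] .
  have Y: "?Y \<inter> prs a = l'" "?Y \<inter> rgt a = r'" using glue_restrict[OF l(3,4) r(3,4)] .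
  have ll: "l \<subseteq> l'" "r \<subseteq> r'" using step by auto
  have sub: "?X \<subseteq> ?Y"
    by (rule jn_least[OF okY]) (use ll jn_upper(1)[of l' r'] jn_upper(2)[of r' l'] in auto)
  have nC: "\<not> C ?X ?Y"
  proof
    assume c: "C ?X ?Y"
    have okp: "ok n (prs a)" by (rule okI) (use a in \<open>auto simp: prs_def\<close>)
    have okr: "ok n (prs n \<inter> rgt a)" by (rule okI) (use a in \<open>auto simp: prs_def rgt_def\<close>)
    have ml: "mt n Z (prs a) = Z \<inter> prs a" if "ok n Z" for Z
      by (intro equalityI mt_greatest ok_left that Int_greatest mt_lower okp) auto
    have mr: "mt n Z (prs n \<inter> rgt a) = Z \<inter> rgt a" if "ok n Z" for Z
    proof
      show "mt n Z (prs n \<inter> rgt a) \<subseteq> Z \<inter> rgt a" using mt_lower[OF that okr] by auto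
      show "Z \<inter> rgt a \<subseteq> mt n Z (prs n \<inter> rgt a)"
        by (rule mt_greatest[OF ok_right[OF that]]) (use ok_prs[OF that] in auto)
    qed
    have "C l l'" using Cmt[OF c okp] ml[OF okX] ml[OF okY] X Y by simp
    moreover have "C r r'" using Cmt[OF c okr] mr[OF okX] mr[OF okY] X Y by simp
    ultimately show False using step by auto
  qed
  have lt: "lt ?X ?Y" by (rule lt_sub[OF sub okX okY nC])
  have "False" if k: "lt ?X K" "lt K ?Y" for K
  proof -
    have le: "le ?X K" "le K ?Y" using k unfolding lt_def by auto
    obtain K' where K': "C K K'" "?X \<subseteq> K'" "K' \<subseteq> ?Y" "ok n K'"
      by (rule between[OF le sub]) (rule that)
    have b: "l \<subseteq> K' \<inter> prs a" "K' \<inter> prs a \<subseteq> l'" "r \<subseteq> K' \<inter> rgt a" "K' \<inter> rgt a \<subseteq> r'"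
      using K'(2,3) X Y by auto
    have "(K' \<inter> prs a = l \<and> K' \<inter> rgt a = r) \<or> (K' \<inter> prs a = l' \<and> K' \<inter> rgt a = r')"
      using step
    proof
      assume "l' = insert e l \<and> r' = r \<and> \<not> C l l'"
      then show ?thesis using b by (cases "e \<in> K' \<inter> prs a") auto
    next
      assume "l' = l \<and> r' = insert e r \<and> \<not> C r r'"
      then show ?thesis using b by (cases "e \<in> K' \<inter> rgt a") auto
    qed
    then have "C ?X K' \<or> C ?Y K'" using glue_rep[OF a(1) K'(4)] by auto
    moreover have "\<not> C ?X K'"
    proof
      assume "C ?X K'"
      then have "C ?X K" using Ctrans[OF _ Csym[OF K'(1)]] by simp
      then show False using k(1) unfolding lt_def by simp
    qed
    moreover have "\<not> C ?Y K'"
    proof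
      assume "C ?Y K'"
      then have "C K ?Y" using Ctrans[OF K'(1) Csym] by simp
      then show False using k(2) unfolding lt_def by simp
    qed
    ultimately show False by simp
  qed
  then show ?thesis using lt unfolding adj_def cov_def by auto
qed

lemma adj_unit:
  assumes "ok n I" "ok n (insert (i, Suc i) I)" "(i, Suc i) \<notin> I"
  shows "adj I (insert (i, Suc i) I)"
  by (rule adj_up[OF assms(1,2) alive_unit[OF assms]])

text \<open>An alive middle edge in the hexagon on i, i+1, i+2 supplies the class strictly between a
  neighbour and the top that \<open>not_sqr_upper\<close> requires.\<close>

lemma sqr_zero_near:
  assumes i: "1 \<le> i" "i + 2 \<le> n" and sq: "sqr {} (s i) (s (i+1))"
  shows "dead i (i+2) {} \<and> dead i (i+2) {i+1}"
proof (rule ccontr)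
  assume n: "\<not> ?thesis"
  have ok1: "ok n {(i,i+1)}" by (rule okI) (use i in auto)
  have ok2: "ok n {(i+1,i+2)}" by (rule okI) (use i in auto)
  have ok13: "ok n {(i,i+2),(i,i+1)}" by (rule okI) (use i in auto)
  have ok23: "ok n {(i,i+2),(i+1,i+2)}" by (rule okI) (use i in auto)
  have okH: "ok n {(i,i+1),(i,i+2),(i+1,i+2)}" by (rule okI) (use i in auto)
  have c1: "\<not> C {} {(i,i+1)}" using alive_unit[OF ok_empty, of i] ok1 by simp
  have c2: "\<not> C {} {(i+1,i+2)}" using alive_unit[OF ok_empty, of "i+1"] ok2 by simp
  have "\<exists>F M. (F = {(i,i+1)} \<or> F = {(i+1,i+2)}) \<and> lt F M \<and> lt M {(i,i+1),(i,i+2),(i+1,i+2)}"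
  proof (cases "dead i (i+2) {i+1}")
    case False
    have "\<not> C {(i,i+1)} (insert (i,i+2) {(i,i+1)})"
      by (rule edge_alive[OF ok1 ok13 False]) (auto simp: lset_def)
    moreover have "\<not> C {(i,i+2),(i,i+1)} (insert (i+1,Suc (i+1)) {(i,i+2),(i,i+1)})"
      by (rule alive_unit[OF ok13]) (use okH in \<open>auto simp: insert_commute\<close>)
    moreover have e: "insert (i+1,Suc (i+1)) {(i,i+2),(i,i+1)} = {(i,i+1),(i,i+2),(i+1,i+2)}" by auto
    ultimately have "lt {(i,i+1)} {(i,i+2),(i,i+1)}" "lt {(i,i+2),(i,i+1)} {(i,i+1),(i,i+2),(i+1,i+2)}"
      using lt_sub[OF _ ok1 ok13] lt_sub[OF _ ok13 okH] by auto
    then show ?thesis by blast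
  next
    case True
    then have d: "\<not> dead i (i+2) {}" using n by simp
    have "\<not> C {(i+1,i+2)} (insert (i,i+2) {(i+1,i+2)})"
      by (rule edge_alive[OF ok2 ok23 d]) (auto simp: lset_def)
    moreover have "\<not> C {(i,i+2),(i+1,i+2)} (insert (i,Suc i) {(i,i+2),(i+1,i+2)})"
      by (rule alive_unit[OF ok23]) (use okH in auto)
    ultimately have "lt {(i+1,i+2)} {(i,i+2),(i+1,i+2)}" "lt {(i,i+2),(i+1,i+2)} {(i,i+1),(i,i+2),(i+1,i+2)}"
      using lt_sub[OF _ ok2 ok23] lt_sub[OF _ ok23 okH] by auto
    then show ?thesis by blast
  qed
  then obtain F M where F: "F = {(i,i+1)} \<or> F = {(i+1,i+2)}" "lt F M" "lt M {(i,i+1),(i,i+2),(i+1,i+2)}"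
    by auto
  have "\<not> sqr {} {(i,i+1)} {(i+1,i+2)}"
    by (rule not_sqr_upper[of i "i+1" "i+2" "{}" F M])
      (use ok_empty ok1 ok2 okH c1 c2 F in simp_all)
  then show False using sq unfolding s_def by simp
qed

text \<open>With both middle edges contracted, each side of the hexagon over B keeps two steps; the
  conclusions describe the upper half of the resulting square.\<close>

lemma dead_hexagon_square:
  assumes d: "dead i (i+2) {}" "dead i (i+2) {i+1}"
    and B: "(i,i+1) \<notin> B" "(i+1,i+2) \<notin> B" "(i,i+2) \<notin> B"
    and ok: "ok n (insert (i,i+1) B)" "ok n (insert (i+1,i+2) B)"
      "ok n (insert (i,i+2) (insert (i,i+1) B))" "ok n (insert (i,i+2) (insert (i+1,i+2) B))"
      "ok n (insert (i,i+1) (insert (i,i+2) (insert (i+1,i+2) B)))"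
  shows "C (insert (i,i+1) B) (insert (i,i+2) (insert (i,i+1) B))"
    "C (insert (i+1,i+2) B) (insert (i,i+2) (insert (i+1,i+2) B))"
    "adj (insert (i,i+1) B) (insert (i,i+1) (insert (i,i+2) (insert (i+1,i+2) B)))"
    "adj (insert (i+1,i+2) B) (insert (i,i+1) (insert (i,i+2) (insert (i+1,i+2) B)))"
proof -
  show c1: "C (insert (i,i+1) B) (insert (i,i+2) (insert (i,i+1) B))"
    by (rule edge_dead[OF ok(1,3) d(2)]) (use B in \<open>auto simp: lset_def\<close>)
  show c2: "C (insert (i+1,i+2) B) (insert (i,i+2) (insert (i+1,i+2) B))"
    by (rule edge_dead[OF ok(2,4) d(1)]) (use B in \<open>auto simp: lset_def less_Suc_eq\<close>)
  have e: "insert (i,i+1) (insert (i,i+2) (insert (i+1,i+2) B))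
      = insert (i+1, Suc (i+1)) (insert (i,i+2) (insert (i,i+1) B))" by auto
  have "adj (insert (i,i+2) (insert (i,i+1) B)) (insert (i,i+1) (insert (i,i+2) (insert (i+1,i+2) B)))"
    unfolding e by (rule adj_unit[OF ok(3) ok(5)[unfolded e]]) (use B in auto)
  then show "adj (insert (i,i+1) B) (insert (i,i+1) (insert (i,i+2) (insert (i+1,i+2) B)))"
    by (rule adj_C1[OF Csym[OF c1]])
  have "adj (insert (i,i+2) (insert (i+1,i+2) B)) (insert (i,Suc i) (insert (i,i+2) (insert (i+1,i+2) B)))"
    by (rule adj_unit[OF ok(4)]) (use B ok(5) in auto)
  then show "adj (insert (i+1,i+2) B) (insert (i,i+1) (insert (i,i+2) (insert (i+1,i+2) B)))"
    using adj_C1[OF Csym[OF c2]] by simp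
qed

text \<open>The class of the transposition \<open>a \<leftrightarrow> a+1\<close> lies on strictly more 4-cycles than the bottom.\<close>
lemma bad_first_block:
  assumes vt: "vertex_transitive G" and bad: "bad a" and a1: "a = 1 \<or> cut a"
  shows False
proof -
  have an: "1 \<le> a" "a + 3 \<le> n" "a \<le> n" and
    d: "dead a (a+2) {}" "\<not> dead a (a+2) {a+1}" "dead (a+1) (a+3) {}" "\<not> dead (a+1) (a+3) {a+2}"
      "dead a (a+3) {a+1}" "dead a (a+3) {a+1,a+2}"
    using bad unfolding bad_def by auto
  define X where "X = {(a,a+1)}"
  have Xs: "X = s a" unfolding X_def s_def by simp
  have okX: "ok n X" unfolding Xs by (rule ok_s) (use an in auto)
  have Xr: "X \<subseteq> rgt a" unfolding X_def rgt_def by simp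
  \<comment> \<open>The neighbours of X are indexed like those of the bottom. Index a gives the
    bottom itself and index a+1 the word (a+1) (a+2) a; every other index adds the simple
    transposition j to X, for j < a by gluing at the cut.\<close>
  define y where "y j = (if j < a then jn (s j) X else if j = a then {} else
    if j = a+1 then {(a,a+1),(a,a+2)} else {(a,a+1),(j,j+1)})" for j
  have yl: "y j = jn (s j) X" if "j < a" for j using that unfolding y_def by simp
  have ya: "y a = {}" unfolding y_def by simp
  have ya1: "y (a+1) = insert (a,a+2) X" unfolding y_def X_def by auto
  have yr: "y j = insert (j,Suc j) X" if "a + 2 \<le> j" for j using that unfolding y_def X_def by auto
  have okya1: "ok n (y (a+1))" unfolding ya1 X_def by (rule okI) (use an in auto)
  have okyr: "ok n (y j)" if "a + 2 \<le> j" "j < n" for j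
    unfolding yr[OF that(1)] X_def by (rule okI; (use an that in auto)?; presburger?)
  have sl: "ok n (s j) \<and> s j \<subseteq> prs a" if "1 \<le> j" "j < a" for j
    using ok_s[OF that(1)] that an unfolding s_def prs_def by auto
  have okyl: "ok n (y j)" if "1 \<le> j" "j < a" for j
    unfolding yl[OF that(2)] by (intro ok_jn okX) (use sl[OF that] in simp)
  have sub_yr: "X \<subseteq> y j" if "a < j" for j using that unfolding y_def X_def by auto
  have okyR: "ok n (y j)" if "a < j" "j < n" for j
    using that okya1 okyr by (cases "j = a + 1") auto
  have nCr: "\<not> C X (y j)" if j: "a < j" "j < n" for j
  proof (cases "j = a + 1")
    case True
    show ?thesis unfolding True ya1
      by (rule edge_alive[OF okX okya1[unfolded ya1] d(2)]) (auto simp: X_def lset_def)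
  next
    case False
    then have j2: "a + 2 \<le> j" using j by simp
    show ?thesis unfolding yr[OF j2]
      by (rule alive_unit[OF okX okyr[OF j2 j(2), unfolded yr[OF j2]]]) (use j in \<open>auto simp: X_def\<close>)
  qed
  have adjr: "adj X (y j)" if j: "a < j" "j < n" for j
  proof (cases "j = a + 1")
    case True
    show ?thesis unfolding True ya1 by (rule adj_up[OF okX okya1[unfolded ya1] nCr[OF j, unfolded True ya1]])
  next
    case False
    then have j2: "a + 2 \<le> j" using j by simp
    show ?thesis unfolding yr[OF j2]
      by (rule adj_up[OF okX okyr[OF j2 j(2), unfolded yr[OF j2]] nCr[OF j, unfolded yr[OF j2]]])
  qed
  have adj0: "adj {} X" unfolding Xs by (rule adj_zero) (use an in auto)
  have nC0: "\<not> C {} (s j)" if "1 \<le> j" "j < n" for j using zero_class[of "s j"] unfolding s_def by auto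
  have jn0: "jn {} r = r" if "ok n r" for r by (rule jn_absorb[OF that]) simp
  have jn0': "jn r {} = r" if "ok n r" for r using jn0[OF that] jn_commute by metis
  have left_step: "adj r (jn (s j) r)" if "1 \<le> j" "j < a" "ok n r" "r \<subseteq> rgt a" for j r
  proof -
    have "adj (jn {} r) (jn (s j) r)"
      by (rule glue_adj[OF a1 an(3), of _ _ _ _ "(j,Suc j)"])
        (use sl[OF that(1,2)] that(3,4) ok_empty nC0[of j] that an in \<open>simp_all add: s_def\<close>)
    then show ?thesis unfolding jn0[OF that(3)] .
  qed
  have right_step: "adj (jn (s j) r) (jn (s j) (insert e r))"
    if "1 \<le> j" "j < a" "ok n r" "r \<subseteq> rgt a" "ok n (insert e r)" "insert e r \<subseteq> rgt a" "\<not> C r (insert e r)" for j r e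
    by (rule glue_adj[OF a1 an(3), of _ _ _ _ e]) (use sl[OF that(1,2)] that(3-7) in simp_all)
  have ay: "adj X (y j)" if j: "1 \<le> j" "j < n" for j
  proof -
    consider "j < a" | "j = a" | "a < j" by linarith
    then show ?thesis
    proof cases
      case 1 show ?thesis unfolding yl[OF 1] by (rule left_step[OF j(1) 1 okX Xr])
    next
      case 2 show ?thesis unfolding 2 ya by (rule adj_sym[OF adj0])
    next
      case 3 then show ?thesis by (rule adjr[OF _ j(2)])
    qed
  qed
  have oky: "ok n (y j)" if "1 \<le> j" "j < n" for j using adj_ok[OF ay[OF that]] by simp
  have sj: "s j \<subseteq> y j" if "j < a" for j unfolding yl[OF that] by (rule jn_upper)
  have notin: "(j, Suc j) \<notin> y i" if ij: "1 \<le> i" "i < n" "1 \<le> j" "j < a" "i \<noteq> j" for i j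
  proof (cases "i < a")
    case True
    have "jn (s i) X \<inter> prs a = s i" by (rule glue_restrict(1)) (use sl[OF ij(1) True] okX Xr in auto)
    moreover have "(j, Suc j) \<in> prs a" using ij by (simp add: prs_def)
    moreover have "(j, Suc j) \<notin> s i" using ij unfolding s_def by simp
    ultimately show ?thesis unfolding yl[OF True] by auto
  next
    case False
    then show ?thesis using ij unfolding y_def by auto
  qed
  have nCl: "\<not> C (y i) (y j)" if ij: "1 \<le> i" "i < n" "1 \<le> j" "j < a" "i \<noteq> j" for i j
  proof
    assume c: "C (y i) (y j)"
    have jn': "j < n" using ij an by simp
    have os: "ok n (s j)" using sl[OF ij(3,4)] by simp
    have "C (mt n (y i) (s j)) (mt n (y j) (s j))" by (rule Cmt[OF c os])
    moreover have "mt n (y j) (s j) = s j" by (rule mt_absorb2[OF oky[OF ij(3) jn'] os sj[OF ij(4)]])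
    moreover have "mt n (y i) (s j) = {}"
      using mt_lower[OF oky[OF ij(1,2)] os] notin[OF ij] unfolding s_def by auto
    ultimately have "C {} (s j)" by simp
    then show False using nC0[OF ij(3) jn'] by simp
  qed
  have nCy: "\<not> C (y i) (y j)" if ij: "1 \<le> i" "i < j" "j < n" for i j
  proof -
    consider "i < a" | "i = a" | "a < i" by linarith
    then show ?thesis
    proof cases
      case 1
      then show ?thesis using nCl[of j i] ij Csym[of "y i" "y j"] by auto
    next
      case 2
      have "y j \<noteq> {}" using ij 2 unfolding y_def by auto
      then show ?thesis unfolding 2 ya using zero_class[of "y j"] by auto
    next
      case 3
      then have j2: "a + 2 \<le> j" using ij by simp
      show ?thesis unfolding yr[OF j2]
      proof (rule insert_not_C)
        show "ok n (insert (j, Suc j) X)" "\<not> C X (insert (j, Suc j) X)"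
          using okyr[OF j2 ij(3)] nCr[of j] 3 ij unfolding yr[OF j2] by auto
        show "(j, Suc j) \<notin> y i" using 3 ij unfolding y_def by auto
      qed (rule okX)
    qed
  qed
  have nCW: "\<not> C W X" if "y j \<subseteq> W" "a < j" "j < n" "ok n W" for W j
  proof
    assume "C W X"
    from convex(1)[OF Csym[OF this] sub_yr[OF that(2)] that(1) okyR[OF that(2,3)]]
    show False using nCr[OF that(2,3)] by simp
  qed
  \<comment> \<open>Every square at the bottom has a counterpart at X, by the position of i and j
    relative to a. For consecutive indices the bottom has a square only when both middle edges of
    the hexagon are contracted (\<open>near\<close>); the same contraction gives the square at
    X.\<close>
  have sq: "sqr X (y i) (y j)" if ij: "1 \<le> i" "i < j" "j < n" and s0: "sqr {} (s i) (s j)" for i j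
  proof -
    have near: "dead i (i+2) {} \<and> dead i (i+2) {i+1}" if "j = i + 1"
      using sqr_zero_near[OF ij(1)] s0 ij that by simp
    consider "j < a" | "i < a" "j = a" | "i < a" "a < j" | "i = a" | "a < i"
      by atomize_elim (use ij in presburger)
    then show ?thesis
    proof cases
      case 1
      have ia: "i < a" using 1 ij by simp
      show ?thesis
      proof (cases "j = i + 1")
        case True
        note dd = near[OF True]
        have okH: "ok n {(i,i+1),(i,i+2),(i+1,i+2)}" by (rule okI) (use ij 1 True an in auto)
        have ok1: "ok n {(i,i+2),(i,i+1)}" by (rule okI) (use ij 1 True an in auto)
        have ok2: "ok n {(i,i+2),(i+1,i+2)}" by (rule okI) (use ij 1 True an in auto)
        have o: "ok n {(i,i+1)}" "ok n {(i+1,i+2)}"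
          using sl[of i] sl[of j] ij 1 True unfolding s_def by auto
        have c1: "C {(i,i+1)} {(i,i+2),(i,i+1)}"
          by (rule edge_dead[OF o(1) ok1, of "{i+1}"]) (use dd in \<open>auto simp: lset_def\<close>)
        have c2: "C {(i+1,i+2)} {(i,i+2),(i+1,i+2)}"
          by (rule edge_dead[OF o(2) ok2, of "{}"]) (use dd in \<open>auto simp: lset_def\<close>)
        let ?H = "{(i,i+1),(i,i+2),(i+1,i+2)}"
        have e1: "?H = insert (i+1,Suc (i+1)) {(i,i+2),(i,i+1)}" by auto
        have n1: "\<not> C {(i,i+2),(i,i+1)} ?H" unfolding e1
          by (rule alive_unit[OF ok1]) (use okH[unfolded e1] in auto)
        have e2: "?H = insert (i,Suc i) {(i,i+2),(i+1,i+2)}" by auto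
        have n2: "\<not> C {(i,i+2),(i+1,i+2)} ?H" unfolding e2
          by (rule alive_unit[OF ok2]) (use okH[unfolded e2] in auto)
        have pa: "{(i,i+2),(i,i+1)} \<subseteq> prs a" "{(i,i+2),(i+1,i+2)} \<subseteq> prs a" "?H \<subseteq> prs a"
          using ij 1 True by (auto simp: prs_def)
        have "adj (jn {(i,i+2),(i,i+1)} X) (jn ?H X)"
          by (rule glue_adj[OF a1 an(3) ok1 pa(1) okH pa(3) okX Xr okX Xr, of "(i+1,Suc (i+1))"])
            (use n1 e1 in simp)
        moreover have "C (jn {(i,i+1)} X) (jn {(i,i+2),(i,i+1)} X)" by (rule Cjn[OF c1 okX])
        ultimately have A1: "adj (jn (s i) X) (jn ?H X)" unfolding s_def using adj_C1[OF Csym] by simp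
        have "adj (jn {(i,i+2),(i+1,i+2)} X) (jn ?H X)"
          by (rule glue_adj[OF a1 an(3) ok2 pa(2) okH pa(3) okX Xr okX Xr, of "(i,Suc i)"])
            (use n2 e2 in simp)
        moreover have "C (jn {(i+1,i+2)} X) (jn {(i,i+2),(i+1,i+2)} X)" by (rule Cjn[OF c2 okX])
        ultimately have A2: "adj (jn (s j) X) (jn ?H X)" unfolding s_def True using adj_C1[OF Csym] by simp
        have "\<not> C (jn ?H X) X"
        proof
          assume c: "C (jn ?H X) X"
          have "s i \<subseteq> jn ?H X" using jn_upper(1)[of ?H X] unfolding s_def by auto
          then have "y i \<subseteq> jn ?H X" unfolding yl[OF ia]
            by (intro jn_least[OF ok_jn[OF okH okX]] jn_upper)
          moreover have "X \<subseteq> y i" unfolding yl[OF ia] by (rule jn_upper)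
          ultimately have "C X (y i)" using convex(1)[OF Csym[OF c]] oky[of i] ij by simp
          then show False using adj_nC[OF ay[of i]] ij by simp
        qed
        then show ?thesis unfolding sqr_def yl[OF ia] yl[OF 1] using adj_sym[OF A1] adj_sym[OF A2] by auto
      next
        case False
        let ?W = "{(i,Suc i),(j,Suc j)}"
        have okW: "ok n ?W" by (rule okI) (use ij 1 False an in auto)
        have pa: "?W \<subseteq> prs a" using ij 1 by (auto simp: prs_def)
        have o: "ok n (s i)" "s i \<subseteq> prs a" "ok n (s j)" "s j \<subseteq> prs a" using sl[of i] sl[of j] ij 1 by auto
        have e1: "?W = insert (j,Suc j) (s i)" "?W = insert (i,Suc i) (s j)" unfolding s_def by auto
        have n1: "\<not> C (s i) ?W" unfolding e1(1)
          by (rule alive_unit[OF o(1)]) (use okW[unfolded e1(1)] ij in \<open>auto simp: s_def\<close>)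
        have n2: "\<not> C (s j) ?W" unfolding e1(2)
          by (rule alive_unit[OF o(3)]) (use okW[unfolded e1(2)] ij in \<open>auto simp: s_def\<close>)
        have A1: "adj (jn (s i) X) (jn ?W X)"
          by (rule glue_adj[OF a1 an(3) o(1,2) okW pa okX Xr okX Xr, of "(j,Suc j)"]) (use n1 e1(1) in simp)
        have A2: "adj (jn (s j) X) (jn ?W X)"
          by (rule glue_adj[OF a1 an(3) o(3,4) okW pa okX Xr okX Xr, of "(i,Suc i)"]) (use n2 e1(2) in simp)
        have "\<not> C (jn ?W X) X"
        proof
          assume c: "C (jn ?W X) X"
          have "s i \<subseteq> jn ?W X" using jn_upper(1)[of ?W X] unfolding s_def by auto
          then have "y i \<subseteq> jn ?W X" unfolding yl[OF ia]
            by (intro jn_least[OF ok_jn[OF okW okX]] jn_upper)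
          moreover have "X \<subseteq> y i" unfolding yl[OF ia] by (rule jn_upper)
          ultimately have "C X (y i)" using convex(1)[OF Csym[OF c]] oky[of i] ij by simp
          then show False using adj_nC[OF ay[of i]] ij by simp
        qed
        then show ?thesis unfolding sqr_def yl[OF ia] yl[OF 1] using adj_sym[OF A1] adj_sym[OF A2] by auto
      qed
    next
      case 2
      have "adj (jn (s i) {}) (jn (s i) (insert (a,a+1) {}))"
        by (rule right_step[OF ij(1) 2(1) ok_empty]) (use okX Xr nC0[of a] an in \<open>auto simp: X_def s_def\<close>)
      then have "adj (s i) (y i)" unfolding yl[OF 2(1)] X_def using jn0'[of "s i"] sl[OF ij(1) 2(1)] by simp
      moreover have "adj (s i) (y j)" unfolding 2(2) ya by (rule adj_sym[OF adj_zero]) (use ij in auto)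
      moreover have "\<not> C (s i) X" unfolding Xs using s_eq[of i a] ij 2 an by auto
      ultimately show ?thesis unfolding sqr_def by auto
    next
      case 3
      have Yr: "y j \<subseteq> rgt a" using 3 unfolding y_def rgt_def by auto
      obtain e where e: "y j = insert e X"
      proof (cases "j = a + 1")
        case True then show ?thesis using that ya1 by simp
      next
        case False then show ?thesis using that yr[of j] 3 by simp
      qed
      have "adj (jn (s i) X) (jn (s i) (insert e X))"
        by (rule right_step[OF ij(1) 3(1) okX Xr]) (use okyR[OF 3(2) ij(3)] Yr nCr[OF 3(2) ij(3)] e in simp_all)
      then have A1: "adj (y i) (jn (s i) (y j))" unfolding yl[OF 3(1)] e .
      have A2: "adj (y j) (jn (s i) (y j))" by (rule left_step[OF ij(1) 3(1) okyR[OF 3(2) ij(3)] Yr])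
      have "\<not> C (jn (s i) (y j)) X"
        by (rule nCW[OF jn_upper(2) 3(2) ij(3)]) (use adj_ok[OF A2] in simp)
      then show ?thesis unfolding sqr_def using adj_sym[OF A1] adj_sym[OF A2] by auto
    next
      case 4
      have j2: "a + 2 \<le> j" using near d(2) ij 4 by (cases "j = i + 1") auto
      have o: "ok n (s j)" by (rule ok_s) (use ij in auto)
      have e: "y j = insert (a, Suc a) (s j)" unfolding yr[OF j2] X_def s_def by auto
      have "adj (s j) (y j)" unfolding e
        by (rule adj_unit[OF o]) (use okyr[OF j2 ij(3)] e j2 in \<open>auto simp: s_def\<close>)
      moreover have "adj (s j) (y i)" unfolding 4 ya by (rule adj_sym[OF adj_zero]) (use ij in auto)
      moreover have "\<not> C (s j) X" unfolding Xs using s_eq[of j a] ij 4 an by auto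
      ultimately show ?thesis unfolding sqr_def by auto
    next
      case 5
      have ja: "a + 2 \<le> j" using 5 ij by simp
      show ?thesis
      proof (cases "i = a + 1")
        case True
        have j3: "a + 3 \<le> j"
        proof (rule ccontr)
          assume "\<not> a + 3 \<le> j"
          then have "j = i + 1" using ja True by simp
          from near[OF this] show False using d(4) True by (simp add: numeral_3_eq_3 numeral_2_eq_2)
        qed
        let ?W = "insert (j, Suc j) (y (a+1))"
        have okW: "ok n ?W" unfolding ya1 X_def by (rule okI; (use an ij j3 in auto)?; presburger?)
        have A1: "adj (y i) ?W" unfolding True
          by (rule adj_unit[OF okya1 okW]) (use j3 in \<open>auto simp: ya1[simplified] X_def\<close>)
        have e: "?W = insert (a,a+2) (y j)" unfolding ya1 yr[OF ja] by auto
        have "\<not> C (y j) (insert (a,a+2) (y j))"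
          by (rule edge_alive[OF okyr[OF ja ij(3)] okW[unfolded e] d(2)])
            (use j3 in \<open>auto simp: lset_def yr[OF ja] X_def\<close>)
        then have A2: "adj (y j) ?W" unfolding e
          by (rule adj_up[OF okyr[OF ja ij(3)] okW[unfolded e]])
        have "\<not> C ?W X" by (rule nCW[of "a+1"]) (use okW an in auto)
        then show ?thesis unfolding sqr_def using adj_sym[OF A1] adj_sym[OF A2] by auto
      next
        case False
        then have i2: "a + 2 \<le> i" using 5 by simp
        show ?thesis
        proof (cases "j = i + 1")
          case True
          note dd = near[OF True]
          have o: "ok n (insert (i,i+1) X)" "ok n (insert (i+1,i+2) X)"
            using okyr[OF i2] okyr[OF ja ij(3)] ij True unfolding yr[OF i2] yr[OF ja] by auto
          have o1: "ok n (insert (i,i+2) (insert (i,i+1) X))"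
            unfolding X_def by (rule okI; (use an ij True i2 in auto)?; presburger?)
          have o2: "ok n (insert (i,i+2) (insert (i+1,i+2) X))"
            unfolding X_def by (rule okI; (use an ij True i2 in auto)?; presburger?)
          have o3: "ok n (insert (i,i+1) (insert (i,i+2) (insert (i+1,i+2) X)))" (is "ok n ?W")
            by (rule ok_insertI[OF o2]; (use an ij True i2 in \<open>auto simp: before_def X_def\<close>)?; presburger?)
          have B: "(i,i+1) \<notin> X" "(i+1,i+2) \<notin> X" "(i,i+2) \<notin> X" using i2 unfolding X_def by auto
          note sq = dead_hexagon_square(3,4)[OF conjunct1[OF dd] conjunct2[OF dd] B o o1 o2 o3]
          have yi: "y i = insert (i,i+1) X" "y j = insert (i+1,i+2) X"
            using yr[OF i2] yr[OF ja] True by simp_all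
          have "y i \<subseteq> ?W" unfolding yi by auto
          then have "\<not> C ?W X" by (rule nCW) (use o3 ij i2 in auto)
          then show ?thesis unfolding sqr_def yi using adj_sym[OF sq(1)] adj_sym[OF sq(2)] by blast
        next
          case False
          let ?W = "insert (j, Suc j) (y i)"
          have okW: "ok n ?W" unfolding yr[OF i2] X_def by (rule okI; (use an ij i2 False in auto)?; presburger?)
          have oi: "ok n (y i)" by (rule okyr[OF i2]) (use ij in simp)
          have A1: "adj (y i) ?W"
            by (rule adj_unit[OF oi okW]) (use ij ja in \<open>auto simp: yr[OF i2] X_def\<close>)
          have e: "?W = insert (i, Suc i) (y j)" unfolding yr[OF i2] yr[OF ja] by auto
          have A2: "adj (y j) ?W" unfolding e
            by (rule adj_unit[OF okyr[OF ja ij(3)] okW[unfolded e]]) (use ij i2 in \<open>auto simp: yr[OF ja] X_def\<close>)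
          have "\<not> C ?W X" by (rule nCW[of i]) (use okW ij 5 in auto)
          then show ?thesis unfolding sqr_def using adj_sym[OF A1] adj_sym[OF A2] by auto
        qed
      qed
    qed
  qed
  \<comment> \<open>The hexagon above X on a, a+2, a+3 has its middle edges in the fences (a, a+3,
    {a+1,a+2}) and (a, a+3, {a+1}), both dead by \<open>bad\<close>. So it collapses to a square,
    while the bottom has none for the indices a+1 and a+2.\<close>
  have extra: "sqr X (y (a+1)) (y (a+2))"
  proof -
    have y2: "y (a+2) = insert (a+2,a+3) X" using yr[of "a+2"] by (simp add: numeral_3_eq_3 numeral_2_eq_2)
    have oky2: "ok n (y (a+2))" by (rule okyr) (use an in auto)
    let ?A = "insert (a,a+3) (y (a+1))" and ?B = "insert (a,a+3) (y (a+2))"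
    have okA: "ok n ?A" unfolding ya1 X_def by (rule okI; (use an in auto)?; presburger?)
    have okB: "ok n ?B" unfolding y2 X_def by (rule okI; (use an in auto)?; presburger?)
    let ?W = "insert (a+2,Suc (a+2)) ?A"
    have okW: "ok n ?W"
      by (rule ok_insertI[OF okA]; (use an in \<open>auto simp: before_def ya1[simplified] X_def\<close>)?; presburger?)
    have e: "?W = insert (a,a+2) ?B" unfolding ya1 y2 by auto
    have cA: "C (y (a+1)) ?A"
      by (rule edge_dead[OF okya1 okA d(6)]) (auto simp: ya1[simplified] X_def lset_def)
    have cB: "C (y (a+2)) ?B"
      by (rule edge_dead[OF oky2 okB d(5)]) (auto simp: y2[simplified] X_def lset_def)
    have "adj ?A ?W" by (rule adj_unit[OF okA okW]) (auto simp: ya1[simplified] X_def)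
    then have A1: "adj (y (a+1)) ?W" by (rule adj_C1[OF Csym[OF cA]])
    have "\<not> C ?B (insert (a,a+2) ?B)"
      by (rule edge_alive[OF okB okW[unfolded e] d(2)]) (auto simp: lset_def y2[simplified] X_def)
    then have "adj ?B ?W" unfolding e by (rule adj_up[OF okB okW[unfolded e]])
    then have A2: "adj (y (a+2)) ?W" by (rule adj_C1[OF Csym[OF cB]])
    have "\<not> C ?W X" by (rule nCW[of "a+1"]) (use okW an in auto)
    then show ?thesis unfolding sqr_def using adj_sym[OF A1] adj_sym[OF A2] by auto
  qed
  have nex: "\<not> sqr {} (s (a+1)) (s (a+2))"
    using sqr_zero_near[of "a+1"] an d(4) by (auto simp: numeral_3_eq_3 numeral_2_eq_2)
  obtain g where g: "\<And>J. adj X J \<Longrightarrow> 1 \<le> g J \<and> g J < n"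
    "\<And>J K. adj X J \<Longrightarrow> adj X K \<Longrightarrow> g J = g K \<longleftrightarrow> C J K"
    "\<And>J K. adj X J \<Longrightarrow> adj X K \<Longrightarrow> sqr X J K \<longleftrightarrow> sqr {} (s (g J)) (s (g K))"
    by (rule vt_match[OF vt okX]) (rule that)
  define h where "h i = g (y i)" for i
  have hr: "1 \<le> h i \<and> h i < n" if "1 \<le> i" "i < n" for i unfolding h_def by (rule g(1)[OF ay[OF that]])
  have hinj: "h i \<noteq> h j" if "1 \<le> i" "i < j" "j < n" for i j
    using g(2)[OF ay[of i] ay[of j]] nCy[OF that] that unfolding h_def by simp
  have hinj2: "i = j" if "1 \<le> i" "i < n" "1 \<le> j" "j < n" "h i = h j" for i j
    using hinj[of i j] hinj[of j i] that by (metis linorder_neqE_nat)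
  define S where "S = {(i,j). 1 \<le> i \<and> i < n \<and> 1 \<le> j \<and> j < n \<and> i \<noteq> j \<and> sqr {} (s i) (s j)}"
  have finS: "finite S" by (rule finite_subset[of _ "{..n} \<times> {..n}"]) (auto simp: S_def)
  have hS: "(h i, h j) \<in> S" if ij: "1 \<le> i" "i < n" "1 \<le> j" "j < n" "i \<noteq> j" "sqr X (y i) (y j)" for i j
    using g(3)[OF ay[OF ij(1,2)] ay[OF ij(3,4)]] hr[OF ij(1,2)] hr[OF ij(3,4)] hinj2[OF ij(1-4)] ij
    unfolding S_def h_def by auto
  \<comment> \<open>Relabelling by h sends the index pairs of squares at the bottom, together with
    the additional pair, injectively into the index pairs of squares at the bottom.\<close>
  let ?S' = "insert (a+1,a+2) S"
  have "inj_on (\<lambda>(i,j). (h i, h j)) ?S'"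
  proof (rule inj_onI)
    fix u v assume uv: "u \<in> ?S'" "v \<in> ?S'" "(\<lambda>(i,j). (h i, h j)) u = (\<lambda>(i,j). (h i, h j)) v"
    have r: "1 \<le> fst w \<and> fst w < n \<and> 1 \<le> snd w \<and> snd w < n" if "w \<in> ?S'" for w
      using that an unfolding S_def by auto
    have "h (fst u) = h (fst v)" "h (snd u) = h (snd v)" using uv(3) by (auto simp: case_prod_beta)
    then show "u = v" using hinj2[of "fst u" "fst v"] hinj2[of "snd u" "snd v"] r[OF uv(1)] r[OF uv(2)]
      by (simp add: prod_eq_iff)
  qed
  moreover have "(\<lambda>(i,j). (h i, h j)) ` ?S' \<subseteq> S"
  proof
    fix w assume "w \<in> (\<lambda>(i,j). (h i, h j)) ` ?S'"
    then obtain i j where w: "w = (h i, h j)" "(i,j) \<in> ?S'" by auto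
    show "w \<in> S"
    proof (cases "(i,j) = (a+1,a+2)")
      case True
      then show ?thesis unfolding w using hS[of "a+1" "a+2"] extra an by simp
    next
      case False
      then have ij: "1 \<le> i" "i < n" "1 \<le> j" "j < n" "i \<noteq> j" "sqr {} (s i) (s j)"
        using w(2) unfolding S_def by auto
      have "sqr X (y i) (y j)"
      proof (cases "i < j")
        case True then show ?thesis using sq[of i j] ij by simp
      next
        case False
        then have "j < i" using ij(5) by simp
        then show ?thesis using sq[of j i] ij sqr_sym by simp
      qed
      then show ?thesis unfolding w by (intro hS ij)
    qed
  qed
  ultimately have "card ?S' \<le> card S" by (rule card_inj_on_le[OF _ _ finS])
  moreover have "(a+1,a+2) \<notin> S" using nex unfolding S_def by simp
  ultimately show False using finS by simp
qed

end

subsection \<open>Dead fences without cuts\<close>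

context ess_wcong
begin

text \<open>Mirror composed with reversal: values are reversed and positions keep their order, so L
  is reflected without being complemented.\<close>

definition Cnu :: "(nat \<times> nat) set \<Rightarrow> (nat \<times> nat) set \<Rightarrow> bool" where
  "Cnu = ess_wcong.Crev n Cmir"

lemma ess_Cnu: "ess_wcong n Cnu"
  unfolding Cnu_def by (rule ess_wcong.ess_Crev[OF ess_Cmir])

lemma vt_Cnu: "vertex_transitive G \<Longrightarrow> vertex_transitive (wcong.G n Cnu)"
  unfolding Cnu_def by (rule ess_wcong.vt_Crev[OF ess_Cmir vt_Cmir])

lemma dead_Cnu_eq:
  assumes f: "(a,b,L) \<in> fences n" and e: "Suc n - b = c" "Suc n - a = d"
    "M = {x. c < x \<and> x < d \<and> Suc n - x \<in> L}"
  shows "wcong.dead Cnu a b L \<longleftrightarrow> dead c d M"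
proof -
  have "wcong.dead Cnu a b L \<longleftrightarrow> wcong.dead Cmir a b ({a<..<b} - L)"
    unfolding Cnu_def by (rule ess_wcong.dead_Crev[OF ess_Cmir f])
  also have "\<dots> \<longleftrightarrow> dead c d M"
  proof (rule dead_Cmir_eq[OF fence_compl[OF f] e(1,2)])
    have "1 \<le> a" "b \<le> n" using f by (auto simp: fence_iff)
    then show "M = {x. c < x \<and> x < d \<and> Suc n - x \<notin> {a<..<b} - L}" unfolding e(3) using e(1,2) by auto
  qed
  finally show ?thesis .
qed

text \<open>The reflected form of \<open>bad_step\<close>. The fence (a, a+3, {a+1,a+2}) is its own
  reflection; the remaining (a, a+3, {a+1}) is obtained by forcing from (a+1, a+3, {}).\<close>

lemma bad_step_nu:
  assumes vt: "vertex_transitive G" and a: "1 \<le> a" "a + 3 \<le> n"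
    and d: "dead (a+1) (a+3) {}" "\<not> dead (a+1) (a+3) {a+2}"
    and nc: "\<not> dead a (a+2) {} \<or> \<not> dead a (a+2) {a+1}"
  shows "bad a"
proof -
  interpret N: ess_wcong n Cnu by (rule ess_Cnu)
  define a' where "a' = Suc n - (a + 3)"
  have a': "1 \<le> a'" "a' + 3 \<le> n" "Suc n - (a' + 3) = a" "Suc n - a' = a + 3" "Suc n - (a' + 2) = a + 1"
    "Suc n - (a' + 1) = a + 2" unfolding a'_def using a by auto
  have na: "Suc n = a' + a + 3" unfolding a'_def using a by simp
  have e1: "N.dead a' (a'+2) {} \<longleftrightarrow> dead (a+1) (a+3) {}"
    by (rule dead_Cnu_eq) (use na a a'(1) in \<open>simp_all add: fence_iff set_eq_iff a', (presburger+)?\<close>)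
  have e2: "N.dead a' (a'+2) {a'+1} \<longleftrightarrow> dead (a+1) (a+3) {a+2}"
    by (rule dead_Cnu_eq) (use na a a'(1) in \<open>simp_all add: fence_iff set_eq_iff a', (presburger+)?\<close>)
  have e3: "N.dead (a'+1) (a'+3) {} \<longleftrightarrow> dead a (a+2) {}"
    by (rule dead_Cnu_eq) (use na a a'(1) in \<open>simp_all add: fence_iff set_eq_iff a', (presburger+)?\<close>)
  have e4: "N.dead (a'+1) (a'+3) {a'+2} \<longleftrightarrow> dead a (a+2) {a+1}"
    by (rule dead_Cnu_eq) (use na a a'(1) in \<open>simp_all add: fence_iff set_eq_iff a', (presburger+)?\<close>)
  have e5: "N.dead a' (a'+3) {a'+1,a'+2} \<longleftrightarrow> dead a (a+3) {a+1,a+2}"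
    by (rule dead_Cnu_eq) (use na a a'(1) in \<open>simp_all add: fence_iff set_eq_iff a', (presburger+)?\<close>)
  have "N.bad a'" by (rule N.bad_step[OF vt_Cnu[OF vt] a'(1,2)]) (use d nc e1 e2 e3 e4 in blast)+
  then have b: "dead a (a+2) {}" "\<not> dead a (a+2) {a+1}" "dead a (a+3) {a+1,a+2}"
    unfolding N.bad_def e3 e4 e5 by auto
  have f: "(a, a+3, {a+1}) \<in> fences n" using a by (auto simp: fence_iff)
  have "{a+1} \<inter> {a+1<..<a+3} = {}" by auto
  then have "dead a (a+3) {a+1}" using forcing[OF f, of "a+1" "a+3"] d(1) by simp
  then show ?thesis unfolding bad_def using a d b by simp
qed

text \<open>If a is neither 1 nor a cut, \<open>bad_step_nu\<close> shows that a-1 is bad. The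
  descent stops at 1 or at a cut, where \<open>bad_first_block\<close> applies.\<close>

lemma not_bad: assumes vt: "vertex_transitive G" shows "\<not> bad a"
proof (induction a rule: less_induct)
  case (less a)
  show ?case
  proof
    assume bad: "bad a"
    show False
    proof (cases "a = 1 \<or> cut a")
      case True then show False by (rule bad_first_block[OF vt bad])
    next
      case False
      have b: "1 \<le> a" "a + 3 \<le> n" "dead a (a+2) {}" "\<not> dead a (a+2) {a+1}" using bad unfolding bad_def by auto
      define c where "c = a - 1"
      have c: "a = c + 1" "1 \<le> c" "c + 3 \<le> n" using False b unfolding c_def by auto
      have "bad c"
        by (rule bad_step_nu[OF vt c(2,3)]) (use b False c in \<open>simp_all add: cut_def numeral_3_eq_3 numeral_2_eq_2\<close>)
      then show False using less.IH[of c] c by simp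
    qed
  qed
qed

lemma half_dead_cut_right:
  assumes vt: "vertex_transitive G" and a: "1 \<le> a" "a + 3 \<le> n"
    and d: "dead a (a+2) {}" "\<not> dead a (a+2) {a+1}"
  shows "cut (a+2)"
proof (rule ccontr)
  assume "\<not> cut (a+2)"
  then have "\<not> dead (a+1) (a+3) {} \<or> \<not> dead (a+1) (a+3) {a+2}"
    using a unfolding cut_def by (simp add: numeral_3_eq_3 numeral_2_eq_2)
  from bad_step[OF vt a d this] show False using not_bad[OF vt] by simp
qed

lemma half_dead_cut_left:
  assumes vt: "vertex_transitive G" and a: "1 \<le> a" "a + 3 \<le> n"
    and d: "dead (a+1) (a+3) {}" "\<not> dead (a+1) (a+3) {a+2}"
  shows "cut (a+1)"
proof (rule ccontr)
  assume "\<not> cut (a+1)"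
  then have "\<not> dead a (a+2) {} \<or> \<not> dead a (a+2) {a+1}"
    using a unfolding cut_def by (simp add: numeral_3_eq_3 numeral_2_eq_2)
  from bad_step_nu[OF vt a d this] show False using not_bad[OF vt] by simp
qed

lemma half_dead_cut_empty:
  assumes vt: "vertex_transitive G" and c: "1 \<le> c" "c + 2 \<le> n"
    and d: "dead c (c+2) {}" "\<not> dead c (c+2) {c+1}"
  shows "(c = 1 \<or> cut c) \<and> (c + 2 = n \<or> cut (c+2))"
proof
  show "c + 2 = n \<or> cut (c+2)" using half_dead_cut_right[OF vt c(1) _ d] c(2) by force
  show "c = 1 \<or> cut c"
  proof (cases "c = 1")
    case False
    define a where "a = c - 1"
    have a: "c = a + 1" "1 \<le> a" "a + 3 \<le> n" using False c unfolding a_def by auto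
    have "cut (a+1)"
      by (rule half_dead_cut_left[OF vt a(2,3)]) (use d a in \<open>simp_all add: numeral_3_eq_3 numeral_2_eq_2\<close>)
    then show ?thesis using a by simp
  qed simp
qed

lemma dead_Crev_short:
  assumes "1 \<le> c" "c + 2 \<le> n"
  shows "wcong.dead Crev c (c+2) {} \<longleftrightarrow> dead c (c+2) {c+1}"
    "wcong.dead Crev c (c+2) {c+1} \<longleftrightarrow> dead c (c+2) {}"
proof -
  have e: "{c<..<c+2} - {} = {c+1}" "{c<..<c+2} - {c+1} = {}" by auto
  show "wcong.dead Crev c (c+2) {} \<longleftrightarrow> dead c (c+2) {c+1}"
    using dead_Crev[of c "c+2" "{}"] assms unfolding e by (simp add: fence_iff)
  show "wcong.dead Crev c (c+2) {c+1} \<longleftrightarrow> dead c (c+2) {}"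
    using dead_Crev[of c "c+2" "{c+1}"] assms unfolding e by (simp add: fence_iff)
qed

lemma cut_Crev: "ess_wcong.cut n Crev c \<longleftrightarrow> cut c"
proof -
  interpret V: ess_wcong n Crev by (rule ess_Crev)
  show ?thesis
  proof (cases "1 < c \<and> c < n")
    case True
    define a where "a = c - 1"
    have a: "c = a + 1" "1 \<le> a" "a + 2 \<le> n" using True unfolding a_def by auto
    show ?thesis unfolding V.cut_def cut_def a(1) using dead_Crev_short[OF a(2,3)] by (auto simp: numeral_2_eq_2)
  qed (auto simp: V.cut_def cut_def)
qed

text \<open>Reversal exchanges the two fences of length two around a value and preserves cuts, so it
  suffices to treat the case where the fence with empty L is the dead one.\<close>

lemma half_dead_cut:
  assumes vt: "vertex_transitive G" and c: "1 \<le> c" "c + 2 \<le> n"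
    and d: "dead c (c+2) {} \<noteq> dead c (c+2) {c+1}"
  shows "(c = 1 \<or> cut c) \<and> (c + 2 = n \<or> cut (c+2))"
proof (cases "dead c (c+2) {}")
  case True
  then show ?thesis using half_dead_cut_empty[OF vt c] d by simp
next
  case False
  interpret V: ess_wcong n Crev by (rule ess_Crev)
  show ?thesis using V.half_dead_cut_empty[OF vt_Crev[OF vt] c] dead_Crev_short[OF c] False d
    by (simp add: cut_Crev)
qed

text \<open>\<open>triangle_long\<close> makes (a, b, {a+1}) dead as well. Shrinking it leads to a
  half-dead fence on [a, a+2], hence to a cut at a+2, and the fence (a+1, a+3, {}) of that cut
  contradicts minimality.\<close>

lemma no_long_minimal_empty:
  assumes vt: "vertex_transitive G" and f: "1 \<le> a" "a + 3 \<le> b" "b \<le> n" and dead: "dead a b {}"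
    and sub: "\<And>c d. a \<le> c \<Longrightarrow> c < d \<Longrightarrow> d \<le> b \<Longrightarrow> (c,d) \<noteq> (a,b) \<Longrightarrow> \<not> dead c d {}"
  shows False
proof -
  have n1: "\<not> dead (a+1) b {}" by (rule sub) (use f in simp_all)
  have n2: "\<not> dead a (a+2) {}" by (rule sub) (use f in simp_all)
  have d1: "dead a b {a+1}"
    by (rule ccontr) (rule triangle_long[OF vt f dead n1 _ disjI1[OF n2]])
  \<comment> \<open>The shortest interval starting at a on which L = {a+1} is dead. For d > a+2 this
    would be a minimal dead fence whose L contains a+1 but not a+2.\<close>
  define d where "d = (LEAST d. a + 2 \<le> d \<and> dead a d {a+1})"
  have d: "a + 2 \<le> d \<and> dead a d {a+1}"
    unfolding d_def by (rule LeastI[of _ b]) (use d1 f in simp)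
  have db: "d \<le> b" unfolding d_def by (rule Least_le) (use d1 f in simp)
  have least: "\<not> dead a e {a+1}" if "a + 2 \<le> e" "e < d" for e
    using not_less_Least[of e "\<lambda>d. a + 2 \<le> d \<and> dead a d {a+1}"] that unfolding d_def by auto
  have "d = a + 2"
  proof (rule ccontr)
    assume "d \<noteq> a + 2"
    then have d3: "a + 3 \<le> d" using d by simp
    have "{a+1} = ({}::nat set) \<or> {a+1} = {a<..<d}"
    proof (rule minimal_dead_extreme[OF vt _ conjunct2[OF d]])
      show "(a, d, {a+1}) \<in> fences n" using f db d3 by (auto simp: fence_iff)
      fix c e assume h: "a \<le> c" "c < e" "e \<le> d" "(c,e) \<noteq> (a,d)"
      show "\<not> dead c e ({a+1} \<inter> {c<..<e})"
      proof (cases "c = a \<and> a + 2 \<le> e")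
        case True
        then have i: "{a+1} \<inter> {c<..<e} = {a+1}" by auto
        have "e < d" using True h(3,4) by (cases "e = d") auto
        then show ?thesis unfolding i using least[of e] True by simp
      next
        case False
        then have e: "{a+1} \<inter> {c<..<e} = {}" using h by auto
        have "(c,e) \<noteq> (a,b)" using False f by auto
        then show ?thesis unfolding e using sub[of c e] h db by simp
      qed
    qed
    then have "{a+1} = {a<..<d}" by simp
    moreover have "a + 2 \<in> {a<..<d}" using d3 by simp
    ultimately have "a + 2 \<in> {a+1}" by (simp only:)
    then show False by simp
  qed
  then have d2: "dead a (a+2) {a+1}" using d by simp
  have an: "a + 2 \<le> n" "a + 2 \<noteq> n" using f by auto
  have "dead a (a+2) {} \<noteq> dead a (a+2) {a+1}" using n2 d2 by simp
  from half_dead_cut[OF vt f(1) an(1) this] an(2) have "cut (a+2)" by simp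
  then have "dead (a+1) (a+3) {}" unfolding cut_def by (simp add: numeral_3_eq_3 numeral_2_eq_2)
  moreover have "\<not> dead (a+1) (a+3) {}" by (rule sub) (use f in auto)
  ultimately show False by simp
qed

lemma no_long_minimal:
  assumes vt: "vertex_transitive G" and f: "(a,b,L) \<in> fences n" and ab: "a + 3 \<le> b" and dead: "dead a b L"
    and sub: "\<And>c d. a \<le> c \<Longrightarrow> c < d \<Longrightarrow> d \<le> b \<Longrightarrow> (c,d) \<noteq> (a,b) \<Longrightarrow> \<not> dead c d (L \<inter> {c<..<d})"
  shows False
proof -
  have ab': "1 \<le> a" "b \<le> n" using f by (auto simp: fence_iff)
  consider "L = {}" | "L = {a<..<b}" using minimal_dead_extreme[OF vt f dead sub] by auto
  then show False
  proof cases
    case 1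
    show False by (rule no_long_minimal_empty[OF vt ab'(1) ab ab'(2)]) (use dead sub 1 in auto)
  next
    case 2
    interpret V: ess_wcong n Crev by (rule ess_Crev)
    show False
    proof (rule V.no_long_minimal_empty[OF vt_Crev[OF vt] ab'(1) ab ab'(2)])
      show "V.dead a b {}" using dead_Crev[of a b "{}"] dead 2 f by (simp add: fence_iff)
      fix c d assume h: "a \<le> c" "c < d" "d \<le> b" "(c,d) \<noteq> (a,b)"
      have "L \<inter> {c<..<d} = {c<..<d}" unfolding 2 using h by auto
      then have "\<not> dead c d {c<..<d}" using sub[OF h] by simp
      then show "\<not> V.dead c d {}" using dead_Crev[of c d "{}"] h ab' by (simp add: fence_iff)
    qed
  qed
qed

text \<open>A shortest dead fence inside [a,b] with the restricted L has length two, and exactly one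
  of the two fences there is dead since the middle value is no cut. Its ends are cuts or boundary
  values, so they can only be a and b.\<close>

lemma dead_without_cut:
  assumes vt: "vertex_transitive G" and f: "(a,b,L) \<in> fences n" and dead: "dead a b L"
    and nocut: "\<And>c. a < c \<Longrightarrow> c < b \<Longrightarrow> \<not> cut c"
  shows "b = a + 2 \<and> (a = 1 \<or> cut a) \<and> (b = n \<or> cut b)"
proof -
  have ab: "1 \<le> a" "a < b" "b \<le> n" and L: "L \<subseteq> {a<..<b}" using f by (auto simp: fence_iff)
  define P where "P k \<longleftrightarrow> (\<exists>c d. a \<le> c \<and> c < d \<and> d \<le> b \<and> d - c = k \<and> dead c d (L \<inter> {c<..<d}))" for k
  have "L \<inter> {a<..<b} = L" using L by auto
  then have "P (b - a)" unfolding P_def using ab dead by (intro exI[of _ a] exI[of _ b]) simp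
  then have Pk: "P (LEAST k. P k)" by (rule LeastI)
  then obtain c d where cd: "a \<le> c" "c < d" "d \<le> b" "d - c = (LEAST k. P k)" "dead c d (L \<inter> {c<..<d})"
    unfolding P_def by auto
  let ?M = "L \<inter> {c<..<d}"
  have fM: "(c,d,?M) \<in> fences n" using cd ab by (auto simp: fence_iff)
  have sub: "\<not> dead x y (?M \<inter> {x<..<y})" if h: "c \<le> x" "x < y" "y \<le> d" "(x,y) \<noteq> (c,d)" for x y
  proof
    assume dd: "dead x y (?M \<inter> {x<..<y})"
    have "?M \<inter> {x<..<y} = L \<inter> {x<..<y}" using h by auto
    then have "P (y - x)" unfolding P_def using dd h cd by (intro exI[of _ x] exI[of _ y]) simp
    then have "(LEAST k. P k) \<le> y - x" by (rule Least_le)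
    then show False using h cd by auto
  qed
  have "\<not> c + 3 \<le> d" using no_long_minimal[OF vt fM _ cd(5) sub] by auto
  moreover have "d \<noteq> c + 1"
  proof
    assume "d = c + 1"
    moreover have "L \<inter> {c<..<Suc c} = {}" by auto
    ultimately show False using cd(5) ess[of c] cd ab by auto
  qed
  ultimately have d2: "d = c + 2" using cd(2) by presburger
  have c1: "c + 1 \<in> {a<..<b}" using cd d2 by auto
  have iv: "{c<..<c+2} = {c+1}" by auto
  have "L \<inter> {c+1} = {} \<or> L \<inter> {c+1} = {c+1}" by auto
  moreover have "dead c (c+2) (L \<inter> {c+1})" using cd(5) unfolding d2 iv .
  ultimately have 1: "dead c (c+2) {} \<or> dead c (c+2) {c+1}" by (elim disjE) simp_all
  have "\<not> cut (c+1)" using nocut c1 by simp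
  moreover have "1 < c + 1" "c + 1 < n" using cd(1,3) ab d2 by auto
  ultimately have "\<not> (dead c (c+2) {} \<and> dead c (c+2) {c+1})"
    unfolding cut_def by (simp add: numeral_2_eq_2)
  then have "dead c (c+2) {} \<noteq> dead c (c+2) {c+1}" using 1 by blast
  then have h: "(c = 1 \<or> cut c) \<and> (c + 2 = n \<or> cut (c+2))"
    using half_dead_cut[OF vt, of c] cd(1,3) ab d2 by simp
  have "c = a"
  proof (rule ccontr)
    assume "c \<noteq> a"
    then show False using h nocut[of c] cd(1-3) ab by simp
  qed
  moreover have "d = b"
  proof (rule ccontr)
    assume "d \<noteq> b"
    then show False using h nocut[of d] cd(1-3) ab unfolding d2 by simp
  qed
  ultimately show ?thesis using h d2 by simp
qed

end

subsection \<open>Congruences of the weak order\<close>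

lemma weak_le_perm_of: "ok n I \<Longrightarrow> ok n J \<Longrightarrow> weak_le (perm_of n I) (perm_of n J) \<longleftrightarrow> I \<subseteq> J"
  unfolding weak_le_def by (simp add: invs_perm_of)

lemma is_join_jn:
  assumes "ok n I" "ok n J"
  shows "is_join n (perm_of n I) (perm_of n J) (perm_of n (jn I J))"
  unfolding is_join_def
proof (intro conjI ballI impI)
  show "perm_of n (jn I J) \<in> perms n" by (rule perm_of_perms)
  show "weak_le (perm_of n I) (perm_of n (jn I J))" "weak_le (perm_of n J) (perm_of n (jn I J))"
    using assms by (simp_all add: weak_le_perm_of ok_jn jn_upper)
  fix u assume u: "u \<in> perms n" "weak_le (perm_of n I) u \<and> weak_le (perm_of n J) u"
  then have "I \<subseteq> invs u" "J \<subseteq> invs u" unfolding weak_le_def using assms by (simp_all add: invs_perm_of)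
  then have "jn I J \<subseteq> invs u" by (rule jn_least[OF invs_ok[OF u(1)]])
  then show "weak_le (perm_of n (jn I J)) u" unfolding weak_le_def
    using invs_perm_of[OF ok_jn[OF assms]] by simp
qed

lemma is_meet_mt:
  assumes "ok n I" "ok n J"
  shows "is_meet n (perm_of n I) (perm_of n J) (perm_of n (mt n I J))"
  unfolding is_meet_def
proof (intro conjI ballI impI)
  show "perm_of n (mt n I J) \<in> perms n" by (rule perm_of_perms)
  show "weak_le (perm_of n (mt n I J)) (perm_of n I)" "weak_le (perm_of n (mt n I J)) (perm_of n J)"
    using assms by (simp_all add: weak_le_perm_of ok_mt mt_lower)
  fix u assume u: "u \<in> perms n" "weak_le u (perm_of n I) \<and> weak_le u (perm_of n J)"
  then have "invs u \<subseteq> I" "invs u \<subseteq> J" unfolding weak_le_def using assms by (simp_all add: invs_perm_of)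
  then have "invs u \<subseteq> mt n I J" by (rule mt_greatest[OF invs_ok[OF u(1)]])
  then show "weak_le u (perm_of n (mt n I J))" unfolding weak_le_def
    using invs_perm_of[OF ok_mt[OF assms]] by simp
qed

lemma is_join_unique: assumes "is_join n x z j" "is_join n x z k" shows "j = k"
proof -
  have "weak_le j k" "weak_le k j" "j \<in> perms n" "k \<in> perms n"
    using assms unfolding is_join_def by auto
  then show ?thesis using invs_inj[of j n k] unfolding weak_le_def by simp
qed

lemma is_meet_unique: assumes "is_meet n x z j" "is_meet n x z k" shows "j = k"
proof -
  have "weak_le j k" "weak_le k j" "j \<in> perms n" "k \<in> perms n"
    using assms unfolding is_meet_def by auto
  then show ?thesis using invs_inj[of j n k] unfolding weak_le_def by simp
qed

lemma lattice_congD: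
  assumes "lattice_cong n R"
  shows "R \<subseteq> perms n \<times> perms n" "equiv (perms n) R"
    "(x,y) \<in> R \<Longrightarrow> z \<in> perms n \<Longrightarrow> is_join n x z j1 \<Longrightarrow> is_join n y z j2 \<Longrightarrow> (j1,j2) \<in> R"
    "(x,y) \<in> R \<Longrightarrow> z \<in> perms n \<Longrightarrow> is_meet n x z j1 \<Longrightarrow> is_meet n y z j2 \<Longrightarrow> (j1,j2) \<in> R"
proof -
  note a = assms[unfolded lattice_cong_def]
  show "R \<subseteq> perms n \<times> perms n" by (rule a[THEN conjunct1])
  show "equiv (perms n) R" by (rule a[THEN conjunct2, THEN conjunct1])
  show "(j1,j2) \<in> R" if "(x,y) \<in> R" "z \<in> perms n" "is_join n x z j1" "is_join n y z j2"
    by (rule a[THEN conjunct2, THEN conjunct2, THEN conjunct1, rule_format,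
        OF conjI[OF that(1) conjI[OF that(2) conjI[OF that(3,4)]]]])
  show "(j1,j2) \<in> R" if "(x,y) \<in> R" "z \<in> perms n" "is_meet n x z j1" "is_meet n y z j2"
    by (rule a[THEN conjunct2, THEN conjunct2, THEN conjunct2, rule_format,
        OF conjI[OF that(1) conjI[OF that(2) conjI[OF that(3,4)]]]])
qed

definition CR :: "nat \<Rightarrow> (nat list \<times> nat list) set \<Rightarrow> (nat \<times> nat) set \<Rightarrow> (nat \<times> nat) set \<Rightarrow> bool" where
  "CR n R I J \<longleftrightarrow> ok n I \<and> ok n J \<and> (perm_of n I, perm_of n J) \<in> R"

lemma CR_invs: "x \<in> perms n \<Longrightarrow> y \<in> perms n \<Longrightarrow> CR n R (invs x) (invs y) \<longleftrightarrow> (x,y) \<in> R"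
  unfolding CR_def by (simp add: invs_ok perm_of_invs)

lemma wcong_CR:
  assumes "lattice_cong n R" shows "wcong n (CR n R)"
proof -
  note eq = lattice_congD(2)[OF assms] and J = lattice_congD(3)[OF assms] and M = lattice_congD(4)[OF assms]
  show ?thesis
  proof
    show "ok n I \<and> ok n J" if "CR n R I J" for I J using that unfolding CR_def by simp
    show "CR n R I I" if "ok n I" for I
    proof -
      have "(perm_of n I, perm_of n I) \<in> R"
        by (rule refl_onD[of "perms n"]) (use eq perm_of_perms in \<open>simp_all add: equiv_def\<close>)
      then show ?thesis using that unfolding CR_def by simp
    qed
    show "CR n R J I" if "CR n R I J" for I J
    proof -
      have "sym R" using eq unfolding equiv_def by simp
      then have "(perm_of n J, perm_of n I) \<in> R" by (rule symD) (use that in \<open>simp add: CR_def\<close>)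
      then show ?thesis using that unfolding CR_def by simp
    qed
    show "CR n R I K" if "CR n R I J" "CR n R J K" for I J K
    proof -
      have "trans R" using eq unfolding equiv_def by simp
      then have "(perm_of n I, perm_of n K) \<in> R" by (rule transD) (use that in \<open>auto simp: CR_def\<close>)
      then show ?thesis using that unfolding CR_def by simp
    qed
    show "CR n R (jn I K) (jn J K)" if h: "CR n R I J" "ok n K" for I J K
    proof -
      have o: "ok n I" "ok n J" "(perm_of n I, perm_of n J) \<in> R" using h(1) unfolding CR_def by auto
      have "(perm_of n (jn I K), perm_of n (jn J K)) \<in> R"
        by (rule J[OF o(3) perm_of_perms is_join_jn[OF o(1) h(2)] is_join_jn[OF o(2) h(2)]])
      then show ?thesis unfolding CR_def using ok_jn o(1,2) h(2) by simp
    qed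
    show "CR n R (mt n I K) (mt n J K)" if h: "CR n R I J" "ok n K" for I J K
    proof -
      have o: "ok n I" "ok n J" "(perm_of n I, perm_of n J) \<in> R" using h(1) unfolding CR_def by auto
      have "(perm_of n (mt n I K), perm_of n (mt n J K)) \<in> R"
        by (rule M[OF o(3) perm_of_perms is_meet_mt[OF o(1) h(2)] is_meet_mt[OF o(2) h(2)]])
      then show ?thesis unfolding CR_def using ok_mt o(1,2) h(2) by simp
    qed
  qed
qed

text \<open>The edge from \<open>ju\<close> to \<open>jv\<close> belongs to the fence, so
  contracting all edges makes the fence dead; the converse is \<open>edge_iff\<close>.\<close>

lemma FR_iff:
  assumes R: "lattice_cong n R"
  shows "(a,b,L) \<in> FR n R \<longleftrightarrow> (a,b,L) \<in> fences n \<and> wcong.dead (CR n R) a b L"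
proof (cases "(a,b,L) \<in> fences n")
  case f: True
  interpret W: wcong n "CR n R" by (rule wcong_CR[OF R])
  have "(\<forall>e\<in>fence_edges n (a,b,L). e \<in> R) \<longleftrightarrow> W.dead a b L"
  proof
    assume h: "\<forall>e\<in>fence_edges n (a,b,L). e \<in> R"
    have "(perm_of n (ju a b L), perm_of n (jv a b L)) \<in> fence_edges n (a,b,L)"
      unfolding fence_edges_iff[OF f] invs_perm_of[OF ok_ju[OF f]] invs_perm_of[OF ok_jv[OF f]]
    proof (intro conjI perm_of_perms)
      show "(a,b) \<notin> ju a b L" unfolding ju_def by simp
      show "jv a b L = insert (a,b) (ju a b L)" using insert_ju[OF f] by simp
      show "L = {c. a < c \<and> c < b \<and> (a,c) \<in> ju a b L}" using lset_ju[OF f] unfolding lset_def by simp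
    qed
    then show "W.dead a b L" unfolding W.dead_def CR_def using h ok_ju[OF f] ok_jv[OF f] by simp
  next
    assume d: "W.dead a b L"
    show "\<forall>e\<in>fence_edges n (a,b,L). e \<in> R"
    proof
      fix e assume e: "e \<in> fence_edges n (a,b,L)"
      obtain u v where uv: "e = (u,v)" by fastforce
      note h0 = e[unfolded uv fence_edges_iff[OF f]]
      have h: "u \<in> perms n" "v \<in> perms n" "(a,b) \<notin> invs u" "invs v = insert (a,b) (invs u)"
        "lset a b (invs u) = L"
        using h0[THEN conjunct1] h0[THEN conjunct2, THEN conjunct1]
          h0[THEN conjunct2, THEN conjunct2, THEN conjunct1]
          h0[THEN conjunct2, THEN conjunct2, THEN conjunct2, THEN conjunct1]
          h0[THEN conjunct2, THEN conjunct2, THEN conjunct2, THEN conjunct2, symmetric]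
        unfolding lset_def by simp_all
      have o: "ok n (insert (a,b) (invs u))" using invs_ok[OF h(2)] h(4) by simp
      have "CR n R (invs u) (insert (a,b) (invs u))"
        using W.edge_iff[OF invs_ok[OF h(1)] o h(3)] d h(5) by simp
      then show "e \<in> R" unfolding uv using CR_invs[OF h(1,2), of R] h(4) by simp
    qed
  qed
  then show ?thesis unfolding FR_def using f by simp
qed (simp add: FR_def)

lemma ess_CR:
  assumes R: "R \<in> ess_congs n" shows "ess_wcong n (CR n R)"
proof -
  have l: "lattice_cong n R" and e: "\<And>a. (a, Suc a, {}) \<notin> FR n R" using R unfolding ess_congs_def by auto
  show ?thesis
  proof (intro ess_wcong.intro wcong_CR[OF l] ess_wcong_axioms.intro)
    fix a assume a: "1 \<le> a" "a < n"
    have "(a, Suc a, {}) \<in> fences n" using a by (simp add: fence_iff)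
    then show "\<not> wcong.dead (CR n R) a (Suc a) {}" using e[of a] FR_iff[OF l] by simp
  qed
qed

lemma Q_iso:
  assumes R: "lattice_cong n R"
  shows "graph_iso (Q n R) (wcong.G n (CR n R))"
proof -
  interpret W: wcong n "CR n R" by (rule wcong_CR[OF R])
  note eq = lattice_congD(2)[OF R] and sub = lattice_congD(1)[OF R]
  have cls: "invs ` (R `` {x}) = W.cl (invs x)" if x: "x \<in> perms n" for x
  proof (rule set_eqI)
    fix J
    show "J \<in> invs ` (R `` {x}) \<longleftrightarrow> J \<in> W.cl (invs x)"
    proof
      assume "J \<in> invs ` (R `` {x})"
      then obtain y where y: "J = invs y" "y \<in> R `` {x}" by (rule imageE)
      then have r: "(x,y) \<in> R" by simp
      then have "y \<in> perms n" using sub by auto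
      then show "J \<in> W.cl (invs x)" unfolding W.cl_def y(1) using CR_invs[OF x] r by simp
    next
      assume "J \<in> W.cl (invs x)"
      then have c: "CR n R (invs x) J" unfolding W.cl_def by simp
      then have o: "ok n J" "(x, perm_of n J) \<in> R" unfolding CR_def using perm_of_invs[OF x] by auto
      show "J \<in> invs ` (R `` {x})" by (rule image_eqI[of _ _ "perm_of n J"]) (use o invs_perm_of in auto)
    qed
  qed
  have "bij_betw (\<lambda>X. invs ` X) (perms n // R) (W.cl ` {I. ok n I})"
  proof (rule bij_betw_imageI)
    show "inj_on (\<lambda>X. invs ` X) (perms n // R)"
    proof (rule inj_onI)
      fix X Y assume h: "X \<in> perms n // R" "Y \<in> perms n // R" "invs ` X = invs ` Y"
      have "X \<subseteq> perms n" "Y \<subseteq> perms n" using h(1,2) sub unfolding quotient_def by auto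
      moreover have "inj_on invs (perms n)" by (rule inj_onI) (rule invs_inj)
      ultimately show "X = Y" using h(3) by (simp add: inj_on_image_eq_iff)
    qed
    show "(\<lambda>X. invs ` X) ` (perms n // R) = W.cl ` {I. ok n I}"
    proof (intro equalityI subsetI)
      fix Z assume "Z \<in> (\<lambda>X. invs ` X) ` (perms n // R)"
      then obtain X where X: "Z = invs ` X" "X \<in> perms n // R" by (rule imageE)
      from X(2) obtain x where "X = R `` {x}" "x \<in> perms n" by (rule quotientE)
      then have "Z = W.cl (invs x)" "ok n (invs x)" using X(1) cls invs_ok by auto
      then show "Z \<in> W.cl ` {I. ok n I}" by simp
    next
      fix Z assume "Z \<in> W.cl ` {I. ok n I}"
      then obtain I where I: "Z = W.cl I" "ok n I" by auto
      have "Z = invs ` (R `` {perm_of n I})" using cls[OF perm_of_perms[of n I]] invs_perm_of[OF I(2)] I(1) by simp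
      moreover have "R `` {perm_of n I} \<in> perms n // R" by (rule quotientI[OF perm_of_perms])
      ultimately show "Z \<in> (\<lambda>X. invs ` X) ` (perms n // R)" by simp
    qed
  qed
  then show ?thesis unfolding Q_def W.G_def
  proof (rule cover_graph_iso)
    have "quot_le X Y \<longleftrightarrow> (\<exists>I\<in>invs ` X. \<exists>J\<in>invs ` Y. I \<subseteq> J)" for X Y
      unfolding quot_le_def weak_le_def by auto
    then show "(\<forall>X\<in>perms n // R. \<forall>Y\<in>perms n // R. quot_le X Y \<longleftrightarrow> (\<exists>I\<in>invs ` X. \<exists>J\<in>invs ` Y. I \<subseteq> J))
      \<or> (\<forall>X\<in>perms n // R. \<forall>Y\<in>perms n // R. quot_le X Y \<longleftrightarrow> (\<exists>I\<in>invs ` Y. \<exists>J\<in>invs ` X. I \<subseteq> J))"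
      by simp
  qed
qed

text \<open>For I below K, consider the first edge towards K that C2 does not contract: C1 contracts
  it by convexity, so its fence is dead for C1 and hence for C2. The general case passes through the
  join of I and J.\<close>

lemma cong_determined:
  assumes w: "wcong n C1" "wcong n C2"
    and d: "\<And>a b L. (a,b,L) \<in> fences n \<Longrightarrow> wcong.dead C1 a b L \<Longrightarrow> wcong.dead C2 a b L"
    and c: "C1 I J"
  shows "C2 I J"
proof -
  interpret A: wcong n C1 by (rule w)
  interpret B: wcong n C2 by (rule w)
  have up: "C2 I K" if sub: "I \<subseteq> K" and c: "C1 I K" for I K
  proof (rule ccontr)
    assume nc: "\<not> C2 I K"
    have o: "ok n I" "ok n K" using A.Cok[OF c] by auto
    obtain M p q where M: "ok n M" "ok n (insert (p,q) M)" "(p,q) \<notin> M" "I \<subseteq> M" "insert (p,q) M \<subseteq> K"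
      "C2 I M" "\<not> C2 M (insert (p,q) M)"
      by (rule B.first_edge[OF o sub nc]) (rule that)
    have "C1 M K" by (rule A.convex(2)[OF c M(4) _ M(1)]) (use M(5) in simp)
    then have "C1 M (insert (p,q) M)" by (rule A.convex(1)[OF _ subset_insertI M(5,2)])
    then have "A.dead p q (lset p q M)" using A.edge_iff[OF M(1,2,3)] by simp
    then have "B.dead p q (lset p q M)" by (rule d[OF edge_fence[OF M(2)]])
    then show False using B.edge_iff[OF M(1,2,3)] M(7) by simp
  qed
  have o: "ok n I" "ok n J" using A.Cok[OF c] by auto
  have "C1 (jn I J) (jn J J)" by (rule A.Cjn[OF c o(2)])
  then have cJ: "C1 J (jn I J)" unfolding jn_absorb[OF o(2) order_refl] by (rule A.Csym)
  have 1: "C2 J (jn I J)" by (rule up[OF jn_upper(2) cJ])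
  have 2: "C2 I (jn I J)" by (rule up[OF jn_upper(1) A.Ctrans[OF c cJ]])
  show ?thesis by (rule B.Ctrans[OF 2 B.Csym[OF 1]])
qed

lemma ess_congs_FR_inj:
  assumes "R1 \<in> ess_congs n" "R2 \<in> ess_congs n" "FR n R1 = FR n R2"
  shows "R1 = R2"
proof -
  have sub: "R \<subseteq> S" if R: "R \<in> ess_congs n" and S: "S \<in> ess_congs n" and e: "FR n R = FR n S" for R S
  proof (rule subrelI)
    fix x y assume xy: "(x,y) \<in> R"
    have l: "lattice_cong n R" "lattice_cong n S" using R S unfolding ess_congs_def by auto
    have p: "x \<in> perms n" "y \<in> perms n" using lattice_congD(1)[OF l(1)] xy by auto
    have "CR n S (invs x) (invs y)"
    proof (rule cong_determined[OF wcong_CR[OF l(1)] wcong_CR[OF l(2)]])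
      show "CR n R (invs x) (invs y)" using CR_invs[OF p] xy by simp
      fix a b L assume "(a,b,L) \<in> fences n" "wcong.dead (CR n R) a b L"
      then show "wcong.dead (CR n S) a b L" using FR_iff[OF l(1), of a b L] FR_iff[OF l(2), of a b L] e by simp
    qed
    then show "(x,y) \<in> S" using CR_invs[OF p] by simp
  qed
  show ?thesis by (rule equalityI[OF sub[OF assms] sub[OF assms(2,1) assms(3)[symmetric]]])
qed

definition RC :: "nat \<Rightarrow> ((nat \<times> nat) set \<Rightarrow> (nat \<times> nat) set \<Rightarrow> bool) \<Rightarrow> (nat list \<times> nat list) set" where
  "RC n C = {(x,y). x \<in> perms n \<and> y \<in> perms n \<and> C (invs x) (invs y)}"

lemma lattice_cong_RC:
  assumes w: "wcong n C" shows "lattice_cong n (RC n C)"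
proof -
  interpret W: wcong n C by (rule w)
  have "equiv (perms n) (RC n C)"
  proof (rule equivI)
    show "RC n C \<subseteq> perms n \<times> perms n" unfolding RC_def by auto
    show "refl_on (perms n) (RC n C)" unfolding refl_on_def RC_def using W.Crefl invs_ok by auto
    show "sym (RC n C)" unfolding sym_def RC_def using W.Csym by auto
    show "trans (RC n C)"
    proof (rule transI)
      fix x y z assume "(x,y) \<in> RC n C" "(y,z) \<in> RC n C"
      then show "(x,z) \<in> RC n C" unfolding RC_def using W.Ctrans[of "invs x" "invs y" "invs z"] by simp
    qed
  qed
  note eqv = this
  have JJ: "(j1,j2) \<in> RC n C" if h: "(x,y) \<in> RC n C" "z \<in> perms n" "is_join n x z j1" "is_join n y z j2" for x y z j1 j2
  proof -
    have p: "x \<in> perms n" "y \<in> perms n" "C (invs x) (invs y)" using h(1) unfolding RC_def by auto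
    have "j1 = perm_of n (jn (invs x) (invs z))"
      by (rule is_join_unique[OF h(3)])
        (use is_join_jn[OF invs_ok[OF p(1)] invs_ok[OF h(2)]] in
          \<open>simp only: perm_of_invs[OF p(1)] perm_of_invs[OF h(2)]\<close>)
    moreover have "j2 = perm_of n (jn (invs y) (invs z))"
      by (rule is_join_unique[OF h(4)])
        (use is_join_jn[OF invs_ok[OF p(2)] invs_ok[OF h(2)]] in
          \<open>simp only: perm_of_invs[OF p(2)] perm_of_invs[OF h(2)]\<close>)
    ultimately show ?thesis unfolding RC_def
      using W.Cjn[OF p(3) invs_ok[OF h(2)]] by (simp add: perm_of_perms invs_perm_of ok_jn invs_ok p h(2))
  qed
  have MM: "(j1,j2) \<in> RC n C" if h: "(x,y) \<in> RC n C" "z \<in> perms n" "is_meet n x z j1" "is_meet n y z j2" for x y z j1 j2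
  proof -
    have p: "x \<in> perms n" "y \<in> perms n" "C (invs x) (invs y)" using h(1) unfolding RC_def by auto
    have "j1 = perm_of n (mt n (invs x) (invs z))"
      by (rule is_meet_unique[OF h(3)])
        (use is_meet_mt[OF invs_ok[OF p(1)] invs_ok[OF h(2)]] in
          \<open>simp only: perm_of_invs[OF p(1)] perm_of_invs[OF h(2)]\<close>)
    moreover have "j2 = perm_of n (mt n (invs y) (invs z))"
      by (rule is_meet_unique[OF h(4)])
        (use is_meet_mt[OF invs_ok[OF p(2)] invs_ok[OF h(2)]] in
          \<open>simp only: perm_of_invs[OF p(2)] perm_of_invs[OF h(2)]\<close>)
    ultimately show ?thesis unfolding RC_def
      using W.Cmt[OF p(3) invs_ok[OF h(2)]] by (simp add: perm_of_perms invs_perm_of ok_mt invs_ok p h(2))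
  qed
  show ?thesis unfolding lattice_cong_def
  proof (intro conjI allI impI)
    show "RC n C \<subseteq> perms n \<times> perms n" unfolding RC_def by auto
    fix x y z j1 j2
    show "(j1,j2) \<in> RC n C" if "(x,y) \<in> RC n C \<and> z \<in> perms n \<and> is_join n x z j1 \<and> is_join n y z j2"
      using JJ[of x y z j1 j2] that by simp
    show "(j1,j2) \<in> RC n C" if "(x,y) \<in> RC n C \<and> z \<in> perms n \<and> is_meet n x z j1 \<and> is_meet n y z j2"
      using MM[of x y z j1 j2] that by simp
  qed (rule eqv)
qed

lemma CR_RC: assumes "wcong n C" shows "CR n (RC n C) = C"
proof (intro ext)
  fix I J
  interpret W: wcong n C by (rule assms)
  show "CR n (RC n C) I J = C I J"
    unfolding CR_def RC_def using W.Cok[of I J] by (auto simp: invs_perm_of perm_of_perms)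
qed

subsection \<open>Compositions and their blocks\<close>

lemma spos_0: "spos a 0 = 1"
  unfolding spos_def by simp

lemma spos_Suc: "j < length a \<Longrightarrow> spos a (Suc j) = spos a j + a ! j"
  unfolding spos_def by (simp add: take_Suc_conv_app_nth)

lemma spos_mono: "i \<le> j \<Longrightarrow> spos a i \<le> spos a j"
proof (induction j)
  case (Suc j)
  have "spos a j \<le> spos a (Suc j)"
  proof (cases "j < length a")
    case True then show ?thesis by (simp add: spos_Suc)
  next
    case False then show ?thesis by (simp add: spos_def)
  qed
  then show ?case using Suc by (cases "i = Suc j") auto
qed simp

lemma spos_less:
  assumes "\<forall>x\<in>set a. 0 < x" "i < j" "j \<le> length a" shows "spos a i < spos a j"
proof -
  have "spos a i < spos a (Suc i)" using spos_Suc[of i a] assms by auto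
  also have "\<dots> \<le> spos a j" by (rule spos_mono) (use assms in simp)
  finally show ?thesis .
qed

lemma spos_less_iff:
  assumes "\<forall>x\<in>set a. 0 < x" "i \<le> length a" "j \<le> length a" shows "spos a i < spos a j \<longleftrightarrow> i < j"
  using spos_less[OF assms(1), of i j] spos_mono[of j i a] assms(2,3) by (cases "i < j") auto

lemma spos_inj:
  assumes "\<forall>x\<in>set a. 0 < x" "i \<le> length a" "j \<le> length a" "spos a i = spos a j" shows "i = j"
  using spos_less_iff[OF assms(1-3)] spos_less_iff[OF assms(1,3,2)] assms(4) by (metis less_irrefl nat_neq_iff)

lemma spos_length: "spos a (length a) = 1 + sum_list a"
  unfolding spos_def by simp

lemma spos_locate:
  assumes "1 \<le> x" "x < spos a (length a)"
  obtains j where "j < length a" "spos a j \<le> x" "x < spos a (Suc j)"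
proof -
  define k where "k = (LEAST k. x < spos a k)"
  have k: "x < spos a k" unfolding k_def by (rule LeastI[of _ "length a"]) (rule assms(2))
  have kl: "k \<le> length a" unfolding k_def by (rule Least_le) (rule assms(2))
  have "k \<noteq> 0" using k assms(1) spos_0[of a] by (cases k) auto
  then obtain j where j: "k = Suc j" by (cases k) auto
  have "\<not> x < spos a j" using not_less_Least[of j "\<lambda>k. x < spos a k"] j unfolding k_def by auto
  then show ?thesis using that[of j] k kl j by auto
qed

section \<open>The congruence attached to a composition with choices\<close>

locale block_data =
  fixes n :: nat and a :: "nat list" and e :: "eps list"
  assumes valid: "valid_data n a e" and n2: "2 \<le> n"
begin

lemma pos: "\<forall>x\<in>set a. 0 < x" and sum: "sum_list a = n - 1" and len: "length e = length a"
  and eps: "j < length a \<Longrightarrow> a ! j \<noteq> 2 \<Longrightarrow> e ! j = ENone"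
  using valid unfolding valid_data_def by auto

lemma spos_end: "spos a (length a) = n"
  using spos_length[of a] sum n2 by simp

lemma spos_range: "j \<le> length a \<Longrightarrow> 1 \<le> spos a j \<and> spos a j \<le> n"
  using spos_mono[of 0 j a] spos_mono[of j "length a" a] spos_0[of a] spos_end by simp

text \<open>Neighbouring blocks share the value at the cut but no pair p < q.\<close>

definition blk :: "nat \<Rightarrow> (nat \<times> nat) set" where
  "blk j = {(p,q). spos a j \<le> p \<and> q \<le> spos a (Suc j)}"

text \<open>Write c for \<open>spos a j\<close>. The choice \<open>ELeft\<close> contracts the edge
  from {(c+1,c+2)} to {(c,c+2),(c+1,c+2)}; among the sets containing (c,c+2), its upper end is the
  one lacking (c,c+1). For \<open>ERight\<close> the roles of the two unit pairs are
  exchanged.\<close>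

definition drop_left :: "nat \<Rightarrow> (nat \<times> nat) set \<Rightarrow> bool" where
  "drop_left j I \<longleftrightarrow> e ! j = ELeft \<and> (spos a j, Suc (spos a j)) \<notin> I"

definition drop_right :: "nat \<Rightarrow> (nat \<times> nat) set \<Rightarrow> bool" where
  "drop_right j I \<longleftrightarrow> e ! j = ERight \<and> (Suc (spos a j), Suc (Suc (spos a j))) \<notin> I"

text \<open>Restriction to a block, followed in a pentagon block by the projection to the bottom of the
  contracted edge.\<close>
definition tr :: "nat \<Rightarrow> (nat \<times> nat) set \<Rightarrow> (nat \<times> nat) set" where
  "tr j I = {(p,q) \<in> I. (p,q) \<in> blk j \<and>
     \<not> ((drop_left j I \<or> drop_right j I) \<and> (p,q) = (spos a j, Suc (Suc (spos a j))))}"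

definition CD :: "(nat \<times> nat) set \<Rightarrow> (nat \<times> nat) set \<Rightarrow> bool" where
  "CD I J \<longleftrightarrow> ok n I \<and> ok n J \<and> (\<forall>j<length a. tr j I = tr j J)"

lemma tr_sub: "tr j I \<subseteq> I" and tr_blk: "tr j I \<subseteq> blk j"
  unfolding tr_def by auto

lemma special: assumes "j < length a" "e ! j \<noteq> ENone"
  shows "a ! j = 2" "spos a (Suc j) = Suc (Suc (spos a j))"
  using eps[OF assms(1)] assms spos_Suc[OF assms(1)] by auto

lemma special_pairs:
  assumes j: "j < length a" "e ! j \<noteq> ENone" and I: "ok n I" and x: "x \<in> I" "x \<in> blk j"
  shows "x = (spos a j, Suc (spos a j)) \<or> x = (Suc (spos a j), Suc (Suc (spos a j)))
    \<or> x = (spos a j, Suc (Suc (spos a j)))"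
proof -
  obtain p q where pq: "x = (p,q)" by fastforce
  have "p < q" using okD(2)[OF I] x pq by auto
  moreover have "spos a j \<le> p" "q \<le> Suc (Suc (spos a j))"
    using x(2) special(2)[OF j] unfolding pq blk_def by auto
  ultimately have "p = spos a j \<and> (q = Suc p \<or> q = Suc (Suc p)) \<or> p = Suc (spos a j) \<and> q = Suc p"
    by presburger
  then show ?thesis unfolding pq by auto
qed

lemma tr_none: "e ! j = ENone \<Longrightarrow> tr j I = I \<inter> blk j"
  unfolding tr_def drop_left_def drop_right_def by auto

text \<open>Whether the pair of the two outer values of a pentagon block survives in
  \<open>tr j I\<close>.\<close>

definition keep :: "nat \<Rightarrow> (nat \<times> nat) set \<Rightarrow> bool" where
  "keep j I \<longleftrightarrow> (spos a j, Suc (Suc (spos a j))) \<in> I \<and> \<not> drop_left j I \<and> \<not> drop_right j I"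

lemma tr_special:
  assumes j: "j < length a" "e ! j \<noteq> ENone" and I: "ok n I"
  shows "x \<in> tr j I \<longleftrightarrow> (x = (spos a j, Suc (spos a j)) \<and> x \<in> I)
     \<or> (x = (Suc (spos a j), Suc (Suc (spos a j))) \<and> x \<in> I)
     \<or> (x = (spos a j, Suc (Suc (spos a j))) \<and> keep j I)"
proof -
  have b: "(spos a j, Suc (spos a j)) \<in> blk j" "(Suc (spos a j), Suc (Suc (spos a j))) \<in> blk j"
    "(spos a j, Suc (Suc (spos a j))) \<in> blk j" unfolding blk_def special(2)[OF j] by auto
  show ?thesis
  proof
    assume h: "x \<in> tr j I"
    then have x: "x \<in> I" "x \<in> blk j" unfolding tr_def by auto
    show "(x = (spos a j, Suc (spos a j)) \<and> x \<in> I)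
     \<or> (x = (Suc (spos a j), Suc (Suc (spos a j))) \<and> x \<in> I)
     \<or> (x = (spos a j, Suc (Suc (spos a j))) \<and> keep j I)"
      using special_pairs[OF j I x] h x(1) unfolding tr_def keep_def by auto
  qed (use b in \<open>auto simp: tr_def keep_def\<close>)
qed

lemma tr_special_eq:
  assumes j: "j < length a" "e ! j \<noteq> ENone" and I: "ok n I" "ok n J"
  shows "tr j I = tr j J \<longleftrightarrow>
    ((spos a j, Suc (spos a j)) \<in> I \<longleftrightarrow> (spos a j, Suc (spos a j)) \<in> J)
    \<and> ((Suc (spos a j), Suc (Suc (spos a j))) \<in> I \<longleftrightarrow> (Suc (spos a j), Suc (Suc (spos a j))) \<in> J)
    \<and> (keep j I \<longleftrightarrow> keep j J)" (is "?l \<longleftrightarrow> ?r")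
proof
  assume l: ?l
  have m: "x \<in> tr j I \<longleftrightarrow> x \<in> tr j J" for x unfolding l ..
  show ?r using m[of "(spos a j, Suc (spos a j))"] m[of "(Suc (spos a j), Suc (Suc (spos a j)))"]
      m[of "(spos a j, Suc (Suc (spos a j)))"]
    unfolding tr_special[OF j I(1)] tr_special[OF j I(2)] by simp
next
  assume r: ?r
  show ?l by (rule set_eqI) (use r in \<open>auto simp: tr_special[OF j I(1)] tr_special[OF j I(2)]\<close>)
qed

text \<open>An ascending path between consecutive values has a single step.\<close>

lemma jn_unit: assumes "ok n I" "ok n K"
  shows "(x, Suc x) \<in> jn I K \<longleftrightarrow> (x, Suc x) \<in> I \<or> (x, Suc x) \<in> K"
proof
  assume h: "(x, Suc x) \<in> jn I K"
  from this[unfolded jn_def] show "(x, Suc x) \<in> I \<or> (x, Suc x) \<in> K"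
  proof (cases rule: tranclE)
    case (step z)
    have "x < z" using okD(2)[OF ok_jn[OF assms], of x z] step(1) unfolding jn_def by simp
    moreover have "z < Suc x" using step(2) okD(2)[OF assms(1)] okD(2)[OF assms(2)] by auto
    ultimately show ?thesis by simp
  qed simp
qed (auto simp: jn_def)

lemma jn_two: assumes "ok n I" "ok n K"
  shows "(x, Suc (Suc x)) \<in> jn I K \<longleftrightarrow> (x, Suc (Suc x)) \<in> I \<or> (x, Suc (Suc x)) \<in> K
    \<or> ((x, Suc x) \<in> I \<or> (x, Suc x) \<in> K) \<and> ((Suc x, Suc (Suc x)) \<in> I \<or> (Suc x, Suc (Suc x)) \<in> K)"
proof
  assume h: "(x, Suc (Suc x)) \<in> jn I K"
  from this[unfolded jn_def] show "(x, Suc (Suc x)) \<in> I \<or> (x, Suc (Suc x)) \<in> K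
    \<or> ((x, Suc x) \<in> I \<or> (x, Suc x) \<in> K) \<and> ((Suc x, Suc (Suc x)) \<in> I \<or> (Suc x, Suc (Suc x)) \<in> K)"
  proof (cases rule: tranclE)
    case (step z)
    have z1: "x < z" using okD(2)[OF ok_jn[OF assms], of x z] step(1) unfolding jn_def by simp
    moreover have "z < Suc (Suc x)" using step(2) okD(2)[OF assms(1)] okD(2)[OF assms(2)] by auto
    ultimately have z: "z = Suc x" by simp
    have "(x, Suc x) \<in> jn I K" using step(1) unfolding z jn_def .
    then show ?thesis using jn_unit[OF assms] step(2) unfolding z by auto
  qed blast
next
  assume "(x, Suc (Suc x)) \<in> I \<or> (x, Suc (Suc x)) \<in> K
    \<or> ((x, Suc x) \<in> I \<or> (x, Suc x) \<in> K) \<and> ((Suc x, Suc (Suc x)) \<in> I \<or> (Suc x, Suc (Suc x)) \<in> K)"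
  then show "(x, Suc (Suc x)) \<in> jn I K"
  proof (elim disjE)
    assume "((x, Suc x) \<in> I \<or> (x, Suc x) \<in> K) \<and> ((Suc x, Suc (Suc x)) \<in> I \<or> (Suc x, Suc (Suc x)) \<in> K)"
    then have "(x, Suc x) \<in> jn I K" "(Suc x, Suc (Suc x)) \<in> jn I K" unfolding jn_unit[OF assms] by auto
    then show ?thesis by (rule ok_trans[OF ok_jn[OF assms]])
  qed (auto simp: jn_def)
qed

text \<open>An ascending path whose two ends lie in a block never leaves it, so joins can be
  computed block by block.\<close>

lemma jn_blk:
  assumes I: "ok n I" and K: "ok n K"
  shows "jn I K \<inter> blk j = (I \<inter> blk j \<union> K \<inter> blk j)\<^sup>+"
proof
  have "(x,y) \<in> (I \<inter> blk j \<union> K \<inter> blk j)\<^sup>+" if "(x,y) \<in> jn I K" "spos a j \<le> x" "y \<le> spos a (Suc j)" for x y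
    using that unfolding jn_def
  proof (induction rule: trancl.induct)
    case (r_into_trancl x y)
    then show ?case by (intro trancl.r_into_trancl) (auto simp: blk_def)
  next
    case (trancl_into_trancl x y z)
    have yz: "y < z" using okD(2)[OF I, of y z] okD(2)[OF K, of y z] trancl_into_trancl.hyps(2) by auto
    have xy: "x < y" using okD(2)[OF ok_jn[OF I K], of x y] trancl_into_trancl.hyps(1) unfolding jn_def by simp
    have "(x,y) \<in> (I \<inter> blk j \<union> K \<inter> blk j)\<^sup>+" using trancl_into_trancl yz by simp
    moreover have "(y,z) \<in> I \<inter> blk j \<union> K \<inter> blk j"
      using trancl_into_trancl xy by (auto simp: blk_def)
    ultimately show ?case by (rule trancl.trancl_into_trancl)
  qed
  then show "jn I K \<inter> blk j \<subseteq> (I \<inter> blk j \<union> K \<inter> blk j)\<^sup>+" by (auto simp: blk_def)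
next
  show "(I \<inter> blk j \<union> K \<inter> blk j)\<^sup>+ \<subseteq> jn I K \<inter> blk j"
  proof (rule subrelI)
    fix x y assume "(x,y) \<in> (I \<inter> blk j \<union> K \<inter> blk j)\<^sup>+"
    then show "(x,y) \<in> jn I K \<inter> blk j"
    proof (induction rule: trancl.induct)
      case (r_into_trancl x y)
      then show ?case by (auto simp: jn_def)
    next
      case (trancl_into_trancl x y z)
      have "(y,z) \<in> jn I K" using trancl_into_trancl.hyps(2) by (auto simp: jn_def)
      then have "(x,z) \<in> jn I K" using ok_trans[OF ok_jn[OF I K]] trancl_into_trancl.IH by auto
      moreover have "(x,z) \<in> blk j" using trancl_into_trancl by (auto simp: blk_def)
      ultimately show ?case by simp
    qed
  qed
qed

lemma mt_blk:
  assumes "ok n I" "ok n K"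
  shows "mt n I K \<inter> blk j = (prs n \<inter> blk j) - ((prs n \<inter> blk j - I \<inter> blk j) \<union> (prs n \<inter> blk j - K \<inter> blk j))\<^sup>+"
proof -
  have "mt n I K \<inter> blk j = (prs n \<inter> blk j) - (jn (prs n - I) (prs n - K) \<inter> blk j)"
    unfolding mt_def by auto
  also have "jn (prs n - I) (prs n - K) \<inter> blk j = ((prs n - I) \<inter> blk j \<union> (prs n - K) \<inter> blk j)\<^sup>+"
    by (rule jn_blk) (intro ok_compl assms)+
  also have "(prs n - I) \<inter> blk j = prs n \<inter> blk j - I \<inter> blk j" by auto
  also have "(prs n - K) \<inter> blk j = prs n \<inter> blk j - K \<inter> blk j" by auto
  finally show ?thesis .
qed

text \<open>In an uncontracted block this is \<open>jn_blk\<close>. In a pentagon block three pairs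
  matter, and their membership in a join is a Boolean function of their membership in the arguments,
  so compatibility becomes a propositional check.\<close>

lemma tr_jn:
  assumes j: "j < length a" and o: "ok n I" "ok n J" "ok n K" and t: "tr j I = tr j J"
  shows "tr j (jn I K) = tr j (jn J K)"
proof (cases "e ! j = ENone")
  case True
  then show ?thesis using t o by (simp add: tr_none jn_blk)
next
  case False
  define c where "c = spos a j"
  note T = tr_special_eq[OF j False, folded c_def]
  note K = keep_def[of j, unfolded drop_left_def drop_right_def, folded c_def]
  have tt: "(c, Suc c) \<in> X \<Longrightarrow> (Suc c, Suc (Suc c)) \<in> X \<Longrightarrow> (c, Suc (Suc c)) \<in> X" if "ok n X" for X
    using ok_trans[OF that] by simp
  have cc: "(c, Suc (Suc c)) \<in> X \<Longrightarrow> (c, Suc c) \<in> X \<or> (Suc c, Suc (Suc c)) \<in> X" if "ok n X" for X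
    using ok_cotrans[OF that, of c "Suc (Suc c)" "Suc c"] by simp
  show ?thesis
    using t tt[OF o(1)] tt[OF o(2)] tt[OF o(3)] cc[OF o(1)] cc[OF o(2)] cc[OF o(3)] False
    unfolding T[OF o(1,2)] T[OF ok_jn[OF o(1,3)] ok_jn[OF o(2,3)]] K
      jn_unit[OF o(1,3)] jn_unit[OF o(2,3)] jn_two[OF o(1,3)] jn_two[OF o(2,3)]
    by (cases "e ! j") (simp_all, argo+)
qed

lemma tr_mt:
  assumes j: "j < length a" and o: "ok n I" "ok n J" "ok n K" and t: "tr j I = tr j J"
  shows "tr j (mt n I K) = tr j (mt n J K)"
proof (cases "e ! j = ENone")
  case True
  then show ?thesis using t o by (simp add: tr_none mt_blk)
next
  case False
  define c where "c = spos a j"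
  note T = tr_special_eq[OF j False, folded c_def]
  note K = keep_def[of j, unfolded drop_left_def drop_right_def, folded c_def]
  have tt: "(c, Suc c) \<in> X \<Longrightarrow> (Suc c, Suc (Suc c)) \<in> X \<Longrightarrow> (c, Suc (Suc c)) \<in> X" if "ok n X" for X
    using ok_trans[OF that] by simp
  have cc: "(c, Suc (Suc c)) \<in> X \<Longrightarrow> (c, Suc c) \<in> X \<or> (Suc c, Suc (Suc c)) \<in> X" if "ok n X" for X
    using ok_cotrans[OF that, of c "Suc (Suc c)" "Suc c"] by simp
  have r: "1 \<le> c" "Suc (Suc c) \<le> n"
    using spos_range[of j] spos_range[of "Suc j"] special(2)[OF j False] j unfolding c_def by auto
  have p: "(c, Suc c) \<in> prs n" "(Suc c, Suc (Suc c)) \<in> prs n" "(c, Suc (Suc c)) \<in> prs n"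
    using r unfolding prs_def by auto
  have m: "x \<in> mt n X Y \<longleftrightarrow> x \<in> prs n \<and> x \<notin> jn (prs n - X) (prs n - Y)" for x X Y unfolding mt_def by simp
  have oc: "ok n (prs n - I)" "ok n (prs n - J)" "ok n (prs n - K)" using o by (simp_all add: ok_compl)
  show ?thesis
    using t tt[OF o(1)] tt[OF o(2)] tt[OF o(3)] cc[OF o(1)] cc[OF o(2)] cc[OF o(3)] False p
    unfolding T[OF o(1,2)] T[OF ok_mt[OF o(1,3)] ok_mt[OF o(2,3)]] K m
      jn_unit[OF oc(1,3)] jn_unit[OF oc(2,3)] jn_two[OF oc(1,3)] jn_two[OF oc(2,3)] Diff_iff
    by (cases "e ! j") (simp_all, argo+)
qed

lemma wcong_CD: "wcong n CD"
proof
  fix I J K assume c: "CD I J" and K: "ok n K"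
  have o: "ok n I" "ok n J" "\<And>j. j < length a \<Longrightarrow> tr j I = tr j J" using c unfolding CD_def by auto
  show "CD (jn I K) (jn J K)" unfolding CD_def
    using tr_jn[OF _ o(1,2) K o(3)] ok_jn[OF o(1) K] ok_jn[OF o(2) K] by simp
  show "CD (mt n I K) (mt n J K)" unfolding CD_def
    using tr_mt[OF _ o(1,2) K o(3)] ok_mt[OF o(1) K] ok_mt[OF o(2) K] by simp
qed (simp_all add: CD_def)

text \<open>The two ends of the lowest edge differ in (p,q) alone. Restriction forgets this pair
  when it lies outside the block, and the pentagon projection forgets it only on the contracted
  edge.\<close>

lemma tr_step:
  assumes j: "j < length a" and f: "(p,q,L) \<in> fences n"
  shows "tr j (ju p q L) = tr j (jv p q L) \<longleftrightarrow> (p,q) \<notin> blk j \<or> (p = spos a j \<and> q = p + 2 \<and>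
    (e ! j = ELeft \<and> L = {} \<or> e ! j = ERight \<and> L = {p + 1}))"
proof -
  have pq: "1 \<le> p" "p < q" "q \<le> n" "L \<subseteq> {p<..<q}" using f by (auto simp: fence_iff)
  have v: "jv p q L = insert (p,q) (ju p q L)" using insert_ju[OF f] by simp
  have nu: "(p,q) \<notin> ju p q L" unfolding ju_def by simp
  note ou = ok_ju[OF f] and ov = ok_jv[OF f]
  define c where "c = spos a j"
  show ?thesis
  proof (cases "(p,q) \<in> blk j")
    case b: False
    have "drop_left j (jv p q L) = drop_left j (ju p q L)" if "e ! j \<noteq> ENone"
    proof -
      have "(p,q) \<noteq> (c, Suc c)" using b special(2)[OF j that] unfolding blk_def c_def by auto
      then show ?thesis unfolding drop_left_def v c_def[symmetric] by auto
    qed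
    moreover have "drop_right j (jv p q L) = drop_right j (ju p q L)" if "e ! j \<noteq> ENone"
    proof -
      have "(p,q) \<noteq> (Suc c, Suc (Suc c))" using b special(2)[OF j that] unfolding blk_def c_def by auto
      then show ?thesis unfolding drop_right_def v c_def[symmetric] by auto
    qed
    ultimately have "drop_left j (jv p q L) \<or> drop_right j (jv p q L) \<longleftrightarrow> drop_left j (ju p q L) \<or> drop_right j (ju p q L)"
      by (cases "e ! j = ENone") (simp_all add: drop_left_def drop_right_def)
    then have "tr j (ju p q L) = tr j (jv p q L)" unfolding tr_def v using b by auto
    then show ?thesis using b by simp
  next
    case b: True
    show ?thesis
    proof (cases "e ! j = ENone")
      case True
      have "(p,q) \<in> tr j (jv p q L)" "(p,q) \<notin> tr j (ju p q L)" unfolding tr_none[OF True] v using b nu by auto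
      then have "tr j (ju p q L) \<noteq> tr j (jv p q L)" by auto
      then show ?thesis using b True by simp
    next
      case False
      note T = tr_special_eq[OF j False ou ov, folded c_def]
      note K = keep_def[of j, unfolded drop_left_def drop_right_def, folded c_def]
      consider "(p,q) = (c, Suc c)" | "(p,q) = (Suc c, Suc (Suc c))" | "(p,q) = (c, Suc (Suc c))"
        using special_pairs[OF j False ov _ b] v unfolding c_def by auto
      then show ?thesis
      proof cases
        case 1
        then show ?thesis unfolding T using b nu v c_def by auto
      next
        case 2
        then show ?thesis unfolding T using b nu v c_def by auto
      next
        case 3
        have pc: "p = c" "q = Suc (Suc c)" using 3 by auto
        have m: "(c, Suc c) \<in> ju p q L \<longleftrightarrow> Suc c \<in> L" "(Suc c, Suc (Suc c)) \<in> ju p q L \<longleftrightarrow> Suc c \<notin> L"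
          unfolding ju_def pc using pq(4) pc by (auto simp: mem_jv)
        have "{c<..<Suc (Suc c)} = {Suc c}" by auto
        then have L: "L = {} \<or> L = {Suc c}" using pq(4) subset_singletonD unfolding pc by simp
        show ?thesis unfolding T unfolding K v using m L nu b False unfolding pc c_def[symmetric]
          by (cases "e ! j") auto
      qed
    qed
  qed
qed

lemma dead_CD:
  assumes f: "(p,q,L) \<in> fences n"
  shows "wcong.dead CD p q L \<longleftrightarrow> (\<forall>j<length a. (p,q) \<notin> blk j \<or> (p = spos a j \<and> q = p + 2 \<and>
    (e ! j = ELeft \<and> L = {} \<or> e ! j = ERight \<and> L = {p + 1})))"
  unfolding wcong.dead_def[OF wcong_CD] CD_def using ok_ju[OF f] ok_jv[OF f] tr_step[OF _ f] by auto

text \<open>The block whose half-open range contains p must end before q if the pair does not fit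
  into it, and the end of that block is the cut.\<close>

lemma not_in_block_iff:
  assumes pq: "1 \<le> p" "p < q" "q \<le> n"
  shows "(\<forall>j<length a. (p,q) \<notin> blk j) \<longleftrightarrow> (\<exists>i. 1 \<le> i \<and> i < length a \<and> p < spos a i \<and> spos a i < q)"
proof
  obtain j where j: "j < length a" "spos a j \<le> p" "p < spos a (Suc j)"
    by (rule spos_locate[of p a]) (use pq spos_end in auto)
  assume "\<forall>j<length a. (p,q) \<notin> blk j"
  then have q: "spos a (Suc j) < q" using j unfolding blk_def by auto
  have "Suc j \<noteq> length a" using q spos_end pq by auto
  then show "\<exists>i. 1 \<le> i \<and> i < length a \<and> p < spos a i \<and> spos a i < q" using j q
    by (intro exI[of _ "Suc j"]) auto
next
  assume "\<exists>i. 1 \<le> i \<and> i < length a \<and> p < spos a i \<and> spos a i < q"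
  then obtain i where i: "1 \<le> i" "i < length a" "p < spos a i" "spos a i < q" by auto
  show "\<forall>j<length a. (p,q) \<notin> blk j"
  proof (intro allI impI notI)
    fix j assume j: "j < length a" "(p,q) \<in> blk j"
    then have "spos a j < spos a i" "spos a i < spos a (Suc j)" using i unfolding blk_def by auto
    then have "j < i" "i < Suc j" using spos_less_iff[OF pos] i j by auto
    then show False by simp
  qed
qed

text \<open>The two generators at a cut force exactly the fences crossing it. A pentagon generator
  spans its whole block, so any further fence below it reaches past an end of the block and already
  crosses the cut there.\<close>

lemma gen_downset_iff:
  "(p,q,L) \<in> gen_downset n (gens a e) \<longleftrightarrow> (p,q,L) \<in> fences n \<and>
    ((\<exists>i. 1 \<le> i \<and> i < length a \<and> p < spos a i \<and> spos a i < q) \<or>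
     (\<exists>j<length a. p = spos a j \<and> q = p + 2 \<and>
        (e ! j = ELeft \<and> L = {} \<or> e ! j = ERight \<and> L = {p + 1})))" (is "?l \<longleftrightarrow> ?f \<and> (?i \<or> ?j)")
proof
  assume l: ?l
  then have f: ?f unfolding gen_downset_def by auto
  then have pq: "1 \<le> p" "p < q" "q \<le> n" "L \<subseteq> {p<..<q}" by (auto simp: fence_iff)
  obtain g where g: "g \<in> gens a e" "(p,q,L) = g \<or> (p,q,L) \<prec>\<^sub>f g" using l unfolding gen_downset_def by auto
  obtain x y M where gx: "g = (x,y,M)" by (cases g) auto
  have w: "p \<le> x" "y \<le> q" "(p,q) = (x,y) \<Longrightarrow> L = M" using g(2) unfolding gx forces_def by auto
  consider (1) i where "1 \<le> i" "i < length a" "x = spos a i - 1" "y = spos a i + 1"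
    | (2) j where "j < length a" "a ! j = 2" "x = spos a j" "y = spos a (Suc j)"
      "e ! j = ELeft \<and> M = {} \<or> e ! j = ERight \<and> M = {x + 1}"
    using g(1) unfolding gx gens_def by auto
  then show "?f \<and> (?i \<or> ?j)"
  proof cases
    case 1
    \<comment> \<open>Puts \<open>spos a i\<close> above 1, hence the subtraction of 1 in the
      generator is not truncated.\<close>
    have "spos a 0 < spos a i" by (rule spos_less[OF pos]) (use 1 in auto)
    then have "p < spos a i" "spos a i < q" using w 1 spos_0[of a] by auto
    then have ?i using 1(1,2) by auto
    then show ?thesis using f by simp
  next
    case 2
    have y: "y = x + 2" using 2 spos_Suc[OF 2(1)] by simp
    show ?thesis
    proof (cases "(p,q) = (x,y)")
      case True
      then have ?j using 2 w(3)[OF True] y by (intro exI[of _ j]) auto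
      then show ?thesis using f by simp
    next
      case False
      then have "p < spos a j \<or> spos a (Suc j) < q" using w 2 by auto
      then have ?i
      proof
        assume h: "p < spos a j"
        have "j \<noteq> 0" using h spos_0[of a] pq(1) by (cases j) auto
        moreover have "spos a j < q" using 2 w y by simp
        ultimately show ?i using h 2(1) by (intro exI[of _ j]) auto
      next
        assume h: "spos a (Suc j) < q"
        have "Suc j \<noteq> length a" using h spos_end pq(3) by auto
        moreover have "p < spos a (Suc j)" using 2 w y by simp
        ultimately show ?i using h 2(1) by (intro exI[of _ "Suc j"]) auto
      qed
      then show ?thesis using f by simp
    qed
  qed
next
  assume h: "?f \<and> (?i \<or> ?j)"
  then have f: ?f by simp
  then have pq: "1 \<le> p" "p < q" "q \<le> n" "L \<subseteq> {p<..<q}" by (auto simp: fence_iff)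
  have "\<exists>g\<in>gens a e. (p,q,L) = g \<or> (p,q,L) \<prec>\<^sub>f g" using conjunct2[OF h]
  proof
    assume ?i
    then obtain i where i: "1 \<le> i" "i < length a" "p < spos a i" "spos a i < q" by auto
    define M where "M = L \<inter> {spos a i}"
    have "M = {} \<or> M = {spos a i}" unfolding M_def by auto
    then have g: "(spos a i - 1, spos a i + 1, M) \<in> gens a e" unfolding gens_def using i by auto
    have iv: "{spos a i - 1<..<spos a i + 1} = {spos a i}" using i by auto
    have "(p,q,L) = (spos a i - 1, spos a i + 1, M) \<or> (p,q,L) \<prec>\<^sub>f (spos a i - 1, spos a i + 1, M)"
    proof (cases "(p,q) = (spos a i - 1, spos a i + 1)")
      case True
      then have "L \<subseteq> {spos a i}" using pq(4) iv by auto
      then show ?thesis using True unfolding M_def by auto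
    next
      case False
      moreover have "p \<le> spos a i - 1" "spos a i - 1 < spos a i + 1" "spos a i + 1 \<le> q"
        "M = L \<inter> {spos a i - 1<..<spos a i + 1}" unfolding iv M_def using i by simp_all
      ultimately have "(p,q,L) \<prec>\<^sub>f (spos a i - 1, spos a i + 1, M)" unfolding forces_def prod.case by blast
      then show ?thesis by simp
    qed
    then show ?thesis using g by (intro bexI)
  next
    assume ?j
    then obtain j where j: "j < length a" "p = spos a j" "q = p + 2"
      "e ! j = ELeft \<and> L = {} \<or> e ! j = ERight \<and> L = {p + 1}" by auto
    have a2: "a ! j = 2" using special(1)[OF j(1)] j(4) by auto
    have "q = spos a (Suc j)" using spos_Suc[OF j(1)] a2 j by simp
    then have "(p,q,L) \<in> gens a e" unfolding gens_def using j a2 by auto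
    then show ?thesis by auto
  qed
  then show ?l unfolding gen_downset_def using f by simp
qed

lemma blk_unique: assumes "j < length a" "j' < length a" "(p,q) \<in> blk j" "(p,q) \<in> blk j'" "p < q" shows "j = j'"
proof (rule ccontr)
  assume "j \<noteq> j'"
  then consider "j < j'" | "j' < j" by linarith
  then show False
  proof cases
    case 1
    then have "spos a (Suc j) \<le> spos a j'" by (intro spos_mono) simp
    then show False using assms(3-5) unfolding blk_def by auto
  next
    case 2
    then have "spos a (Suc j') \<le> spos a j" by (intro spos_mono) simp
    then show False using assms(3-5) unfolding blk_def by auto
  qed
qed

lemma dead_CD_gen:
  assumes f: "(p,q,L) \<in> fences n"
  shows "wcong.dead CD p q L \<longleftrightarrow> (p,q,L) \<in> gen_downset n (gens a e)"
proof -
  have pq: "1 \<le> p" "p < q" "q \<le> n" using f by (auto simp: fence_iff)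
  let ?s = "\<lambda>j. p = spos a j \<and> q = p + 2 \<and> (e ! j = ELeft \<and> L = {} \<or> e ! j = ERight \<and> L = {p + 1})"
  have sb: "(p,q) \<in> blk j" if "j < length a" "?s j" for j
  proof -
    have "e ! j \<noteq> ENone" using that(2) by auto
    then show ?thesis using special(2)[OF that(1)] that(2) unfolding blk_def by simp
  qed
  have "wcong.dead CD p q L \<longleftrightarrow> (\<forall>j<length a. (p,q) \<notin> blk j) \<or> (\<exists>j<length a. ?s j)"
    unfolding dead_CD[OF f]
  proof
    assume "\<forall>j<length a. (p,q) \<notin> blk j \<or> ?s j"
    then show "(\<forall>j<length a. (p,q) \<notin> blk j) \<or> (\<exists>j<length a. ?s j)" by blast
  next
    assume "(\<forall>j<length a. (p,q) \<notin> blk j) \<or> (\<exists>j<length a. ?s j)"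
    then show "\<forall>j<length a. (p,q) \<notin> blk j \<or> ?s j"
    proof
      assume "\<exists>j<length a. ?s j"
      then obtain j where j: "j < length a" "?s j" by auto
      show ?thesis
      proof (intro allI impI)
        fix j' assume j': "j' < length a"
        show "(p,q) \<notin> blk j' \<or> ?s j'"
          using blk_unique[OF j(1) j' sb[OF j] _ pq(2)] j(2) by auto
      qed
    qed auto
  qed
  then show ?thesis unfolding gen_downset_iff not_in_block_iff[OF pq] using f by simp
qed

definition RD :: "(nat list \<times> nat list) set" where
  "RD = RC n CD"

lemma lattice_cong_RD: "lattice_cong n RD"
  unfolding RD_def by (rule lattice_cong_RC[OF wcong_CD])

lemma CR_RD: "CR n RD = CD"
  unfolding RD_def by (rule CR_RC[OF wcong_CD])

lemma FR_RD: "FR n RD = gen_downset n (gens a e)"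
proof (rule set_eqI)
  fix x :: fence
  obtain p q L where x: "x = (p,q,L)" by (cases x) auto
  show "x \<in> FR n RD \<longleftrightarrow> x \<in> gen_downset n (gens a e)"
    unfolding x FR_iff[OF lattice_cong_RD] CR_RD using dead_CD_gen[of p q L] gen_downset_iff[of p q L] by auto
qed

lemma RD_ess: "RD \<in> ess_congs n"
proof -
  have "(x, Suc x, {}) \<notin> FR n RD" for x unfolding FR_RD gen_downset_iff by auto
  then show ?thesis unfolding ess_congs_def using lattice_cong_RD by simp
qed

end

subsection \<open>The quotient as a product\<close>

lemma graph_iso_trans:
  assumes "graph_iso G H" "graph_iso H K" shows "graph_iso G K"
proof -
  obtain V E where G: "G = (V,E)" by fastforce
  obtain W F where H: "H = (W,F)" by fastforce
  obtain X D where K: "K = (X,D)" by fastforce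
  obtain f where f: "bij_betw f V W" "\<forall>x\<in>V. \<forall>y\<in>V. E x y \<longleftrightarrow> F (f x) (f y)"
    using assms(1) unfolding G H graph_iso_def by auto
  obtain g where g: "bij_betw g W X" "\<forall>x\<in>W. \<forall>y\<in>W. F x y \<longleftrightarrow> D (g x) (g y)"
    using assms(2) unfolding H K graph_iso_def by auto
  show ?thesis unfolding G K graph_iso_def prod.case
  proof (intro exI[of _ "g \<circ> f"] conjI ballI)
    show "bij_betw (g \<circ> f) V X" by (rule bij_betw_trans[OF f(1) g(1)])
    fix x y assume xy: "x \<in> V" "y \<in> V"
    have "f x \<in> W" "f y \<in> W" using bij_betw_apply[OF f(1)] xy by auto
    then show "E x y \<longleftrightarrow> D ((g \<circ> f) x) ((g \<circ> f) y)" using f(2) g(2) xy by simp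
  qed
qed

text \<open>Changing one differing coordinate of xs to a value between its two entries gives an
  intermediate tuple. So a cover differs in one coordinate only and is a cover there.\<close>

lemma covers_product:
  fixes k :: nat and V :: "nat \<Rightarrow> 'v set" and le :: "nat \<Rightarrow> 'v \<Rightarrow> 'v \<Rightarrow> bool"
  defines "P \<equiv> {xs. length xs = k \<and> (\<forall>i<k. xs ! i \<in> V i)}"
  defines "ple \<equiv> \<lambda>xs ys. \<forall>i<k. le i (xs ! i) (ys ! i)"
  assumes refl: "\<And>i x. i < k \<Longrightarrow> x \<in> V i \<Longrightarrow> le i x x"
    and anti: "\<And>i x y. i < k \<Longrightarrow> x \<in> V i \<Longrightarrow> y \<in> V i \<Longrightarrow> le i x y \<Longrightarrow> le i y x \<Longrightarrow> x = y"
    and xy: "xs \<in> P" "ys \<in> P"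
  shows "covers P ple xs ys \<longleftrightarrow>
    (\<exists>i<k. covers (V i) (le i) (xs ! i) (ys ! i) \<and> (\<forall>j<k. j \<noteq> i \<longrightarrow> xs ! j = ys ! j))" (is "?c \<longleftrightarrow> ?r")
proof -
  have l: "length xs = k" "length ys = k" and v: "\<And>i. i < k \<Longrightarrow> xs ! i \<in> V i" "\<And>i. i < k \<Longrightarrow> ys ! i \<in> V i"
    using xy unfolding P_def by auto
  have upd: "xs[i := z] \<in> P" if "i < k" "z \<in> V i" for i z
    unfolding P_def using l v that by (auto simp: nth_list_update)
  show ?thesis
  proof
    assume c: ?c
    then have ne: "xs \<noteq> ys" and le: "ple xs ys"
      and nb: "\<And>z. z \<in> P \<Longrightarrow> z \<noteq> xs \<Longrightarrow> z \<noteq> ys \<Longrightarrow> ple xs z \<Longrightarrow> ple z ys \<Longrightarrow> False"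
      unfolding covers_def by auto
    obtain i where i: "i < k" "xs ! i \<noteq> ys ! i" using ne l nth_equalityI[of xs ys] by auto
    have between: "xs[i := z] = xs \<or> xs[i := z] = ys" if z: "z \<in> V i" "le i (xs ! i) z" "le i z (ys ! i)" for z
    proof (rule ccontr)
      assume n: "\<not> ?thesis"
      have "le j (xs ! j) (xs[i := z] ! j)" if "j < k" for j
        using refl[OF that v(1)[OF that]] z(2) i(1) l(1) by (cases "j = i") simp_all
      then have 1: "ple xs (xs[i := z])" unfolding ple_def by simp
      have "le j (xs[i := z] ! j) (ys ! j)" if "j < k" for j
        using le[unfolded ple_def, rule_format, OF that] z(3) i(1) l(1) by (cases "j = i") simp_all
      then have 2: "ple (xs[i := z]) ys" unfolding ple_def by simp
      show False using nb[OF upd[OF i(1) z(1)] _ _ 1 2] n by simp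
    qed
    have "xs[i := ys ! i] = ys"
    proof -
      have "le i (xs ! i) (ys ! i)" using le i unfolding ple_def by simp
      then have "xs[i := ys ! i] = xs \<or> xs[i := ys ! i] = ys" using between[of "ys ! i"] v refl i by simp
      moreover have "xs[i := ys ! i] \<noteq> xs"
      proof
        assume "xs[i := ys ! i] = xs"
        then have "xs[i := ys ! i] ! i = xs ! i" by simp
        then show False using i l by simp
      qed
      ultimately show ?thesis by simp
    qed
    then have others: "xs ! j = ys ! j" if "j \<noteq> i" for j using that by (metis nth_list_update_neq)
    have "covers (V i) (le i) (xs ! i) (ys ! i)" unfolding covers_def
    proof (intro conjI notI)
      show "le i (xs ! i) (ys ! i)" using le i unfolding ple_def by simp
      assume "\<exists>z\<in>V i. z \<noteq> xs ! i \<and> z \<noteq> ys ! i \<and> le i (xs ! i) z \<and> le i z (ys ! i)"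
      then obtain z where z: "z \<in> V i" "z \<noteq> xs ! i" "z \<noteq> ys ! i" "le i (xs ! i) z" "le i z (ys ! i)" by auto
      have "xs[i := z] ! i = z" using i l by simp
      then show False using between[OF z(1,4,5)] z(2,3) by metis
    qed (use i in simp)
    then show "\<exists>i<k. covers (V i) (le i) (xs ! i) (ys ! i) \<and> (\<forall>j<k. j \<noteq> i \<longrightarrow> xs ! j = ys ! j)"
      using i others by (intro exI[of _ i]) simp
  next
    assume "\<exists>i<k. covers (V i) (le i) (xs ! i) (ys ! i) \<and> (\<forall>j<k. j \<noteq> i \<longrightarrow> xs ! j = ys ! j)"
    then obtain i where i: "i < k" "covers (V i) (le i) (xs ! i) (ys ! i)" "\<And>j. j < k \<Longrightarrow> j \<noteq> i \<Longrightarrow> xs ! j = ys ! j"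
      by auto
    have ci: "xs ! i \<noteq> ys ! i" "le i (xs ! i) (ys ! i)"
      "\<And>z. z \<in> V i \<Longrightarrow> le i (xs ! i) z \<Longrightarrow> le i z (ys ! i) \<Longrightarrow> z = xs ! i \<or> z = ys ! i"
      using i(2) unfolding covers_def by auto
    show "covers P ple xs ys" unfolding covers_def
    proof (intro conjI notI)
      show "ple xs ys" unfolding ple_def
      proof (intro allI impI)
        fix j assume j: "j < k"
        show "le j (xs ! j) (ys ! j)" using ci(2) i(3)[OF j] refl[OF j v(1)[OF j]] by (cases "j = i") auto
      qed
      show False if "xs = ys" using that ci(1) by simp
      assume "\<exists>z\<in>P. z \<noteq> xs \<and> z \<noteq> ys \<and> ple xs z \<and> ple z ys"
      then obtain z where z: "z \<in> P" "z \<noteq> xs" "z \<noteq> ys" "ple xs z" "ple z ys" by auto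
      have lz: "length z = k" and vz: "\<And>i. i < k \<Longrightarrow> z ! i \<in> V i" using z(1) unfolding P_def by auto
      have o: "z ! j = xs ! j" if "j < k" "j \<noteq> i" for j
      proof (rule anti[OF that(1) vz[OF that(1)] v(1)[OF that(1)]])
        show "le j (z ! j) (xs ! j)" using z(5) that i(3)[OF that] unfolding ple_def by simp
        show "le j (xs ! j) (z ! j)" using z(4) that unfolding ple_def by simp
      qed
      have "z ! i = xs ! i \<or> z ! i = ys ! i"
        by (rule ci(3)[OF vz[OF i(1)]]) (use z(4,5) i(1) in \<open>simp_all add: ple_def\<close>)
      then show False
      proof
        assume zi: "z ! i = xs ! i"
        have eqx: "z ! j = xs ! j" if "j < k" for j using o[OF that] zi by (cases "j = i") auto
        have "z = xs" by (rule nth_equalityI) (simp add: lz l, rule eqx, simp add: lz)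
        then show False using z(2) by simp
      next
        assume zi: "z ! i = ys ! i"
        have "z ! j = ys ! j" if "j < k" for j using o[OF that] i(3)[OF that] zi by (cases "j = i") auto
        then have "z = ys" by (intro nth_equalityI) (use lz l in auto)
        then show False using z(3) by simp
      qed
    qed
  qed
qed

text \<open>The pentagon lattice with long side 0 < 1 < 2 < 3 and short side 0 < 4 < 3; with this
  numbering its covers are the edges of the cycle \<open>C5\<close>.\<close>

definition le5 :: "nat list \<Rightarrow> nat list \<Rightarrow> bool" where
  "le5 x y \<longleftrightarrow> x = y \<or> x = [0] \<or> y = [3] \<or> (x = [1] \<and> y = [2])"

lemma less_5: "k < 5 \<longleftrightarrow> k = 0 \<or> k = 1 \<or> k = 2 \<or> k = 3 \<or> k = (4::nat)"
  by presburger

lemma C5_vertices: "fst C5 = {[0],[1],[2],[3],[4]}"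
  unfolding C5_def less_5 by auto

lemma C5_edge: assumes "k < 5" "l < 5" shows "snd C5 [k] [l] \<longleftrightarrow> l = Suc k mod 5 \<or> k = Suc l mod 5"
  using assms unfolding C5_def by auto

lemma C5_covers:
  assumes "x \<in> fst C5" "y \<in> fst C5"
  shows "snd C5 x y \<longleftrightarrow> covers (fst C5) le5 x y \<or> covers (fst C5) le5 y x"
proof -
  have e: "snd C5 [k] [l] \<longleftrightarrow> l = Suc k mod 5 \<or> k = Suc l mod 5" if "k < 5" "l < 5" for k l
    by (rule C5_edge[OF that])
  show ?thesis
    using assms unfolding C5_vertices covers_def le5_def
    by (elim insertE; simp add: e)
qed

lemma weak_graph_covers: "snd (weak_graph m) x y \<longleftrightarrow> covers (perms m) weak_le x y \<or> covers (perms m) weak_le y x"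
  unfolding weak_graph_def cover_graph_covers by simp

section \<open>Blocks as factors of the quotient\<close>

context block_data
begin

text \<open>Enlarging I can only switch the conditions \<open>drop_left\<close> and
  \<open>drop_right\<close> off.\<close>

lemma tr_mono: "I \<subseteq> J \<Longrightarrow> tr j I \<subseteq> tr j J"
  unfolding tr_def drop_left_def drop_right_def by auto

lemma unit_blk: assumes "j < length a" "e ! j \<noteq> ENone"
  shows "(spos a j, Suc (spos a j)) \<in> blk j" "(Suc (spos a j), Suc (Suc (spos a j))) \<in> blk j"
    "(spos a j, Suc (Suc (spos a j))) \<in> blk j"
  unfolding blk_def special(2)[OF assms] by auto

lemma tr_cong:
  assumes j: "j < length a" and e: "I \<inter> blk j = J \<inter> blk j" shows "tr j I = tr j J"
proof -
  have m: "x \<in> blk j \<Longrightarrow> x \<in> I \<longleftrightarrow> x \<in> J" for x using e by auto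
  have d: "drop_left j I = drop_left j J" "drop_right j I = drop_right j J"
    unfolding drop_left_def drop_right_def using unit_blk[OF j] m by (metis eps.distinct(1,3))+
  show ?thesis unfolding tr_def d using m by auto
qed

lemma tr_tr: assumes j: "j < length a" shows "tr j (tr j I) = tr j I"
proof -
  have "drop_left j (tr j I) = drop_left j I"
  proof (cases "e ! j = ENone")
    case False
    then show ?thesis unfolding drop_left_def using unit_blk[OF j False] by (auto simp: tr_def)
  qed (simp add: drop_left_def)
  moreover have "drop_right j (tr j I) = drop_right j I"
  proof (cases "e ! j = ENone")
    case False
    then show ?thesis unfolding drop_right_def using unit_blk[OF j False] by (auto simp: tr_def)
  qed (simp add: drop_right_def)
  ultimately show ?thesis unfolding tr_def[of j "tr j I"] by (auto simp: tr_def[of j I])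
qed

text \<open>Dropping the outer pair cannot spoil transitivity, as the drop condition says that one
  of the two unit pairs composing it is missing. Cotransitivity survives because no longer pair of
  the block could need it.\<close>

lemma ok_tr: assumes j: "j < length a" and I: "ok n I" shows "ok n (tr j I)"
proof (rule okI)
  fix p q assume "(p,q) \<in> tr j I" then show "1 \<le> p \<and> p < q \<and> q \<le> n" using okD[OF I, of p q] tr_sub by auto
next
  fix p q r assume h: "(p,q) \<in> tr j I" "(q,r) \<in> tr j I"
  then have i: "(p,q) \<in> I" "(q,r) \<in> I" "(p,q) \<in> blk j" "(q,r) \<in> blk j" unfolding tr_def by auto
  have pr: "(p,r) \<in> I" by (rule ok_trans[OF I i(1,2)])
  have b: "(p,r) \<in> blk j" using i(3,4) unfolding blk_def by auto
  have lt: "p < q" "q < r" using okD(2)[OF I] i(1,2) by auto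
  show "(p,r) \<in> tr j I"
  proof (rule ccontr)
    assume "(p,r) \<notin> tr j I"
    then have d: "drop_left j I \<or> drop_right j I" "p = spos a j" "r = Suc (Suc (spos a j))"
      using pr b unfolding tr_def by auto
    then have "q = Suc (spos a j)" using lt by simp
    then show False using d i unfolding drop_left_def drop_right_def by auto
  qed
next
  fix p r q assume h: "(p,q) \<in> tr j I" "p < r" "r < q"
  then have i: "(p,q) \<in> I" "(p,q) \<in> blk j" unfolding tr_def by auto
  have b: "(p,r) \<in> blk j" "(r,q) \<in> blk j" using i(2) h unfolding blk_def by auto
  have d: "e ! j \<noteq> ENone" if "drop_left j I \<or> drop_right j I" using that unfolding drop_left_def drop_right_def by auto
  have n: "\<not> ((drop_left j I \<or> drop_right j I) \<and> (p,r) = (spos a j, Suc (Suc (spos a j))))"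
    "\<not> ((drop_left j I \<or> drop_right j I) \<and> (r,q) = (spos a j, Suc (Suc (spos a j))))"
    using d i(2) h special(2)[OF j] unfolding blk_def by auto
  show "(p,r) \<in> tr j I \<or> (r,q) \<in> tr j I"
    using ok_cotrans[OF I i(1) h(2,3)] b n unfolding tr_def by auto
qed

definition glue :: "(nat \<Rightarrow> (nat \<times> nat) set) \<Rightarrow> (nat \<times> nat) set" where
  "glue S = (\<Union>j<length a. S j)\<^sup>+"

lemma ok_glue: assumes "\<And>j. j < length a \<Longrightarrow> ok n (S j)" shows "ok n (glue S)"
  unfolding glue_def
proof (rule trancl_ok)
  show "(\<Union>j<length a. S j) \<subseteq> prs n" using ok_prs[OF assms] by auto
  show "cotrans (\<Union>j<length a. S j)" unfolding cotrans_def
  proof (intro allI impI)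
    fix p r q assume h: "(p,q) \<in> (\<Union>j<length a. S j)" "p < r" "r < q"
    then obtain j where j: "j < length a" "(p,q) \<in> S j" by auto
    then show "(p,r) \<in> (\<Union>j<length a. S j) \<or> (r,q) \<in> (\<Union>j<length a. S j)"
      using ok_cotrans[OF assms[OF j(1)] j(2) h(2,3)] by auto
  qed
qed

text \<open>A path that starts and ends in block j stays in it, and each of its steps comes from S j
  since a pair lies in only one block.\<close>

lemma glue_blk:
  assumes S: "\<And>j. j < length a \<Longrightarrow> ok n (S j)" "\<And>j. j < length a \<Longrightarrow> S j \<subseteq> blk j" and j: "j < length a"
  shows "glue S \<inter> blk j = S j"
proof
  have U: "x < y" if "(x,y) \<in> (\<Union>j<length a. S j)" for x y using that okD(2)[OF S(1)] by auto
  have "(x,y) \<in> S j" if "(x,y) \<in> glue S" "spos a j \<le> x" "y \<le> spos a (Suc j)" for x y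
    using that unfolding glue_def
  proof (induction rule: trancl.induct)
    case (r_into_trancl x y)
    then obtain k where k: "k < length a" "(x,y) \<in> S k" by auto
    have "(x,y) \<in> blk k" "(x,y) \<in> blk j" "x < y"
      using S(2)[OF k(1)] k(2) r_into_trancl okD(2)[OF S(1)[OF k(1)] k(2)] by (auto simp: blk_def)
    then have "k = j" using blk_unique[OF k(1) j] by simp
    then show ?case using k by simp
  next
    case (trancl_into_trancl x y z)
    have yz: "y < z" using U trancl_into_trancl.hyps(2) by simp
    have xy: "x < y" using okD(2)[OF ok_glue[of S, OF S(1)], of x y] trancl_into_trancl.hyps(1) unfolding glue_def by simp
    have 1: "(x,y) \<in> S j" using trancl_into_trancl yz by simp
    obtain k where k: "k < length a" "(y,z) \<in> S k" using trancl_into_trancl.hyps(2) by auto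
    have "(y,z) \<in> blk k" using S(2)[OF k(1)] k(2) by auto
    moreover have "(y,z) \<in> blk j" using trancl_into_trancl.prems xy unfolding blk_def by auto
    ultimately have "k = j" using blk_unique[OF k(1) j] yz by simp
    then show ?case using ok_trans[OF S(1)[OF j] 1] k by simp
  qed
  then show "glue S \<inter> blk j \<subseteq> S j" by (auto simp: blk_def)
  show "S j \<subseteq> glue S \<inter> blk j" using S(2)[OF j] j unfolding glue_def by auto
qed

lemma glue_mono: assumes "\<And>j. j < length a \<Longrightarrow> S j \<subseteq> T j" shows "glue S \<subseteq> glue T"
  unfolding glue_def by (rule trancl_mono_subset) (use assms in auto)

lemma tr_glue:
  assumes "\<And>j. j < length a \<Longrightarrow> ok n (S j)" "\<And>j. j < length a \<Longrightarrow> S j \<subseteq> blk j" "j < length a"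
  shows "tr j (glue S) = tr j (S j)"
  by (rule tr_cong[OF assms(3)]) (use glue_blk[of S, OF assms] assms(2)[OF assms(3)] in auto)

text \<open>A canonical member of the class that depends only on the traces in the blocks. As gluing
  is monotone, classes can be compared trace by trace.\<close>

lemma CD_glue_tr: assumes I: "ok n I" shows "CD I (glue (\<lambda>j. tr j I))"
proof -
  have o: "\<And>j. j < length a \<Longrightarrow> ok n (tr j I)" using ok_tr I by simp
  have "tr j I = tr j (glue (\<lambda>j. tr j I))" if j: "j < length a" for j
    using tr_glue[of "\<lambda>j. tr j I", OF o tr_blk j] tr_tr[OF j] by simp
  then show ?thesis unfolding CD_def using I ok_glue[of "\<lambda>j. tr j I", OF o] by simp
qed

text \<open>The values of block j are shifted down to 1, ..., a!j + 1. The guard excludes pairs that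
  would start left of the block; the guards in \<open>up\<close> keep the subtraction exact.\<close>

definition dn :: "nat \<Rightarrow> (nat \<times> nat) set \<Rightarrow> (nat \<times> nat) set" where
  "dn j S = {(p,q). 1 \<le> p \<and> (p + (spos a j - 1), q + (spos a j - 1)) \<in> S}"

definition up :: "nat \<Rightarrow> (nat \<times> nat) set \<Rightarrow> (nat \<times> nat) set" where
  "up j X = {(p,q). spos a j \<le> p \<and> spos a j \<le> q \<and> (p - (spos a j - 1), q - (spos a j - 1)) \<in> X}"

lemma ok_dn: assumes j: "j < length a" and S: "ok n S" "S \<subseteq> blk j" shows "ok (a ! j + 1) (dn j S)"
proof (rule okI)
  have s1: "1 \<le> spos a j" using spos_range[of j] j by simp
  fix p q assume "(p,q) \<in> dn j S"
  then have h: "1 \<le> p" "(p + (spos a j - 1), q + (spos a j - 1)) \<in> S" unfolding dn_def by auto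
  then have "p < q" using okD(2)[OF S(1)] by fastforce
  moreover have "q + (spos a j - 1) \<le> spos a (Suc j)" using h(2) S(2) unfolding blk_def by auto
  ultimately show "1 \<le> p \<and> p < q \<and> q \<le> a ! j + 1" using h(1) spos_Suc[OF j] s1 by simp
next
  fix p q r assume "(p,q) \<in> dn j S" "(q,r) \<in> dn j S"
  then show "(p,r) \<in> dn j S" unfolding dn_def
    using ok_trans[OF S(1), of "p + (spos a j - 1)" "q + (spos a j - 1)" "r + (spos a j - 1)"] by simp
next
  fix p r q assume "(p,q) \<in> dn j S" "p < r" "r < q"
  then show "(p,r) \<in> dn j S \<or> (r,q) \<in> dn j S" unfolding dn_def
    using ok_cotrans[OF S(1), of "p + (spos a j - 1)" "q + (spos a j - 1)" "r + (spos a j - 1)"] by auto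
qed

lemma ok_up: assumes j: "j < length a" and X: "ok (a ! j + 1) X" shows "ok n (up j X)" "up j X \<subseteq> blk j"
proof -
  have s1: "1 \<le> spos a j" "spos a (Suc j) \<le> n" using spos_range[of j] spos_range[of "Suc j"] j by auto
  have r: "spos a j \<le> p \<and> p < q \<and> q \<le> spos a (Suc j)" if "(p,q) \<in> up j X" for p q
  proof -
    have h: "spos a j \<le> p" "spos a j \<le> q" "(p - (spos a j - 1), q - (spos a j - 1)) \<in> X" using that unfolding up_def by auto
    have "p - (spos a j - 1) < q - (spos a j - 1)" "q - (spos a j - 1) \<le> a ! j + 1" using okD[OF X h(3)] by auto
    then show ?thesis using h(1,2) s1 spos_Suc[OF j] by linarith
  qed
  show "up j X \<subseteq> blk j" using r unfolding blk_def by auto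
  show "ok n (up j X)"
  proof (rule okI)
    fix p q assume "(p,q) \<in> up j X" then show "1 \<le> p \<and> p < q \<and> q \<le> n" using r[of p q] s1 by auto
  next
    fix p q t assume "(p,q) \<in> up j X" "(q,t) \<in> up j X"
    then show "(p,t) \<in> up j X" unfolding up_def
      using ok_trans[OF X, of "p - (spos a j - 1)" "q - (spos a j - 1)" "t - (spos a j - 1)"] by simp
  next
    fix p t q assume h: "(p,q) \<in> up j X" "p < t" "t < q"
    have p: "spos a j \<le> p" "spos a j \<le> t" "spos a j \<le> q" using r[OF h(1)] h by auto
    then have l: "p - (spos a j - 1) < t - (spos a j - 1)" "t - (spos a j - 1) < q - (spos a j - 1)"
      using h s1 by linarith+
    show "(p,t) \<in> up j X \<or> (t,q) \<in> up j X"
      using ok_cotrans[OF X _ l] h(1) p unfolding up_def by auto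
  qed
qed

lemma dn_up: assumes j: "j < length a" and X: "ok (a ! j + 1) X" shows "dn j (up j X) = X"
proof -
  have s1: "1 \<le> spos a j" using spos_range[of j] j by simp
  show ?thesis
  proof (rule set_eqI)
    fix x :: "nat \<times> nat"
    obtain p q where x: "x = (p,q)" by fastforce
    show "x \<in> dn j (up j X) \<longleftrightarrow> x \<in> X" unfolding x dn_def up_def using okD[OF X, of p q] s1 by auto
  qed
qed

lemma dn_mono_iff: assumes j: "j < length a" and S: "ok n S" "S \<subseteq> blk j"
  shows "S \<subseteq> T \<longleftrightarrow> dn j S \<subseteq> dn j T"
proof
  have s1: "1 \<le> spos a j" using spos_range[of j] j by simp
  assume d: "dn j S \<subseteq> dn j T"
  show "S \<subseteq> T"
  proof (rule subrelI)
    fix p q assume pq: "(p,q) \<in> S"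
    then have r: "spos a j \<le> p" "p < q" using S(2) okD(2)[OF S(1) pq] unfolding blk_def by auto
    have "(p - (spos a j - 1), q - (spos a j - 1)) \<in> dn j S" unfolding dn_def using pq r s1 by auto
    then have "(p - (spos a j - 1), q - (spos a j - 1)) \<in> dn j T" using d by auto
    then show "(p,q) \<in> T" unfolding dn_def using r s1 by auto
  qed
qed (auto simp: dn_def)

text \<open>The unit pair that starts the long side of the pentagon, the side without a contracted
  edge; \<open>snd_unit\<close> starts the short side.\<close>

definition fst_unit :: "nat \<Rightarrow> nat \<times> nat" where
  "fst_unit j = (if e ! j = ELeft then (spos a j, Suc (spos a j)) else (Suc (spos a j), Suc (Suc (spos a j))))"

definition snd_unit :: "nat \<Rightarrow> nat \<times> nat" where
  "snd_unit j = (if e ! j = ELeft then (Suc (spos a j), Suc (Suc (spos a j))) else (spos a j, Suc (spos a j)))"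

definition top_pair :: "nat \<Rightarrow> nat \<times> nat" where
  "top_pair j = (spos a j, Suc (Suc (spos a j)))"

text \<open>The five values of the pentagon projection, numbered as in \<open>le5\<close>: 0 to 3 up
  the long side and 4 on the short side.\<close>

definition cset :: "nat \<Rightarrow> nat \<Rightarrow> (nat \<times> nat) set" where
  "cset j k = (if k = 0 then {} else if k = 1 then {fst_unit j} else if k = 2 then {fst_unit j, top_pair j}
    else if k = 3 then {fst_unit j, snd_unit j, top_pair j} else {snd_unit j})"

lemma units_distinct: "fst_unit j \<noteq> snd_unit j" "fst_unit j \<noteq> top_pair j" "snd_unit j \<noteq> top_pair j"
  unfolding fst_unit_def snd_unit_def top_pair_def by auto

lemma cset_mono: assumes "k < 5" "l < 5" shows "cset j k \<subseteq> cset j l \<longleftrightarrow> le5 [k] [l]"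
  using assms units_distinct[of j] unfolding less_5
  by (elim disjE; simp add: cset_def le5_def)

lemma cset_inj: assumes "k < 5" "l < 5" "cset j k = cset j l" shows "k = l"
proof -
  have "le5 [k] [l]" "le5 [l] [k]" using cset_mono[OF assms(1,2)] cset_mono[OF assms(2,1)] assms(3) by auto
  then show ?thesis unfolding le5_def by auto
qed

lemma cset_ok: assumes j: "j < length a" "e ! j \<noteq> ENone" shows "ok n (cset j k)" "cset j k \<subseteq> blk j"
proof -
  have r: "1 \<le> spos a j" "Suc (Suc (spos a j)) \<le> n"
    using spos_range[of j] spos_range[of "Suc j"] special(2)[OF j] j by auto
  show "cset j k \<subseteq> blk j" unfolding cset_def fst_unit_def snd_unit_def top_pair_def using unit_blk[OF j] by simp
  define c where "c = spos a j"
  have o: "ok n {}" "ok n {(c, Suc c)}" "ok n {(Suc c, Suc (Suc c))}" "ok n {(c, Suc c), (c, Suc (Suc c))}"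
    "ok n {(Suc c, Suc (Suc c)), (c, Suc (Suc c))}" "ok n {(c, Suc c), (Suc c, Suc (Suc c)), (c, Suc (Suc c))}"
    using r[folded c_def] by (auto intro!: okI)
  show "ok n (cset j k)"
    unfolding cset_def fst_unit_def snd_unit_def top_pair_def c_def[symmetric] using o by (simp add: insert_commute)
qed

lemma tr_cset: assumes j: "j < length a" "e ! j \<noteq> ENone" shows "tr j (cset j k) = cset j k"
proof -
  have d: "\<not> (drop_left j (cset j k) \<or> drop_right j (cset j k)) \<or> top_pair j \<notin> cset j k"
    using j(2) units_distinct[of j]
    unfolding cset_def drop_left_def drop_right_def fst_unit_def snd_unit_def top_pair_def by (cases "e ! j") auto
  show ?thesis unfolding tr_def using d cset_ok(2)[OF j, of k] unfolding top_pair_def by auto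
qed

text \<open>After the projection the outer pair occurs only together with \<open>fst_unit\<close>,
  so five of the six words of the hexagon remain.\<close>

lemma tr_cases: assumes j: "j < length a" "e ! j \<noteq> ENone" and I: "ok n I"
  shows "\<exists>k<5. tr j I = cset j k"
proof -
  define c where "c = spos a j"
  note T = tr_special[OF j I, folded c_def] and K = keep_def[of j I, unfolded drop_left_def drop_right_def, folded c_def]
  define f s t where "f = fst_unit j" and "s = snd_unit j" and "t = top_pair j"
  note fst = f_def[unfolded fst_unit_def, folded c_def] s_def[unfolded snd_unit_def, folded c_def]
    t_def[unfolded top_pair_def, folded c_def]
  have tt: "t \<in> I" if "f \<in> I" "s \<in> I"
    using ok_trans[OF I, of c "Suc c" "Suc (Suc c)"] that unfolding fst by (simp split: if_splits)
  have eq: "x \<in> tr j I \<longleftrightarrow> x = f \<and> f \<in> I \<or> x = s \<and> s \<in> I \<or> x = t \<and> t \<in> I \<and> f \<in> I" for x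
  proof (cases "e ! j")
    case ENone then show ?thesis using j(2) by simp
  next
    case ELeft
    then have "f = (c, Suc c)" "s = (Suc c, Suc (Suc c))" "t = (c, Suc (Suc c))" unfolding fst by simp_all
    then show ?thesis unfolding T K using ELeft by auto
  next
    case ERight
    then have "s = (c, Suc c)" "f = (Suc c, Suc (Suc c))" "t = (c, Suc (Suc c))" unfolding fst by simp_all
    then show ?thesis unfolding T K using ERight by auto
  qed
  have c: "cset j 0 = {}" "cset j 1 = {f}" "cset j 2 = {f,t}" "cset j 3 = {f,s,t}" "cset j 4 = {s}"
    unfolding cset_def f_def s_def t_def by simp_all
  consider "f \<in> I" "s \<in> I" | "f \<in> I" "s \<notin> I" "t \<in> I" | "f \<in> I" "s \<notin> I" "t \<notin> I"
    | "f \<notin> I" "s \<in> I" | "f \<notin> I" "s \<notin> I" by argo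
  then show ?thesis
  proof cases
    case 1
    have "tr j I = cset j 3" unfolding c by (rule set_eqI) (simp add: eq 1 tt[OF 1])
    then show ?thesis by (intro exI[of _ 3]) simp
  next
    case 2
    have "tr j I = cset j 2" unfolding c by (rule set_eqI) (simp add: eq 2)
    then show ?thesis by (intro exI[of _ 2]) simp
  next
    case 3
    have "tr j I = cset j 1" unfolding c by (rule set_eqI) (simp add: eq 3)
    then show ?thesis by (intro exI[of _ 1]) simp
  next
    case 4
    have "tr j I = cset j 4" unfolding c by (rule set_eqI) (simp add: eq 4)
    then show ?thesis by (intro exI[of _ 4]) simp
  next
    case 5
    have "tr j I = cset j 0" unfolding c by (rule set_eqI) (simp add: eq 5)
    then show ?thesis by (intro exI[of _ 0]) simp
  qed
qed

definition vert :: "nat \<Rightarrow> (nat \<times> nat) set \<Rightarrow> nat list" where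
  "vert j S = (if e ! j = ENone then perm_of (a ! j + 1) (dn j S) else [THE k. k < 5 \<and> S = cset j k])"

definition leb :: "nat \<Rightarrow> nat list \<Rightarrow> nat list \<Rightarrow> bool" where
  "leb j = (if e ! j = ENone then weak_le else le5)"

definition VB :: "nat \<Rightarrow> nat list set" where
  "VB j = (if e ! j = ENone then perms (a ! j + 1) else fst C5)"

lemma vert_cset: assumes "e ! j \<noteq> ENone" "k < 5" shows "vert j (cset j k) = [k]"
proof -
  have "(THE l. l < 5 \<and> cset j k = cset j l) = k"
    by (rule the_equality) (use assms cset_inj in auto)
  then show ?thesis unfolding vert_def using assms by simp
qed

lemma vert_in: assumes j: "j < length a" and I: "ok n I" shows "vert j (tr j I) \<in> VB j"
proof (cases "e ! j = ENone")
  case True then show ?thesis unfolding vert_def VB_def by (simp only: simp_thms if_True perm_of_perms)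
next
  case False
  obtain k where k: "k < 5" "tr j I = cset j k" using tr_cases[OF j False I] by auto
  have "vert j (tr j I) = [k]" unfolding k(2) by (rule vert_cset[OF False k(1)])
  then show ?thesis unfolding VB_def C5_vertices using False k(1) less_5[of k] by auto
qed

lemma vert_le: assumes j: "j < length a" and I: "ok n I" "ok n J"
  shows "leb j (vert j (tr j I)) (vert j (tr j J)) \<longleftrightarrow> tr j I \<subseteq> tr j J"
proof (cases "e ! j = ENone")
  case True
  have o: "ok (a ! j + 1) (dn j (tr j I))" "ok (a ! j + 1) (dn j (tr j J))"
    by (rule ok_dn[OF j ok_tr[OF j] tr_blk], rule I)+
  have "leb j (vert j (tr j I)) (vert j (tr j J)) \<longleftrightarrow> dn j (tr j I) \<subseteq> dn j (tr j J)"
    unfolding leb_def vert_def using True weak_le_perm_of[OF o] by simp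
  also have "\<dots> \<longleftrightarrow> tr j I \<subseteq> tr j J" using dn_mono_iff[OF j ok_tr[OF j I(1)] tr_blk] by simp
  finally show ?thesis .
next
  case False
  obtain k where k: "k < 5" "tr j I = cset j k" using tr_cases[OF j False I(1)] by auto
  obtain l where l: "l < 5" "tr j J = cset j l" using tr_cases[OF j False I(2)] by auto
  show ?thesis unfolding k(2) l(2) vert_cset[OF False k(1)] vert_cset[OF False l(1)] leb_def
    using False cset_mono[OF k(1) l(1)] by simp
qed

lemma vert_surj: assumes j: "j < length a" and v: "v \<in> VB j"
  shows "\<exists>S. ok n S \<and> S \<subseteq> blk j \<and> tr j S = S \<and> vert j S = v"
proof (cases "e ! j = ENone")
  case True
  then have v: "v \<in> perms (a ! j + 1)" using v unfolding VB_def by simp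
  have o: "ok (a ! j + 1) (invs v)" by (rule invs_ok[OF v])
  note u = ok_up[OF j o]
  have "tr j (up j (invs v)) = up j (invs v)" unfolding tr_none[OF True] using u(2) by auto
  moreover have "vert j (up j (invs v)) = v" unfolding vert_def dn_up[OF j o] perm_of_invs[OF v] using True by simp
  ultimately show ?thesis using u by (intro exI[of _ "up j (invs v)"]) simp
next
  case False
  obtain k where k: "k < 5" "v = [k]" using v False unfolding VB_def C5_def by auto
  show ?thesis unfolding k(2)
    by (intro exI[of _ "cset j k"] conjI cset_ok[OF j False] tr_cset[OF j False] vert_cset[OF False k(1)])
qed

lemma factors_nth: assumes "j < length a"
  shows "factors a e ! j = (if e ! j = ENone then weak_graph (a ! j + 1) else C5)"
  using assms special(1)[OF assms] unfolding factors_def by auto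

lemma leb_order:
  assumes j: "j < length a"
  shows "x \<in> VB j \<Longrightarrow> leb j x x" "x \<in> VB j \<Longrightarrow> y \<in> VB j \<Longrightarrow> leb j x y \<Longrightarrow> leb j y x \<Longrightarrow> x = y"
proof -
  show "leb j x x" unfolding leb_def weak_le_def le5_def by simp
  show "x = y" if h: "x \<in> VB j" "y \<in> VB j" "leb j x y" "leb j y x"
  proof (cases "e ! j = ENone")
    case True
    have "x \<in> perms (a ! j + 1)" "y \<in> perms (a ! j + 1)" using h(1,2) True unfolding VB_def by simp_all
    moreover have "invs x = invs y" using h(3,4) True unfolding leb_def weak_le_def by auto
    ultimately show ?thesis by (rule invs_inj)
  next
    case False
    then have "le5 x y" "le5 y x" using h(3,4) unfolding leb_def by simp_all
    then show ?thesis unfolding le5_def by (elim disjE conjE) simp_all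
  qed
qed

text \<open>A class corresponds to the tuple of its traces, with \<open>glue\<close> as inverse. The
  order is coordinatewise by \<open>tr_mono\<close> and \<open>glue_mono\<close>, and
  \<open>covers_product\<close> turns covers of the product into edges of the Cartesian
  product.\<close>

theorem quotient_iso: "graph_iso (Q n RD) (cart_prod (factors a e))"
proof -
  interpret W: wcong n CD by (rule wcong_CD)
  let ?m = "length a"
  let ?P = "{xs. length xs = ?m \<and> (\<forall>i<?m. xs ! i \<in> VB i)}"
  let ?ple = "\<lambda>xs ys. \<forall>i<?m. leb i (xs ! i) (ys ! i)"
  let ?V = "W.cl ` {I. ok n I}"
  \<comment> \<open>The chosen member is immaterial, as traces are constant on a class;
    \<open>Fcl\<close> records this.\<close>
  define F where "F X = map (\<lambda>j. vert j (tr j (SOME I. I \<in> X))) [0..<?m]" for X :: "(nat \<times> nat) set set"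
  have Fcl: "F (W.cl I) = map (\<lambda>j. vert j (tr j I)) [0..<?m]" if I: "ok n I" for I
  proof -
    have "I \<in> W.cl I" unfolding W.cl_def using W.Crefl[OF I] by simp
    then have "(SOME J. J \<in> W.cl I) \<in> W.cl I" by (rule someI)
    then have "CD I (SOME J. J \<in> W.cl I)" unfolding W.cl_def by simp
    then have "tr j (SOME J. J \<in> W.cl I) = tr j I" if "j < ?m" for j unfolding CD_def using that by simp
    then show ?thesis unfolding F_def by simp
  qed
  have le: "(\<exists>I'\<in>W.cl I. \<exists>J'\<in>W.cl J. I' \<subseteq> J') \<longleftrightarrow> ?ple (F (W.cl I)) (F (W.cl J))" if o: "ok n I" "ok n J" for I J
  proof -
    have "?ple (F (W.cl I)) (F (W.cl J)) \<longleftrightarrow> (\<forall>j<?m. tr j I \<subseteq> tr j J)"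
      unfolding Fcl[OF o(1)] Fcl[OF o(2)] using vert_le[OF _ o] by simp
    also have "\<dots> \<longleftrightarrow> (\<exists>I'\<in>W.cl I. \<exists>J'\<in>W.cl J. I' \<subseteq> J')"
    proof
      assume h: "\<forall>j<?m. tr j I \<subseteq> tr j J"
      have "glue (\<lambda>j. tr j I) \<subseteq> glue (\<lambda>j. tr j J)" by (rule glue_mono) (use h in simp)
      moreover have "glue (\<lambda>j. tr j I) \<in> W.cl I" "glue (\<lambda>j. tr j J) \<in> W.cl J"
        unfolding W.cl_def using CD_glue_tr o by auto
      ultimately show "\<exists>I'\<in>W.cl I. \<exists>J'\<in>W.cl J. I' \<subseteq> J'" by (intro bexI)
    next
      assume "\<exists>I'\<in>W.cl I. \<exists>J'\<in>W.cl J. I' \<subseteq> J'"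
      then obtain I' J' where h: "CD I I'" "CD J J'" "I' \<subseteq> J'" unfolding W.cl_def by auto
      have "tr j I' \<subseteq> tr j J'" for j by (rule tr_mono[OF h(3)])
      then show "\<forall>j<?m. tr j I \<subseteq> tr j J" using h(1,2) unfolding CD_def by simp
    qed
    finally show ?thesis by simp
  qed
  have bij: "bij_betw F ?V ?P"
  proof (rule bij_betw_imageI)
    show "inj_on F ?V"
    proof (rule inj_onI)
      fix X Y assume h: "X \<in> ?V" "Y \<in> ?V" "F X = F Y"
      from h(1) obtain I where I: "X = W.cl I" "ok n I" by auto
      from h(2) obtain J where J: "Y = W.cl J" "ok n J" by auto
      have "vert j (tr j I) = vert j (tr j J)" if "j < ?m" for j
        using arg_cong[OF h(3), of "\<lambda>xs. xs ! j"] that unfolding I(1) J(1) Fcl[OF I(2)] Fcl[OF J(2)] by simp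
      then have "tr j I = tr j J" if "j < ?m" for j
        using vert_le[OF that I(2) J(2)] vert_le[OF that J(2) I(2)] leb_order(1)[OF that vert_in[OF that I(2)]] that by auto
      then have "CD I J" unfolding CD_def using I J by simp
      then show "X = Y" using W.cl_eq[OF I(2) J(2)] I J by simp
    qed
    show "F ` ?V = ?P"
    proof (intro equalityI subsetI)
      fix xs assume "xs \<in> F ` ?V"
      then obtain I where I: "ok n I" "xs = F (W.cl I)" by auto
      then show "xs \<in> ?P" using Fcl[OF I(1)] vert_in by simp
    next
      fix xs assume xs: "xs \<in> ?P"
      have "\<forall>j\<in>{..<?m}. \<exists>S. ok n S \<and> S \<subseteq> blk j \<and> tr j S = S \<and> vert j S = xs ! j"
        using vert_surj xs by simp
      from bchoice[OF this] obtain S where S: "\<forall>j\<in>{..<?m}. ok n (S j) \<and> S j \<subseteq> blk j \<and> tr j (S j) = S j \<and> vert j (S j) = xs ! j" ..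
      have o: "\<And>j. j < ?m \<Longrightarrow> ok n (S j)" "\<And>j. j < ?m \<Longrightarrow> S j \<subseteq> blk j" using S by auto
      have okg: "ok n (glue S)" by (rule ok_glue[OF o(1)])
      have "F (W.cl (glue S)) = xs"
        unfolding Fcl[OF okg] by (rule nth_equalityI) (use xs S tr_glue[of S, OF o] in auto)
      then show "xs \<in> F ` ?V" using okg by (intro image_eqI[of _ _ "W.cl (glue S)"]) auto
    qed
  qed
  have 1: "graph_iso W.G (cover_graph ?P ?ple)" unfolding W.G_def
  proof (rule cover_graph_iso[OF bij], rule disjI1, intro ballI)
    fix X Y assume "X \<in> ?V" "Y \<in> ?V"
    then obtain I J where "X = W.cl I" "ok n I" "Y = W.cl J" "ok n J" by auto
    then show "(\<exists>I\<in>X. \<exists>J\<in>Y. I \<subseteq> J) \<longleftrightarrow> ?ple (F X) (F Y)" using le by simp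
  qed
  have fs: "length (factors a e) = ?m" unfolding factors_def by simp
  have vf: "fst (factors a e ! i) = VB i" if "i < ?m" for i
    unfolding factors_nth[OF that] VB_def weak_graph_def cover_graph_covers by simp
  have ef: "snd (factors a e ! i) x y \<longleftrightarrow> covers (VB i) (leb i) x y \<or> covers (VB i) (leb i) y x"
    if "i < ?m" "x \<in> VB i" "y \<in> VB i" for i x y
  proof (cases "e ! i = ENone")
    case True
    then show ?thesis unfolding factors_nth[OF that(1)] VB_def leb_def using weak_graph_covers by simp
  next
    case False
    then show ?thesis using that C5_covers[of x y] unfolding factors_nth[OF that(1)] VB_def leb_def by simp
  qed
  have 2: "graph_iso (cover_graph ?P ?ple) (cart_prod (factors a e))"
    unfolding graph_iso_def cover_graph_covers cart_prod_def prod.case fs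
  proof (intro exI[of _ "\<lambda>x. x"] conjI ballI)
    show "bij_betw (\<lambda>x. x) ?P {xs. length xs = ?m \<and> (\<forall>i<?m. xs ! i \<in> fst (factors a e ! i))}"
    proof -
      have "?P = {xs. length xs = ?m \<and> (\<forall>i<?m. xs ! i \<in> fst (factors a e ! i))}" using vf by simp
      then show ?thesis using bij_betw_id[of ?P] unfolding id_def by simp
    qed
    fix xs ys assume xy: "xs \<in> ?P" "ys \<in> ?P"
    have c: "covers ?P ?ple xs ys \<longleftrightarrow> (\<exists>i<?m. covers (VB i) (leb i) (xs ! i) (ys ! i) \<and> (\<forall>j<?m. j \<noteq> i \<longrightarrow> xs ! j = ys ! j))"
      if "xs \<in> ?P" "ys \<in> ?P" for xs ys
      by (rule covers_product[OF leb_order that])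
    have "snd (factors a e ! i) (xs ! i) (ys ! i) \<longleftrightarrow> covers (VB i) (leb i) (xs ! i) (ys ! i) \<or> covers (VB i) (leb i) (ys ! i) (xs ! i)"
      if "i < ?m" for i using ef[OF that] xy that by simp
    then have F: "(\<exists>i<?m. snd (factors a e ! i) (xs ! i) (ys ! i) \<and> (\<forall>j<?m. j \<noteq> i \<longrightarrow> xs ! j = ys ! j)) \<longleftrightarrow>
      (\<exists>i<?m. (covers (VB i) (leb i) (xs ! i) (ys ! i) \<or> covers (VB i) (leb i) (ys ! i) (xs ! i))
        \<and> (\<forall>j<?m. j \<noteq> i \<longrightarrow> xs ! j = ys ! j))"
      by (intro ex_cong1) (simp cong: conj_cong)
    have s: "(\<forall>j<?m. j \<noteq> i \<longrightarrow> ys ! j = xs ! j) \<longleftrightarrow> (\<forall>j<?m. j \<noteq> i \<longrightarrow> xs ! j = ys ! j)" for i by auto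
    show "covers ?P ?ple xs ys \<or> covers ?P ?ple ys xs \<longleftrightarrow>
      (\<exists>i<?m. snd (factors a e ! i) (xs ! i) (ys ! i) \<and> (\<forall>j<?m. j \<noteq> i \<longrightarrow> xs ! j = ys ! j))"
      unfolding c[OF xy] c[OF xy(2,1)] F s by blast
  qed
  show ?thesis using graph_iso_trans[OF Q_iso[OF lattice_cong_RD, unfolded CR_RD] graph_iso_trans[OF 1 2]] .
qed

end

subsection \<open>Vertex transitivity of the factors\<close>

lemma graph_iso_sym:
  assumes "graph_iso G H" shows "graph_iso H G"
proof -
  obtain V E where G: "G = (V,E)" by fastforce
  obtain W F where H: "H = (W,F)" by fastforce
  obtain f where f: "bij_betw f V W" "\<forall>x\<in>V. \<forall>y\<in>V. E x y \<longleftrightarrow> F (f x) (f y)"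
    using assms unfolding G H graph_iso_def by auto
  show ?thesis unfolding G H graph_iso_def prod.case
  proof (intro exI[of _ "inv_into V f"] conjI ballI)
    show b: "bij_betw (inv_into V f) W V" by (rule bij_betw_inv_into[OF f(1)])
    fix x y assume xy: "x \<in> W" "y \<in> W"
    have "inv_into V f x \<in> V" "inv_into V f y \<in> V" using bij_betw_apply[OF b] xy by auto
    then show "F x y \<longleftrightarrow> E (inv_into V f x) (inv_into V f y)"
      using f(2) bij_betw_inv_into_right[OF f(1)] xy by simp
  qed
qed

lemma swap_adj_nth:
  assumes "Suc i < length x" shows "swap_adj x i ! i = x ! Suc i" "swap_adj x i ! Suc i = x ! i"
  using assms unfolding swap_adj_def by simp_all

lemma swap_adj_swap_adj:
  assumes "Suc i < length x" shows "swap_adj (swap_adj x i) i = x"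
  using assms unfolding swap_adj_def by (intro nth_equalityI) (auto simp: nth_list_update)

text \<open>\<open>exists_ascent\<close> finds a step by one pair inside every interval, so a cover
  adds a single pair, and \<open>insert_swap_adj\<close> reads this as an adjacent swap.\<close>

lemma covers_weak_le:
  assumes x: "x \<in> perms m" and y: "y \<in> perms m"
  shows "covers (perms m) weak_le x y \<longleftrightarrow> (\<exists>i. Suc i < m \<and> x ! i < x ! Suc i \<and> y = swap_adj x i)"
proof
  assume c: "covers (perms m) weak_le x y"
  then have s: "x \<noteq> y" "invs x \<subseteq> invs y"
    and nb: "\<And>z. z \<in> perms m \<Longrightarrow> weak_le x z \<Longrightarrow> weak_le z y \<Longrightarrow> z = x \<or> z = y"
    unfolding covers_def weak_le_def by auto
  have "invs x \<noteq> invs y" using s(1) invs_inj[OF x y] by auto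
  then have "invs x \<subset> invs y" using s(2) by auto
  then obtain p q where pq: "(p,q) \<in> invs y" "(p,q) \<notin> invs x" "ok m (insert (p,q) (invs x))"
    by (rule exists_ascent[OF invs_ok[OF x] invs_ok[OF y]])
  let ?z = "perm_of m (insert (p,q) (invs x))"
  have iz: "invs ?z = insert (p,q) (invs x)" by (rule invs_perm_of[OF pq(3)])
  have "weak_le x ?z" "weak_le ?z y" unfolding weak_le_def iz using pq(1) s(2) by auto
  then have "?z = x \<or> ?z = y" by (rule nb[OF perm_of_perms])
  moreover have "?z \<noteq> x" using iz pq(2) by auto
  ultimately have iy: "invs y = insert (p,q) (invs x)" using iz by simp
  obtain i where i: "Suc i < length x" "x ! i = p" "x ! Suc i = q" "y = swap_adj x i"
    by (rule insert_swap_adj[OF x y pq(2) iy])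
  have "p < q" using okD(2)[OF pq(3), of p q] by simp
  then show "\<exists>i. Suc i < m \<and> x ! i < x ! Suc i \<and> y = swap_adj x i"
    using i perms_length[OF x] by (intro exI[of _ i]) simp
next
  assume "\<exists>i. Suc i < m \<and> x ! i < x ! Suc i \<and> y = swap_adj x i"
  then obtain i where i: "Suc i < length x" "x ! i < x ! Suc i" "y = swap_adj x i" using perms_length[OF x] by auto
  note s = swap_adj_invs[OF x i(1,2), folded i(3)]
  show "covers (perms m) weak_le x y" unfolding covers_def
  proof (intro conjI notI)
    show "weak_le x y" unfolding weak_le_def s(1) by auto
    show False if "x = y" using s that by auto
    assume "\<exists>z\<in>perms m. z \<noteq> x \<and> z \<noteq> y \<and> weak_le x z \<and> weak_le z y"
    then obtain z where z: "z \<in> perms m" "z \<noteq> x" "z \<noteq> y" "invs x \<subseteq> invs z" "invs z \<subseteq> insert (x ! i, x ! Suc i) (invs x)"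
      unfolding weak_le_def s(1) by auto
    have "invs z = invs x \<or> invs z = invs y" unfolding s(1) using z(4,5) by auto
    then show False using invs_inj[OF z(1) x] invs_inj[OF z(1) y] z(2,3) by auto
  qed
qed

lemma weak_graph_edge:
  assumes x: "x \<in> perms m" and y: "y \<in> perms m"
  shows "snd (weak_graph m) x y \<longleftrightarrow> (\<exists>i. Suc i < m \<and> y = swap_adj x i)"
  unfolding weak_graph_covers covers_weak_le[OF x y] covers_weak_le[OF y x]
proof
  assume "(\<exists>i. Suc i < m \<and> x ! i < x ! Suc i \<and> y = swap_adj x i) \<or>
    (\<exists>i. Suc i < m \<and> y ! i < y ! Suc i \<and> x = swap_adj y i)"
  then show "\<exists>i. Suc i < m \<and> y = swap_adj x i"
  proof
    assume "\<exists>i. Suc i < m \<and> y ! i < y ! Suc i \<and> x = swap_adj y i"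
    then obtain i where i: "Suc i < m" "x = swap_adj y i" by auto
    have "swap_adj x i = y" unfolding i(2) by (rule swap_adj_swap_adj) (use i(1) perms_length[OF y] in simp)
    then show ?thesis using i(1) by auto
  qed auto
next
  assume "\<exists>i. Suc i < m \<and> y = swap_adj x i"
  then obtain i where i: "Suc i < m" "y = swap_adj x i" by auto
  have l: "Suc i < length x" using i(1) perms_length[OF x] by simp
  have "x ! i \<noteq> x ! Suc i" using perms_nth_eq[OF x, of i "Suc i"] i(1) by auto
  then consider "x ! i < x ! Suc i" | "x ! Suc i < x ! i" by linarith
  then show "(\<exists>i. Suc i < m \<and> x ! i < x ! Suc i \<and> y = swap_adj x i) \<or>
    (\<exists>i. Suc i < m \<and> y ! i < y ! Suc i \<and> x = swap_adj y i)"
  proof cases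
    case 2
    then have "y ! i < y ! Suc i" unfolding i(2) swap_adj_nth[OF l] .
    moreover have "x = swap_adj y i" unfolding i(2) swap_adj_swap_adj[OF l] ..
    ultimately show ?thesis using i(1) by (intro disjI2 exI[of _ i]) simp
  qed (use i in auto)
qed

lemma finite_perms: "finite (perms m)"
proof (rule finite_subset)
  show "perms m \<subseteq> {xs. set xs \<subseteq> {1..m} \<and> length xs = m}" using perms_length unfolding perms_def by auto
qed (simp add: finite_lists_length_eq)

lemma map_swap_adj: "Suc i < length x \<Longrightarrow> swap_adj (map t x) i = map t (swap_adj x i)"
  unfolding swap_adj_def by (simp add: map_update)

text \<open>Relabelling the values of a permutation preserves the positions of adjacent transpositions.\<close>
lemma weak_graph_vertex_transitive: "vertex_transitive (weak_graph m)"
proof -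
  have V: "weak_graph m = (perms m, snd (weak_graph m))" unfolding weak_graph_def cover_graph_def by simp
  have "\<exists>f. bij_betw f (perms m) (perms m) \<and>
      (\<forall>x\<in>perms m. \<forall>y\<in>perms m. snd (weak_graph m) x y \<longleftrightarrow> snd (weak_graph m) (f x) (f y)) \<and> f u = v"
    if u: "u \<in> perms m" and v: "v \<in> perms m" for u v
  proof -
    have bu: "bij_betw ((!) x) {..<m} {1..m}" if "x \<in> perms m" for x
      using bij_betw_nth[of x "{..<m}" "{1..m}"] that perms_length[OF that] unfolding perms_def by simp
    \<comment> \<open>The permutation of the values that carries the word u to the word v.\<close>
    define t where "t = (!) v \<circ> inv_into {..<m} ((!) u)"
    have bt: "bij_betw t {1..m} {1..m}" unfolding t_def
      by (rule bij_betw_trans[OF bij_betw_inv_into[OF bu[OF u]] bu[OF v]])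
    have it: "inj_on t {1..m}" and st: "t ` {1..m} = {1..m}" using bt unfolding bij_betw_def by auto
    have tu: "t (u ! i) = v ! i" if "i < m" for i
      unfolding t_def using bij_betw_inv_into_left[OF bu[OF u]] that by simp
    have mp: "map t x \<in> perms m" if "x \<in> perms m" for x
      using that it st unfolding perms_def by (auto simp: distinct_map)
    have inj: "map t x = map t y \<Longrightarrow> x = y" if "x \<in> perms m" "y \<in> perms m" for x y
      by (rule map_inj_on[of t]) (use that it in \<open>auto simp: perms_def\<close>)
    have "inj_on (map t) (perms m)" by (rule inj_onI) (rule inj)
    moreover have "map t ` perms m = perms m"
      by (rule endo_inj_surj[OF finite_perms _ \<open>inj_on (map t) (perms m)\<close>]) (use mp in auto)
    ultimately have b: "bij_betw (map t) (perms m) (perms m)" unfolding bij_betw_def by simp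
    have "snd (weak_graph m) x y \<longleftrightarrow> snd (weak_graph m) (map t x) (map t y)"
      if x: "x \<in> perms m" and y: "y \<in> perms m" for x y
    proof -
      have "map t y = swap_adj (map t x) i \<longleftrightarrow> y = swap_adj x i" if "Suc i < m" for i
      proof -
        have i: "Suc i < length x" using that perms_length[OF x] by simp
        show ?thesis unfolding map_swap_adj[OF i] using inj[OF y swap_adj_perms[OF x i]] by auto
      qed
      then show ?thesis unfolding weak_graph_edge[OF x y] weak_graph_edge[OF mp[OF x] mp[OF y]] by auto
    qed
    moreover have "map t u = v" by (rule nth_equalityI) (use tu perms_length[OF u] perms_length[OF v] in auto)
    ultimately show ?thesis using b by (intro exI[of _ "map t"]) simp
  qed
  then show ?thesis unfolding vertex_transitive_def by (subst V) simp
qed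

lemma C5_vertex_transitive: "vertex_transitive C5"
proof -
  let ?V = "{[k] | k. k < (5::nat)}"
  have V: "C5 = (?V, snd C5)" unfolding C5_def by simp
  have "\<exists>f. bij_betw f ?V ?V \<and> (\<forall>x\<in>?V. \<forall>y\<in>?V. snd C5 x y \<longleftrightarrow> snd C5 (f x) (f y)) \<and> f u = v"
    if u: "u \<in> ?V" and v: "v \<in> ?V" for u v
  proof -
    obtain k l where kl: "u = [k]" "v = [l]" "k < 5" "l < 5" using u v by auto
    \<comment> \<open>The angle of the rotation from k to l; the added 5 prevents truncation in the
      subtraction.\<close>
    define d where "d = (5 + l - k) mod 5"
    have d: "d < 5" unfolding d_def by simp
    have kd: "(k + d) mod 5 = l" unfolding d_def using kl(3,4)[unfolded less_5] by (elim disjE) simp_all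
    define f where "f x = [(hd x + d) mod 5]" for x
    have fk: "f [x] = [(x + d) mod 5]" for x unfolding f_def by simp
    have inj0: "x = y" if "x < 5" "y < 5" "(x + d) mod 5 = (y + d) mod 5" for x y
      using that d unfolding less_5 by (elim disjE) simp_all
    have inj: "inj_on f ?V"
    proof (rule inj_onI)
      fix x y assume h: "x \<in> ?V" "y \<in> ?V" "f x = f y"
      from h(1) obtain i where i: "x = [i]" "i < 5" by auto
      from h(2) obtain j where j: "y = [j]" "j < 5" by auto
      have "i = j" by (rule inj0[OF i(2) j(2)]) (use h(3) in \<open>simp add: i(1) j(1) fk\<close>)
      then show "x = y" using i j by simp
    qed
    have fin: "finite ?V" by (rule finite_subset[of _ "(\<lambda>k. [k]) ` {..<5}"]) auto
    have "f ` ?V = ?V" by (rule endo_inj_surj[OF fin _ inj]) (auto simp: fk)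
    then have b: "bij_betw f ?V ?V" using inj unfolding bij_betw_def by simp
    have s: "y = Suc x mod 5 \<longleftrightarrow> (y + d) mod 5 = Suc ((x + d) mod 5) mod 5" if "x < 5" "y < 5" for x y
      using that d unfolding less_5 by (elim disjE) simp_all
    have e: "snd C5 [x] [y] \<longleftrightarrow> snd C5 (f [x]) (f [y])" if "x < 5" "y < 5" for x y
      unfolding fk C5_edge[OF that] using s[OF that] s[OF that(2,1)] C5_edge[of "(x + d) mod 5" "(y + d) mod 5"] by simp
    have "snd C5 x y \<longleftrightarrow> snd C5 (f x) (f y)" if "x \<in> ?V" "y \<in> ?V" for x y
    proof -
      from that(1) obtain i where i: "x = [i]" "i < 5" by auto
      from that(2) obtain j where j: "y = [j]" "j < 5" by auto
      show ?thesis unfolding i(1) j(1) by (rule e[OF i(2) j(2)])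
    qed
    moreover have "f u = v" unfolding kl(1,2) fk kd ..
    ultimately show ?thesis using b by (intro exI[of _ f] conjI ballI)
  qed
  then show ?thesis unfolding vertex_transitive_def by (subst V) simp
qed

lemma cart_prod_vertex_transitive:
  assumes vt: "\<And>i. i < length Gs \<Longrightarrow> vertex_transitive (Gs ! i)"
  shows "vertex_transitive (cart_prod Gs)"
  unfolding cart_prod_def vertex_transitive_def prod.case
proof (intro ballI)
  let ?k = "length Gs"
  define V where "V i = fst (Gs ! i)" for i
  define E where "E i = snd (Gs ! i)" for i
  let ?P = "{xs. length xs = ?k \<and> (\<forall>i<?k. xs ! i \<in> fst (Gs ! i))}"
  let ?E = "\<lambda>xs ys. \<exists>i<?k. snd (Gs ! i) (xs ! i) (ys ! i) \<and> (\<forall>j<?k. j \<noteq> i \<longrightarrow> xs ! j = ys ! j)"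
  fix u v assume u: "u \<in> ?P" and v: "v \<in> ?P"
  have "\<forall>i\<in>{..<?k}. \<exists>f. bij_betw f (V i) (V i) \<and> (\<forall>x\<in>V i. \<forall>y\<in>V i. E i x y \<longleftrightarrow> E i (f x) (f y)) \<and> f (u ! i) = v ! i"
  proof
    fix i assume "i \<in> {..<?k}"
    then have i: "i < ?k" by simp
    have uv: "u ! i \<in> V i" "v ! i \<in> V i" using u v i unfolding V_def by auto
    have "Gs ! i = (V i, E i)" unfolding V_def E_def by simp
    then show "\<exists>f. bij_betw f (V i) (V i) \<and> (\<forall>x\<in>V i. \<forall>y\<in>V i. E i x y \<longleftrightarrow> E i (f x) (f y)) \<and> f (u ! i) = v ! i"
      using vt[OF i] uv unfolding vertex_transitive_def by simp
  qed
  from bchoice[OF this] obtain f where f: "\<forall>i\<in>{..<?k}. bij_betw (f i) (V i) (V i) \<and>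
    (\<forall>x\<in>V i. \<forall>y\<in>V i. E i x y \<longleftrightarrow> E i (f i x) (f i y)) \<and> f i (u ! i) = v ! i" ..
  have b: "bij_betw (f i) (V i) (V i)" and ef: "\<And>x y. x \<in> V i \<Longrightarrow> y \<in> V i \<Longrightarrow> E i x y \<longleftrightarrow> E i (f i x) (f i y)"
    and fu: "f i (u ! i) = v ! i" if "i < ?k" for i using f that by auto
  have inj: "f i x = f i y \<longleftrightarrow> x = y" if "i < ?k" "x \<in> V i" "y \<in> V i" for i x y
    using bij_betw_imp_inj_on[OF b[OF that(1)]] that(2,3) by (simp add: inj_on_eq_iff)
  define g where "g xs = map (\<lambda>i. f i (xs ! i)) [0..<?k]" for xs
  have gl: "length (g xs) = ?k" and gn: "i < ?k \<Longrightarrow> g xs ! i = f i (xs ! i)" for xs i unfolding g_def by simp_all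
  have PV: "xs \<in> ?P \<longleftrightarrow> length xs = ?k \<and> (\<forall>i<?k. xs ! i \<in> V i)" for xs unfolding V_def by simp
  have bg: "bij_betw g ?P ?P"
  proof (rule bij_betw_imageI)
    show "inj_on g ?P"
    proof (rule inj_onI)
      fix xs ys assume h: "xs \<in> ?P" "ys \<in> ?P" "g xs = g ys"
      have "xs ! i = ys ! i" if i: "i < ?k" for i
        using arg_cong[OF h(3), of "\<lambda>z. z ! i"] inj[OF i] h(1,2) i unfolding PV gn[OF i] by simp
      then show "xs = ys" using h(1,2) by (intro nth_equalityI) auto
    qed
    show "g ` ?P = ?P"
    proof (intro equalityI subsetI)
      fix ys assume "ys \<in> g ` ?P"
      then obtain xs where xs: "xs \<in> ?P" "ys = g xs" by auto
      show "ys \<in> ?P" unfolding PV xs(2) using xs(1)[unfolded PV] gl gn bij_betw_apply[OF b] by simp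
    next
      fix ys assume ys: "ys \<in> ?P"
      let ?x = "map (\<lambda>i. inv_into (V i) (f i) (ys ! i)) [0..<?k]"
      have i: "inv_into (V i) (f i) (ys ! i) \<in> V i" "f i (inv_into (V i) (f i) (ys ! i)) = ys ! i" if "i < ?k" for i
        using bij_betw_apply[OF bij_betw_inv_into[OF b[OF that]]] bij_betw_inv_into_right[OF b[OF that]] ys[unfolded PV] that
        by auto
      have "?x \<in> ?P" unfolding PV using i(1) by simp
      moreover have "g ?x = ys" by (rule nth_equalityI) (use ys gl gn i(2) in auto)
      ultimately show "ys \<in> g ` ?P" by (intro image_eqI[of _ _ ?x]) auto
    qed
  qed
  have e: "?E xs ys \<longleftrightarrow> ?E (g xs) (g ys)" if xy: "xs \<in> ?P" "ys \<in> ?P" for xs ys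
  proof -
    have m: "xs ! i \<in> V i" "ys ! i \<in> V i" if "i < ?k" for i using xy that unfolding PV by auto
    have 1: "snd (Gs ! i) (g xs ! i) (g ys ! i) \<longleftrightarrow> snd (Gs ! i) (xs ! i) (ys ! i)" if "i < ?k" for i
      unfolding gn[OF that] using ef[OF that m[OF that]] unfolding E_def by simp
    have 2: "g xs ! j = g ys ! j \<longleftrightarrow> xs ! j = ys ! j" if "j < ?k" for j
      unfolding gn[OF that] by (rule inj[OF that m[OF that]])
    show ?thesis using 1 2 by (simp cong: conj_cong)
  qed
  have "g u = v" by (rule nth_equalityI) (use gl gn fu v in auto)
  then show "\<exists>\<phi>. bij_betw \<phi> ?P ?P \<and> (\<forall>x\<in>?P. \<forall>y\<in>?P. ?E x y \<longleftrightarrow> ?E (\<phi> x) (\<phi> y)) \<and> \<phi> u = v"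
    using bg e by (intro exI[of _ g] conjI ballI)
qed

context block_data
begin

lemma RD_vertex_transitive: "vertex_transitive (Q n RD)"
proof (rule vertex_transitive_iso[OF graph_iso_sym[OF quotient_iso]], rule cart_prod_vertex_transitive)
  fix i assume "i < length (factors a e)"
  then have i: "i < length a" unfolding factors_def by simp
  show "vertex_transitive (factors a e ! i)"
    unfolding factors_nth[OF i] by (simp add: weak_graph_vertex_transitive C5_vertex_transitive)
qed

end

subsection \<open>Recovering the data from a congruence\<close>

lemma spos_append: "i \<le> length a \<Longrightarrow> spos (a @ b) i = spos a i"
  unfolding spos_def by simp

text \<open>By induction on m: the largest cut k splits off the last part m - k, and the smaller
  cuts are the partial sums of a composition ending at k.\<close>

lemma composition_with_cuts:
  assumes "1 \<le> m" "C \<subseteq> {1<..<m}"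
  shows "\<exists>a. (\<forall>x\<in>set a. 0 < x) \<and> 1 + sum_list a = m \<and> (\<forall>c. c \<in> C \<longleftrightarrow> (\<exists>i. 1 \<le> i \<and> i < length a \<and> c = spos a i))"
  using assms
proof (induction m arbitrary: C rule: less_induct)
  case (less m)
  show ?case
  proof (cases "m = 1")
    case True
    then have "C = {}" using less.prems by auto
    then show ?thesis using True by (intro exI[of _ "[]"]) simp
  next
    case False
    \<comment> \<open>Inserting 1 covers the case without cuts, in which the last part is the only
      one.\<close>
    define k where "k = Max (insert 1 C)"
    have fin: "finite (insert 1 C)" using less.prems(2) finite_subset[of C "{1<..<m}"] by simp
    have kin: "k \<in> insert 1 C" unfolding k_def by (rule Max_in[OF fin]) simp
    have kmax: "c \<le> k" if "c \<in> insert 1 C" for c unfolding k_def by (rule Max_ge[OF fin that])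
    have k: "1 \<le> k" "k < m" using kin kmax[of 1] less.prems False by auto
    have sub: "C - {k} \<subseteq> {1<..<k}"
    proof
      fix c assume "c \<in> C - {k}"
      then have "c \<le> k" "c \<noteq> k" "1 < c" using kmax less.prems(2) by auto
      then show "c \<in> {1<..<k}" by simp
    qed
    obtain b where b: "\<forall>x\<in>set b. 0 < x" "1 + sum_list b = k"
      "\<And>c. c \<in> C - {k} \<longleftrightarrow> (\<exists>i. 1 \<le> i \<and> i < length b \<and> c = spos b i)"
      using less.IH[OF k(2,1) sub] by auto
    have bend: "spos b (length b) = k" using spos_length[of b] b(2) by simp
    have kC: "k \<in> C \<longleftrightarrow> 1 \<le> length b"
    proof
      assume "k \<in> C"
      then have "1 < k" using less.prems(2) by auto
      then show "1 \<le> length b" using b(2) by (cases b) auto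
    next
      assume "1 \<le> length b"
      then have "1 < k" using b(1,2) by (cases b) auto
      then show "k \<in> C" using kin by simp
    qed
    let ?a = "b @ [m - k]"
    have "c \<in> C \<longleftrightarrow> (\<exists>i. 1 \<le> i \<and> i < length ?a \<and> c = spos ?a i)" for c
    proof
      assume c: "c \<in> C"
      show "\<exists>i. 1 \<le> i \<and> i < length ?a \<and> c = spos ?a i"
      proof (cases "c = k")
        case True
        then have "1 \<le> length b" using kC c by simp
        then show ?thesis using True bend spos_append[of "length b" b "[m - k]"] by (intro exI[of _ "length b"]) simp
      next
        case False
        then have "c \<in> C - {k}" using c by simp
        then obtain i where i: "1 \<le> i" "i < length b" "c = spos b i" using b(3) by auto
        then show ?thesis using spos_append[of i b "[m - k]"] by (intro exI[of _ i]) simp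
      qed
    next
      assume "\<exists>i. 1 \<le> i \<and> i < length ?a \<and> c = spos ?a i"
      then obtain i where i: "1 \<le> i" "i \<le> length b" "c = spos b i" using spos_append[of _ b "[m - k]"] by auto
      show "c \<in> C"
      proof (cases "i = length b")
        case True then show ?thesis using i kC bend by simp
      next
        case False
        then have "c \<in> C - {k}" unfolding b(3) using i by (intro exI[of _ i]) simp
        then show ?thesis by simp
      qed
    qed
    then show ?thesis using b(1,2) k by (intro exI[of _ ?a]) simp
  qed
qed

theorem vertex_transitive_data:
  assumes n: "2 \<le> n" and R: "R \<in> ess_congs n" and vt: "vertex_transitive (Q n R)"
  shows "\<exists>a e. valid_data n a e \<and> FR n R = gen_downset n (gens a e)"
proof -
  have lc: "lattice_cong n R" using R unfolding ess_congs_def by simp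
  interpret W: ess_wcong n "CR n R" by (rule ess_CR[OF R])
  have vtG: "vertex_transitive W.G" by (rule vertex_transitive_iso[OF Q_iso[OF lc] vt])
  have "{c. W.cut c} \<subseteq> {1<..<n}" unfolding W.cut_def by auto
  from composition_with_cuts[OF _ this] n
  obtain a where a: "\<forall>x\<in>set a. 0 < x" "1 + sum_list a = n"
    "\<And>c. W.cut c \<longleftrightarrow> (\<exists>i. 1 \<le> i \<and> i < length a \<and> c = spos a i)" by auto
  \<comment> \<open>At most one of the two tests succeeds: if both fences on a block of three values
    were dead, the middle value would be a cut, hence a partial sum strictly inside a part.\<close>
  define e where "e = map (\<lambda>j. if a ! j \<noteq> 2 then ENone
    else if W.dead (spos a j) (spos a j + 2) {} then ELeft
    else if W.dead (spos a j) (spos a j + 2) {spos a j + 1} then ERight else ENone) [0..<length a]"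
  have ej: "e ! j = (if a ! j \<noteq> 2 then ENone
    else if W.dead (spos a j) (spos a j + 2) {} then ELeft
    else if W.dead (spos a j) (spos a j + 2) {spos a j + 1} then ERight else ENone)" if "j < length a" for j
    unfolding e_def using that by simp
  have valid: "valid_data n a e" unfolding valid_data_def using a n ej by (simp add: e_def)
  interpret B: block_data n a e by standard (rule valid, rule n)
  have "(p,q,L) \<in> FR n R \<longleftrightarrow> (p,q,L) \<in> gen_downset n (gens a e)" for p q L
  proof (cases "(p,q,L) \<in> fences n")
    case f: True
    have pq: "1 \<le> p" "p < q" "q \<le> n" "L \<subseteq> {p<..<q}" using f by (auto simp: fence_iff)
    let ?i = "\<exists>i. 1 \<le> i \<and> i < length a \<and> p < spos a i \<and> spos a i < q"
    let ?j = "\<exists>j<length a. p = spos a j \<and> q = p + 2 \<and> (e ! j = ELeft \<and> L = {} \<or> e ! j = ERight \<and> L = {p + 1})"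
    have "W.dead p q L \<longleftrightarrow> ?i \<or> ?j"
    proof
      assume d: "W.dead p q L"
      show "?i \<or> ?j"
      proof (cases ?i)
        case ni: False
        have nocut: "\<not> W.cut c" if "p < c" "c < q" for c using ni that unfolding a(3) by auto
        note w = W.dead_without_cut[OF vtG f d nocut]
        have la: "0 < length a" using a(2) n by (cases a) auto
        obtain j where j: "j < length a" "p = spos a j"
        proof -
          have "p = 1 \<or> W.cut p" by (rule conjunct1[OF conjunct2[OF w]])
          then have "\<exists>j<length a. p = spos a j"
          proof
            assume "p = 1" then show ?thesis using la spos_0[of a] by (intro exI[of _ 0]) simp
          qed (auto simp: a(3))
          then show ?thesis by (elim exE conjE) (rule that)
        qed
        obtain k where k: "k \<le> length a" "q = spos a k"
        proof -
          have "q = n \<or> W.cut q" by (rule conjunct2[OF conjunct2[OF w]])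
          then have "\<exists>k\<le>length a. q = spos a k"
          proof
            assume "q = n" then show ?thesis using B.spos_end by (intro exI[of _ "length a"]) simp
          next
            assume "W.cut q"
            then obtain i where "i < length a" "q = spos a i" unfolding a(3) by auto
            then show ?thesis by (intro exI[of _ i]) simp
          qed
          then show ?thesis by (elim exE conjE) (rule that)
        qed
        have jk: "j < k" using spos_less_iff[OF a(1), of j k] j k pq(2) by simp
        have "\<not> Suc j < k"
        proof
          assume h: "Suc j < k"
          have "p < spos a (Suc j)" "spos a (Suc j) < q"
            using spos_less[OF a(1), of j "Suc j"] spos_less[OF a(1), of "Suc j" k] h j k by auto
          then have ?i using h k by (intro exI[of _ "Suc j"]) simp
          then show False using ni by simp
        qed
        then have kj: "k = Suc j" using jk by simp
        have q2: "q = p + 2" using w by simp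
        have a2: "a ! j = 2" using spos_Suc[OF j(1)] j k kj q2 by simp
        have iv: "{p<..<p + 2} = {p + 1}" by auto
        then have "L = {} \<or> L = {p + 1}" using pq(4) subset_singletonD unfolding q2 iv by simp
        then have "e ! j = ELeft \<and> L = {} \<or> e ! j = ERight \<and> L = {p + 1}"
        proof
          assume L: "L = {}"
          then show ?thesis using d ej[OF j(1)] a2 j q2 by simp
        next
          assume L: "L = {p + 1}"
          have "\<not> W.dead p (p + 2) {}"
          proof
            assume h: "W.dead p (p + 2) {}"
            have "W.cut (p + 1)" unfolding W.cut_def using h d L pq q2 by simp
            then show False using nocut[of "p + 1"] q2 by simp
          qed
          then show ?thesis using d ej[OF j(1)] a2 j q2 L by simp
        qed
        then have ?j using j q2 by (intro exI[of _ j]) simp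
        then show ?thesis by simp
      qed simp
    next
      assume "?i \<or> ?j"
      then show "W.dead p q L"
      proof
        assume ?i
        then obtain i where i: "1 \<le> i" "i < length a" "p < spos a i" "spos a i < q" by auto
        have "W.cut (spos a i)" unfolding a(3) using i by (intro exI[of _ i]) simp
        then show ?thesis by (intro W.crossing_dead[OF _ f i(3,4)]) simp
      next
        assume ?j
        then obtain j where j: "j < length a" "p = spos a j" "q = p + 2"
          "e ! j = ELeft \<and> L = {} \<or> e ! j = ERight \<and> L = {p + 1}" by auto
        then show ?thesis using ej[OF j(1)] by (auto split: if_splits)
      qed
    qed
    then show ?thesis unfolding FR_iff[OF lc] B.gen_downset_iff using f by simp
  qed (simp_all add: FR_def gen_downset_def)
  then have "FR n R = gen_downset n (gens a e)" by (intro set_eqI) auto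
  then show ?thesis using valid by auto
qed

section \<open>Recovering the composition and the choices from the downset\<close>

context block_data
begin

text \<open>A pentagon block contributes only one of the two fences around its middle value, so both
  of them occur together only at an interior partial sum.\<close>

lemma cut_iff_spos:
  "(\<exists>i. 1 \<le> i \<and> i < length a \<and> c = spos a i) \<longleftrightarrow> 1 < c \<and> c < n \<and>
    (c - 1, c + 1, {}) \<in> gen_downset n (gens a e) \<and> (c - 1, c + 1, {c}) \<in> gen_downset n (gens a e)" (is "?i \<longleftrightarrow> ?r")
proof
  assume ?i
  then obtain i where i: "1 \<le> i" "i < length a" "c = spos a i" by auto
  have c: "1 < c" "c < n"
    using spos_less[OF pos, of 0 i] spos_less[OF pos, of i "length a"] i spos_0[of a] spos_end by auto
  have "(c - 1, c + 1, L) \<in> gen_downset n (gens a e)" if "L \<subseteq> {c}" for L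
  proof -
    have "\<exists>i. 1 \<le> i \<and> i < length a \<and> c - 1 < spos a i \<and> spos a i < c + 1"
      using i c by (intro exI[of _ i]) simp
    moreover have "(c - 1, c + 1, L) \<in> fences n" unfolding fence_iff using c that by auto
    ultimately show ?thesis unfolding gen_downset_iff by simp
  qed
  then show ?r using c by simp
next
  assume r: ?r
  then have c: "1 < c" "c < n" by auto
  show ?i
  proof (rule ccontr)
    assume ni: "\<not> ?i"
    have n2: "\<not> (\<exists>i. 1 \<le> i \<and> i < length a \<and> c - 1 < spos a i \<and> spos a i < c + 1)"
    proof
      assume "\<exists>i. 1 \<le> i \<and> i < length a \<and> c - 1 < spos a i \<and> spos a i < c + 1"
      then obtain i where i: "1 \<le> i" "i < length a" "c - 1 < spos a i" "spos a i < c + 1" by auto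
      have "c = spos a i" using i(3,4) by simp
      then show False using ni i(1,2) by auto
    qed
    have "(c - 1, c + 1, {}) \<in> gen_downset n (gens a e)" using r by simp
    then obtain j where j: "j < length a" "c - 1 = spos a j" "e ! j = ELeft"
      unfolding gen_downset_iff using n2 by auto
    have "(c - 1, c + 1, {c}) \<in> gen_downset n (gens a e)" using r by simp
    then obtain k where k: "k < length a" "c - 1 = spos a k" "e ! k = ERight"
      unfolding gen_downset_iff using n2 by auto
    have "j = k" by (rule spos_inj[OF pos]) (use j k in auto)
    then show False using j k by simp
  qed
qed

lemma eps_iff:
  assumes j: "j < length a" "a ! j = 2"
  shows "(spos a j, spos a j + 2, {}) \<in> gen_downset n (gens a e) \<longleftrightarrow> e ! j = ELeft"
    and "(spos a j, spos a j + 2, {spos a j + 1}) \<in> gen_downset n (gens a e) \<longleftrightarrow> e ! j = ERight"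
proof -
  have s: "spos a (Suc j) = spos a j + 2" using spos_Suc[OF j(1)] j(2) by simp
  have r: "1 \<le> spos a j" "spos a j + 2 \<le> n" using spos_range[of j] spos_range[of "Suc j"] j s by auto
  have ni: "\<not> (\<exists>i. 1 \<le> i \<and> i < length a \<and> spos a j < spos a i \<and> spos a i < spos a j + 2)"
  proof
    assume "\<exists>i. 1 \<le> i \<and> i < length a \<and> spos a j < spos a i \<and> spos a i < spos a j + 2"
    then obtain i where i: "i < length a" "spos a j < spos a i" "spos a i < spos a (Suc j)" unfolding s by auto
    have "j < i" "i < Suc j"
      using i j spos_less_iff[OF pos, of j i] spos_less_iff[OF pos, of i "Suc j"] by auto
    then show False by simp
  qed
  have u: "(\<exists>k<length a. spos a j = spos a k \<and> P k) \<longleftrightarrow> P j" for P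
  proof
    assume "\<exists>k<length a. spos a j = spos a k \<and> P k"
    then obtain k where k: "k < length a" "spos a j = spos a k" "P k" by auto
    have "j = k" by (rule spos_inj[OF pos]) (use j k in auto)
    then show "P j" using k by simp
  qed (use j in auto)
  have f: "(spos a j, spos a j + 2, {}) \<in> fences n" "(spos a j, spos a j + 2, {spos a j + 1}) \<in> fences n"
    unfolding fence_iff using r by auto
  show "(spos a j, spos a j + 2, {}) \<in> gen_downset n (gens a e) \<longleftrightarrow> e ! j = ELeft"
    unfolding gen_downset_iff u by (simp only: f ni) simp
  show "(spos a j, spos a j + 2, {spos a j + 1}) \<in> gen_downset n (gens a e) \<longleftrightarrow> e ! j = ERight"
    unfolding gen_downset_iff u by (simp only: f ni) simp
qed

text \<open>The partial sums enumerate the cuts and the two boundary values in strictly increasing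
  order, so the list is determined by its set.\<close>

lemma spos_list: "sorted (map (spos a) [0..<Suc (length a)])" "distinct (map (spos a) [0..<Suc (length a)])"
  "set (map (spos a) [0..<Suc (length a)]) = insert 1 (insert n {c. \<exists>i. 1 \<le> i \<and> i < length a \<and> c = spos a i})"
proof -
  show "sorted (map (spos a) [0..<Suc (length a)])"
    unfolding sorted_map by (rule sorted_wrt_mono_rel[of _ "(\<le>)"]) (auto simp: spos_mono simp del: upt_Suc)
  show "distinct (map (spos a) [0..<Suc (length a)])"
    unfolding distinct_map using spos_inj[OF pos] by (auto simp: inj_on_def simp del: upt_Suc)
  have "i \<le> length a \<longleftrightarrow> i = 0 \<or> i = length a \<or> 1 \<le> i \<and> i < length a" for i by auto
  then have "{0..<Suc (length a)} = insert 0 (insert (length a) {i. 1 \<le> i \<and> i < length a})" by auto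
  then show "set (map (spos a) [0..<Suc (length a)]) = insert 1 (insert n {c. \<exists>i. 1 \<le> i \<and> i < length a \<and> c = spos a i})"
    using spos_0[of a] spos_end unfolding set_map set_upt by auto
qed

end

text \<open>The downset determines the cuts, the cuts determine the partial sums, and their
  differences are the parts; \<open>eps_iff\<close> then reads off the choices.\<close>

lemma data_unique:
  assumes "block_data n a1 e1" "block_data n a2 e2" and eq: "gen_downset n (gens a1 e1) = gen_downset n (gens a2 e2)"
  shows "a1 = a2 \<and> e1 = e2"
proof -
  interpret A: block_data n a1 e1 by (rule assms(1))
  interpret B: block_data n a2 e2 by (rule assms(2))
  have "(\<exists>i. 1 \<le> i \<and> i < length a1 \<and> c = spos a1 i) \<longleftrightarrow> (\<exists>i. 1 \<le> i \<and> i < length a2 \<and> c = spos a2 i)" for c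
    unfolding A.cut_iff_spos B.cut_iff_spos eq ..
  then have "set (map (spos a1) [0..<Suc (length a1)]) = set (map (spos a2) [0..<Suc (length a2)])"
    unfolding A.spos_list(3) B.spos_list(3) by simp
  then have m: "map (spos a1) [0..<Suc (length a1)] = map (spos a2) [0..<Suc (length a2)]"
    using sorted_distinct_set_unique A.spos_list(1,2) B.spos_list(1,2) by metis
  have l: "length a1 = length a2" using arg_cong[OF m, of length] by simp
  have s: "spos a1 i = spos a2 i" if "i \<le> length a1" for i
    using arg_cong[OF m, of "\<lambda>x. x ! i"] that l by (simp del: upt_Suc)
  have a: "a1 = a2"
  proof (rule nth_equalityI[OF l])
    fix i assume i: "i < length a1"
    show "a1 ! i = a2 ! i" using spos_Suc[OF i] spos_Suc[of i a2] i l s[of i] s[of "Suc i"] by simp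
  qed
  have "e1 = e2"
  proof (rule nth_equalityI)
    show "length e1 = length e2" using A.len B.len l by simp
    fix j assume "j < length e1"
    then have j: "j < length a1" "j < length a2" using A.len l by auto
    show "e1 ! j = e2 ! j"
    proof (cases "a1 ! j = 2")
      case True
      have "e1 ! j = ELeft \<longleftrightarrow> e2 ! j = ELeft" "e1 ! j = ERight \<longleftrightarrow> e2 ! j = ERight"
        using A.eps_iff[OF j(1) True] B.eps_iff[OF j(2)] True eq unfolding a by auto
      then show ?thesis by (cases "e1 ! j"; cases "e2 ! j") simp_all
    next
      case False
      then show ?thesis using A.eps[OF j(1)] B.eps[OF j(2)] a by simp
    qed
  qed
  then show ?thesis using a by simp
qed

subsection \<open>Counting\<close>

definition choices :: "nat list \<Rightarrow> eps list set" where
  "choices a = {e. length e = length a \<and> (\<forall>j<length a. a ! j \<noteq> 2 \<longrightarrow> e ! j = ENone)}"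

lemma choices_Cons:
  "choices (x # a) = (\<lambda>(h,t). h # t) ` ((if x = 2 then {ENone, ELeft, ERight} else {ENone}) \<times> choices a)" (is "_ = ?f ` (?A \<times> _)")
proof (intro equalityI subsetI)
  fix e assume e: "e \<in> choices (x # a)"
  then obtain h t where ht: "e = h # t" "length t = length a" unfolding choices_def by (cases e) auto
  have m: "(x # a) ! j \<noteq> 2 \<longrightarrow> e ! j = ENone" if "j < Suc (length a)" for j using e that unfolding choices_def by simp
  have "h \<in> ?A" using m[of 0] ht(1) by (cases h) auto
  moreover have "t \<in> choices a" unfolding choices_def
  proof (intro CollectI conjI allI impI)
    fix j assume "j < length a" "a ! j \<noteq> 2"
    then show "t ! j = ENone" using m[of "Suc j"] ht(1) by simp
  qed (rule ht(2))
  ultimately show "e \<in> ?f ` (?A \<times> choices a)" using ht(1) by (intro image_eqI[of _ _ "(h,t)"]) auto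
next
  fix e assume "e \<in> ?f ` (?A \<times> choices a)"
  then obtain h t where ht: "e = h # t" "h \<in> ?A" "t \<in> choices a" by auto
  show "e \<in> choices (x # a)" unfolding choices_def
  proof (intro CollectI conjI allI impI)
    show "length e = length (x # a)" using ht unfolding choices_def by simp
    fix j assume j: "j < length (x # a)" "(x # a) ! j \<noteq> 2"
    show "e ! j = ENone" using j ht unfolding choices_def by (cases j) auto
  qed
qed

lemma card_choices: "finite (choices a) \<and> card (choices a) = 3 ^ count_list a 2"
proof (induction a)
  case Nil
  have "choices [] = {[]}" unfolding choices_def by auto
  then show ?case by simp
next
  case (Cons x a)
  have "inj_on (\<lambda>(h,t). h # t) ((if x = 2 then {ENone, ELeft, ERight} else {ENone}) \<times> choices a)"
    by (auto simp: inj_on_def)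
  then show ?case unfolding choices_Cons using Cons by (simp add: card_image card_cartesian_product)
qed

lemma length_le_sum_list: "\<forall>x\<in>set a. 0 < x \<Longrightarrow> length a \<le> sum_list (a :: nat list)"
  by (induction a) auto

lemma finite_compositions: "finite (compositions m)"
proof (rule finite_subset)
  show "compositions m \<subseteq> {xs. set xs \<subseteq> {..m} \<and> length xs \<le> m}"
    unfolding compositions_def using length_le_sum_list member_le_sum_list by auto
qed (simp add: finite_lists_length_le)

text \<open>Compositions are grouped by their number of parts equal to 2. Parts are positive, so a
  composition of n-1 has at most n-1 of them, which makes the finite range of k exhaustive.\<close>

lemma card_valid_data:
  "card {(a,e). valid_data n a e} = (\<Sum>k\<le>n - 1. 3 ^ k * comp_count (n - 1) k)"
proof -
  let ?K = "compositions (n - 1)"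
  have "{(a,e). valid_data n a e} = Sigma ?K choices"
    unfolding valid_data_def compositions_def choices_def by auto
  then have "card {(a,e). valid_data n a e} = (\<Sum>a\<in>?K. 3 ^ count_list a 2)"
    using card_SigmaI[OF finite_compositions, of "n - 1" choices] card_choices by simp
  also have "\<dots> = (\<Sum>k\<le>n - 1. \<Sum>a\<in>{a \<in> ?K. count_list a 2 = k}. 3 ^ count_list a 2)"
  proof (rule sum.group[symmetric, OF finite_compositions])
    show "(\<lambda>a. count_list a 2) ` ?K \<subseteq> {..n - 1}"
    proof
      fix k assume "k \<in> (\<lambda>a. count_list a 2) ` ?K"
      then obtain a where a: "a \<in> ?K" "k = count_list a 2" by auto
      have "k \<le> length a" unfolding a(2) by (rule count_le_length)
      also have "\<dots> \<le> n - 1" using a(1) length_le_sum_list[of a] unfolding compositions_def by simp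
      finally show "k \<in> {..n - 1}" by simp
    qed
  qed simp
  also have "\<dots> = (\<Sum>k\<le>n - 1. 3 ^ k * comp_count (n - 1) k)"
    unfolding comp_count_def by (rule sum.cong) simp_all
  finally show ?thesis .
qed

theorem mainTheorem18:
  fixes n :: nat and R :: "(nat list \<times> nat list) set"
  assumes "2 \<le> n" and "R \<in> ess_congs n"
  shows "(vertex_transitive (Q n R) \<longleftrightarrow>
            (\<exists>a e. valid_data n a e \<and> FR n R = gen_downset n (gens a e)))
    \<and> (\<forall>a1 e1 a2 e2. valid_data n a1 e1 \<and> valid_data n a2 e2 \<and> (a1, e1) \<noteq> (a2, e2)
          \<longrightarrow> gen_downset n (gens a1 e1) \<noteq> gen_downset n (gens a2 e2))
    \<and> (\<forall>a e. valid_data n a e \<and> FR n R = gen_downset n (gens a e)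
          \<longrightarrow> graph_iso (Q n R) (cart_prod (factors a e)))
    \<and> card {R' \<in> ess_congs n. vertex_transitive (Q n R')}
        = (\<Sum>k\<le>n - 1. 3 ^ k * comp_count (n - 1) k)"
proof -
  have bd: "block_data n a e" if "valid_data n a e" for a e
    by (rule block_data.intro[OF that assms(1)])
  have RD: "S = block_data.RD n a e"
    if "S \<in> ess_congs n" "valid_data n a e" "FR n S = gen_downset n (gens a e)" for S a e
    by (rule ess_congs_FR_inj[OF that(1) block_data.RD_ess[OF bd[OF that(2)]]])
      (simp add: block_data.FR_RD[OF bd[OF that(2)]] that(3))
  have uniq: "(a1,e1) = (a2,e2)"
    if "valid_data n a1 e1" "valid_data n a2 e2" "gen_downset n (gens a1 e1) = gen_downset n (gens a2 e2)"
    for a1 e1 a2 e2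
    using data_unique[OF bd[OF that(1)] bd[OF that(2)] that(3)] by simp
  have vt: "vertex_transitive (Q n R)" if "valid_data n a e" "FR n R = gen_downset n (gens a e)" for a e
    unfolding RD[OF assms(2) that] by (rule block_data.RD_vertex_transitive[OF bd[OF that(1)]])
  have iso: "graph_iso (Q n R) (cart_prod (factors a e))"
    if "valid_data n a e" "FR n R = gen_downset n (gens a e)" for a e
    unfolding RD[OF assms(2) that] by (rule block_data.quotient_iso[OF bd[OF that(1)]])
  let ?S = "{R' \<in> ess_congs n. vertex_transitive (Q n R')}"
  \<comment> \<open>Data are matched with vertex-transitive congruences: injectively because the
    downset determines the data, surjectively because it also determines an essential
    congruence.\<close>
  have "bij_betw (\<lambda>(a,e). block_data.RD n a e) {(a,e). valid_data n a e} ?S"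
  proof (rule bij_betw_imageI)
    show "inj_on (\<lambda>(a,e). block_data.RD n a e) {(a,e). valid_data n a e}"
    proof (rule inj_onI)
      fix x y assume h: "x \<in> {(a,e). valid_data n a e}" "y \<in> {(a,e). valid_data n a e}"
        "(case x of (a,e) \<Rightarrow> block_data.RD n a e) = (case y of (a,e) \<Rightarrow> block_data.RD n a e)"
      obtain a1 e1 where x: "x = (a1,e1)" by fastforce
      obtain a2 e2 where y: "y = (a2,e2)" by fastforce
      have v: "valid_data n a1 e1" "valid_data n a2 e2" and e: "block_data.RD n a1 e1 = block_data.RD n a2 e2"
        using h unfolding x y by simp_all
      show "x = y" unfolding x y
        by (rule uniq[OF v]) (metis e block_data.FR_RD[OF bd[OF v(1)]] block_data.FR_RD[OF bd[OF v(2)]])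
    qed
    show "(\<lambda>(a,e). block_data.RD n a e) ` {(a,e). valid_data n a e} = ?S"
    proof (intro equalityI subsetI)
      fix S assume "S \<in> (\<lambda>(a,e). block_data.RD n a e) ` {(a,e). valid_data n a e}"
      then obtain a e where ae: "valid_data n a e" "S = block_data.RD n a e" by auto
      show "S \<in> ?S" unfolding ae(2)
        using block_data.RD_ess[OF bd[OF ae(1)]] block_data.RD_vertex_transitive[OF bd[OF ae(1)]] by simp
    next
      fix S assume "S \<in> ?S"
      then have S: "S \<in> ess_congs n" "vertex_transitive (Q n S)" by auto
      obtain a e where ae: "valid_data n a e" "FR n S = gen_downset n (gens a e)"
        using vertex_transitive_data[OF assms(1) S] by auto
      show "S \<in> (\<lambda>(a,e). block_data.RD n a e) ` {(a,e). valid_data n a e}"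
        using RD[OF S(1) ae] ae(1) by (intro image_eqI[of _ _ "(a,e)"]) simp_all
    qed
  qed
  then have "card ?S = card {(a,e). valid_data n a e}" by (rule bij_betw_same_card[symmetric])
  then have card: "card ?S = (\<Sum>k\<le>n - 1. 3 ^ k * comp_count (n - 1) k)" unfolding card_valid_data .
  have "vertex_transitive (Q n R) \<longleftrightarrow> (\<exists>a e. valid_data n a e \<and> FR n R = gen_downset n (gens a e))"
  proof
    assume "\<exists>a e. valid_data n a e \<and> FR n R = gen_downset n (gens a e)"
    then obtain a e where "valid_data n a e" "FR n R = gen_downset n (gens a e)" by auto
    then show "vertex_transitive (Q n R)" by (rule vt)
  qed (rule vertex_transitive_data[OF assms])
  moreover have "\<forall>a1 e1 a2 e2. valid_data n a1 e1 \<and> valid_data n a2 e2 \<and> (a1, e1) \<noteq> (a2, e2)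
          \<longrightarrow> gen_downset n (gens a1 e1) \<noteq> gen_downset n (gens a2 e2)"
  proof (intro allI impI notI)
    fix a1 e1 a2 e2
    assume "valid_data n a1 e1 \<and> valid_data n a2 e2 \<and> (a1, e1) \<noteq> (a2, e2)"
      and "gen_downset n (gens a1 e1) = gen_downset n (gens a2 e2)"
    then show False using uniq[of a1 e1 a2 e2] by simp
  qed
  ultimately show ?thesis using iso card by simp
qed

end
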